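(* Let $(S,g,\xi_i,\eta_i,\Phi_i)$ be a regular or quasi-regular $3$-Sasakian orbifold of dimension $7$, and let $Z$ be the quotient of $S$ by the foliation generated by $\xi_3$. Define $2$-forms $\alpha_i$ on $S$ by $2\alpha_i:=d\eta_i-\epsilon_{ijk}\,\eta_j\wedge\eta_k$ (sum over $j,k$), set $\alpha:=\alpha_1+i\alpha_2$, $\eta:=\eta_1+i\eta_2$, and for $a,b,\gamma\in\mathbb{R}$ let $$\omega_{a,b}:=a\,\alpha_3-\frac{i}{2}b^2\,\eta\wedge\bar\eta,\qquad \Omega_{a,b,\gamma}:=ab\,e^{i\gamma}\,\alpha\wedge\bar\eta ,$$ regarded as forms on $Z$ (they are basic with respect to $\xi_3$). (1) If $a>0$, $a=2b^2$ and $\gamma\in\mathbb{R}$, then $(\omega_{a,b},\Omega_{a,b,\gamma})$ is a nearly Kähler $SU(3)$-structure on $Z$: $W_1\neq 0$ and $W_2=W_3=W_4=W_5=0$. (2) If $a=-b^2$, $a\neq 0$ and $\gamma\in\mathbb{R}$, then $(\omega_{a,b},\Omega_{a,b,\gamma})$ is a symplectic $SU(1,2)$-structure on $Z$: $W_2\neq 0$ and $W_1=W_3=W_4=W_5=0$.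
   Context: **3-Sasakian structures.** A Riemannian manifold $(S,g)$ is $3$-Sasakian if its cone $(C(S)=S\times\mathbb{R}_{>0},\ \bar g=dr^2+r^2g)$ is hyperkähler, with integrable complex structures $J_1,J_2,J_3$, each Kähler with respect to $\bar g$, satisfying $J_iJ_j=-\delta_{ij}+\epsilon_{ijk}J_k$. $S$ is identified with $\{r=1\}\subset C(S)$. The Reeb vector fields are $\xi_i=J_i(r\partial_r)$ (tangent to $S$), the dual contact forms are $\eta_i=\frac1{r^2}\bar g(\xi_i,\cdot)$ (restricted to $S$), and $\Phi_i=\nabla\xi_i$ with $\nabla$ the Levi-Civita connection of $g$. They satisfy $$\eta_i(\xi_j)=\delta_{ij},\quad \iota_{\xi_i}d\eta_i=0\ (\text{no sum}),\quad \Phi_i\xi_j=\epsilon_{ijk}\xi_k,\quad \Phi_i\Phi_j-\eta_j\otimes\xi_i=-\delta_{ij}+\epsilon_{ijk}\Phi_k,\quad [\xi_i,\xi_j]=-2\epsilon_{ijk}\xi_k,$$ and $\omega_i:=\bar g(J_i\cdot,\cdot)=\frac12 d(r^2\eta_i)$. A $3$-Sasakian orbifold is a Riemannian orbifold with three characteristic vector fields satisfying these relations and preserved by the local uniformizing groups. The Reeb foliation generated by $\xi_u=u_1\xi_1+u_2\xi_2+u_3\xi_3$, $u\in S^2$ (in particular by $\xi_3$) is quasi-regular if $\xi_u$ integrates (up to rescaling of the period) to an effective $S^1$-action that is almost free (finite stabilizers), and regular if this action is free; $S$ is called (quasi-)regular accordingly. Then $Z=S/\langle\xi_3\rangle$ is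 a $6$-dimensional orbifold, and tensors on $Z$ are understood in the orbifold sense. A form $\beta$ on $S$ is basic with respect to $\xi_3$ if $\iota_{\xi_3}\beta=0$ and $\mathcal{L}_{\xi_3}\beta=0$; basic forms descend to $Z$ and are denoted by the same symbol. **$SU(3)$- and $SU(1,2)$-structures.** An $SU(3)$-structure on a $6$-dimensional manifold or orbifold is an almost hermitian structure $(g,J,\omega)$ (that is, $\omega$ is a real $2$-form with $\omega(J\cdot,J\cdot)=\omega$ and $g=\omega(\cdot,J\cdot)$ a Riemannian metric) together with a nowhere vanishing $(3,0)$-form $\Omega$ such that $\omega\wedge\Omega=0$ and $\Omega\wedge\overline\Omega=-8i\,\frac{\omega^3}{3!}$. ($J$ and $g$ are determined by $\omega,\Omega$.) An $SU(1,2)$-structure is defined by the same data and equations except that $g=\omega(\cdot,J\cdot)$ is a pseudo-Riemannian metric of signature $(2,4)$ (two positive and four negative directions). In both cases the torsion classes are defined by $$d\omega=\tfrac32\,\mathrm{Im}(\overline{W_1}\,\Omega)+W_4\wedge\omega+W_3,\qquad d\Omega=W_1\,\omega^2+W_2\wedge\omega+\overline{W_5}\wedge\Omega,$$ where $W_1$ is a complex function, $W_2$ a primitive (complex) $(1,1)$-form, $W_3$ a real primitive $(2,1)+(1,2)$-form, $W_4$ a real $1$-form and $W_5$ a $(1,0)$-form; a $k$-form $\beta$ is primitive if $\beta\wedge\omega^{4-k}=0$. "Nearly Kähler" means that $W_1\ne0$ is the only non-vanishing torsion class; "symplectic" refers to $d\omega=0$. *)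

theory Defs
  imports "HOL-Analysis.Analysis" "HOL-Combinatorics.Permutations"
begin

section \<open>Smooth maps on open sets\<close>

(* Only used on open sets, where frechet_derivative f (at x) v is the directional derivative. *)
primrec k_smooth_on ::
  "nat \<Rightarrow> 'a::euclidean_space set \<Rightarrow> ('a \<Rightarrow> 'b::real_normed_vector) \<Rightarrow> bool" where
  "k_smooth_on 0 U f \<longleftrightarrow> continuous_on U f"
| "k_smooth_on (Suc k) U f \<longleftrightarrow>
     (\<forall>x\<in>U. f differentiable (at x)) \<and>
     (\<forall>v. k_smooth_on k U (\<lambda>x. frechet_derivative f (at x) v))"

definition smooth_on :: "'a::euclidean_space set \<Rightarrow> ('a \<Rightarrow> 'b::real_normed_vector) \<Rightarrow> bool" where
  "smooth_on U f \<longleftrightarrow> (\<forall>k. k_smooth_on k U f)"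

definition diffeo_on ::
  "'a::euclidean_space set \<Rightarrow> 'b::euclidean_space set \<Rightarrow> ('a \<Rightarrow> 'b) \<Rightarrow> bool" where
  "diffeo_on U V f \<longleftrightarrow> open U \<and> open V \<and> f ` U = V \<and> smooth_on U f \<and>
     (\<exists>f'. smooth_on V f' \<and> (\<forall>x\<in>U. f' (f x) = x))"

section \<open>Tensor calculus in a coordinate domain\<close>

(* A complex valued k-form: beta x v is its value at the point x on the tangent vectors
   v 0, ..., v (k-1). The degree is passed explicitly to the operations. *)
type_synonym 'a form = "'a \<Rightarrow> (nat \<Rightarrow> 'a) \<Rightarrow> complex"

definition k_form :: "nat \<Rightarrow> 'a::euclidean_space set \<Rightarrow> 'a form \<Rightarrow> bool" where
  "k_form k U \<beta> \<longleftrightarrow>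
     (\<forall>x\<in>U. (\<forall>v w. (\<forall>i<k. v i = w i) \<longrightarrow> \<beta> x v = \<beta> x w) \<and>
            (\<forall>v. \<forall>i<k. linear (\<lambda>u. \<beta> x (v(i := u)))) \<and>
            (\<forall>v. \<forall>j<k. \<forall>i<j. v i = v j \<longrightarrow> \<beta> x v = 0)) \<and>
     (\<forall>v. smooth_on U (\<lambda>x. \<beta> x v))"

definition vec2 :: "'a \<Rightarrow> 'a \<Rightarrow> nat \<Rightarrow> 'a" where
  "vec2 u w = (\<lambda>i. if i = 0 then u else w)"

(* Normalised so that (alpha \<and> beta)(u,w) = alpha(u) beta(w) - alpha(w) beta(u) for 1-forms. *)
definition wedge :: "nat \<Rightarrow> nat \<Rightarrow> 'a form \<Rightarrow> 'a form \<Rightarrow> 'a form" where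
  "wedge p q \<alpha> \<beta> = (\<lambda>x v.
     (\<Sum>\<sigma> | \<sigma> permutes {..<p + q}.
        of_int (sign \<sigma>) * \<alpha> x (\<lambda>i. v (\<sigma> i)) * \<beta> x (\<lambda>i. v (\<sigma> (p + i)))) / (fact p * fact q))"

primrec wedge_power :: "'a form \<Rightarrow> nat \<Rightarrow> 'a form" where
  "wedge_power \<omega> 0 = (\<lambda>x v. 1)"
| "wedge_power \<omega> (Suc n) = wedge 2 (2 * n) \<omega> (wedge_power \<omega> n)"

definition ext_deriv :: "nat \<Rightarrow> 'a::euclidean_space form \<Rightarrow> 'a form" where
  "ext_deriv k \<beta> = (\<lambda>x v. \<Sum>i\<le>k. (- 1) ^ i *
     frechet_derivative (\<lambda>y. \<beta> y (\<lambda>j. if j < i then v j else v (Suc j))) (at x) (v i))"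

definition interior_product :: "('a \<Rightarrow> 'a) \<Rightarrow> 'a form \<Rightarrow> 'a form" where
  "interior_product X \<beta> = (\<lambda>x v. \<beta> x (\<lambda>j. case j of 0 \<Rightarrow> X x | Suc i \<Rightarrow> v i))"

definition lie_derivative ::
  "nat \<Rightarrow> ('a::euclidean_space \<Rightarrow> 'a) \<Rightarrow> 'a form \<Rightarrow> 'a form" where
  "lie_derivative k X \<beta> = (\<lambda>x v.
     frechet_derivative (\<lambda>y. \<beta> y v) (at x) (X x) +
     (\<Sum>i<k. \<beta> x (v(i := frechet_derivative X (at x) (v i)))))"

definition pullback :: "('a::euclidean_space \<Rightarrow> 'b::euclidean_space) \<Rightarrow> 'b form \<Rightarrow> 'a form" where
  "pullback f \<beta> = (\<lambda>x v. \<beta> (f x) (\<lambda>i. frechet_derivative f (at x) (v i)))"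

definition conj_form :: "'a form \<Rightarrow> 'a form" where
  "conj_form \<beta> = (\<lambda>x v. cnj (\<beta> x v))"

definition lie_bracket ::
  "('a::euclidean_space \<Rightarrow> 'a) \<Rightarrow> ('a \<Rightarrow> 'a) \<Rightarrow> 'a \<Rightarrow> 'a" where
  "lie_bracket X Y = (\<lambda>x. frechet_derivative Y (at x) (X x) - frechet_derivative X (at x) (Y x))"

definition nijenhuis ::
  "('a::euclidean_space \<Rightarrow> 'a \<Rightarrow> 'a) \<Rightarrow> ('a \<Rightarrow> 'a) \<Rightarrow> ('a \<Rightarrow> 'a) \<Rightarrow> 'a \<Rightarrow> 'a" where
  "nijenhuis J X Y = (\<lambda>x.
     lie_bracket (\<lambda>y. J y (X y)) (\<lambda>y. J y (Y y)) x
     - J x (lie_bracket (\<lambda>y. J y (X y)) Y x)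
     - J x (lie_bracket X (\<lambda>y. J y (Y y)) x)
     - lie_bracket X Y x)"

(* The Levi-Civita connection: christoffel g x u w is the covariant derivative at x, in the
   direction u, of the constant coordinate field w, as given by the Koszul formula. *)
definition christoffel ::
  "('a::euclidean_space \<Rightarrow> 'a \<Rightarrow> 'a \<Rightarrow> real) \<Rightarrow> 'a \<Rightarrow> 'a \<Rightarrow> 'a \<Rightarrow> 'a" where
  "christoffel g x u w = (THE z. \<forall>y. 2 * g x z y =
     frechet_derivative (\<lambda>p. g p w y) (at x) u +
     frechet_derivative (\<lambda>p. g p u y) (at x) w -
     frechet_derivative (\<lambda>p. g p u w) (at x) y)"

definition covariant_derivative ::
  "('a::euclidean_space \<Rightarrow> 'a \<Rightarrow> 'a \<Rightarrow> real) \<Rightarrow> ('a \<Rightarrow> 'a) \<Rightarrow> 'a \<Rightarrow> 'a \<Rightarrow> 'a" where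
  "covariant_derivative g X x u = frechet_derivative X (at x) u + christoffel g x u (X x)"

section \<open>Orbifolds and tensors on them\<close>

(* A local uniformizing chart (U, G, phi). The elements of G are total functions on the model
   space that are extended by the identity outside U, so that G acts effectively on U. *)
record ('e, 'p) ochart =
  cdom :: "'e set"
  cgrp :: "('e \<Rightarrow> 'e) set"
  cmap :: "'e \<Rightarrow> 'p"

record ('e, 'p) orbifold =
  ospace :: "'p topology"
  charts :: "('e, 'p) ochart set"

definition uniformizing_chart ::
  "'p topology \<Rightarrow> ('e::euclidean_space, 'p) ochart \<Rightarrow> bool" where
  "uniformizing_chart X c \<longleftrightarrow>
     open (cdom c) \<and> connected (cdom c) \<and> cdom c \<noteq> {} \<and>
     finite (cgrp c) \<and> id \<in> cgrp c \<and>
     (\<forall>f\<in>cgrp c. \<forall>f'\<in>cgrp c. f \<circ> f' \<in> cgrp c) \<and>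
     (\<forall>f\<in>cgrp c. diffeo_on (cdom c) (cdom c) f \<and> (\<forall>x. x \<notin> cdom c \<longrightarrow> f x = x)) \<and>
     continuous_map (top_of_set (cdom c)) X (cmap c) \<and>
     open_map (top_of_set (cdom c)) X (cmap c) \<and>
     (\<forall>x\<in>cdom c. \<forall>y\<in>cdom c. cmap c x = cmap c y \<longleftrightarrow> (\<exists>f\<in>cgrp c. y = f x))"

definition transition ::
  "('e::euclidean_space, 'p) ochart \<Rightarrow> ('e, 'p) ochart \<Rightarrow> 'e set \<Rightarrow> ('e \<Rightarrow> 'e) \<Rightarrow> bool" where
  "transition c c' N h \<longleftrightarrow>
     N \<subseteq> cdom c \<and> h ` N \<subseteq> cdom c' \<and> diffeo_on N (h ` N) h \<and>
     (\<forall>x\<in>N. cmap c' (h x) = cmap c x)"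

definition is_orbifold :: "('e::euclidean_space, 'p) orbifold \<Rightarrow> bool" where
  "is_orbifold M \<longleftrightarrow>
     Hausdorff_space (ospace M) \<and> second_countable (ospace M) \<and>
     (\<forall>c\<in>charts M. uniformizing_chart (ospace M) c) \<and>
     (\<Union>c\<in>charts M. cmap c ` cdom c) = topspace (ospace M) \<and>
     (\<forall>c\<in>charts M. \<forall>c'\<in>charts M. \<forall>x\<in>cdom c. \<forall>y\<in>cdom c'. cmap c x = cmap c' y \<longrightarrow>
        (\<exists>N h. x \<in> N \<and> h x = y \<and> transition c c' N h))"

(* Tensors in the orbifold sense are families of tensors on the uniformizing charts that are
   preserved by all transitions, in particular by the local uniformizing groups. *)
type_synonym ('e, 'p) oform = "('e, 'p) ochart \<Rightarrow> 'e form"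
type_synonym ('e, 'p) ovector = "('e, 'p) ochart \<Rightarrow> 'e \<Rightarrow> 'e"
type_synonym ('e, 'p) oendo = "('e, 'p) ochart \<Rightarrow> 'e \<Rightarrow> 'e \<Rightarrow> 'e"
type_synonym ('e, 'p) obilinear = "('e, 'p) ochart \<Rightarrow> 'e \<Rightarrow> 'e \<Rightarrow> 'e \<Rightarrow> real"

definition orb_form ::
  "('e::euclidean_space, 'p) orbifold \<Rightarrow> nat \<Rightarrow> ('e, 'p) oform \<Rightarrow> bool" where
  "orb_form M k \<beta> \<longleftrightarrow>
     (\<forall>c\<in>charts M. k_form k (cdom c) (\<beta> c)) \<and>
     (\<forall>c\<in>charts M. \<forall>c'\<in>charts M. \<forall>N h. transition c c' N h \<longrightarrow>
        (\<forall>x\<in>N. \<forall>v. pullback h (\<beta> c') x v = \<beta> c x v))"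

definition orb_endo :: "('e::euclidean_space, 'p) orbifold \<Rightarrow> ('e, 'p) oendo \<Rightarrow> bool" where
  "orb_endo M J \<longleftrightarrow>
     (\<forall>c\<in>charts M. (\<forall>x\<in>cdom c. linear (J c x)) \<and> (\<forall>u. smooth_on (cdom c) (\<lambda>x. J c x u))) \<and>
     (\<forall>c\<in>charts M. \<forall>c'\<in>charts M. \<forall>N h. transition c c' N h \<longrightarrow>
        (\<forall>x\<in>N. \<forall>u. frechet_derivative h (at x) (J c x u) =
                   J c' (h x) (frechet_derivative h (at x) u)))"

definition riemannian_metric ::
  "('e::euclidean_space, 'p) orbifold \<Rightarrow> ('e, 'p) obilinear \<Rightarrow> bool" where
  "riemannian_metric M g \<longleftrightarrow>
     (\<forall>c\<in>charts M.
        (\<forall>x\<in>cdom c. bilinear (g c x) \<and> (\<forall>u w. g c x u w = g c x w u) \<and>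
                    (\<forall>u. u \<noteq> 0 \<longrightarrow> g c x u u > 0)) \<and>
        (\<forall>u w. smooth_on (cdom c) (\<lambda>x. g c x u w))) \<and>
     (\<forall>c\<in>charts M. \<forall>c'\<in>charts M. \<forall>N h. transition c c' N h \<longrightarrow>
        (\<forall>x\<in>N. \<forall>u w. g c' (h x) (frechet_derivative h (at x) u) (frechet_derivative h (at x) w) =
                     g c x u w))"

section \<open>Hyperkaehler cones and 3-Sasakian orbifolds\<close>

definition eps :: "nat \<Rightarrow> nat \<Rightarrow> nat \<Rightarrow> real" where
  "eps i j k = (real j - real i) * (real k - real i) * (real k - real j) / 2"

definition kaehler_form :: "('e, 'p) obilinear \<Rightarrow> ('e, 'p) oendo \<Rightarrow> ('e, 'p) oform" where
  "kaehler_form g J c = (\<lambda>x v. complex_of_real (g c x (J c x (v 0)) (v 1)))"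

(* The Nijenhuis tensor is tensorial, so it suffices to evaluate it on constant coordinate fields. *)
definition kaehler ::
  "('e::euclidean_space, 'p) orbifold \<Rightarrow> ('e, 'p) obilinear \<Rightarrow> ('e, 'p) oendo \<Rightarrow> bool" where
  "kaehler M g J \<longleftrightarrow> riemannian_metric M g \<and> orb_endo M J \<and>
     (\<forall>c\<in>charts M. \<forall>x\<in>cdom c.
        (\<forall>u. J c x (J c x u) = - u) \<and>
        (\<forall>u w. nijenhuis (J c) (\<lambda>_. u) (\<lambda>_. w) x = 0) \<and>
        (\<forall>u w. g c x (J c x u) (J c x w) = g c x u w) \<and>
        (\<forall>v. ext_deriv 2 (kaehler_form g J c) x v = 0))"

definition hyperkaehler ::
  "('e::euclidean_space, 'p) orbifold \<Rightarrow> ('e, 'p) obilinear \<Rightarrow> (nat \<Rightarrow> ('e, 'p) oendo) \<Rightarrow> bool" where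
  "hyperkaehler M g J \<longleftrightarrow> (\<forall>i\<in>{1..3}. kaehler M g (J i)) \<and>
     (\<forall>c\<in>charts M. \<forall>x\<in>cdom c. \<forall>i\<in>{1..3}. \<forall>j\<in>{1..3}. \<forall>u.
        J i c x (J j c x u) =
          - (if i = j then u else 0) + (\<Sum>k\<in>{1..3}. eps i j k *\<^sub>R J k c x u))"

definition cone_chart :: "('e, 'p) ochart \<Rightarrow> ('e \<times> real, 'p \<times> real) ochart" where
  "cone_chart c =
     \<lparr>cdom = cdom c \<times> {0<..},
      cgrp = (\<lambda>f (x, r). if r > 0 then (f x, r) else (x, r)) ` cgrp c,
      cmap = (\<lambda>(x, r). (cmap c x, r))\<rparr>"

definition cone_orbifold :: "('e, 'p) orbifold \<Rightarrow> ('e \<times> real, 'p \<times> real) orbifold" where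
  "cone_orbifold S = \<lparr>ospace = prod_topology (ospace S) (top_of_set {0<..}), charts = cone_chart ` charts S\<rparr>"

(* gbar represents dr^2 + r^2 g on the cone. *)
definition is_cone_metric ::
  "('e, 'p) orbifold \<Rightarrow> ('e, 'p) obilinear \<Rightarrow> ('e \<times> real, 'p \<times> real) obilinear \<Rightarrow> bool" where
  "is_cone_metric S g gbar \<longleftrightarrow>
     (\<forall>c\<in>charts S. \<forall>x\<in>cdom c. \<forall>r>0. \<forall>u s w t.
        gbar (cone_chart c) (x, r) (u, s) (w, t) = s * t + r\<^sup>2 * g c x u w)"

definition contact_form :: "('e, 'p) obilinear \<Rightarrow> ('e, 'p) ovector \<Rightarrow> ('e, 'p) oform" where
  "contact_form g X c = (\<lambda>x v. complex_of_real (g c x (X c x) (v 0)))"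

(* The condition on J says that J_i(r d/dr) is tangent to {r = 1} and equal to xi_i there. *)
definition three_sasakian ::
  "('e::euclidean_space, 'p) orbifold \<Rightarrow> ('e, 'p) obilinear \<Rightarrow> (nat \<Rightarrow> ('e, 'p) ovector) \<Rightarrow>
   (nat \<Rightarrow> ('e, 'p) oform) \<Rightarrow> (nat \<Rightarrow> ('e, 'p) oendo) \<Rightarrow> bool" where
  "three_sasakian S g \<xi> \<eta> \<Phi> \<longleftrightarrow>
     is_orbifold S \<and> riemannian_metric S g \<and>
     (\<exists>gbar J. is_cone_metric S g gbar \<and> hyperkaehler (cone_orbifold S) gbar J \<and>
        (\<forall>i\<in>{1..3}. \<forall>c\<in>charts S. \<forall>x\<in>cdom c.
           J i (cone_chart c) (x, 1) (0, 1) = (\<xi> i c x, 0))) \<and>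
     (\<forall>i\<in>{1..3}. \<eta> i = contact_form g (\<xi> i)) \<and>
     (\<forall>i\<in>{1..3}. \<Phi> i = (\<lambda>c. covariant_derivative (g c) (\<xi> i c)))"

section \<open>Circle actions and the quotient orbifold\<close>

(* An effective action of the circle R/TZ on the orbifold S, written as a T-periodic action rho of
   the reals, whose infinitesimal generator is the vector field X. *)
definition circle_action ::
  "('e::euclidean_space, 'p) orbifold \<Rightarrow> ('e, 'p) ovector \<Rightarrow> (real \<Rightarrow> 'p \<Rightarrow> 'p) \<Rightarrow> real \<Rightarrow> bool" where
  "circle_action S X \<rho> T \<longleftrightarrow> T > 0 \<and>
     continuous_map (prod_topology euclideanreal (ospace S)) (ospace S) (\<lambda>(t, p). \<rho> t p) \<and>
     (\<forall>p\<in>topspace (ospace S). \<rho> 0 p = p) \<and>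
     (\<forall>p\<in>topspace (ospace S). \<forall>s t. \<rho> (s + t) p = \<rho> s (\<rho> t p)) \<and>
     (\<forall>t. (\<forall>p\<in>topspace (ospace S). \<rho> t p = p) \<longleftrightarrow> (\<exists>n::int. t = of_int n * T)) \<and>
     (\<forall>c\<in>charts S. \<forall>x\<in>cdom c. \<exists>e>0. \<exists>N F.
        open N \<and> x \<in> N \<and> N \<subseteq> cdom c \<and> smooth_on (N \<times> {-e<..<e}) F \<and>
        (\<forall>y\<in>N. F (y, 0) = y \<and>
           (\<forall>t\<in>{-e<..<e}. F (y, t) \<in> cdom c \<and> cmap c (F (y, t)) = \<rho> t (cmap c y) \<and>
              ((\<lambda>s. F (y, s)) has_vector_derivative X c (F (y, t))) (at t))))"

definition quasi_regular ::
  "('e::euclidean_space, 'p) orbifold \<Rightarrow> ('e, 'p) ovector \<Rightarrow> (real \<Rightarrow> 'p \<Rightarrow> 'p) \<Rightarrow> real \<Rightarrow> bool" where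
  "quasi_regular S X \<rho> T \<longleftrightarrow> circle_action S X \<rho> T \<and>
     (\<forall>p\<in>topspace (ospace S). finite {t\<in>{0..<T}. \<rho> t p = p})"

definition regular ::
  "('e::euclidean_space, 'p) orbifold \<Rightarrow> ('e, 'p) ovector \<Rightarrow> (real \<Rightarrow> 'p \<Rightarrow> 'p) \<Rightarrow> real \<Rightarrow> bool" where
  "regular S X \<rho> T \<longleftrightarrow> circle_action S X \<rho> T \<and>
     (\<forall>p\<in>topspace (ospace S). {t\<in>{0..<T}. \<rho> t p = p} = {0})"

(* F lifts the map s from cdom c \<times> R to |S| to a local diffeomorphism into the chart c' of S. *)
definition local_lift ::
  "('f::euclidean_space \<times> real \<Rightarrow> 'p) \<Rightarrow> ('f, 'q) ochart \<Rightarrow> ('e::euclidean_space, 'p) ochart \<Rightarrow>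
   ('f \<times> real) set \<Rightarrow> ('f \<times> real \<Rightarrow> 'e) \<Rightarrow> bool" where
  "local_lift s c c' N F \<longleftrightarrow>
     N \<subseteq> cdom c \<times> UNIV \<and> F ` N \<subseteq> cdom c' \<and> diffeo_on N (F ` N) F \<and>
     (\<forall>z\<in>N. cmap c' (F z) = s z)"

(* Z, together with the projection pi, is the leaf space S/rho with its quotient orbifold structure:
   S is a circle orbibundle over Z. Over every chart V of Z the orbibundle is uniformized by a
   trivial bundle V \<times> R (periodic in the second variable, the bundle V \<times> S^1) through the
   equivariant map sigma, and the transitions of Z lift to bundle maps. *)
definition circle_quotient ::
  "('e::euclidean_space, 'p) orbifold \<Rightarrow> (real \<Rightarrow> 'p \<Rightarrow> 'p) \<Rightarrow> ('f::euclidean_space, 'q) orbifold \<Rightarrow>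
   ('p \<Rightarrow> 'q) \<Rightarrow> (('f, 'q) ochart \<Rightarrow> 'f \<times> real \<Rightarrow> 'p) \<Rightarrow> bool" where
  "circle_quotient S \<rho> Z \<pi> \<sigma> \<longleftrightarrow>
     is_orbifold Z \<and> quotient_map (ospace S) (ospace Z) \<pi> \<and>
     (\<forall>p\<in>topspace (ospace S). \<forall>q\<in>topspace (ospace S). \<pi> p = \<pi> q \<longleftrightarrow> (\<exists>t. q = \<rho> t p)) \<and>
     (\<forall>c\<in>charts Z. \<forall>y\<in>cdom c. \<forall>t.
        \<sigma> c (y, t) \<in> topspace (ospace S) \<and> \<pi> (\<sigma> c (y, t)) = cmap c y \<and>
        (\<forall>s. \<sigma> c (y, s + t) = \<rho> s (\<sigma> c (y, t))) \<and>
        (\<exists>c'\<in>charts S. \<exists>N F. (y, t) \<in> N \<and> local_lift (\<sigma> c) c c' N F)) \<and>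
     (\<forall>c\<in>charts Z. \<forall>c'\<in>charts Z. \<forall>N h. transition c c' N h \<longrightarrow>
        (\<forall>y\<in>N. \<exists>N' \<tau>. open N' \<and> y \<in> N' \<and> N' \<subseteq> N \<and> smooth_on N' (\<tau> :: 'f \<Rightarrow> real) \<and>
           (\<forall>w\<in>N'. \<forall>t. \<sigma> c' (h w, \<tau> w + t) = \<sigma> c (w, t))))"

definition basic_form ::
  "('e::euclidean_space, 'p) orbifold \<Rightarrow> ('e, 'p) ovector \<Rightarrow> nat \<Rightarrow> ('e, 'p) oform \<Rightarrow> bool" where
  "basic_form S X k \<beta> \<longleftrightarrow> orb_form S k \<beta> \<and>
     (\<forall>c\<in>charts S. \<forall>x\<in>cdom c. \<forall>v.
        interior_product (X c) (\<beta> c) x v = 0 \<and> lie_derivative k (X c) (\<beta> c) x v = 0)"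

(* The form beta' on Z pulls back to the form beta on S; the pullbacks are compared on the
   uniformizing bundles V \<times> R, whose projection to V is fst. *)
definition descends_to ::
  "('e::euclidean_space, 'p) orbifold \<Rightarrow> ('f::euclidean_space, 'q) orbifold \<Rightarrow>
   (('f, 'q) ochart \<Rightarrow> 'f \<times> real \<Rightarrow> 'p) \<Rightarrow> nat \<Rightarrow> ('e, 'p) oform \<Rightarrow> ('f, 'q) oform \<Rightarrow> bool" where
  "descends_to S Z \<sigma> k \<beta> \<beta>' \<longleftrightarrow> orb_form Z k \<beta>' \<and>
     (\<forall>c\<in>charts Z. \<forall>c'\<in>charts S. \<forall>N F. local_lift (\<sigma> c) c c' N F \<longrightarrow>
        (\<forall>z\<in>N. \<forall>v. pullback F (\<beta> c') z v = pullback fst (\<beta>' c) z v))"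

section \<open>SU(3)- and SU(1,2)-structures\<close>

(* The form beta at x, extended complex linearly, vanishes unless the number of its arguments of
   type (1,0) lies in A and the others are of type (0,1): it has components of type (p,k-p), p in A,
   only. The inner sum is the value of beta on the vectors v j - i J (v j), of type (1,0), for j in P
   and v j + i J (v j), of type (0,1), for j not in P, expanded by multilinearity. *)
definition has_type :: "nat \<Rightarrow> nat set \<Rightarrow> ('a \<Rightarrow> 'a \<Rightarrow> 'a) \<Rightarrow> 'a form \<Rightarrow> 'a \<Rightarrow> bool" where
  "has_type k A J \<beta> x \<longleftrightarrow>
     (\<forall>P\<subseteq>{..<k}. card P \<notin> A \<longrightarrow> (\<forall>v.
        (\<Sum>Q\<in>Pow {..<k}. (\<Prod>j\<in>Q. if j \<in> P then - \<i> else \<i>) *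
           \<beta> x (\<lambda>j. if j \<in> Q then J x (v j) else v j)) = 0))"

(* b has p positive and q negative directions; used with p + q the dimension. *)
definition has_signature :: "('a::euclidean_space \<Rightarrow> 'a \<Rightarrow> real) \<Rightarrow> nat \<Rightarrow> nat \<Rightarrow> bool" where
  "has_signature b p q \<longleftrightarrow> p + q = DIM('a) \<and>
     (\<exists>V W. subspace V \<and> subspace W \<and> dim V = p \<and> dim W = q \<and>
        (\<forall>u\<in>V. u \<noteq> 0 \<longrightarrow> b u u > 0) \<and> (\<forall>u\<in>W. u \<noteq> 0 \<longrightarrow> b u u < 0))"

definition hermitian_metric :: "('e, 'p) oform \<Rightarrow> ('e, 'p) oendo \<Rightarrow> ('e, 'p) obilinear" where
  "hermitian_metric \<omega> J c = (\<lambda>x u w. Re (\<omega> c x (vec2 u (J c x w))))"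

definition real_form :: "('e, 'p) orbifold \<Rightarrow> ('e, 'p) oform \<Rightarrow> bool" where
  "real_form M \<beta> \<longleftrightarrow> (\<forall>c\<in>charts M. \<forall>x\<in>cdom c. \<forall>v. Im (\<beta> c x v) = 0)"

definition zero_form :: "('e, 'p) orbifold \<Rightarrow> ('e, 'p) oform \<Rightarrow> bool" where
  "zero_form M \<beta> \<longleftrightarrow> (\<forall>c\<in>charts M. \<forall>x\<in>cdom c. \<forall>v. \<beta> c x v = 0)"

definition nonvanishing_form :: "('e, 'p) orbifold \<Rightarrow> ('e, 'p) oform \<Rightarrow> bool" where
  "nonvanishing_form M \<beta> \<longleftrightarrow> (\<forall>c\<in>charts M. \<forall>x\<in>cdom c. \<exists>v. \<beta> c x v \<noteq> 0)"

(* The data and equations common to SU(3)- and SU(1,2)-structures; the metric is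
   hermitian_metric omega J. *)
definition su_structure ::
  "(real^6, 'q) orbifold \<Rightarrow> (real^6, 'q) oendo \<Rightarrow> (real^6, 'q) oform \<Rightarrow> (real^6, 'q) oform \<Rightarrow> bool" where
  "su_structure Z J \<omega> \<Omega> \<longleftrightarrow>
     orb_endo Z J \<and> orb_form Z 2 \<omega> \<and> real_form Z \<omega> \<and>
     orb_form Z 3 \<Omega> \<and> nonvanishing_form Z \<Omega> \<and>
     (\<forall>c\<in>charts Z. \<forall>x\<in>cdom c.
        (\<forall>u. J c x (J c x u) = - u) \<and>
        (\<forall>u w. \<omega> c x (vec2 (J c x u) (J c x w)) = \<omega> c x (vec2 u w)) \<and>
        has_type 3 {3} (J c) (\<Omega> c) x \<and>
        (\<forall>v. wedge 2 3 (\<omega> c) (\<Omega> c) x v = 0) \<and>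
        (\<forall>v. wedge 3 3 (\<Omega> c) (conj_form (\<Omega> c)) x v = - 8 * \<i> * wedge_power (\<omega> c) 3 x v / fact 3))"

definition SU3_structure ::
  "(real^6, 'q) orbifold \<Rightarrow> (real^6, 'q) oendo \<Rightarrow> (real^6, 'q) oform \<Rightarrow> (real^6, 'q) oform \<Rightarrow> bool" where
  "SU3_structure Z J \<omega> \<Omega> \<longleftrightarrow> su_structure Z J \<omega> \<Omega> \<and> riemannian_metric Z (hermitian_metric \<omega> J)"

definition SU12_structure ::
  "(real^6, 'q) orbifold \<Rightarrow> (real^6, 'q) oendo \<Rightarrow> (real^6, 'q) oform \<Rightarrow> (real^6, 'q) oform \<Rightarrow> bool" where
  "SU12_structure Z J \<omega> \<Omega> \<longleftrightarrow> su_structure Z J \<omega> \<Omega> \<and>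
     (\<forall>c\<in>charts Z. \<forall>x\<in>cdom c. has_signature (hermitian_metric \<omega> J c x) 2 4)"

definition primitive_form ::
  "(real^6, 'q) orbifold \<Rightarrow> (real^6, 'q) oform \<Rightarrow> nat \<Rightarrow> (real^6, 'q) oform \<Rightarrow> bool" where
  "primitive_form Z \<omega> k \<beta> \<longleftrightarrow> (\<forall>c\<in>charts Z. \<forall>x\<in>cdom c. \<forall>v.
     wedge k (2 * (4 - k)) (\<beta> c) (wedge_power (\<omega> c) (4 - k)) x v = 0)"

(* W1 is a function, represented as a 0-form. *)
definition torsion_classes ::
  "(real^6, 'q) orbifold \<Rightarrow> (real^6, 'q) oendo \<Rightarrow> (real^6, 'q) oform \<Rightarrow> (real^6, 'q) oform \<Rightarrow>
   (real^6, 'q) oform \<Rightarrow> (real^6, 'q) oform \<Rightarrow> (real^6, 'q) oform \<Rightarrow> (real^6, 'q) oform \<Rightarrow>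
   (real^6, 'q) oform \<Rightarrow> bool" where
  "torsion_classes Z J \<omega> \<Omega> W1 W2 W3 W4 W5 \<longleftrightarrow>
     orb_form Z 0 W1 \<and>
     orb_form Z 2 W2 \<and> (\<forall>c\<in>charts Z. \<forall>x\<in>cdom c. has_type 2 {1} (J c) (W2 c) x) \<and>
     primitive_form Z \<omega> 2 W2 \<and>
     orb_form Z 3 W3 \<and> real_form Z W3 \<and>
     (\<forall>c\<in>charts Z. \<forall>x\<in>cdom c. has_type 3 {1, 2} (J c) (W3 c) x) \<and>
     primitive_form Z \<omega> 3 W3 \<and>
     orb_form Z 1 W4 \<and> real_form Z W4 \<and>
     orb_form Z 1 W5 \<and> (\<forall>c\<in>charts Z. \<forall>x\<in>cdom c. has_type 1 {1} (J c) (W5 c) x) \<and>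
     (\<forall>c\<in>charts Z. \<forall>x\<in>cdom c. \<forall>v.
        ext_deriv 2 (\<omega> c) x v =
          3 / 2 * complex_of_real (Im (cnj (W1 c x v) * \<Omega> c x v)) +
          wedge 1 2 (W4 c) (\<omega> c) x v + W3 c x v \<and>
        ext_deriv 3 (\<Omega> c) x v =
          W1 c x v * wedge_power (\<omega> c) 2 x v +
          wedge 2 2 (W2 c) (\<omega> c) x v + wedge 1 3 (conj_form (W5 c)) (\<Omega> c) x v)"

section \<open>The forms on the 3-Sasakian orbifold\<close>

definition alpha_form :: "(nat \<Rightarrow> ('e::euclidean_space, 'p) oform) \<Rightarrow> nat \<Rightarrow> ('e, 'p) oform" where
  "alpha_form \<eta> i c = (\<lambda>x v. (ext_deriv 1 (\<eta> i c) x v -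
     (\<Sum>j\<in>{1..3}. \<Sum>k\<in>{1..3}. complex_of_real (eps i j k) * wedge 1 1 (\<eta> j c) (\<eta> k c) x v)) / 2)"

definition alpha_cx :: "(nat \<Rightarrow> ('e::euclidean_space, 'p) oform) \<Rightarrow> ('e, 'p) oform" where
  "alpha_cx \<eta> c = (\<lambda>x v. alpha_form \<eta> 1 c x v + \<i> * alpha_form \<eta> 2 c x v)"

definition eta_cx :: "(nat \<Rightarrow> ('e, 'p) oform) \<Rightarrow> ('e, 'p) oform" where
  "eta_cx \<eta> c = (\<lambda>x v. \<eta> 1 c x v + \<i> * \<eta> 2 c x v)"

definition omega_ab ::
  "(nat \<Rightarrow> ('e::euclidean_space, 'p) oform) \<Rightarrow> real \<Rightarrow> real \<Rightarrow> ('e, 'p) oform" where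
  "omega_ab \<eta> a b c = (\<lambda>x v. of_real a * alpha_form \<eta> 3 c x v -
     \<i> / 2 * of_real (b\<^sup>2) * wedge 1 1 (eta_cx \<eta> c) (conj_form (eta_cx \<eta> c)) x v)"

definition Omega_ab ::
  "(nat \<Rightarrow> ('e::euclidean_space, 'p) oform) \<Rightarrow> real \<Rightarrow> real \<Rightarrow> real \<Rightarrow> ('e, 'p) oform" where
  "Omega_ab \<eta> a b \<gamma> c = (\<lambda>x v. of_real (a * b) * exp (\<i> * of_real \<gamma>) *
     wedge 2 1 (alpha_cx \<eta> c) (conj_form (eta_cx \<eta> c)) x v)"

end

theory Submission
  imports Defs
begin

text \<open>Over a chart, the hyperkaehler cone condition is quaternionic linear algebra: completing the radial vector
  to a quaternionic orthonormal basis gives complex 1-forms \<open>s\<close>, \<open>t\<close> which together with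
  \<open>\<eta>\<^sub>1 + i \<eta>\<^sub>2\<close> express the three forms \<open>\<alpha>\<^sub>i\<close>, hence \<open>\<omega>\<close> and \<open>\<Omega>\<close>, with constant
  coefficients. The differentials of \<open>\<omega>\<close> and \<open>\<Omega>\<close> only involve \<open>d\<alpha>\<^sub>i\<close> and \<open>d\<eta>\<^sub>i\<close>, and these are
  determined by \<open>d\<eta>\<^sub>i = 2\<alpha>\<^sub>i + \<epsilon>\<^sub>i\<^sub>j\<^sub>k \<eta>\<^sub>j \<and> \<eta>\<^sub>k\<close> and \<open>dd\<eta>\<^sub>i = 0\<close>; no derivative of
  \<open>s\<close> and \<open>t\<close> is needed. All forms are annihilated by and invariant under the flow of \<open>\<xi>\<^sub>3\<close>, so they descend to \<open>Z\<close>,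
  where the almost complex structure is recovered from \<open>\<Omega>\<close> alone. The torsion is then
  read off pointwise: \<open>d\<omega>\<close> is a multiple of \<open>(a + b\<^sup>2) Im(\<alpha> \<and> cnj \<eta>)\<close>, while \<open>d\<Omega>\<close> is a
  constant multiple of \<open>\<omega>\<^sup>2\<close> for \<open>a = 2b\<^sup>2\<close>, and of \<open>(\<alpha>\<^sub>3 - i \<eta> \<and> cnj \<eta>) \<and> \<omega>\<close>, with primitive first
  factor, for \<open>a = - b\<^sup>2\<close>.\<close>

section \<open>Smooth functions\<close>

text \<open>The cone hypothesis prescribes the metric dr^2 + r^2 g and the values of J_i on the
  radial vector at r = 1, but says nothing about how J_i depends on r. The structure equation
  d\<eta>_i = 2 g(J_i ., .) therefore has to be extracted at r = 1, by playing closedness of the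
  Kaehler form against integrability of J_i. The second obstacle is the orbifold setting: two local
  lifts of one map agree only up to an element of a finite group that may jump from point to point.
  Lifts are therefore compared through their first derivatives at a single point, which is all that
  the pullback of an invariant form sees. Finally, the torsion form in the symplectic case is
  itself, up to a constant, the member a = 1, b = sqrt 2 of the family \<omega>. For this reason,
  and because one complex structure belongs to all \<Omega> with a and b nonzero, the frames on
  \<open>Z\<close> are set up for all parameters at once.\<close>

lemma k_smooth_on_cong:
  assumes "open U" "\<And>x. x \<in> U \<Longrightarrow> f x = g x" "k_smooth_on k U f"
  shows "k_smooth_on k U g"
  using assms(2,3)
proof (induction k arbitrary: f g)
  case 0
  then show ?case by (metis continuous_on_eq k_smooth_on.simps(1))
next
  case (Suc k)
  have d: "(f has_derivative D) (at x) \<longleftrightarrow> (g has_derivative D) (at x)" if "x \<in> U" for x D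
    using has_derivative_transform_within_open[of f D x UNIV U g]
      has_derivative_transform_within_open[of g D x UNIV U f] that \<open>open U\<close> Suc.prems(1) by auto
  have "frechet_derivative f (at x) = frechet_derivative g (at x)" if "x \<in> U" for x
    using d[OF that] by (simp add: frechet_derivative_def)
  then show ?case
    using Suc.prems Suc.IH[of "\<lambda>x. frechet_derivative f (at x) v" "\<lambda>x. frechet_derivative g (at x) v" for v]
      d by (auto simp: differentiable_def)
qed

lemma k_smooth_on_subset:
  assumes "V \<subseteq> U" "k_smooth_on k U f"
  shows "k_smooth_on k V f"
  using assms(2)
  by (induction k arbitrary: f) (use \<open>V \<subseteq> U\<close> continuous_on_subset in auto)

lemma k_smooth_on_continuous: "k_smooth_on k U f \<Longrightarrow> continuous_on U f"
  by (cases k) (auto intro!: continuous_at_imp_continuous_on differentiable_imp_continuous_within)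

lemma k_smooth_on_SucD: "k_smooth_on (Suc k) U f \<Longrightarrow> k_smooth_on k U f"
proof (induction k arbitrary: f)
  case 0
  then show ?case using k_smooth_on_continuous by fastforce
next
  case (Suc k)
  then show ?case by (auto simp del: k_smooth_on.simps(2) simp: k_smooth_on.simps(2)[of "Suc k"] k_smooth_on.simps(2)[of k U f])
qed

text \<open>\<open>frechet_derivative\<close> is a choice operator; any pointwise derivative
  \<open>D\<close> may stand in for it because derivatives are unique. Most closure proofs below
  enter the inductive step through this rule.\<close>

lemma k_smooth_on_SucI:
  assumes "open U" and der: "\<And>x. x \<in> U \<Longrightarrow> (f has_derivative D x) (at x)"
    and sm: "\<And>v. k_smooth_on k U (\<lambda>x. D x v)"
  shows "k_smooth_on (Suc k) U f"
proof -
  have "frechet_derivative f (at x) = D x" if "x \<in> U" for x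
    using frechet_derivative_at[OF der[OF that]] by simp
  then show ?thesis
    using der k_smooth_on_cong[OF \<open>open U\<close> _ sm] by (auto simp: differentiable_def)
qed

lemma k_smooth_on_SucE:
  assumes "k_smooth_on (Suc k) U f"
  obtains "\<And>x. x \<in> U \<Longrightarrow> (f has_derivative frechet_derivative f (at x)) (at x)"
    "\<And>v. k_smooth_on k U (\<lambda>x. frechet_derivative f (at x) v)"
  using assms frechet_derivative_works by auto

lemma k_smooth_on_const: "open U \<Longrightarrow> k_smooth_on k U (\<lambda>x. c)"
proof (induction k arbitrary: c)
  case (Suc k)
  then show ?case by (intro k_smooth_on_SucI[OF _ has_derivative_const])
qed simp

lemma k_smooth_on_bounded_linear_comp:
  assumes "open U" "bounded_linear L" "k_smooth_on k U f"
  shows "k_smooth_on k U (\<lambda>x. L (f x))"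
  using assms(3)
proof (induction k arbitrary: f)
  case 0
  then show ?case using assms(2) by (auto intro: bounded_linear.continuous_on)
next
  case (Suc k)
  from Suc.prems obtain
    "\<And>x. x \<in> U \<Longrightarrow> (f has_derivative frechet_derivative f (at x)) (at x)"
    "\<And>v. k_smooth_on k U (\<lambda>x. frechet_derivative f (at x) v)" by (rule k_smooth_on_SucE) blast
  then show ?case
    using Suc.IH by (intro k_smooth_on_SucI[OF \<open>open U\<close> bounded_linear.has_derivative[OF assms(2)]]) auto
qed

lemma k_smooth_on_add:
  assumes "open U" "k_smooth_on k U f" "k_smooth_on k U g"
  shows "k_smooth_on k U (\<lambda>x. f x + g x)"
  using assms(2,3)
proof (induction k arbitrary: f g)
  case 0
  then show ?case by (simp add: continuous_on_add)
next
  case (Suc k)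
  from Suc.prems(1) obtain
    "\<And>x. x \<in> U \<Longrightarrow> (f has_derivative frechet_derivative f (at x)) (at x)"
    "\<And>v. k_smooth_on k U (\<lambda>x. frechet_derivative f (at x) v)" by (rule k_smooth_on_SucE) blast
  moreover from Suc.prems(2) obtain
    "\<And>x. x \<in> U \<Longrightarrow> (g has_derivative frechet_derivative g (at x)) (at x)"
    "\<And>v. k_smooth_on k U (\<lambda>x. frechet_derivative g (at x) v)" by (rule k_smooth_on_SucE) blast
  ultimately show ?case
    using Suc.IH by (intro k_smooth_on_SucI[OF \<open>open U\<close> has_derivative_add]) auto
qed

lemma k_smooth_on_bilinear:
  assumes "open U" "bounded_bilinear P" "k_smooth_on k U f" "k_smooth_on k U g"
  shows "k_smooth_on k U (\<lambda>x. P (f x) (g x))"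
  using assms(3,4)
proof (induction k arbitrary: f g)
  case 0
  then show ?case using assms(2) by (auto intro: bounded_bilinear.continuous_on)
next
  case (Suc k)
  from Suc.prems(1) obtain
    f: "\<And>x. x \<in> U \<Longrightarrow> (f has_derivative frechet_derivative f (at x)) (at x)"
    "\<And>v. k_smooth_on k U (\<lambda>x. frechet_derivative f (at x) v)" by (rule k_smooth_on_SucE) blast
  from Suc.prems(2) obtain
    g: "\<And>x. x \<in> U \<Longrightarrow> (g has_derivative frechet_derivative g (at x)) (at x)"
    "\<And>v. k_smooth_on k U (\<lambda>x. frechet_derivative g (at x) v)" by (rule k_smooth_on_SucE) blast
  have "((\<lambda>x. P (f x) (g x)) has_derivative
      (\<lambda>h. P (f x) (frechet_derivative g (at x) h) + P (frechet_derivative f (at x) h) (g x))) (at x)"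
    if "x \<in> U" for x
    using bounded_bilinear.FDERIV[OF assms(2) f(1)[OF that] g(1)[OF that]] by simp
  \<comment> \<open>The Leibniz terms pair one function with a derivative of the other, so the
    hypotheses on \<open>f\<close> and \<open>g\<close> are lowered by one order before the
    induction hypothesis is applied.\<close>
  moreover have "k_smooth_on k U
      (\<lambda>x. P (f x) (frechet_derivative g (at x) v) + P (frechet_derivative f (at x) v) (g x))" for v
    using Suc.prems[THEN k_smooth_on_SucD] f(2)[of v] g(2)[of v]
    by (intro k_smooth_on_add[OF \<open>open U\<close>] Suc.IH)
  ultimately show ?case by (rule k_smooth_on_SucI[OF \<open>open U\<close>])
qed

lemma k_smooth_on_sum:
  assumes "open U" "finite I" "\<And>i. i \<in> I \<Longrightarrow> k_smooth_on k U (f i)"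
  shows "k_smooth_on k U (\<lambda>x. \<Sum>i\<in>I. f i x)"
  using assms(2,3)
  by (induction I) (auto intro: k_smooth_on_const k_smooth_on_add \<open>open U\<close> simp del: k_smooth_on.simps(2))

lemma linear_eq_sum_Basis:
  fixes L :: "'a::euclidean_space \<Rightarrow> 'b::real_normed_vector"
  assumes "linear L"
  shows "L v = (\<Sum>b\<in>Basis. (v \<bullet> b) *\<^sub>R L b)"
proof -
  have "L v = L (\<Sum>b\<in>Basis. (v \<bullet> b) *\<^sub>R b)" by (simp add: euclidean_representation)
  then show ?thesis using assms by (simp add: linear_sum linear_cmul)
qed

text \<open>Smoothness is known only for each fixed argument of \<open>L x\<close>. Expanding
  \<open>w x\<close> in the basis writes the value as a finite sum of products of smooth functions.
  This is how tensors are evaluated on varying vector fields throughout.\<close>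

lemma k_smooth_on_linear_family:
  fixes L :: "'c::euclidean_space \<Rightarrow> 'a::euclidean_space \<Rightarrow> 'b::real_normed_vector"
  assumes "open U" "\<And>x. x \<in> U \<Longrightarrow> linear (L x)" "\<And>v. k_smooth_on k U (\<lambda>x. L x v)"
    "k_smooth_on k U w"
  shows "k_smooth_on k U (\<lambda>x. L x (w x))"
proof (rule k_smooth_on_cong[OF \<open>open U\<close>])
  show "(\<Sum>b\<in>Basis. (w x \<bullet> b) *\<^sub>R L x b) = L x (w x)" if "x \<in> U" for x
    by (rule linear_eq_sum_Basis[OF assms(2)[OF that], symmetric])
  have "k_smooth_on k U (\<lambda>x. (w x \<bullet> b) *\<^sub>R L x b)" for b
    by (rule k_smooth_on_bilinear[OF assms(1) bounded_bilinear_scaleR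
          k_smooth_on_bounded_linear_comp[OF assms(1) bounded_linear_inner_left assms(4)] assms(3)])
  then show "k_smooth_on k U (\<lambda>x. \<Sum>b\<in>Basis. (w x \<bullet> b) *\<^sub>R L x b)"
    by (intro k_smooth_on_sum[OF assms(1)]) auto
qed

text \<open>By the chain rule the derivative is the linear family of derivatives of \<open>f\<close>
  at \<open>g x\<close>, evaluated on the derivative of \<open>g\<close>. The induction generalises
  \<open>f\<close> but keeps \<open>g\<close>, which only has to be lowered by one order.\<close>

lemma k_smooth_on_compose:
  fixes f :: "'b::euclidean_space \<Rightarrow> 'c::real_normed_vector"
  assumes "open U" "open V" "g ` U \<subseteq> V" "k_smooth_on k U g" "k_smooth_on k V f"
  shows "k_smooth_on k U (\<lambda>x. f (g x))"
  using assms(4,5)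
proof (induction k arbitrary: f)
  case 0
  then show ?case using assms(3) by (auto intro: continuous_on_compose2)
next
  case (Suc k)
  from Suc.prems(1) obtain
    g: "\<And>x. x \<in> U \<Longrightarrow> (g has_derivative frechet_derivative g (at x)) (at x)"
    "\<And>v. k_smooth_on k U (\<lambda>x. frechet_derivative g (at x) v)" by (rule k_smooth_on_SucE) blast
  from Suc.prems(2) obtain
    f: "\<And>x. x \<in> V \<Longrightarrow> (f has_derivative frechet_derivative f (at x)) (at x)"
    "\<And>v. k_smooth_on k V (\<lambda>x. frechet_derivative f (at x) v)" by (rule k_smooth_on_SucE) blast
  show ?case
  proof (rule k_smooth_on_SucI[OF \<open>open U\<close>])
    show "((\<lambda>x. f (g x)) has_derivative
        (\<lambda>v. frechet_derivative f (at (g x)) (frechet_derivative g (at x) v))) (at x)" if "x \<in> U" for x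
      using diff_chain_at[OF g(1)[OF that] f(1)] that assms(3) by (auto simp: o_def)
    have "k_smooth_on k U (\<lambda>x. frechet_derivative f (at (g x)) v)" for v
      using Suc.IH[OF k_smooth_on_SucD[OF Suc.prems(1)] f(2)[of v]] .
    moreover have "linear (frechet_derivative f (at (g x)))" if "x \<in> U" for x
      using f(1)[THEN has_derivative_linear] assms(3) that by blast
    ultimately show "k_smooth_on k U (\<lambda>x. frechet_derivative f (at (g x)) (frechet_derivative g (at x) v))" for v
      by (rule k_smooth_on_linear_family[OF \<open>open U\<close> _ _ g(2)[of v], of "\<lambda>x. frechet_derivative f (at (g x))", rotated])
  qed
qed

lemma k_smooth_on_local:
  assumes "\<And>x. x \<in> U \<Longrightarrow> \<exists>V. open V \<and> x \<in> V \<and> k_smooth_on k V f"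
  shows "k_smooth_on k U f"
  using assms
proof (induction k arbitrary: f)
  case 0
  have "isCont f x" if "x \<in> U" for x
    using 0[OF that] by (auto simp: continuous_on_eq_continuous_at)
  then show ?case by (simp add: continuous_at_imp_continuous_on)
next
  case (Suc k)
  have "k_smooth_on k U (\<lambda>x. frechet_derivative f (at x) v)" for v
  proof (rule Suc.IH)
    fix x assume "x \<in> U"
    from Suc.prems[OF this] obtain V where "open V" "x \<in> V" "k_smooth_on (Suc k) V f" by blast
    then show "\<exists>V. open V \<and> x \<in> V \<and> k_smooth_on k V (\<lambda>x. frechet_derivative f (at x) v)" by auto
  qed
  moreover have "f differentiable (at x)" if "x \<in> U" for x
    using Suc.prems[OF that] by auto
  ultimately show ?case by simp
qed

lemma smooth_onI: "(\<And>k. k_smooth_on k U f) \<Longrightarrow> smooth_on U f"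
  by (simp add: smooth_on_def)

lemma smooth_onD: "smooth_on U f \<Longrightarrow> k_smooth_on k U f"
  by (simp add: smooth_on_def)

lemma smooth_on_cong:
  "open U \<Longrightarrow> (\<And>x. x \<in> U \<Longrightarrow> f x = g x) \<Longrightarrow> smooth_on U f \<Longrightarrow> smooth_on U g"
  unfolding smooth_on_def using k_smooth_on_cong[of U f g] by blast

lemma smooth_on_subset: "smooth_on U f \<Longrightarrow> V \<subseteq> U \<Longrightarrow> smooth_on V f"
  unfolding smooth_on_def using k_smooth_on_subset[of V U _ f] by blast

lemma smooth_on_local:
  "(\<And>x. x \<in> U \<Longrightarrow> \<exists>V. open V \<and> x \<in> V \<and> smooth_on V f) \<Longrightarrow> smooth_on U f"
  by (rule smooth_onI, rule k_smooth_on_local) (use smooth_onD in blast)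

lemma smooth_on_const: "open U \<Longrightarrow> smooth_on U (\<lambda>x. c)"
  by (simp add: smooth_onI k_smooth_on_const)

lemma smooth_on_bounded_linear_comp:
  "open U \<Longrightarrow> bounded_linear L \<Longrightarrow> smooth_on U f \<Longrightarrow> smooth_on U (\<lambda>x. L (f x))"
  by (simp add: smooth_on_def k_smooth_on_bounded_linear_comp)

lemma smooth_on_bounded_linear:
  fixes L :: "'a::euclidean_space \<Rightarrow> 'b::real_normed_vector"
  assumes "open U" "bounded_linear L"
  shows "smooth_on U L"
proof (rule smooth_onI)
  show "k_smooth_on k U L" for k
  proof (cases k)
    case 0
    then show ?thesis using assms by (simp add: linear_continuous_on)
  next
    case (Suc j)
    show ?thesis unfolding Suc
      by (rule k_smooth_on_SucI[OF \<open>open U\<close> bounded_linear_imp_has_derivative[OF assms(2)] k_smooth_on_const[OF \<open>open U\<close>]])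
  qed
qed

lemma smooth_on_id: "open U \<Longrightarrow> smooth_on U (\<lambda>x. x)"
  by (simp add: smooth_on_bounded_linear)

lemma smooth_on_add:
  "open U \<Longrightarrow> smooth_on U f \<Longrightarrow> smooth_on U g \<Longrightarrow> smooth_on U (\<lambda>x. f x + g x)"
  by (simp add: smooth_on_def k_smooth_on_add)

lemma smooth_on_bilinear:
  "open U \<Longrightarrow> bounded_bilinear P \<Longrightarrow> smooth_on U f \<Longrightarrow> smooth_on U g \<Longrightarrow> smooth_on U (\<lambda>x. P (f x) (g x))"
  by (simp add: smooth_on_def k_smooth_on_bilinear)

lemmas smooth_on_mult = smooth_on_bilinear[OF _ bounded_bilinear_mult]
lemmas smooth_on_scaleR = smooth_on_bilinear[OF _ bounded_bilinear_scaleR]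

lemma smooth_on_minus: "open U \<Longrightarrow> smooth_on U f \<Longrightarrow> smooth_on U (\<lambda>x. - f x)"
  by (rule smooth_on_bounded_linear_comp) (simp_all add: bounded_linear_minus bounded_linear_ident)

lemma smooth_on_diff:
  "open U \<Longrightarrow> smooth_on U f \<Longrightarrow> smooth_on U g \<Longrightarrow> smooth_on U (\<lambda>x. f x - g x)"
  using smooth_on_add[OF _ _ smooth_on_minus, of U f g] by simp

lemma smooth_on_sum:
  "open U \<Longrightarrow> finite I \<Longrightarrow> (\<And>i. i \<in> I \<Longrightarrow> smooth_on U (f i)) \<Longrightarrow> smooth_on U (\<lambda>x. \<Sum>i\<in>I. f i x)"
  by (simp add: smooth_on_def k_smooth_on_sum)

lemma smooth_on_Pair:
  assumes "open U" "smooth_on U f" "smooth_on U g"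
  shows "smooth_on U (\<lambda>x. (f x, g x))"
  using smooth_on_add[OF assms(1)
      smooth_on_bounded_linear_comp[OF assms(1) bounded_linear_Pair[OF bounded_linear_ident bounded_linear_zero] assms(2)]
      smooth_on_bounded_linear_comp[OF assms(1) bounded_linear_Pair[OF bounded_linear_zero bounded_linear_ident] assms(3)]]
  by simp

lemma smooth_on_fst: "open U \<Longrightarrow> smooth_on U f \<Longrightarrow> smooth_on U (\<lambda>x. fst (f x))"
  by (rule smooth_on_bounded_linear_comp[OF _ bounded_linear_fst])

lemma smooth_on_linear_family:
  fixes L :: "'c::euclidean_space \<Rightarrow> 'a::euclidean_space \<Rightarrow> 'b::real_normed_vector"
  shows "open U \<Longrightarrow> (\<And>x. x \<in> U \<Longrightarrow> linear (L x)) \<Longrightarrow> (\<And>v. smooth_on U (\<lambda>x. L x v)) \<Longrightarrow>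
    smooth_on U w \<Longrightarrow> smooth_on U (\<lambda>x. L x (w x))"
  by (simp add: smooth_on_def k_smooth_on_linear_family)

lemma smooth_on_compose:
  fixes f :: "'b::euclidean_space \<Rightarrow> 'c::real_normed_vector"
  shows "open U \<Longrightarrow> open V \<Longrightarrow> g ` U \<subseteq> V \<Longrightarrow> smooth_on U g \<Longrightarrow> smooth_on V f \<Longrightarrow>
    smooth_on U (\<lambda>x. f (g x))"
  by (simp add: smooth_on_def k_smooth_on_compose)

lemma smooth_on_has_derivative:
  "smooth_on U f \<Longrightarrow> x \<in> U \<Longrightarrow> (f has_derivative frechet_derivative f (at x)) (at x)"
  using smooth_onD[of U f "Suc 0"] by (simp add: frechet_derivative_works[symmetric])

lemma smooth_on_derivative: "smooth_on U f \<Longrightarrow> smooth_on U (\<lambda>x. frechet_derivative f (at x) v)"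
  by (rule smooth_onI) (use smooth_onD[of U f "Suc k" for k] in simp)

lemma smooth_on_continuous: "smooth_on U f \<Longrightarrow> continuous_on U f"
  using smooth_onD[of U f 0] by simp

lemma linear_frechet_derivative':
  "smooth_on U f \<Longrightarrow> x \<in> U \<Longrightarrow> linear (frechet_derivative f (at x))"
  by (rule has_derivative_linear[OF smooth_on_has_derivative])

lemma frechet_derivative_eqI:
  "(f has_derivative D) (at x) \<Longrightarrow> frechet_derivative f (at x) = D"
  by (rule frechet_derivative_at[symmetric])

text \<open>A product rule for evaluation: \<open>L\<close> is differentiated with its argument
  frozen at \<open>w x\<close>, and \<open>w\<close> with \<open>L x\<close> frozen. Both parts come
  from the expansion of \<open>w\<close> in the basis.\<close>

lemma has_derivative_linear_family:
  fixes L :: "'c::euclidean_space \<Rightarrow> 'a::euclidean_space \<Rightarrow> 'b::real_normed_vector"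
  assumes "open U" "x \<in> U" "\<And>y. y \<in> U \<Longrightarrow> linear (L y)" "\<And>v. smooth_on U (\<lambda>y. L y v)"
    and w: "(w has_derivative w') (at x)"
  shows "((\<lambda>y. L y (w y)) has_derivative
    (\<lambda>h. frechet_derivative (\<lambda>y. L y (w x)) (at x) h + L x (w' h))) (at x)"
proof (rule has_derivative_transform_within_open[OF _ assms(1,2)])
  have "((\<lambda>y. L y b) has_derivative frechet_derivative (\<lambda>y. L y b) (at x)) (at x)" for b
    using assms smooth_on_has_derivative by blast
  then have D: "((\<lambda>y. \<Sum>b\<in>Basis. (w y \<bullet> b) *\<^sub>R L y b) has_derivative
    (\<lambda>h. \<Sum>b\<in>Basis. (w x \<bullet> b) *\<^sub>R frechet_derivative (\<lambda>y. L y b) (at x) h + (w' h \<bullet> b) *\<^sub>R L x b)) (at x)"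
    by (intro has_derivative_sum has_derivative_scaleR has_derivative_inner_left w)
  have "((\<lambda>y. \<Sum>b\<in>Basis. (w x \<bullet> b) *\<^sub>R L y b) has_derivative
    (\<lambda>h. \<Sum>b\<in>Basis. (w x \<bullet> b) *\<^sub>R frechet_derivative (\<lambda>y. L y b) (at x) h)) (at x)"
    using assms smooth_on_has_derivative by (intro has_derivative_sum has_derivative_scaleR_right) blast
  then have "((\<lambda>y. L y (w x)) has_derivative
    (\<lambda>h. \<Sum>b\<in>Basis. (w x \<bullet> b) *\<^sub>R frechet_derivative (\<lambda>y. L y b) (at x) h)) (at x)"
    by (rule has_derivative_transform_within_open[OF _ assms(1,2)])
      (simp add: linear_eq_sum_Basis[OF assms(3), symmetric])
  then have "frechet_derivative (\<lambda>y. L y (w x)) (at x) =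
    (\<lambda>h. \<Sum>b\<in>Basis. (w x \<bullet> b) *\<^sub>R frechet_derivative (\<lambda>y. L y b) (at x) h)"
    by (rule frechet_derivative_eqI)
  then show "((\<lambda>y. \<Sum>b\<in>Basis. (w y \<bullet> b) *\<^sub>R L y b) has_derivative
    (\<lambda>h. frechet_derivative (\<lambda>y. L y (w x)) (at x) h + L x (w' h))) (at x)"
    using D by (simp add: sum.distrib linear_eq_sum_Basis[OF assms(3)[OF assms(2)], symmetric])
qed (simp add: linear_eq_sum_Basis[OF assms(3), symmetric])

lemma frechet_derivative_compose':
  assumes "smooth_on U g" "smooth_on V f" "x \<in> U" "g x \<in> V"
  shows "frechet_derivative (\<lambda>y. f (g y)) (at x) v = frechet_derivative f (at (g x)) (frechet_derivative g (at x) v)"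
  using frechet_derivative_eqI[OF diff_chain_at[OF smooth_on_has_derivative[OF assms(1,3)] smooth_on_has_derivative[OF assms(2,4)]]]
  by (simp add: o_def)

section \<open>Symmetry of second derivatives\<close>

lemma has_derivative_along_line:
  fixes f :: "'a::real_normed_vector \<Rightarrow> real"
  assumes "(f has_derivative D) (at (c + s *\<^sub>R u))"
  shows "((\<lambda>s. f (c + s *\<^sub>R u)) has_real_derivative D u) (at s)"
proof -
  have "((\<lambda>s. c + s *\<^sub>R u) has_derivative (\<lambda>k. k *\<^sub>R u)) (at s)"
    by (auto intro!: derivative_eq_intros)
  from diff_chain_at[OF this assms] show ?thesis
    using has_derivative_linear[OF assms] by (simp add: o_def linear_cmul has_field_derivative_def mult_commute_abs)
qed

text \<open>The mean value theorem is applied twice: along \<open>u\<close> to the difference in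
  direction \<open>v\<close>, then along \<open>v\<close> to the resulting derivative. The second
  difference on the left is symmetric in \<open>u\<close> and \<open>v\<close>, while the mixed
  derivative on the right is not visibly so.\<close>

lemma smooth_on_second_difference:
  fixes f :: "'a::euclidean_space \<Rightarrow> real"
  assumes "smooth_on U f" "0 < h"
    and in_U: "\<And>s t. s \<in> {0..h} \<Longrightarrow> t \<in> {0..h} \<Longrightarrow> x + s *\<^sub>R u + t *\<^sub>R v \<in> U"
  obtains s t where "s \<in> {0..h}" "t \<in> {0..h}"
    "f (x + h *\<^sub>R u + h *\<^sub>R v) - f (x + h *\<^sub>R u) - f (x + h *\<^sub>R v) + f x =
      h\<^sup>2 * frechet_derivative (\<lambda>y. frechet_derivative f (at y) u) (at (x + s *\<^sub>R u + t *\<^sub>R v)) v"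
proof -
  let ?D = "\<lambda>y. frechet_derivative f (at y)"
  let ?g = "\<lambda>y. ?D y u"
  have f: "(f has_derivative ?D y) (at y)" if "y \<in> U" for y
    using smooth_on_has_derivative[OF assms(1) that] .
  have g: "(?g has_derivative frechet_derivative ?g (at y)) (at y)" if "y \<in> U" for y
    using smooth_on_has_derivative[OF smooth_on_derivative[OF assms(1)] that] .
  let ?\<phi> = "\<lambda>s. f (x + s *\<^sub>R u + h *\<^sub>R v) - f (x + s *\<^sub>R u)"
  have "(?\<phi> has_real_derivative ?g (x + s *\<^sub>R u + h *\<^sub>R v) - ?g (x + s *\<^sub>R u)) (at s)"
    if "s \<in> {0..h}" for s
  proof -
    have 1: "x + s *\<^sub>R u + h *\<^sub>R v \<in> U" "x + s *\<^sub>R u \<in> U"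
      using in_U[OF that, of h] in_U[OF that, of 0] \<open>0 < h\<close> by auto
    have "((\<lambda>s. f (x + s *\<^sub>R u + h *\<^sub>R v)) has_real_derivative ?g (x + s *\<^sub>R u + h *\<^sub>R v)) (at s)"
      using has_derivative_along_line[of f "?D (x + s *\<^sub>R u + h *\<^sub>R v)" "x + h *\<^sub>R v" s u] f[OF 1(1)]
      by (simp add: add_ac)
    from DERIV_diff[OF this has_derivative_along_line[OF f[OF 1(2)]]] show ?thesis .
  qed
  then obtain s where s: "0 < s" "s < h" "?\<phi> h - ?\<phi> 0 = h * (?g (x + s *\<^sub>R u + h *\<^sub>R v) - ?g (x + s *\<^sub>R u))"
    using MVT2[OF \<open>0 < h\<close>, of ?\<phi> "\<lambda>s. ?g (x + s *\<^sub>R u + h *\<^sub>R v) - ?g (x + s *\<^sub>R u)"] by auto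
  let ?\<psi> = "\<lambda>t. ?g (x + s *\<^sub>R u + t *\<^sub>R v)"
  have "(?\<psi> has_real_derivative frechet_derivative ?g (at (x + s *\<^sub>R u + t *\<^sub>R v)) v) (at t)"
    if "t \<in> {0..h}" for t
  proof -
    have 1: "x + s *\<^sub>R u + t *\<^sub>R v \<in> U" using in_U[OF _ that, of s] s by auto
    show ?thesis by (rule has_derivative_along_line[OF g[OF 1]])
  qed
  then obtain t where t: "0 < t" "t < h" "?\<psi> h - ?\<psi> 0 = h * frechet_derivative ?g (at (x + s *\<^sub>R u + t *\<^sub>R v)) v"
    using MVT2[OF \<open>0 < h\<close>, of ?\<psi> "\<lambda>t. frechet_derivative ?g (at (x + s *\<^sub>R u + t *\<^sub>R v)) v"] by auto
  show thesis
    by (rule that[of s t]) (use s t in \<open>auto simp: power2_eq_square\<close>)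
qed

text \<open>The symmetric second difference equals h^2 times either mixed derivative, each taken at
  some point near \<open>x\<close>. As \<open>h\<close> tends to 0 both points tend to
  \<open>x\<close>, and continuity of the two mixed derivatives identifies their values
  there.\<close>

lemma smooth_on_second_derivative_symmetric_real:
  fixes f :: "'a::euclidean_space \<Rightarrow> real"
  assumes "open U" "smooth_on U f" "x \<in> U"
  shows "frechet_derivative (\<lambda>y. frechet_derivative f (at y) u) (at x) v =
    frechet_derivative (\<lambda>y. frechet_derivative f (at y) v) (at x) u"
proof -
  let ?A = "\<lambda>y. frechet_derivative (\<lambda>y. frechet_derivative f (at y) u) (at y) v"
  let ?B = "\<lambda>y. frechet_derivative (\<lambda>y. frechet_derivative f (at y) v) (at y) u"
  obtain e where e: "0 < e" "ball x e \<subseteq> U" using assms open_contains_ball by blast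
  \<comment> \<open>Every parallelogram with sides \<open>h *\<^sub>R u\<close> and
    \<open>h *\<^sub>R v\<close>, where h < d, lies in \<open>ball x e\<close>; the summand 1 keeps
    the denominator positive when both vectors vanish.\<close>
  define d where "d = e / (norm u + norm v + 1)"
  have d: "0 < d" using e by (simp add: d_def add_nonneg_pos)
  have near: "dist x (x + s *\<^sub>R u + t *\<^sub>R v) \<le> h * (norm u + norm v)" if "s \<in> {0..h}" "t \<in> {0..h}" for s t h
  proof -
    have "norm (s *\<^sub>R u + t *\<^sub>R v) \<le> s * norm u + t * norm v"
      using that norm_triangle_ineq[of "s *\<^sub>R u" "t *\<^sub>R v"] by simp
    also have "\<dots> \<le> h * norm u + h * norm v" using that by (intro add_mono mult_right_mono) auto
    finally have "norm (s *\<^sub>R u + t *\<^sub>R v) \<le> h * norm u + h * norm v" .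
    moreover have "dist x (x + s *\<^sub>R u + t *\<^sub>R v) = norm (s *\<^sub>R u + t *\<^sub>R v)"
      using norm_minus_commute[of "s *\<^sub>R u + t *\<^sub>R v" 0] by (simp add: dist_norm norm_minus_commute add.assoc)
    ultimately show ?thesis by (simp add: algebra_simps)
  qed
  have in_U: "x + s *\<^sub>R u + t *\<^sub>R v \<in> U" if "s \<in> {0..h}" "t \<in> {0..h}" "0 < h" "h < d" for s t h
  proof -
    have "h * (norm u + norm v) \<le> h * (norm u + norm v + 1)" using that by simp
    also have "\<dots> < d * (norm u + norm v + 1)" using that by (intro mult_strict_right_mono) (auto simp: add_nonneg_pos)
    also have "\<dots> = e" by (simp add: d_def add_nonneg_pos less_imp_neq[OF add_nonneg_pos, symmetric])
    finally show ?thesis using near[OF that(1,2)] e by (auto simp: subset_iff)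
  qed
  have in_U': "x + s *\<^sub>R v + t *\<^sub>R u \<in> U" if "s \<in> {0..h}" "t \<in> {0..h}" "0 < h" "h < d" for s t h
    using in_U[OF that(2,1,3,4)] by (simp add: add_ac)
  have "\<exists>y z. dist x y \<le> h * (norm u + norm v) \<and> dist x z \<le> h * (norm u + norm v) \<and> ?A y = ?B z"
    if h: "0 < h" "h < d" for h
  proof -
    obtain s t where st: "s \<in> {0..h}" "t \<in> {0..h}"
      "f (x + h *\<^sub>R u + h *\<^sub>R v) - f (x + h *\<^sub>R u) - f (x + h *\<^sub>R v) + f x = h\<^sup>2 * ?A (x + s *\<^sub>R u + t *\<^sub>R v)"
      using smooth_on_second_difference[OF assms(2) h(1) in_U[OF _ _ h]] by blast
    obtain s' t' where st': "s' \<in> {0..h}" "t' \<in> {0..h}"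
      "f (x + h *\<^sub>R v + h *\<^sub>R u) - f (x + h *\<^sub>R v) - f (x + h *\<^sub>R u) + f x = h\<^sup>2 * ?B (x + s' *\<^sub>R v + t' *\<^sub>R u)"
      using smooth_on_second_difference[OF assms(2) h(1) in_U'[OF _ _ h]] by blast
    have "h\<^sup>2 * ?A (x + s *\<^sub>R u + t *\<^sub>R v) = h\<^sup>2 * ?B (x + t' *\<^sub>R u + s' *\<^sub>R v)"
      using st(3) st'(3) by (simp add: algebra_simps)
    then show ?thesis using near[OF st(1,2)] near[OF st'(2,1)] h by auto
  qed
  \<comment> \<open>The shift by 2 makes the step size strictly smaller than \<open>d\<close>
    already for \<open>n = 0\<close>.\<close>
  moreover have "0 < d / real (n + 2)" "d / real (n + 2) < d" for n
    using d by (auto simp: field_simps add_pos_nonneg)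
  ultimately have "\<forall>n. \<exists>y z. dist x y \<le> (d / real (n + 2)) * (norm u + norm v) \<and>
    dist x z \<le> (d / real (n + 2)) * (norm u + norm v) \<and> ?A y = ?B z"
    by blast
  then obtain y z where yz: "\<And>n. dist x (y n) \<le> (d / real (n + 2)) * (norm u + norm v)"
    "\<And>n. dist x (z n) \<le> (d / real (n + 2)) * (norm u + norm v)" "\<And>n. ?A (y n) = ?B (z n)" by metis
  have "(\<lambda>n. d / real (n + 2)) \<longlonglongrightarrow> 0"
    using LIMSEQ_ignore_initial_segment[OF lim_const_over_n, of d 2] by simp
  then have lim: "(\<lambda>n. (d / real (n + 2)) * (norm u + norm v)) \<longlonglongrightarrow> 0"
    by (rule tendsto_mult_left_zero)
  have y: "y \<longlonglongrightarrow> x" and z: "z \<longlonglongrightarrow> x"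
    by (rule metric_tendsto_imp_tendsto[OF lim], use yz d in \<open>simp add: dist_commute dist_real_def\<close>)+
  have "isCont ?A x" "isCont ?B x"
    using smooth_on_continuous[OF smooth_on_derivative[OF smooth_on_derivative[OF assms(2)]]] assms(1,3)
    by (auto simp: continuous_on_eq_continuous_at)
  then have "(\<lambda>n. ?A (y n)) \<longlonglongrightarrow> ?A x" "(\<lambda>n. ?B (z n)) \<longlonglongrightarrow> ?B x"
    using y z by (auto intro: isCont_tendsto_compose)
  then show ?thesis using yz(3) LIMSEQ_unique by auto
qed

lemma smooth_on_second_derivative_symmetric:
  fixes f :: "'a::euclidean_space \<Rightarrow> 'b::euclidean_space"
  assumes "open U" "smooth_on U f" "x \<in> U"
  shows "frechet_derivative (\<lambda>y. frechet_derivative f (at y) u) (at x) v =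
    frechet_derivative (\<lambda>y. frechet_derivative f (at y) v) (at x) u"
proof (rule euclidean_eqI)
  fix b :: 'b
  let ?g = "\<lambda>y. f y \<bullet> b"
  have g: "smooth_on U ?g"
    by (rule smooth_on_bounded_linear_comp[OF assms(1) bounded_linear_inner_left assms(2)])
  have d: "frechet_derivative (\<lambda>y. h y \<bullet> b) (at y) w = frechet_derivative h (at y) w \<bullet> b"
    if "smooth_on U h" "y \<in> U" for h y w
    using frechet_derivative_eqI[OF has_derivative_inner_left[OF smooth_on_has_derivative[OF that]]] by simp
  have e: "frechet_derivative (\<lambda>y. frechet_derivative ?g (at y) w) (at x) =
      frechet_derivative (\<lambda>y. frechet_derivative f (at y) w \<bullet> b) (at x)" for w
  proof -
    have "((\<lambda>y. frechet_derivative f (at y) w \<bullet> b) has_derivative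
      frechet_derivative (\<lambda>y. frechet_derivative f (at y) w \<bullet> b) (at x)) (at x)"
      by (rule smooth_on_has_derivative[OF smooth_on_bounded_linear_comp[OF assms(1) bounded_linear_inner_left smooth_on_derivative[OF assms(2)]] assms(3)])
    from has_derivative_transform_within_open[OF this assms(1,3), of "\<lambda>y. frechet_derivative ?g (at y) w"]
    show ?thesis using d[OF assms(2)] by (intro frechet_derivative_eqI) auto
  qed
  show "frechet_derivative (\<lambda>y. frechet_derivative f (at y) u) (at x) v \<bullet> b =
    frechet_derivative (\<lambda>y. frechet_derivative f (at y) v) (at x) u \<bullet> b"
    using smooth_on_second_derivative_symmetric_real[OF assms(1) g assms(3), of u v]
    unfolding e by (simp add: d[OF smooth_on_derivative[OF assms(2)] assms(3)])
qed

section \<open>Alternating multilinear maps\<close>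

definition multilinear_map :: "nat \<Rightarrow> ((nat \<Rightarrow> 'a::real_vector) \<Rightarrow> complex) \<Rightarrow> bool" where
  "multilinear_map k T \<longleftrightarrow>
     (\<forall>v w. (\<forall>i<k. v i = w i) \<longrightarrow> T v = T w) \<and> (\<forall>v. \<forall>i<k. linear (\<lambda>u. T (v(i := u))))"

definition alternating_map :: "nat \<Rightarrow> ((nat \<Rightarrow> 'a::real_vector) \<Rightarrow> complex) \<Rightarrow> bool" where
  "alternating_map k T \<longleftrightarrow> multilinear_map k T \<and> (\<forall>v. \<forall>j<k. \<forall>i<j. v i = v j \<longrightarrow> T v = 0)"

text \<open>Antisymmetrisation without division by n!. The factorials enter in
  \<open>wedge_map\<close>, where they cancel against nested antisymmetrisations.\<close>

definition alt_sum :: "nat \<Rightarrow> ((nat \<Rightarrow> 'a) \<Rightarrow> complex) \<Rightarrow> (nat \<Rightarrow> 'a) \<Rightarrow> complex" where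
  "alt_sum n T v = (\<Sum>\<sigma> | \<sigma> permutes {..<n}. of_int (sign \<sigma>) * T (v \<circ> \<sigma>))"

definition wedge_map :: "nat \<Rightarrow> nat \<Rightarrow> ((nat \<Rightarrow> 'a) \<Rightarrow> complex) \<Rightarrow> ((nat \<Rightarrow> 'a) \<Rightarrow> complex) \<Rightarrow>
    (nat \<Rightarrow> 'a) \<Rightarrow> complex" where
  "wedge_map p q A B v = alt_sum (p + q) (\<lambda>w. A w * B (w \<circ> (+) p)) v / (fact p * fact q)"

text \<open>The exterior product of the listed 1-forms, as the Leibniz expansion of the determinant
  of the numbers f_i(v_j). Pointwise identities between forms are later reduced to linear
  combinations of such monomials.\<close>

definition dt :: "('a \<Rightarrow> complex) list \<Rightarrow> (nat \<Rightarrow> 'a) \<Rightarrow> complex" where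
  "dt fs v = alt_sum (length fs) (\<lambda>w. \<Prod>i<length fs. (fs ! i) (w i)) v"

lemma k_form_iff: "k_form k U \<beta> \<longleftrightarrow>
  (\<forall>x\<in>U. alternating_map k (\<beta> x)) \<and> (\<forall>v. smooth_on U (\<lambda>x. \<beta> x v))"
  by (auto simp: k_form_def alternating_map_def multilinear_map_def)

lemma wedge_eq_wedge_map: "wedge p q \<alpha> \<beta> x = wedge_map p q (\<alpha> x) (\<beta> x)"
  by (rule ext) (simp add: wedge_def wedge_map_def alt_sum_def o_def mult.assoc)

lemma linear_cmult_left:
  fixes f :: "'a::real_vector \<Rightarrow> complex"
  assumes "linear f"
  shows "linear (\<lambda>u. c * f u)"
  by (rule linearI) (simp_all add: linear_add[OF assms] linear_cmul[OF assms] distrib_left)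

lemma linear_cmult_right:
  fixes f :: "'a::real_vector \<Rightarrow> complex"
  assumes "linear f"
  shows "linear (\<lambda>u. f u * c)"
  using linear_cmult_left[OF assms, of c] by (simp add: mult.commute)

lemma multilinear_map_cong: "multilinear_map k T \<Longrightarrow> (\<And>i. i < k \<Longrightarrow> v i = w i) \<Longrightarrow> T v = T w"
  by (simp add: multilinear_map_def)

lemma multilinear_map_linear: "multilinear_map k T \<Longrightarrow> i < k \<Longrightarrow> linear (\<lambda>u. T (v(i := u)))"
  by (simp add: multilinear_map_def)

lemma alternating_map_cong: "alternating_map k T \<Longrightarrow> (\<And>i. i < k \<Longrightarrow> v i = w i) \<Longrightarrow> T v = T w"
  by (simp add: alternating_map_def multilinear_map_def)

lemma of_int_sign_sign: "p permutes {..<n :: nat} \<Longrightarrow> q permutes {..<n} \<Longrightarrow> sign (p \<circ> q) = sign p * sign q"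
  by (intro sign_compose permutes_imp_permutation[OF finite_lessThan])

lemma sign_mult_sign [simp]: "of_int (sign p) * (of_int (sign p) * c) = (c::complex)"
  by (metis mult.assoc mult_1 of_int_1 of_int_mult sign_idempotent)

text \<open>Reindexing the sum by right composition with \<tau> costs its sign. The companion
  statement for permuted vectors uses left composition instead.\<close>

lemma alt_sum_permute_argument:
  assumes "\<tau> permutes {..<n}"
  shows "alt_sum n (\<lambda>w. T (w \<circ> \<tau>)) v = of_int (sign \<tau>) * alt_sum n T v"
proof -
  have "alt_sum n T v = (\<Sum>\<sigma> | \<sigma> permutes {..<n}. of_int (sign (\<sigma> \<circ> \<tau>)) * T (v \<circ> (\<sigma> \<circ> \<tau>)))"
    unfolding alt_sum_def by (rule sum_permutations_compose_right[OF assms])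
  also have "\<dots> = (\<Sum>\<sigma> | \<sigma> permutes {..<n}. of_int (sign \<tau>) * (of_int (sign \<sigma>) * T (v \<circ> \<sigma> \<circ> \<tau>)))"
    by (intro sum.cong refl) (use assms in \<open>simp add: of_int_sign_sign o_assoc mult_ac\<close>)
  finally show ?thesis by (simp add: sum_distrib_left[symmetric] alt_sum_def)
qed

lemma alt_sum_permute:
  assumes "\<tau> permutes {..<n}"
  shows "alt_sum n T (v \<circ> \<tau>) = of_int (sign \<tau>) * alt_sum n T v"
proof -
  have "alt_sum n T v = (\<Sum>\<sigma> | \<sigma> permutes {..<n}. of_int (sign (\<tau> \<circ> \<sigma>)) * T (v \<circ> (\<tau> \<circ> \<sigma>)))"
    unfolding alt_sum_def by (rule setum_permutations_compose_left[OF assms])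
  also have "\<dots> = (\<Sum>\<sigma> | \<sigma> permutes {..<n}. of_int (sign \<tau>) * (of_int (sign \<sigma>) * T (v \<circ> \<tau> \<circ> \<sigma>)))"
    by (intro sum.cong refl) (use assms in \<open>simp add: of_int_sign_sign o_assoc mult_ac\<close>)
  finally show ?thesis by (simp add: sum_distrib_left[symmetric] alt_sum_def)
qed

lemma alt_sum_add: "alt_sum n (\<lambda>w. S w + T w) v = alt_sum n S v + alt_sum n T v"
  by (simp add: alt_sum_def sum.distrib distrib_left)

lemma alt_sum_cmult: "alt_sum n (\<lambda>w. c * T w) v = c * alt_sum n T v"
  by (simp add: alt_sum_def sum_distrib_left mult_ac)

text \<open>A permutation of the first \<open>p\<close> slots can be absorbed into the outer sum: it
  leaves \<open>B\<close> alone, and its sign is cancelled by the one it carries. All p! inner terms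
  therefore contribute equally.\<close>

lemma alt_sum_nested_left:
  assumes "p \<le> n" and B: "\<And>\<tau> w. \<tau> permutes {..<p} \<Longrightarrow> B (w \<circ> \<tau>) = B w"
  shows "alt_sum n (\<lambda>w. alt_sum p A w * B w) v = fact p * alt_sum n (\<lambda>w. A w * B w) v"
proof -
  have "alt_sum n (\<lambda>w. alt_sum p A w * B w) v = (\<Sum>\<sigma> | \<sigma> permutes {..<n}. \<Sum>\<tau> | \<tau> permutes {..<p}.
      of_int (sign \<tau>) * (of_int (sign \<sigma>) * (A (v \<circ> \<sigma> \<circ> \<tau>) * B (v \<circ> \<sigma>))))"
    by (simp add: alt_sum_def sum_distrib_left sum_distrib_right mult_ac)
  also have "\<dots> = (\<Sum>\<tau> | \<tau> permutes {..<p}. of_int (sign \<tau>) * alt_sum n (\<lambda>w. A (w \<circ> \<tau>) * B (w \<circ> \<tau>)) v)"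
    by (subst sum.swap) (simp add: alt_sum_def sum_distrib_left B)
  also have "\<dots> = (\<Sum>\<tau> | \<tau> permutes {..<p}. alt_sum n (\<lambda>w. A w * B w) v)"
    using \<open>p \<le> n\<close> by (intro sum.cong refl) (simp add: alt_sum_permute_argument[of _ n "\<lambda>w. A w * B w"] permutes_subset)
  finally show ?thesis by (simp add: card_permutations[OF refl])
qed

text \<open>The mirror image, with inner permutations acting on the slots from \<open>p\<close> on.
  \<open>T\<close> may depend on the first \<open>p\<close> slots as well as on the tail: for the
  exterior derivative of a product the leading slot is the direction of differentiation.\<close>

lemma alt_sum_nested_right:
  assumes T: "\<And>v w z. (\<And>i. i < p \<Longrightarrow> v i = w i) \<Longrightarrow> T v z = T w z"
  shows "alt_sum (p + q) (\<lambda>w. alt_sum q (T w) (w \<circ> (+) p)) v =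
    fact q * alt_sum (p + q) (\<lambda>w. T w (w \<circ> (+) p)) v"
proof -
  \<comment> \<open>Shifts a permutation of the \<open>q\<close> inner slots to the slots p, ..., p
    + q - 1 of the outer sum; it keeps its sign and fixes the first \<open>p\<close> slots.\<close>
  let ?s = "map_permutation {..<q} ((+) p)"
  have s: "?s \<tau> permutes {..<p + q}" "sign (?s \<tau>) = sign \<tau>" "w \<circ> ?s \<tau> \<circ> (+) p = w \<circ> (+) p \<circ> \<tau>"
    "T (w \<circ> ?s \<tau>) z = T w z" if "\<tau> permutes {..<q}" for \<tau> z and w :: "nat \<Rightarrow> 'a"
  proof -
    have "?s \<tau> permutes (+) p ` {..<q}"
      using that by (intro map_permutation_permutes) (auto simp: bij_betw_def)
    then show "?s \<tau> permutes {..<p + q}" by (rule permutes_subset) auto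
    show "sign (?s \<tau>) = sign \<tau>" by (rule sign_map_permutation) (use that in auto)
    have 1: "?s \<tau> (p + i) = p + \<tau> i" for i
    proof (cases "i < q")
      case True
      then show ?thesis using map_permutation_apply[of "(+) p" "{..<q}" i \<tau>] by simp
    next
      case False
      then show ?thesis using permutes_not_in[OF \<open>?s \<tau> permutes {..<p + q}\<close>] permutes_not_in[OF that]
        by simp
    qed
    then show "w \<circ> ?s \<tau> \<circ> (+) p = w \<circ> (+) p \<circ> \<tau>" by (auto simp: fun_eq_iff)
    have "?s \<tau> i = i" if "i < p" for i
      by (rule permutes_not_in[OF \<open>?s \<tau> permutes (+) p ` {..<q}\<close>]) (use that in auto)
    then show "T (w \<circ> ?s \<tau>) z = T w z" by (intro T) simp
  qed
  have "alt_sum (p + q) (\<lambda>w. alt_sum q (T w) (w \<circ> (+) p)) v =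
    (\<Sum>\<sigma> | \<sigma> permutes {..<p + q}. \<Sum>\<tau> | \<tau> permutes {..<q}.
      of_int (sign \<tau>) * (of_int (sign \<sigma>) * T (v \<circ> \<sigma>) (v \<circ> \<sigma> \<circ> (+) p \<circ> \<tau>)))"
    by (simp add: alt_sum_def sum_distrib_left mult_ac)
  also have "\<dots> = (\<Sum>\<tau> | \<tau> permutes {..<q}. of_int (sign (?s \<tau>)) *
      alt_sum (p + q) (\<lambda>w. T (w \<circ> ?s \<tau>) (w \<circ> ?s \<tau> \<circ> (+) p)) v)"
    by (subst sum.swap) (simp add: alt_sum_def sum_distrib_left s)
  also have "\<dots> = (\<Sum>\<tau> | \<tau> permutes {..<q}. alt_sum (p + q) (\<lambda>w. T w (w \<circ> (+) p)) v)"
  proof (intro sum.cong refl)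
    fix \<tau> assume "\<tau> \<in> {\<tau>. \<tau> permutes {..<q}}"
    then show "of_int (sign (?s \<tau>)) * alt_sum (p + q) (\<lambda>w. T (w \<circ> ?s \<tau>) (w \<circ> ?s \<tau> \<circ> (+) p)) v =
      alt_sum (p + q) (\<lambda>w. T w (w \<circ> (+) p)) v"
      using alt_sum_permute_argument[OF s(1), of \<tau> "\<lambda>w. T w (w \<circ> (+) p)" v] by simp
  qed
  finally show ?thesis by (simp add: card_permutations[OF refl])
qed

lemma alt_sum_nested_right_mult:
  assumes "\<And>v w. (\<And>i. i < p \<Longrightarrow> v i = w i) \<Longrightarrow> A v = A w"
  shows "alt_sum (p + q) (\<lambda>w. A w * alt_sum q B (w \<circ> (+) p)) v =
    fact q * alt_sum (p + q) (\<lambda>w. A w * B (w \<circ> (+) p)) v"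
proof -
  have "A v * B z = A w * B z" if "\<And>i. i < p \<Longrightarrow> v i = w i" for v w z
    using assms[of v w] that by simp
  from alt_sum_nested_right[of p "\<lambda>w z. A w * B z", OF this] show ?thesis by (simp add: alt_sum_cmult)
qed

text \<open>Polarisation: placing v_i + v_j in both slots gives 0, and expanding by linearity leaves
  only the two mixed terms.\<close>

lemma alternating_map_swap:
  assumes T: "alternating_map k T" and "i < k" "j < k" "i \<noteq> j"
  shows "T (v \<circ> Transposition.transpose i j) = - T v"
proof -
  have lin: "linear (\<lambda>u. T (w(i := u)))" "linear (\<lambda>u. T (w(j := u)))" for w
    using assms by (auto simp: alternating_map_def multilinear_map_def)
  have eq0: "T (v(i := u, j := u)) = 0" for u
    using T assms(2-4) unfolding alternating_map_def
    by (cases i j rule: linorder_cases) (auto simp: fun_upd_def)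
  have "0 = T (v(i := v i + v j, j := v i + v j))" by (simp add: eq0)
  also have "\<dots> = T (v(i := v i + v j, j := v i)) + T (v(i := v i + v j, j := v j))"
    using linear_add[OF lin(2), of "v(i := v i + v j)"] by simp
  also have "\<dots> = T (v(j := v i, i := v i + v j)) + T (v(j := v j, i := v i + v j))"
    using \<open>i \<noteq> j\<close> by (simp add: fun_upd_twist)
  also have "\<dots> = T (v(j := v i, i := v i)) + T (v(j := v i, i := v j)) + (T (v(j := v j, i := v i)) + T (v(j := v j, i := v j)))"
    by (simp only: linear_add[OF lin(1)])
  also have "T (v(j := v i, i := v i)) = 0" using eq0[of "v i"] \<open>i \<noteq> j\<close> by (metis fun_upd_twist)
  also have "T (v(j := v j, i := v j)) = 0" using eq0[of "v j"] \<open>i \<noteq> j\<close> by (metis fun_upd_twist)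
  also have "v(j := v i, i := v j) = v \<circ> Transposition.transpose i j"
    using \<open>i \<noteq> j\<close> by (auto simp: fun_eq_iff Transposition.transpose_def)
  finally show ?thesis by (simp add: eq_neg_iff_add_eq_0 o_def)
qed

lemma alternating_map_permute:
  assumes T: "alternating_map k T" and "\<tau> permutes {..<k}"
  shows "T (v \<circ> \<tau>) = of_int (sign \<tau>) * T v"
  using assms(2) finite_lessThan
proof (induction arbitrary: v rule: permutes_induct)
  case (swap a b p)
  have "T (v \<circ> (Transposition.transpose a b \<circ> p)) = of_int (sign p) * T (v \<circ> Transposition.transpose a b)"
    unfolding o_assoc by (rule swap)
  also have "\<dots> = of_int (sign p) * - T v"
    using alternating_map_swap[OF T, of a b v] swap by simp
  also have "\<dots> = of_int (sign (Transposition.transpose a b \<circ> p)) * T v"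
    using swap by (subst of_int_sign_sign[of _ k]) (auto simp: permutes_swap_id sign_swap_id)
  finally show ?case .
qed simp

lemma alternating_map_alt_sum:
  assumes "multilinear_map n T"
  shows "alternating_map n (alt_sum n T)"
  unfolding alternating_map_def multilinear_map_def
proof (intro conjI allI impI)
  fix v w :: "nat \<Rightarrow> 'a" assume "\<forall>i<n. v i = w i"
  then have "T (v \<circ> \<sigma>) = T (w \<circ> \<sigma>)" if "\<sigma> permutes {..<n}" for \<sigma>
    by (intro multilinear_map_cong[OF assms]) (use permutes_in_image[OF that] in auto)
  then show "alt_sum n T v = alt_sum n T w" by (simp add: alt_sum_def)
next
  fix v :: "nat \<Rightarrow> 'a" and i assume "i < n"
  have "linear (\<lambda>u. of_int (sign \<sigma>) * T (v(i := u) \<circ> \<sigma>))" if \<sigma>: "\<sigma> permutes {..<n}" for \<sigma>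
  proof -
    obtain j where j: "\<sigma> j = i" "j < n"
      using permutes_image[OF \<sigma>] \<open>i < n\<close> by (metis imageE lessThan_iff)
    then have "v(i := u) \<circ> \<sigma> = (v \<circ> \<sigma>)(j := u)" for u
      using permutes_inj[OF \<sigma>] by (auto simp: fun_eq_iff inj_eq)
    then have "linear (\<lambda>u. T (v(i := u) \<circ> \<sigma>))"
      using multilinear_map_linear[OF assms j(2), of "v \<circ> \<sigma>"] by simp
    then show ?thesis by (rule linear_cmult_left)
  qed
  then show "linear (\<lambda>u. alt_sum n T (v(i := u)))"
    unfolding alt_sum_def by (intro linear_compose_sum ballI) simp
next
  fix v :: "nat \<Rightarrow> 'a" and i j assume ij: "j < n" "i < j" "v i = v j"
  then have "v \<circ> Transposition.transpose i j = v" by (auto simp: fun_eq_iff Transposition.transpose_def)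
  moreover have "Transposition.transpose i j permutes {..<n}" using ij by (auto intro: permutes_swap_id)
  ultimately have "alt_sum n T v = - alt_sum n T v"
    using alt_sum_permute[of "Transposition.transpose i j" n T v] ij by (simp add: sign_swap_id)
  then show "alt_sum n T v = 0" by (simp add: eq_neg_iff_add_eq_0)
qed

lemma multilinear_map_prod:
  assumes A: "multilinear_map p A" and B: "multilinear_map q B"
  shows "multilinear_map (p + q) (\<lambda>w. A w * B (w \<circ> (+) p))"
  unfolding multilinear_map_def
proof (intro conjI allI impI)
  fix v w :: "nat \<Rightarrow> 'a" assume "\<forall>i<p + q. v i = w i"
  then show "A v * B (v \<circ> (+) p) = A w * B (w \<circ> (+) p)"
    using multilinear_map_cong[OF A, of v w] multilinear_map_cong[OF B, of "v \<circ> (+) p" "w \<circ> (+) p"] by simp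
next
  fix v :: "nat \<Rightarrow> 'a" and i assume "i < p + q"
  show "linear (\<lambda>u. A (v(i := u)) * B (v(i := u) \<circ> (+) p))"
  proof (cases "i < p")
    case True
    then have "v(i := u) \<circ> (+) p = v \<circ> (+) p" for u by (auto simp: fun_eq_iff)
    then show ?thesis using linear_cmult_right[OF multilinear_map_linear[OF A True, of v]] by simp
  next
    case False
    then have "v(i := u) \<circ> (+) p = (v \<circ> (+) p)(i - p := u)" "A (v(i := u)) = A v" for u
      by (auto simp: fun_eq_iff intro: multilinear_map_cong[OF A])
    then show ?thesis
      using linear_cmult_left[OF multilinear_map_linear[OF B, of "i - p" "v \<circ> (+) p"], of "A v"] False \<open>i < p + q\<close>
      by simp
  qed
qed

lemma alternating_map_cmult: "alternating_map k T \<Longrightarrow> alternating_map k (\<lambda>v. c * T v)"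
  unfolding alternating_map_def multilinear_map_def
  by (auto intro!: linear_cmult_left)

lemma alternating_map_add: "alternating_map k S \<Longrightarrow> alternating_map k T \<Longrightarrow> alternating_map k (\<lambda>v. S v + T v)"
  unfolding alternating_map_def multilinear_map_def by (auto intro!: linear_compose_add) metis

lemma alternating_map_wedge_map:
  assumes "alternating_map p A" "alternating_map q B"
  shows "alternating_map (p + q) (wedge_map p q A B)"
proof -
  have "alternating_map (p + q) (\<lambda>v. (1 / (fact p * fact q)) * alt_sum (p + q) (\<lambda>w. A w * B (w \<circ> (+) p)) v)"
    using assms by (intro alternating_map_cmult alternating_map_alt_sum multilinear_map_prod)
      (simp_all add: alternating_map_def)
  then show ?thesis by (simp add: wedge_map_def[abs_def])
qed

lemma wedge_map_add_left: "wedge_map p q (\<lambda>v. A v + A' v) B = (\<lambda>v. wedge_map p q A B v + wedge_map p q A' B v)"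
  by (simp add: wedge_map_def distrib_right alt_sum_add add_divide_distrib fun_eq_iff)

lemma wedge_map_add_right: "wedge_map p q A (\<lambda>v. B v + B' v) = (\<lambda>v. wedge_map p q A B v + wedge_map p q A B' v)"
  by (simp add: wedge_map_def distrib_left alt_sum_add add_divide_distrib fun_eq_iff)

lemma wedge_map_cmult_left: "wedge_map p q (\<lambda>v. c * A v) B = (\<lambda>v. c * wedge_map p q A B v)"
  by (simp add: wedge_map_def alt_sum_cmult mult.assoc fun_eq_iff)

lemma wedge_map_cmult_right: "wedge_map p q A (\<lambda>v. c * B v) = (\<lambda>v. c * wedge_map p q A B v)"
  by (simp add: wedge_map_def alt_sum_cmult mult.left_commute[of _ c] fun_eq_iff)

text \<open>The factors p! and q! produced by the two inner antisymmetrisations are exactly those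
  divided out in \<open>wedge_map\<close>. Exterior multiplication of monomials thus becomes
  concatenation of lists.\<close>

lemma wedge_map_dt: "length fs = p \<Longrightarrow> length gs = q \<Longrightarrow> wedge_map p q (dt fs) (dt gs) = dt (fs @ gs)"
proof (rule ext)
  fix v assume len: "length fs = p" "length gs = q"
  let ?F = "\<lambda>w. \<Prod>i<p. (fs ! i) (w i)" and ?G = "\<lambda>w. \<Prod>i<q. (gs ! i) (w i)"
  have "alt_sum (p + q) (\<lambda>w. alt_sum p ?F w * alt_sum q ?G (w \<circ> (+) p)) v =
      fact p * alt_sum (p + q) (\<lambda>w. ?F w * alt_sum q ?G (w \<circ> (+) p)) v"
  proof (rule alt_sum_nested_left)
    show "alt_sum q ?G (w \<circ> \<tau> \<circ> (+) p) = alt_sum q ?G (w \<circ> (+) p)" if "\<tau> permutes {..<p}" for \<tau> w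
      using permutes_not_in[OF that] by (simp add: o_def)
  qed simp
  also have "\<dots> = fact p * (fact q * alt_sum (p + q) (\<lambda>w. ?F w * ?G (w \<circ> (+) p)) v)"
    by (subst alt_sum_nested_right_mult) (auto intro!: prod.cong)
  also have "(\<lambda>w. ?F w * ?G (w \<circ> (+) p)) = (\<lambda>w. \<Prod>i<p + q. ((fs @ gs) ! i) (w i))"
  proof (rule ext)
    fix w :: "nat \<Rightarrow> 'a"
    have "(\<Prod>i<p + q. ((fs @ gs) ! i) (w i)) = (\<Prod>i<p. ((fs @ gs) ! i) (w i)) * (\<Prod>i=p..<p + q. ((fs @ gs) ! i) (w i))"
      by (subst prod.union_disjoint[symmetric]) (auto intro!: prod.cong)
    also have "(\<Prod>i=p..<p + q. ((fs @ gs) ! i) (w i)) = (\<Prod>i<q. ((fs @ gs) ! (p + i)) (w (p + i)))"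
      using prod.shift_bounds_nat_ivl[of "\<lambda>i. ((fs @ gs) ! i) (w i)" 0 p q]
      by (simp add: lessThan_atLeast0 add.commute)
    finally show "?F w * ?G (w \<circ> (+) p) = (\<Prod>i<p + q. ((fs @ gs) ! i) (w i))"
      using len by (simp add: nth_append)
  qed
  finally show "wedge_map p q (dt fs) (dt gs) v = dt (fs @ gs) v"
    by (simp only: wedge_map_def dt_def len length_append) simp
qed

lemma dt_Nil [simp]: "dt [] v = 1"
  by (simp add: dt_def alt_sum_def)

lemma permutes_lessThan_1: "{\<sigma>. \<sigma> permutes {..<Suc 0}} = {id}"
  by (auto simp: lessThan_Suc)

lemma dt_single: "dt [f] v = f (v 0)"
  by (simp add: dt_def alt_sum_def permutes_lessThan_1)

lemma permutes_lessThan_2: "{\<sigma>. \<sigma> permutes {..<Suc (Suc 0)}} = {id, Transposition.transpose 0 1}"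
proof -
  have "{..<Suc (Suc 0)} = {0, 1::nat}" by auto
  then show ?thesis using permutes_doubleton_iff[of _ 0 "1::nat"] by auto
qed

lemma alt_sum_2: "alt_sum (Suc (Suc 0)) T v = T v - T (v \<circ> Transposition.transpose 0 1)"
proof -
  have "id \<noteq> Transposition.transpose 0 (1::nat)" by (metis id_apply transpose_apply_first zero_neq_one)
  then show ?thesis by (simp add: alt_sum_def permutes_lessThan_2 sign_swap_id)
qed

lemma dt_pair: "dt [f, g] v = f (v 0) * g (v 1) - f (v 1) * g (v 0)"
  by (simp add: dt_def alt_sum_2 lessThan_Suc)

text \<open>Reordering the factors amounts to permuting the vectors by the inverse permutation, so
  the sign rule for \<open>alt_sum\<close> applies.\<close>

lemma dt_permute:
  assumes "\<tau> permutes {..<length fs}"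
  shows "dt (permute_list \<tau> fs) v = of_int (sign \<tau>) * dt fs v"
proof -
  let ?n = "length fs"
  have "(\<Prod>i<?n. (permute_list \<tau> fs ! i) (w i)) = (\<Prod>i<?n. (fs ! i) ((w \<circ> inv \<tau>) i))" for w
  proof -
    have "(\<Prod>i<?n. (fs ! i) ((w \<circ> inv \<tau>) i)) = (\<Prod>i<?n. (fs ! \<tau> i) ((w \<circ> inv \<tau>) (\<tau> i)))"
      using prod.permute[OF assms, of "\<lambda>i. (fs ! i) ((w \<circ> inv \<tau>) i)"] by (simp add: o_def)
    then show ?thesis
      using assms by (auto intro!: prod.cong simp: permute_list_nth permutes_inverses)
  qed
  then have "dt (permute_list \<tau> fs) v = alt_sum ?n (\<lambda>w. \<Prod>i<?n. (fs ! i) ((w \<circ> inv \<tau>) i)) v"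
    by (simp only: dt_def length_permute_list)
  also have "\<dots> = of_int (sign (inv \<tau>)) * dt fs v"
    unfolding dt_def by (rule alt_sum_permute_argument[OF permutes_inv[OF assms]])
  finally show ?thesis
    using sign_inverse[OF permutes_imp_permutation[OF _ assms]] by simp
qed

lemma dt_swap: "dt (xs @ a # b # ys) v = - dt (xs @ b # a # ys) v"
proof -
  let ?n = "length xs" and ?t = "Transposition.transpose (length xs) (Suc (length xs))"
  have t: "?t permutes {..<length (xs @ b # a # ys)}" by (intro permutes_swap_id) auto
  have "permute_list ?t (xs @ b # a # ys) = xs @ a # b # ys"
  proof (rule nth_equalityI)
    fix i assume "i < length (permute_list ?t (xs @ b # a # ys))"
    then have "permute_list ?t (xs @ b # a # ys) ! i = (xs @ b # a # ys) ! ?t i"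
      using t by (simp add: permute_list_nth)
    also have "\<dots> = (xs @ a # b # ys) ! i"
      by (auto simp: Transposition.transpose_def nth_append nth_Cons' Suc_le_eq)
    finally show "permute_list ?t (xs @ b # a # ys) ! i = (xs @ a # b # ys) ! i" .
  qed simp
  then show ?thesis using dt_permute[OF t, of v] by (simp add: sign_swap_id)
qed

lemma dt_not_distinct:
  assumes "\<not> distinct fs"
  shows "dt fs v = 0"
proof -
  obtain i j where ij: "i < length fs" "j < length fs" "i \<noteq> j" "fs ! i = fs ! j"
    using assms distinct_conv_nth by blast
  have t: "Transposition.transpose i j permutes {..<length fs}" using ij by (intro permutes_swap_id) auto
  have "permute_list (Transposition.transpose i j) fs = fs"
    by (rule nth_equalityI) (use ij t in \<open>auto simp: permute_list_nth Transposition.transpose_def\<close>)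
  then have "dt fs v = - dt fs v" using dt_permute[OF t, of v] ij by (simp add: sign_swap_id)
  then show ?thesis by (simp add: eq_neg_iff_add_eq_0)
qed

lemma dt_eq_0:
  assumes "\<And>f. f \<in> set fs \<Longrightarrow> f (v i) = 0" "i < length fs"
  shows "dt fs v = 0"
proof -
  have "(\<Prod>j<length fs. (fs ! j) ((v \<circ> \<sigma>) j)) = 0" if \<sigma>: "\<sigma> permutes {..<length fs}" for \<sigma>
  proof -
    obtain j where "\<sigma> j = i" "j < length fs"
      using permutes_image[OF \<sigma>] assms(2) by (metis imageE lessThan_iff)
    then show ?thesis using assms(1) by (auto simp: prod_zero_iff intro!: bexI[of _ j])
  qed
  then show ?thesis unfolding dt_def alt_sum_def by (intro sum.neutral) simp
qed

lemma cnj_dt: "cnj (dt fs v) = dt (map (\<lambda>f u. cnj (f u)) fs) v"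
  by (simp add: dt_def alt_sum_def)

lemma dt_comp: "dt fs (\<lambda>i. h (v i)) = dt (map (\<lambda>f u. f (h u)) fs) v"
  by (simp add: dt_def alt_sum_def o_def)

section \<open>Exterior derivative and wedge product\<close>

lemma k_form_alternating: "k_form k U \<beta> \<Longrightarrow> x \<in> U \<Longrightarrow> alternating_map k (\<beta> x)"
  by (simp add: k_form_iff)

lemma k_form_smooth: "k_form k U \<beta> \<Longrightarrow> smooth_on U (\<lambda>x. \<beta> x v)"
  by (simp add: k_form_iff)

lemma k_form_cong:
  "open U \<Longrightarrow> (\<And>x v. x \<in> U \<Longrightarrow> \<beta> x v = \<beta>' x v) \<Longrightarrow> k_form k U \<beta> \<Longrightarrow> k_form k U \<beta>'"
  unfolding k_form_iff
  by (metis (no_types, lifting) ext smooth_on_cong)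

lemma k_form_cmult: "open U \<Longrightarrow> k_form k U \<beta> \<Longrightarrow> k_form k U (\<lambda>x v. c * \<beta> x v)"
  by (auto simp: k_form_iff intro!: alternating_map_cmult smooth_on_mult smooth_on_const)

lemma k_form_add: "open U \<Longrightarrow> k_form k U \<beta> \<Longrightarrow> k_form k U \<beta>' \<Longrightarrow> k_form k U (\<lambda>x v. \<beta> x v + \<beta>' x v)"
  by (auto simp: k_form_iff intro!: alternating_map_add smooth_on_add)

lemma k_form_diff: "open U \<Longrightarrow> k_form k U \<beta> \<Longrightarrow> k_form k U \<beta>' \<Longrightarrow> k_form k U (\<lambda>x v. \<beta> x v - \<beta>' x v)"
  using k_form_add[OF _ _ k_form_cmult[of U k \<beta>' "- 1"], of \<beta>] by simp

lemma k_form_wedge: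
  assumes "open U" "k_form p U \<alpha>" "k_form q U \<beta>"
  shows "k_form (p + q) U (wedge p q \<alpha> \<beta>)"
  unfolding k_form_iff
proof (intro conjI ballI allI)
  show "alternating_map (p + q) (wedge p q \<alpha> \<beta> x)" if "x \<in> U" for x
    using assms(2,3) that by (simp add: wedge_eq_wedge_map alternating_map_wedge_map k_form_iff)
  show "smooth_on U (\<lambda>x. wedge p q \<alpha> \<beta> x v)" for v
    unfolding wedge_def divide_inverse
    by (intro smooth_on_mult smooth_on_sum smooth_on_const assms(1) k_form_smooth[OF assms(2)]
        k_form_smooth[OF assms(3)] finite_permutations finite_lessThan)
qed

lemma smooth_on_cnj: "open U \<Longrightarrow> smooth_on U f \<Longrightarrow> smooth_on U (\<lambda>x. cnj (f x))"
  by (rule smooth_on_bounded_linear_comp[OF _ bounded_linear_cnj])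

lemma k_form_conj: "open U \<Longrightarrow> k_form k U \<beta> \<Longrightarrow> k_form k U (conj_form \<beta>)"
  by (auto simp: k_form_iff conj_form_def alternating_map_def multilinear_map_def
      intro: smooth_on_cnj linear_compose[of _ cnj, unfolded o_def] bounded_linear.linear[OF bounded_linear_cnj])

lemma k_form_has_derivative:
  "k_form k U \<beta> \<Longrightarrow> x \<in> U \<Longrightarrow>
    ((\<lambda>y. \<beta> y v) has_derivative frechet_derivative (\<lambda>y. \<beta> y v) (at x)) (at x)"
  by (rule smooth_on_has_derivative[OF k_form_smooth])

lemma frechet_derivative_cong_open:
  assumes "open U" "x \<in> U" "\<And>y. y \<in> U \<Longrightarrow> f y = g y"
  shows "frechet_derivative f (at x) = frechet_derivative g (at x)"
proof -
  have "(f has_derivative D) (at x) \<longleftrightarrow> (g has_derivative D) (at x)" for D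
    using has_derivative_transform_within_open[of f D x UNIV U g]
      has_derivative_transform_within_open[of g D x UNIV U f] assms by auto
  then show ?thesis by (simp add: frechet_derivative_def)
qed

lemma frechet_derivative_linear_combination:
  fixes f :: "'i \<Rightarrow> 'a::real_normed_vector \<Rightarrow> complex"
  assumes "\<And>i. i \<in> I \<Longrightarrow> f i differentiable (at x)"
  shows "frechet_derivative (\<lambda>y. \<Sum>i\<in>I. c i * f i y) (at x) u = (\<Sum>i\<in>I. c i * frechet_derivative (f i) (at x) u)"
proof -
  have "((\<lambda>y. \<Sum>i\<in>I. c i * f i y) has_derivative (\<lambda>u. \<Sum>i\<in>I. c i * frechet_derivative (f i) (at x) u)) (at x)"
    using assms by (intro has_derivative_sum has_derivative_mult_right) (simp add: frechet_derivative_works[symmetric])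
  then show ?thesis by (simp add: frechet_derivative_eqI)
qed

lemma frechet_derivative_cmult:
  fixes f :: "'a::real_normed_vector \<Rightarrow> complex"
  assumes "f differentiable (at x)"
  shows "frechet_derivative (\<lambda>y. c * f y) (at x) u = c * frechet_derivative f (at x) u"
  using frechet_derivative_linear_combination[of "{()}" "\<lambda>_. f" x "\<lambda>_. c" u] assms by simp

lemma k_form_differentiable: "k_form k U \<beta> \<Longrightarrow> x \<in> U \<Longrightarrow> (\<lambda>y. \<beta> y v) differentiable (at x)"
  using k_form_has_derivative differentiable_def by blast

text \<open>The total derivative before antisymmetrisation: slot 0 is the direction of
  differentiation and the remaining slots feed the form.\<close>

definition form_derivative :: "'a::euclidean_space form \<Rightarrow> 'a form" where
  "form_derivative \<beta> x v = frechet_derivative (\<lambda>y. \<beta> y (v \<circ> Suc)) (at x) (v 0)"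

text \<open>In \<open>v \<circ> cycle_to i\<close> the vector \<open>v i\<close> comes first and the
  others follow in their order, which is the pattern of the i-th term of \<open>ext_deriv\<close>;
  the sign (-1)^i of that term is the sign of the cycle.\<close>

definition cycle_to :: "nat \<Rightarrow> nat \<Rightarrow> nat" where
  "cycle_to i j = (case j of 0 \<Rightarrow> i | Suc l \<Rightarrow> if l < i then l else Suc l)"

lemma cycle_to_simps [simp]:
  "cycle_to i 0 = i" "cycle_to i (Suc l) = (if l < i then l else Suc l)"
  by (simp_all add: cycle_to_def)

lemma cycle_to_0: "cycle_to 0 = id"
  by (auto simp: fun_eq_iff cycle_to_def split: nat.split)

lemma cycle_to_Suc: "cycle_to (Suc i) = Transposition.transpose i (Suc i) \<circ> cycle_to i"
proof
  fix j show "cycle_to (Suc i) j = (Transposition.transpose i (Suc i) \<circ> cycle_to i) j"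
    by (cases j) (auto simp: Transposition.transpose_def)
qed

lemma cycle_to_permutes: "i \<le> n \<Longrightarrow> cycle_to i permutes {..n}"
proof (induction i)
  case (Suc i)
  then have "Transposition.transpose i (Suc i) permutes {..n}" by (intro permutes_swap_id) auto
  then show ?case using Suc unfolding cycle_to_Suc by (intro permutes_compose) auto
qed (simp add: cycle_to_0 permutes_id)

lemma sign_cycle_to: "sign (cycle_to i) = (- 1) ^ i"
proof (induction i)
  case (Suc i)
  have "permutation (cycle_to i)" using permutes_imp_permutation[OF _ cycle_to_permutes[of i i]] by simp
  then show ?case using Suc unfolding cycle_to_Suc
    by (subst sign_compose) (simp_all add: permutation_swap_id sign_swap_id)
qed (simp add: cycle_to_0)

text \<open>Permutations that fix slot 0 only move arguments of the alternating form, and its sign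
  rule survives differentiation. The auxiliary \<open>?q\<close> is the same permutation with all
  indices lowered by one.\<close>

lemma form_derivative_permute:
  assumes \<beta>: "k_form k U \<beta>" "open U" "x \<in> U" and q: "q permutes {Suc 0..<Suc k}"
  shows "form_derivative \<beta> x (v \<circ> q) = of_int (sign q) * form_derivative \<beta> x v"
proof -
  let ?q = "map_permutation {Suc 0..<Suc k} (\<lambda>j. j - 1) q"
  have inj: "inj_on (\<lambda>j. j - 1) {Suc 0..<Suc k}" by (auto simp: inj_on_def)
  have "bij_betw (\<lambda>j. j - 1) {Suc 0..<Suc k} {..<k}"
    by (rule bij_betw_byWitness[where f' = Suc]) auto
  then have p: "?q permutes {..<k}" by (rule map_permutation_permutes[OF _ q])
  have s: "sign ?q = sign q" by (rule sign_map_permutation[OF inj q]) simp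
  have "q 0 = 0" using permutes_not_in[OF q] by auto
  moreover have "q (Suc j) = Suc (?q j)" for j
  proof (cases "j < k")
    case True
    then have "?q j = q (Suc j) - 1" using map_permutation_apply[OF inj, of "Suc j" q] by simp
    moreover have "q (Suc j) \<in> {Suc 0..<Suc k}" using True permutes_in_image[OF q, of "Suc j"] by simp
    ultimately show ?thesis by simp
  next
    case False
    then show ?thesis using permutes_not_in[OF p, of j] permutes_not_in[OF q, of "Suc j"] by simp
  qed
  ultimately have "v \<circ> q \<circ> Suc = v \<circ> Suc \<circ> ?q" "(v \<circ> q) 0 = v 0" by (auto simp: fun_eq_iff)
  then have "form_derivative \<beta> x (v \<circ> q) = frechet_derivative (\<lambda>y. \<beta> y (v \<circ> Suc \<circ> ?q)) (at x) (v 0)"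
    by (simp add: form_derivative_def)
  also have "\<dots> = frechet_derivative (\<lambda>y. of_int (sign ?q) * \<beta> y (v \<circ> Suc)) (at x) (v 0)"
    using alternating_map_permute[OF k_form_alternating[OF \<beta>(1)] p]
    by (subst frechet_derivative_cong_open[OF assms(2,3)]) auto
  also have "\<dots> = of_int (sign q) * form_derivative \<beta> x v"
    unfolding s form_derivative_def by (rule frechet_derivative_cmult[OF k_form_differentiable[OF assms(1,3)]])
  finally show ?thesis .
qed

lemma ext_deriv_cycle: "ext_deriv k \<beta> x v = (\<Sum>i\<le>k. of_int (sign (cycle_to i)) * form_derivative \<beta> x (v \<circ> cycle_to i))"
proof -
  have "(\<lambda>j. if j < i then v j else v (Suc j)) = v \<circ> cycle_to i \<circ> Suc" for i
    by (auto simp: fun_eq_iff)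
  then show ?thesis by (simp add: ext_deriv_def form_derivative_def sign_cycle_to)
qed

text \<open>The symmetric group on \<open>Suc k\<close> letters splits into cosets of the stabiliser
  of 0. On each coset all k! terms agree by \<open>form_derivative_permute\<close>, and the coset of
  permutations sending 0 to \<open>b\<close> yields the b-th summand of
  \<open>ext_deriv\<close>.\<close>

lemma ext_deriv_alt_sum:
  assumes \<beta>: "k_form k U \<beta>" "open U" "x \<in> U"
  shows "ext_deriv k \<beta> x v = alt_sum (Suc k) (form_derivative \<beta> x) v / fact k"
proof -
  let ?T = "form_derivative \<beta> x" and ?t = "Transposition.transpose (0::nat)" and ?S = "{Suc 0..<Suc k}"
  have ins: "{..<Suc k} = insert 0 ?S" and S: "?S \<subseteq> {..<Suc k}" by auto
  have "of_int (sign (?t b \<circ> q)) * ?T (v \<circ> (?t b \<circ> q)) = of_int (sign (cycle_to b)) * ?T (v \<circ> cycle_to b)"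
    if b: "b \<le> k" and q: "q permutes ?S" for b q
  proof -
    \<comment> \<open>The sum over permutations is organised by the transpositions
      \<open>?t b\<close>, while \<open>ext_deriv\<close> uses the cycles \<open>cycle_to b\<close>.
      Both send 0 to \<open>b\<close>, so they differ by an element \<open>?r\<close> of the
      stabiliser.\<close>
    let ?r = "inv (?t b) \<circ> cycle_to b"
    have c: "cycle_to b permutes {..<Suc k}" using cycle_to_permutes[OF b] by (simp add: lessThan_Suc_atMost)
    have t: "?t b permutes {..<Suc k}" using b by (intro permutes_swap_id) auto
    have q': "q permutes {..<Suc k}" by (rule permutes_subset[OF q]) auto
    have "?r permutes {..<Suc k}" by (intro permutes_compose permutes_inv c t)
    then have r: "?r permutes ?S"
      by (rule permutes_superset) (auto simp: ins inv_transpose_eq)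
    have ct: "cycle_to b = ?t b \<circ> ?r" by (simp add: o_assoc permutes_inv_o[OF t])
    have "of_int (sign (?t b \<circ> q)) * ?T (v \<circ> (?t b \<circ> q)) = of_int (sign (?t b)) * ?T (v \<circ> ?t b)"
      if "q permutes ?S" for q
      using form_derivative_permute[OF assms that, of "v \<circ> ?t b"] of_int_sign_sign[OF t permutes_subset[OF that S]]
      by (simp add: o_assoc mult.assoc)
    from this[OF q] this[OF r] show ?thesis unfolding ct[symmetric] by simp
  qed
  then have "alt_sum (Suc k) ?T v = (\<Sum>b\<in>insert 0 ?S. \<Sum>q | q permutes ?S. of_int (sign (cycle_to b)) * ?T (v \<circ> cycle_to b))"
    unfolding alt_sum_def ins 
    by (subst sum_over_permutations_insert, simp, simp, intro sum.cong refl) auto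
  also have "\<dots> = (\<Sum>b\<in>insert 0 ?S. fact k * (of_int (sign (cycle_to b)) * ?T (v \<circ> cycle_to b)))"
    using card_permutations[of ?S k] by simp
  also have "insert 0 ?S = {..k}" by auto
  finally show ?thesis by (simp add: ext_deriv_cycle sum_distrib_left[symmetric] o_def)
qed

lemma alternating_map_fun_upd_cycle:
  assumes "alternating_map k T" "j < k"
  shows "T (\<lambda>i. case i of 0 \<Rightarrow> u | Suc l \<Rightarrow> (v \<circ> cycle_to j \<circ> Suc) l) = (- 1) ^ j * T (v(j := u))"
proof -
  have "(\<lambda>i. case i of 0 \<Rightarrow> u | Suc l \<Rightarrow> (v \<circ> cycle_to j \<circ> Suc) l) = v(j := u) \<circ> cycle_to j"
    by (auto simp: fun_eq_iff split: nat.split)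
  moreover have "cycle_to j permutes {..<k}"
    using permutes_subset[OF cycle_to_permutes[of j "k - 1"], of "{..<k}"] assms(2) by fastforce
  ultimately have "T (\<lambda>i. case i of 0 \<Rightarrow> u | Suc l \<Rightarrow> (v \<circ> cycle_to j \<circ> Suc) l) = of_int (sign (cycle_to j)) * T (v(j := u))"
    using alternating_map_permute[OF assms(1)] by (simp only:)
  then show ?thesis by (simp add: sign_cycle_to)
qed

text \<open>Cartan's formula, in which the term d(\<iota>_X \<beta>) vanishes because \<iota>_X
  \<beta> = 0 on all of \<open>U\<close>. It turns invariance under the Reeb flow into the algebraic
  statement that \<open>X\<close> also annihilates the exterior derivative.\<close>

lemma lie_derivative_eq_interior_ext_deriv:
  assumes \<beta>: "k_form k U \<beta>" "open U" "x \<in> U" and X: "smooth_on U X"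
    and 0: "\<And>y w. y \<in> U \<Longrightarrow> interior_product X \<beta> y w = 0" and k: "k > 0"
  shows "lie_derivative k X \<beta> x v = interior_product X (ext_deriv k \<beta>) x v"
proof -
  let ?X = "X x" and ?DX = "frechet_derivative X (at x)"
  let ?c = "\<lambda>u w i. case i of 0 \<Rightarrow> u | Suc l \<Rightarrow> w l"
  have lin: "linear (\<lambda>u. \<beta> y (?c u w))" if "y \<in> U" for y w
  proof -
    have "linear (\<lambda>u. \<beta> y ((?c 0 w)(0 := u)))"
      using multilinear_map_linear[of k "\<beta> y" 0 "?c 0 w"] k_form_alternating[OF \<beta>(1) that] k
      by (simp add: alternating_map_def)
    moreover have "(?c 0 w)(0 := u) = ?c u w" for u by (auto simp: fun_eq_iff split: nat.split)
    ultimately show ?thesis by simp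
  qed
  \<comment> \<open>Differentiating the identity \<beta>(X, w) = 0 trades the derivative of \<beta>
    with \<open>X\<close> frozen for a term in the derivative of \<open>X\<close>, which becomes the
    correction term of the Lie derivative.\<close>
  have D: "frechet_derivative (\<lambda>y. \<beta> y (?c ?X w)) (at x) h = - \<beta> x (?c (?DX h) w)" for w h
  proof -
    have "((\<lambda>y. \<beta> y (?c (X y) w)) has_derivative
      (\<lambda>h. frechet_derivative (\<lambda>y. \<beta> y (?c ?X w)) (at x) h + \<beta> x (?c (?DX h) w))) (at x)"
      by (rule has_derivative_linear_family[OF assms(2,3) lin k_form_smooth[OF \<beta>(1)]
            smooth_on_has_derivative[OF X assms(3)]])
    moreover have "((\<lambda>y. \<beta> y (?c (X y) w)) has_derivative (\<lambda>h. 0)) (at x)"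
      by (rule has_derivative_transform_within_open[OF has_derivative_const assms(2,3)])
        (use 0 in \<open>simp add: interior_product_def\<close>)
    ultimately have "(\<lambda>h. frechet_derivative (\<lambda>y. \<beta> y (?c ?X w)) (at x) h + \<beta> x (?c (?DX h) w)) = (\<lambda>h. 0)"
      by (rule has_derivative_unique)
    from fun_cong[OF this, of h] show ?thesis by (simp add: add_eq_0_iff2)
  qed
  have "interior_product X (ext_deriv k \<beta>) x v =
    (\<Sum>i\<le>k. (- 1) ^ i * frechet_derivative (\<lambda>y. \<beta> y (\<lambda>j. if j < i then ?c ?X v j else v j)) (at x) (?c ?X v i))"
    by (simp add: interior_product_def ext_deriv_def cong: if_cong)
  also have "\<dots> = frechet_derivative (\<lambda>y. \<beta> y v) (at x) ?X +
    (\<Sum>i<k. (- 1) ^ Suc i * frechet_derivative (\<lambda>y. \<beta> y (\<lambda>j. if j < Suc i then ?c ?X v j else v j)) (at x) (v i))"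
    by (subst sum.atMost_shift) simp
  also have "(\<Sum>i<k. (- 1) ^ Suc i * frechet_derivative (\<lambda>y. \<beta> y (\<lambda>j. if j < Suc i then ?c ?X v j else v j)) (at x) (v i)) =
     (\<Sum>i<k. \<beta> x (v(i := ?DX (v i))))"
  proof (intro sum.cong refl)
    fix i assume "i \<in> {..<k}"
    have "(\<lambda>j. if j < Suc i then ?c ?X v j else v j) = ?c ?X (v \<circ> cycle_to i \<circ> Suc)"
      by (auto simp: fun_eq_iff split: nat.split)
    then have "frechet_derivative (\<lambda>y. \<beta> y (\<lambda>j. if j < Suc i then ?c ?X v j else v j)) (at x) (v i) =
      - \<beta> x (?c (?DX (v i)) (v \<circ> cycle_to i \<circ> Suc))" by (simp only: D)
    then show "(- 1) ^ Suc i * frechet_derivative (\<lambda>y. \<beta> y (\<lambda>j. if j < Suc i then ?c ?X v j else v j)) (at x) (v i) =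
      \<beta> x (v(i := ?DX (v i)))"
      using alternating_map_fun_upd_cycle[OF k_form_alternating[OF \<beta>(1,3)], of i "?DX (v i)" v] \<open>i \<in> {..<k}\<close>
      by (simp add: power_mult_distrib[symmetric] mult.assoc[symmetric])
  qed
  finally show ?thesis by (simp add: lie_derivative_def)
qed

lemma form_derivative_wedge:
  assumes "k_form p U \<alpha>" "k_form q U \<beta>" "x \<in> U"
  shows "form_derivative (wedge p q \<alpha> \<beta>) x v =
    alt_sum (p + q) (\<lambda>w. frechet_derivative (\<lambda>y. \<alpha> y w) (at x) (v 0) * \<beta> x (w \<circ> (+) p) +
      \<alpha> x w * frechet_derivative (\<lambda>y. \<beta> y (w \<circ> (+) p)) (at x) (v 0)) (v \<circ> Suc) / (fact p * fact q)"
proof -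
  let ?w = "v \<circ> Suc"
  have "((\<lambda>y. \<Sum>\<sigma> | \<sigma> permutes {..<p + q}. of_int (sign \<sigma>) * (\<alpha> y (?w \<circ> \<sigma>) * \<beta> y (?w \<circ> \<sigma> \<circ> (+) p)))
    has_derivative (\<lambda>h. \<Sum>\<sigma> | \<sigma> permutes {..<p + q}. of_int (sign \<sigma>) *
      (\<alpha> x (?w \<circ> \<sigma>) * frechet_derivative (\<lambda>y. \<beta> y (?w \<circ> \<sigma> \<circ> (+) p)) (at x) h +
       frechet_derivative (\<lambda>y. \<alpha> y (?w \<circ> \<sigma>)) (at x) h * \<beta> x (?w \<circ> \<sigma> \<circ> (+) p)))) (at x)"
    by (intro has_derivative_sum has_derivative_mult_right has_derivative_mult
        k_form_has_derivative[OF assms(1,3)] k_form_has_derivative[OF assms(2,3)])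
  from has_derivative_mult_left[OF this, of "1 / (fact p * fact q)"]
  have "((\<lambda>y. wedge p q \<alpha> \<beta> y ?w) has_derivative
    (\<lambda>h. alt_sum (p + q) (\<lambda>w. frechet_derivative (\<lambda>y. \<alpha> y w) (at x) h * \<beta> x (w \<circ> (+) p) +
      \<alpha> x w * frechet_derivative (\<lambda>y. \<beta> y (w \<circ> (+) p)) (at x) h) ?w / (fact p * fact q))) (at x)"
    by (simp add: wedge_eq_wedge_map wedge_map_def alt_sum_def add.commute)
  then show ?thesis unfolding form_derivative_def by (simp add: frechet_derivative_eqI)
qed

text \<open>All three terms are antisymmetrisations of parts of the product rule for the total
  derivative. In the part where \<beta> is differentiated the direction sits in front of the
  arguments of \<alpha>; moving it past these \<open>p\<close> slots by a cycle gives the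
  sign.\<close>

lemma ext_deriv_wedge:
  assumes "open U" "k_form p U \<alpha>" "k_form q U \<beta>" "x \<in> U"
  shows "ext_deriv (p + q) (wedge p q \<alpha> \<beta>) x v =
    wedge (Suc p) q (ext_deriv p \<alpha>) \<beta> x v + (- 1) ^ p * wedge p (Suc q) \<alpha> (ext_deriv q \<beta>) x v"
proof -
  let ?n = "p + q"
  let ?F = "fact p * fact q :: complex"
  let ?A = "\<lambda>w. form_derivative \<alpha> x w * \<beta> x (w \<circ> (+) (Suc p))"
  let ?B = "\<lambda>w. \<alpha> x (w \<circ> Suc) * frechet_derivative (\<lambda>y. \<beta> y (w \<circ> (+) (Suc p))) (at x) (w 0)"
  let ?C = "\<lambda>w. \<alpha> x w * frechet_derivative (\<lambda>y. \<beta> y (w \<circ> (+) (Suc p))) (at x) (w p)"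
  have plus: "w \<circ> Suc \<circ> (+) p = w \<circ> (+) (Suc p)" "w \<circ> (+) p \<circ> Suc = w \<circ> (+) (Suc p)" for w :: "nat \<Rightarrow> 'a"
    by (simp_all add: fun_eq_iff)
  let ?T = "\<lambda>w z. frechet_derivative (\<lambda>y. \<alpha> y z) (at x) (w 0) * \<beta> x (z \<circ> (+) p) +
        \<alpha> x z * frechet_derivative (\<lambda>y. \<beta> y (z \<circ> (+) p)) (at x) (w 0)"
  have fd: "form_derivative (wedge p q \<alpha> \<beta>) x = (\<lambda>w. (1 / ?F) * alt_sum ?n (?T w) (w \<circ> Suc))"
    using form_derivative_wedge[OF assms(2-4)] by (simp add: fun_eq_iff)
  have Suc_eq: "(+) (Suc 0) = Suc" by (simp add: fun_eq_iff)
  have "alt_sum (Suc 0 + ?n) (\<lambda>w. alt_sum ?n (?T w) (w \<circ> (+) (Suc 0))) v =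
      fact ?n * alt_sum (Suc 0 + ?n) (\<lambda>w. ?T w (w \<circ> (+) (Suc 0))) v"
    by (rule alt_sum_nested_right[of "Suc 0" ?T]) simp
  then have "alt_sum (Suc ?n) (\<lambda>w. alt_sum ?n (?T w) (w \<circ> Suc)) v = fact ?n * alt_sum (Suc ?n) (\<lambda>w. ?T w (w \<circ> Suc)) v"
    by (simp only: Suc_eq plus_nat.simps)
  also have "(\<lambda>w. ?T w (w \<circ> Suc)) = (\<lambda>w. ?A w + ?B w)"
    by (simp add: fun_eq_iff form_derivative_def plus)
  also have "alt_sum (Suc ?n) (\<lambda>w. ?A w + ?B w) v = alt_sum (Suc ?n) ?A v + alt_sum (Suc ?n) ?B v"
    by (rule alt_sum_add)
  also have "alt_sum (Suc ?n) ?B v = (- 1) ^ p * alt_sum (Suc ?n) ?C v"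
  proof -
    have c: "cycle_to p permutes {..<Suc ?n}" using cycle_to_permutes[of p ?n] by (simp add: lessThan_Suc_atMost)
    have "?B (w \<circ> cycle_to p) = ?C w" for w
    proof -
      have "\<alpha> x (w \<circ> cycle_to p \<circ> Suc) = \<alpha> x w"
        by (rule alternating_map_cong[OF k_form_alternating[OF assms(2,4)]]) simp
      moreover have "w \<circ> cycle_to p \<circ> (+) (Suc p) = w \<circ> (+) (Suc p)" by (simp add: fun_eq_iff)
      ultimately show ?thesis by simp
    qed
    then have "alt_sum (Suc ?n) ?C v = (- 1) ^ p * alt_sum (Suc ?n) ?B v"
      using alt_sum_permute_argument[OF c, of ?B v] by (simp add: sign_cycle_to)
    then show ?thesis by (simp add: power_mult_distrib[symmetric] mult.assoc[symmetric])
  qed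
  finally have N: "alt_sum (Suc ?n) (\<lambda>w. alt_sum ?n (?T w) (w \<circ> Suc)) v =
    fact ?n * (alt_sum (Suc ?n) ?A v + (- 1) ^ p * alt_sum (Suc ?n) ?C v)" .
  have L: "ext_deriv ?n (wedge p q \<alpha> \<beta>) x v = (alt_sum (Suc ?n) ?A v + (- 1) ^ p * alt_sum (Suc ?n) ?C v) / ?F"
    unfolding ext_deriv_alt_sum[OF k_form_wedge[OF assms(1-3)] assms(1,4)] fd alt_sum_cmult N by simp
  have "alt_sum (Suc ?n) (\<lambda>w. alt_sum (Suc p) (form_derivative \<alpha> x) w * \<beta> x (w \<circ> (+) (Suc p))) v =
    fact (Suc p) * alt_sum (Suc ?n) ?A v"
  proof (rule alt_sum_nested_left)
    show "\<beta> x (w \<circ> \<tau> \<circ> (+) (Suc p)) = \<beta> x (w \<circ> (+) (Suc p))" if "\<tau> permutes {..<Suc p}" for \<tau> w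
      using permutes_not_in[OF that] by (simp add: o_def)
  qed simp
  then have A: "wedge (Suc p) q (ext_deriv p \<alpha>) \<beta> x v = alt_sum (Suc ?n) ?A v / ?F"
    using alt_sum_cmult[of "Suc ?n" "1 / fact p" "\<lambda>w. alt_sum (Suc p) (form_derivative \<alpha> x) w * \<beta> x (w \<circ> (+) (Suc p))" v]
    by (simp add: wedge_eq_wedge_map wedge_map_def ext_deriv_alt_sum[OF assms(2,1,4)] del: fact_Suc)
  have "alt_sum (p + Suc q) (\<lambda>w. \<alpha> x w * alt_sum (Suc q) (form_derivative \<beta> x) (w \<circ> (+) p)) v =
    fact (Suc q) * alt_sum (p + Suc q) (\<lambda>w. \<alpha> x w * form_derivative \<beta> x (w \<circ> (+) p)) v"
    by (rule alt_sum_nested_right_mult) (rule alternating_map_cong[OF k_form_alternating[OF assms(2,4)]])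
  moreover have "(\<lambda>w. \<alpha> x w * form_derivative \<beta> x (w \<circ> (+) p)) = ?C"
    by (simp add: fun_eq_iff form_derivative_def plus)
  ultimately have B: "wedge p (Suc q) \<alpha> (ext_deriv q \<beta>) x v = alt_sum (Suc ?n) ?C v / ?F"
    using alt_sum_cmult[of "Suc ?n" "1 / fact q" "\<lambda>w. \<alpha> x w * alt_sum (Suc q) (form_derivative \<beta> x) (w \<circ> (+) p)" v]
    by (simp add: wedge_eq_wedge_map wedge_map_def ext_deriv_alt_sum[OF assms(3,1,4)] del: fact_Suc)
  show ?thesis unfolding L A B by (simp add: add_divide_distrib)
qed

lemma ext_deriv_add:
  assumes "k_form k U \<beta>" "k_form k U \<beta>'" "x \<in> U"
  shows "ext_deriv k (\<lambda>x v. \<beta> x v + \<beta>' x v) x v = ext_deriv k \<beta> x v + ext_deriv k \<beta>' x v"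
  unfolding ext_deriv_def sum.distrib[symmetric]
proof (intro sum.cong refl)
  fix i
  let ?w = "\<lambda>j. if j < i then v j else v (Suc j)"
  have "frechet_derivative (\<lambda>y. \<beta> y ?w + \<beta>' y ?w) (at x) =
    (\<lambda>h. frechet_derivative (\<lambda>y. \<beta> y ?w) (at x) h + frechet_derivative (\<lambda>y. \<beta>' y ?w) (at x) h)"
    by (intro frechet_derivative_eqI has_derivative_add k_form_has_derivative[OF assms(1,3)]
        k_form_has_derivative[OF assms(2,3)])
  then show "(- 1) ^ i * frechet_derivative (\<lambda>y. \<beta> y ?w + \<beta>' y ?w) (at x) (v i) =
    (- 1) ^ i * frechet_derivative (\<lambda>y. \<beta> y ?w) (at x) (v i) +
    (- 1) ^ i * frechet_derivative (\<lambda>y. \<beta>' y ?w) (at x) (v i)" by (simp add: distrib_left)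
qed

lemma ext_deriv_cmult:
  assumes "k_form k U \<beta>" "x \<in> U"
  shows "ext_deriv k (\<lambda>x v. c * \<beta> x v) x v = c * ext_deriv k \<beta> x v"
  unfolding ext_deriv_def sum_distrib_left
  by (intro sum.cong refl) (simp add: frechet_derivative_cmult[OF k_form_differentiable[OF assms]])

lemma ext_deriv_cong:
  assumes "open U" "x \<in> U" "\<And>y v. y \<in> U \<Longrightarrow> \<beta> y v = \<beta>' y v"
  shows "ext_deriv k \<beta> x v = ext_deriv k \<beta>' x v"
  unfolding ext_deriv_def
  by (intro sum.cong refl arg_cong2[where f = "(*)"] fun_cong[OF frechet_derivative_cong_open[OF assms(1,2)]] assms(3))

lemma k_form_1_eq: "k_form 1 U \<eta> \<Longrightarrow> x \<in> U \<Longrightarrow> v 0 = w 0 \<Longrightarrow> \<eta> x v = \<eta> x w"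
  by (rule alternating_map_cong[OF k_form_alternating]) auto

lemma k_form_1_linear: "k_form 1 U \<eta> \<Longrightarrow> x \<in> U \<Longrightarrow> linear (\<lambda>u. \<eta> x (\<lambda>_. u))"
proof -
  assume "k_form 1 U \<eta>" "x \<in> U"
  then have "linear (\<lambda>u. \<eta> x ((\<lambda>_. 0)(0 := u)))"
    using multilinear_map_linear[of 1 "\<eta> x" 0 "\<lambda>_. 0"] k_form_alternating[of 1 U \<eta> x]
    by (simp add: alternating_map_def)
  moreover have "\<eta> x ((\<lambda>_. 0)(0 := u)) = \<eta> x (\<lambda>_. u)" for u
    by (rule k_form_1_eq[OF \<open>k_form 1 U \<eta>\<close> \<open>x \<in> U\<close>]) simp
  ultimately show ?thesis by simp
qed

lemma k_form_1I:
  assumes "\<And>x. x \<in> U \<Longrightarrow> linear (h x)" "\<And>u. smooth_on U (\<lambda>x. h x u)"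
  shows "k_form 1 U (\<lambda>x v. h x (v 0))"
  using assms by (auto simp: k_form_iff alternating_map_def multilinear_map_def)

lemma ext_deriv_1:
  assumes "k_form 1 U \<eta>" "open U" "x \<in> U"
  shows "ext_deriv 1 \<eta> x v = frechet_derivative (\<lambda>y. \<eta> y (\<lambda>_. v 1)) (at x) (v 0) -
    frechet_derivative (\<lambda>y. \<eta> y (\<lambda>_. v 0)) (at x) (v 1)"
proof -
  have "frechet_derivative (\<lambda>y. \<eta> y w) (at x) = frechet_derivative (\<lambda>y. \<eta> y (\<lambda>_. w 0)) (at x)" for w
    by (rule frechet_derivative_cong_open[OF assms(2,3)]) (rule k_form_1_eq[OF assms(1)], auto)
  from this[of "\<lambda>j. v (Suc j)"] this[of "\<lambda>j. if j = 0 then v j else v (Suc j)"]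
  show ?thesis by (simp add: ext_deriv_def)
qed

lemma frechet_derivative_k_form_1_linear:
  assumes "k_form 1 U \<eta>" "open U" "x \<in> U"
  shows "linear (\<lambda>u. frechet_derivative (\<lambda>y. \<eta> y (\<lambda>_. u)) (at x) h)"
proof (rule linearI)
  note D = k_form_has_derivative[OF assms(1,3)]
  show "frechet_derivative (\<lambda>y. \<eta> y (\<lambda>_. u + u')) (at x) h =
    frechet_derivative (\<lambda>y. \<eta> y (\<lambda>_. u)) (at x) h + frechet_derivative (\<lambda>y. \<eta> y (\<lambda>_. u')) (at x) h" for u u'
  proof -
    have "frechet_derivative (\<lambda>y. \<eta> y (\<lambda>_. u + u')) (at x) = frechet_derivative (\<lambda>y. \<eta> y (\<lambda>_. u) + \<eta> y (\<lambda>_. u')) (at x)"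
      by (rule frechet_derivative_cong_open[OF assms(2,3)]) (rule linear_add[OF k_form_1_linear[OF assms(1)]])
    then show ?thesis using frechet_derivative_eqI[OF has_derivative_add[OF D D]] by simp
  qed
  show "frechet_derivative (\<lambda>y. \<eta> y (\<lambda>_. r *\<^sub>R u)) (at x) h = r *\<^sub>R frechet_derivative (\<lambda>y. \<eta> y (\<lambda>_. u)) (at x) h" for r u
  proof -
    have "frechet_derivative (\<lambda>y. \<eta> y (\<lambda>_. r *\<^sub>R u)) (at x) = frechet_derivative (\<lambda>y. r *\<^sub>R \<eta> y (\<lambda>_. u)) (at x)"
      by (rule frechet_derivative_cong_open[OF assms(2,3)]) (rule linear_cmul[OF k_form_1_linear[OF assms(1)]])
    then show ?thesis using frechet_derivative_eqI[OF has_derivative_scaleR_right[OF D]] by simp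
  qed
qed

lemma k_form_ext_deriv_1:
  assumes \<eta>: "k_form 1 U \<eta>" "open U"
  shows "k_form 2 U (ext_deriv 1 \<eta>)"
  unfolding k_form_iff
proof (intro conjI ballI allI)
  fix x assume x: "x \<in> U"
  have "linear (frechet_derivative (\<lambda>y. \<eta> y v) (at x))" for v
    by (rule linear_frechet_derivative'[OF k_form_smooth[OF \<eta>(1)] x])
  moreover note frechet_derivative_k_form_1_linear[OF \<eta> x]
  ultimately show "alternating_map 2 (ext_deriv 1 \<eta> x)"
    unfolding alternating_map_def multilinear_map_def ext_deriv_1[OF \<eta> x]
    by (auto simp: less_2_cases_iff intro!: linear_compose_sub)
next
  show "smooth_on U (\<lambda>x. ext_deriv 1 \<eta> x v)" for v
    by (rule smooth_on_cong[OF \<eta>(2) ext_deriv_1[OF \<eta>, symmetric]])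
      (auto intro!: smooth_on_diff smooth_on_derivative k_form_smooth[OF \<eta>(1)] \<eta>(2))
qed

lemma ext_deriv_2:
  "ext_deriv 2 \<beta> x v = frechet_derivative (\<lambda>y. \<beta> y (\<lambda>j. v (Suc j))) (at x) (v 0) -
    frechet_derivative (\<lambda>y. \<beta> y (\<lambda>j. if j < 1 then v j else v (Suc j))) (at x) (v 1) +
    frechet_derivative (\<lambda>y. \<beta> y (\<lambda>j. if j < 2 then v j else v (Suc j))) (at x) (v 2)"
  by (simp add: ext_deriv_def numeral_2_eq_2)

text \<open>The second derivatives of the coefficients cancel in three pairs by symmetry. The forms
  met later are built from 1-forms and their differentials by products, so d^2 = 0 enters in this
  degree.\<close>

lemma ext_deriv_ext_deriv_1:
  assumes \<eta>: "k_form 1 U \<eta>" "open U" "x \<in> U"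
  shows "ext_deriv 2 (ext_deriv 1 \<eta>) x v = 0"
proof -
  let ?D = "\<lambda>u y. frechet_derivative (\<lambda>y. \<eta> y (\<lambda>_. u)) (at y)"
  let ?DD = "\<lambda>u h k. frechet_derivative (\<lambda>y. ?D u y h) (at x) k"
  have E: "frechet_derivative (\<lambda>y. ext_deriv 1 \<eta> y w) (at x) h = ?DD (w 1) (w 0) h - ?DD (w 0) (w 1) h" for w h
  proof -
    have "((\<lambda>y. ?D u y h) has_derivative ?DD u h) (at x)" for u h
      by (rule smooth_on_has_derivative[OF smooth_on_derivative[OF k_form_smooth[OF \<eta>(1)]] \<eta>(3)])
    from has_derivative_diff[OF this this]
    have "frechet_derivative (\<lambda>y. ?D (w 1) y (w 0) - ?D (w 0) y (w 1)) (at x) = (\<lambda>h. ?DD (w 1) (w 0) h - ?DD (w 0) (w 1) h)"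
      by (rule frechet_derivative_eqI)
    moreover have "frechet_derivative (\<lambda>y. ext_deriv 1 \<eta> y w) (at x) = frechet_derivative (\<lambda>y. ?D (w 1) y (w 0) - ?D (w 0) y (w 1)) (at x)"
      by (rule frechet_derivative_cong_open[OF \<eta>(2,3) ext_deriv_1[OF \<eta>(1,2)]])
    ultimately show ?thesis by simp
  qed
  have S: "?DD u h k = ?DD u k h" for u h k
    by (rule smooth_on_second_derivative_symmetric[OF \<eta>(2) k_form_smooth[OF \<eta>(1)] \<eta>(3)])
  show ?thesis
    unfolding ext_deriv_2[of "ext_deriv 1 \<eta>"] E
    using S[of "v 2" "v 1" "v 0"] S[of "v 1" "v 2" "v 0"] S[of "v 0" "v 2" "v 1"]
    by (simp add: numeral_2_eq_2)
qed

lemma k_form_1_smooth_family: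
  assumes "k_form 1 V \<eta>" "open U" "open V" "smooth_on U f" "f ` U \<subseteq> V" "smooth_on U w"
  shows "smooth_on U (\<lambda>x. \<eta> (f x) (\<lambda>_. w x))"
proof (rule smooth_on_linear_family[OF assms(2) _ _ assms(6), of "\<lambda>x u. \<eta> (f x) (\<lambda>_. u)"])
  show "linear (\<lambda>u. \<eta> (f x) (\<lambda>_. u))" if "x \<in> U" for x
    using k_form_1_linear[OF assms(1)] assms(5) that by blast
  show "smooth_on U (\<lambda>x. \<eta> (f x) (\<lambda>_. v))" for v
    by (rule smooth_on_compose[OF assms(2,3,5,4) k_form_smooth[OF assms(1)]])
qed

lemma k_form_pullback_1:
  assumes "k_form 1 V \<eta>" "open U" "open V" "smooth_on U f" "f ` U \<subseteq> V"
  shows "k_form 1 U (pullback f \<eta>)"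
proof (rule k_form_cong[OF assms(2)])
  show "\<eta> (f x) (\<lambda>_. frechet_derivative f (at x) (v 0)) = pullback f \<eta> x v" if "x \<in> U" for x v
    unfolding pullback_def by (rule k_form_1_eq[OF assms(1)]) (use assms(5) that in auto)
  show "k_form 1 U (\<lambda>x v. \<eta> (f x) (\<lambda>_. frechet_derivative f (at x) (v 0)))"
  proof (rule k_form_1I)
    show "linear (\<lambda>u. \<eta> (f x) (\<lambda>_. frechet_derivative f (at x) u))" if "x \<in> U" for x
      using linear_compose[OF linear_frechet_derivative'[OF assms(4) that] k_form_1_linear[OF assms(1)]] assms(5) that
      by (auto simp: o_def)
    show "smooth_on U (\<lambda>x. \<eta> (f x) (\<lambda>_. frechet_derivative f (at x) u))" for u
      by (rule k_form_1_smooth_family[OF assms smooth_on_derivative[OF assms(4)]])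
  qed
qed

text \<open>The coefficients of the pullback contain the derivative of \<open>f\<close>, so a second
  derivative of \<open>f\<close> appears; it is symmetric in its two arguments and drops out of the
  antisymmetrised difference.\<close>

lemma ext_deriv_pullback_1:
  fixes f :: "'a::euclidean_space \<Rightarrow> 'b::euclidean_space"
  assumes \<eta>: "k_form 1 V \<eta>" and "open U" "open V" and f: "smooth_on U f" "f ` U \<subseteq> V" and x: "x \<in> U"
  shows "ext_deriv 1 (pullback f \<eta>) x v = pullback f (ext_deriv 1 \<eta>) x v"
proof -
  let ?Df = "\<lambda>u y. frechet_derivative f (at y) u"
  let ?D = "\<lambda>u. frechet_derivative (\<lambda>y. \<eta> y (\<lambda>_. u)) (at (f x))"
  let ?DD = "\<lambda>u h. frechet_derivative (?Df u) (at x) h"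
  have fx: "f x \<in> V" using f x by auto
  have "frechet_derivative (\<lambda>y. pullback f \<eta> y (\<lambda>_. u)) (at x) h = ?D (?Df u x) (?Df h x) + \<eta> (f x) (\<lambda>_. ?DD u h)" for u h
  proof -
    have "((\<lambda>y. \<eta> (f y) (\<lambda>_. ?Df u y)) has_derivative
      (\<lambda>h. frechet_derivative (\<lambda>y. \<eta> (f y) (\<lambda>_. ?Df u x)) (at x) h + \<eta> (f x) (\<lambda>_. ?DD u h))) (at x)"
    proof (rule has_derivative_linear_family[OF \<open>open U\<close> x, of "\<lambda>y u. \<eta> (f y) (\<lambda>_. u)"])
      show "linear (\<lambda>u. \<eta> (f y) (\<lambda>_. u))" if "y \<in> U" for y
        using k_form_1_linear[OF \<eta>] f that by blast
      show "smooth_on U (\<lambda>y. \<eta> (f y) (\<lambda>_. v))" for v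
        by (rule smooth_on_compose[OF assms(2,3) f(2,1) k_form_smooth[OF \<eta>]])
      show "(?Df u has_derivative ?DD u) (at x)"
        by (rule smooth_on_has_derivative[OF smooth_on_derivative[OF f(1)] x])
    qed
    moreover have "frechet_derivative (\<lambda>y. \<eta> (f y) (\<lambda>_. w)) (at x) h = ?D w (?Df h x)" for w
      by (rule frechet_derivative_compose'[OF f(1) k_form_smooth[OF \<eta>] x fx])
    ultimately show ?thesis unfolding pullback_def by (simp add: frechet_derivative_eqI)
  qed
  moreover have "?DD u h = ?DD h u" for u h
    by (rule smooth_on_second_derivative_symmetric[OF assms(2) f(1) x])
  ultimately show ?thesis
    using ext_deriv_1[OF k_form_pullback_1[OF \<eta> assms(2,3) f] assms(2) x, of v] ext_deriv_1[OF \<eta> assms(3) fx]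
    by (simp add: pullback_def)
qed

lemma pullback_wedge: "pullback f (wedge p q \<alpha> \<beta>) x v = wedge p q (pullback f \<alpha>) (pullback f \<beta>) x v"
  by (simp add: pullback_def wedge_def)

section \<open>The forms of a triple of 1-forms\<close>

text \<open>The forms are studied for any three real 1-forms on an open set, because the same
  computation is applied on the charts of \<open>S\<close> and on the bundles V \<times> R over
  charts of \<open>Z\<close>.\<close>

definition form_triple :: "'a::euclidean_space set \<Rightarrow> (nat \<Rightarrow> ('a, 'p) oform) \<Rightarrow> ('a, 'p) ochart \<Rightarrow> bool" where
  "form_triple U \<eta> c \<longleftrightarrow> open U \<and> (\<forall>i\<in>{1..3}. k_form 1 U (\<eta> i c) \<and> (\<forall>x\<in>U. \<forall>v. Im (\<eta> i c x v) = 0))"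

lemma eps_sum_1: "(\<Sum>j\<in>{1..3}. \<Sum>k\<in>{1..3}. complex_of_real (eps 1 j k) * f j k) = f 2 3 - f 3 2"
  and eps_sum_2: "(\<Sum>j\<in>{1..3}. \<Sum>k\<in>{1..3}. complex_of_real (eps 2 j k) * f j k) = f 3 1 - f 1 3"
  and eps_sum_3: "(\<Sum>j\<in>{1..3}. \<Sum>k\<in>{1..3}. complex_of_real (eps 3 j k) * f j k) = f 1 2 - f 2 1"
proof -
  have "{1..3} = {1, 2, 3::nat}" by auto
  then show "(\<Sum>j\<in>{1..3}. \<Sum>k\<in>{1..3}. complex_of_real (eps 1 j k) * f j k) = f 2 3 - f 3 2"
    "(\<Sum>j\<in>{1..3}. \<Sum>k\<in>{1..3}. complex_of_real (eps 2 j k) * f j k) = f 3 1 - f 1 3"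
    "(\<Sum>j\<in>{1..3}. \<Sum>k\<in>{1..3}. complex_of_real (eps 3 j k) * f j k) = f 1 2 - f 2 1"
    by (simp_all add: eps_def)
qed

lemma wedge_1_1:
  assumes "k_form 1 U \<alpha>" "k_form 1 U \<beta>" "x \<in> U"
  shows "wedge 1 1 \<alpha> \<beta> x v = \<alpha> x (\<lambda>_. v 0) * \<beta> x (\<lambda>_. v 1) - \<alpha> x (\<lambda>_. v 1) * \<beta> x (\<lambda>_. v 0)"
proof -
  have "\<alpha> x = dt [\<lambda>u. \<alpha> x (\<lambda>_. u)]" "\<beta> x = dt [\<lambda>u. \<beta> x (\<lambda>_. u)]"
    by (rule ext, simp only: dt_single, rule k_form_1_eq[OF assms(1,3)], simp)
       (rule ext, simp only: dt_single, rule k_form_1_eq[OF assms(2,3)], simp)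
  then have "wedge 1 1 \<alpha> \<beta> x = dt [\<lambda>u. \<alpha> x (\<lambda>_. u), \<lambda>u. \<beta> x (\<lambda>_. u)]"
    unfolding wedge_eq_wedge_map using wedge_map_dt[of "[\<lambda>u. \<alpha> x (\<lambda>_. u)]" 1 "[\<lambda>u. \<beta> x (\<lambda>_. u)]" 1] by simp
  then show ?thesis by (simp add: dt_pair)
qed

context
  fixes U :: "'a::euclidean_space set" and \<eta> :: "nat \<Rightarrow> ('a, 'p) oform" and c :: "('a, 'p) ochart"
  assumes triple: "form_triple U \<eta> c"
begin

lemma triple_open: "open U" and triple_k_form: "i \<in> {1..3} \<Longrightarrow> k_form 1 U (\<eta> i c)"
  and triple_real: "i \<in> {1..3} \<Longrightarrow> x \<in> U \<Longrightarrow> cnj (\<eta> i c x v) = \<eta> i c x v"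
  using triple by (auto simp: form_triple_def complex_eq_iff)

lemma k_form_eta: "k_form 1 U (\<eta> 1 c)" "k_form 1 U (\<eta> 2 c)" "k_form 1 U (\<eta> 3 c)"
  by (rule triple_k_form, simp)+

lemma k_form_eta_cx: "k_form 1 U (eta_cx \<eta> c)"
  unfolding eta_cx_def by (intro k_form_add k_form_cmult triple_open k_form_eta)

lemma k_form_conj_eta_cx: "k_form 1 U (conj_form (eta_cx \<eta> c))"
  by (intro k_form_conj triple_open k_form_eta_cx)

lemma conj_eta_cx: "x \<in> U \<Longrightarrow> conj_form (eta_cx \<eta> c) x v = \<eta> 1 c x v + (- \<i>) * \<eta> 2 c x v"
  using triple_real[of 1] triple_real[of 2] by (simp add: conj_form_def eta_cx_def)

lemma ext_deriv_eta_cx: "x \<in> U \<Longrightarrow> ext_deriv 1 (eta_cx \<eta> c) x v = ext_deriv 1 (\<eta> 1 c) x v + \<i> * ext_deriv 1 (\<eta> 2 c) x v"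
  unfolding eta_cx_def
  by (simp only: ext_deriv_add[OF k_form_eta(1) k_form_cmult[OF triple_open k_form_eta(2)]]
      ext_deriv_cmult[OF k_form_eta(2)])

lemma ext_deriv_conj_eta_cx:
  assumes "x \<in> U"
  shows "ext_deriv 1 (conj_form (eta_cx \<eta> c)) x v = ext_deriv 1 (\<eta> 1 c) x v - \<i> * ext_deriv 1 (\<eta> 2 c) x v"
proof -
  have "ext_deriv 1 (conj_form (eta_cx \<eta> c)) x v = ext_deriv 1 (\<lambda>x v. \<eta> 1 c x v + (- \<i>) * \<eta> 2 c x v) x v"
    by (rule ext_deriv_cong[OF triple_open assms conj_eta_cx])
  also have "\<dots> = ext_deriv 1 (\<eta> 1 c) x v + (- \<i>) * ext_deriv 1 (\<eta> 2 c) x v"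
    unfolding ext_deriv_add[OF k_form_eta(1) k_form_cmult[OF triple_open k_form_eta(2)] assms]
    by (simp only: ext_deriv_cmult[OF k_form_eta(2) assms])
  finally show ?thesis by simp
qed

text \<open>Since \<eta> \<and> cnj \<eta> = -2i \<eta>_1 \<and> \<eta>_2, the subtracted quadratic
  term can be written through \<eta>. The first summand is exact, so only the second contributes to
  the differential.\<close>

lemma alpha_form_3:
  assumes "x \<in> U"
  shows "alpha_form \<eta> 3 c x v =
    (1 / 2) * ext_deriv 1 (\<eta> 3 c) x v + (- \<i> / 2) * wedge 1 1 (eta_cx \<eta> c) (conj_form (eta_cx \<eta> c)) x v"
  unfolding alpha_form_def eps_sum_3 wedge_1_1[OF k_form_eta_cx k_form_conj_eta_cx assms]
    wedge_1_1[OF k_form_eta(1,2) assms] wedge_1_1[OF k_form_eta(2,1) assms] conj_eta_cx[OF assms]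
  by (simp add: eta_cx_def field_simps)

text \<open>The quadratic terms of \<alpha>_1 and \<alpha>_2 combine into one product: -\<eta>_2
  \<and> \<eta>_3 - i \<eta>_3 \<and> \<eta>_1 = i \<eta> \<and> \<eta>_3.\<close>

lemma alpha_cx:
  assumes "x \<in> U"
  shows "alpha_cx \<eta> c x v =
    (1 / 2) * ext_deriv 1 (eta_cx \<eta> c) x v + \<i> * wedge 1 1 (eta_cx \<eta> c) (\<eta> 3 c) x v"
  unfolding alpha_cx_def alpha_form_def eps_sum_1 eps_sum_2 ext_deriv_eta_cx[OF assms]
    wedge_1_1[OF k_form_eta_cx k_form_eta(3) assms] wedge_1_1[OF k_form_eta(2,3) assms]
    wedge_1_1[OF k_form_eta(3,2) assms] wedge_1_1[OF k_form_eta(1,3) assms] wedge_1_1[OF k_form_eta(3,1) assms]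
  by (simp add: eta_cx_def field_simps)

lemma alpha_cx_conj:
  assumes "x \<in> U"
  shows "alpha_form \<eta> 1 c x v - \<i> * alpha_form \<eta> 2 c x v =
    (1 / 2) * ext_deriv 1 (conj_form (eta_cx \<eta> c)) x v + (- \<i>) * wedge 1 1 (conj_form (eta_cx \<eta> c)) (\<eta> 3 c) x v"
  unfolding alpha_form_def eps_sum_1 eps_sum_2 ext_deriv_conj_eta_cx[OF assms]
    wedge_1_1[OF k_form_conj_eta_cx k_form_eta(3) assms] wedge_1_1[OF k_form_eta(2,3) assms]
    wedge_1_1[OF k_form_eta(3,2) assms] wedge_1_1[OF k_form_eta(1,3) assms] wedge_1_1[OF k_form_eta(3,1) assms]
    conj_eta_cx[OF assms]
  by (simp add: field_simps)

lemma k_form_wedge_1_1: "k_form 1 U \<alpha> \<Longrightarrow> k_form 1 U \<beta> \<Longrightarrow> k_form 2 U (wedge 1 1 \<alpha> \<beta>)"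
  using k_form_wedge[OF triple_open, of 1 \<alpha> 1 \<beta>] by (simp add: numeral_2_eq_2)

lemma k_form_alpha_form_3: "k_form 2 U (alpha_form \<eta> 3 c)"
  by (rule k_form_cong[OF triple_open alpha_form_3[symmetric]], assumption)
    (intro k_form_add k_form_cmult triple_open k_form_ext_deriv_1 k_form_wedge_1_1 k_form_eta k_form_eta_cx k_form_conj_eta_cx)

lemma k_form_alpha_cx: "k_form 2 U (alpha_cx \<eta> c)"
  by (rule k_form_cong[OF triple_open alpha_cx[symmetric]], assumption)
    (intro k_form_add k_form_cmult triple_open k_form_ext_deriv_1 k_form_wedge_1_1 k_form_eta k_form_eta_cx)

lemma k_form_omega_ab: "k_form 2 U (omega_ab \<eta> a b c)"
  unfolding omega_ab_def
  by (intro k_form_diff k_form_cmult triple_open k_form_alpha_form_3 k_form_wedge_1_1 k_form_eta_cx k_form_conj_eta_cx)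

lemma k_form_Omega_ab: "k_form 3 U (Omega_ab \<eta> a b \<gamma> c)"
  unfolding Omega_ab_def
  using k_form_wedge[OF triple_open k_form_alpha_cx k_form_conj_eta_cx]
  by (intro k_form_cmult triple_open) (simp add: numeral_3_eq_3)

end

section \<open>Structure equations in a complex coframe\<close>

definition cj :: "('a \<Rightarrow> complex) \<Rightarrow> 'a \<Rightarrow> complex" where
  "cj f = (\<lambda>u. cnj (f u))"

lemma cj_cj [simp]: "cj (cj f) = f"
  by (simp add: cj_def)

lemma cnj_dt_cj: "cnj (dt fs v) = dt (map cj fs) v"
  unfolding cj_def by (rule cnj_dt)

text \<open>On the horizontal distribution \<open>s\<close> and \<open>t\<close> are complex coordinates for the complex structure with
  Kaehler form \<open>\<alpha>\<^sub>3\<close>, unitary with respect to the transversal metric.\<close>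

definition coframe :: "(nat \<Rightarrow> ('a::euclidean_space, 'p) oform) \<Rightarrow> ('a, 'p) ochart \<Rightarrow> 'a \<Rightarrow>
    ('a \<Rightarrow> complex) \<Rightarrow> ('a \<Rightarrow> complex) \<Rightarrow> bool" where
  "coframe \<eta> c x s t \<longleftrightarrow> linear s \<and> linear t \<and>
     (\<forall>v. alpha_cx \<eta> c x v = dt [s, t] v) \<and>
     (\<forall>v. alpha_form \<eta> 1 c x v - \<i> * alpha_form \<eta> 2 c x v = dt [cj s, cj t] v) \<and>
     (\<forall>v. alpha_form \<eta> 3 c x v = \<i> / 2 * (dt [s, cj s] v + dt [t, cj t] v))"

abbreviation eta_at :: "(nat \<Rightarrow> ('a::euclidean_space, 'p) oform) \<Rightarrow> ('a, 'p) ochart \<Rightarrow> 'a \<Rightarrow> 'a \<Rightarrow> complex" where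
  "eta_at \<eta> c x \<equiv> \<lambda>u. eta_cx \<eta> c x (\<lambda>_. u)"

lemma k_form_1_eq_dt:
  assumes "k_form 1 U \<eta>" "x \<in> U"
  shows "\<eta> x = dt [\<lambda>u. \<eta> x (\<lambda>_. u)]"
  by (rule ext, simp only: dt_single, rule k_form_1_eq[OF assms], simp)

lemma wedge_map_dt_simps:
  "wedge_map 1 1 (dt [f]) (dt [g]) = dt [f, g]"
  "wedge_map 2 1 (dt [f, g]) (dt [h]) = dt [f, g, h]"
  "wedge_map 1 2 (dt [h]) (dt [f, g]) = dt [h, f, g]"
  "wedge_map 3 1 (dt [f, g, h]) (dt [k]) = dt [f, g, h, k]"
  "wedge_map 2 2 (dt [f, g]) (dt [h, k]) = dt [f, g, h, k]"
  using wedge_map_dt[of "[f]" 1 "[g]" 1] wedge_map_dt[of "[f, g]" 2 "[h]" 1] wedge_map_dt[of "[h]" 1 "[f, g]" 2]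
    wedge_map_dt[of "[f, g, h]" 3 "[k]" 1] wedge_map_dt[of "[f, g]" 2 "[h, k]" 2]
  by simp_all

lemmas wedge_map_expand =
  wedge_map_add_left wedge_map_add_right wedge_map_cmult_left wedge_map_cmult_right wedge_map_dt_simps

context
  fixes U :: "'a::euclidean_space set" and \<eta> :: "nat \<Rightarrow> ('a, 'p) oform" and c :: "('a, 'p) ochart"
    and x s t H h3
  assumes triple: "form_triple U \<eta> c" and x: "x \<in> U" and co: "coframe \<eta> c x s t"
    and H: "H = eta_at \<eta> c x" and h3: "h3 = (\<lambda>u. \<eta> 3 c x (\<lambda>_. u))"
begin

lemma eta_coframe:
  "eta_cx \<eta> c x = dt [H]" "conj_form (eta_cx \<eta> c) x = dt [cj H]" "\<eta> 3 c x = dt [h3]"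
  "alpha_cx \<eta> c x = dt [s, t]"
  "alpha_form \<eta> 3 c x = (\<lambda>v. \<i> / 2 * (dt [s, cj s] v + dt [t, cj t] v))"
proof -
  show "eta_cx \<eta> c x = dt [H]" unfolding H by (rule k_form_1_eq_dt[OF k_form_eta_cx[OF triple] x])
  show "conj_form (eta_cx \<eta> c) x = dt [cj H]"
    by (rule trans[OF k_form_1_eq_dt[OF k_form_conj_eta_cx[OF triple] x]]) (simp add: H cj_def conj_form_def)
  show "\<eta> 3 c x = dt [h3]" unfolding h3 by (rule k_form_1_eq_dt[OF k_form_eta(3)[OF triple] x])
qed (use co in \<open>auto simp: coframe_def\<close>)

lemma omega_ab_coframe:
  "omega_ab \<eta> a b c x v = of_real a * \<i> / 2 * (dt [s, cj s] v + dt [t, cj t] v) -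
    \<i> / 2 * of_real (b\<^sup>2) * dt [H, cj H] v"
  unfolding omega_ab_def wedge_eq_wedge_map eta_coframe wedge_map_dt_simps by simp

lemma Omega_ab_coframe:
  "Omega_ab \<eta> a b \<gamma> c x v = of_real (a * b) * exp (\<i> * of_real \<gamma>) * dt [s, t, cj H] v"
  unfolding Omega_ab_def wedge_eq_wedge_map eta_coframe wedge_map_dt_simps by simp

lemma d_eta_coframe: "ext_deriv 1 (eta_cx \<eta> c) x = (\<lambda>v. 2 * dt [s, t] v + (- 2 * \<i>) * dt [H, h3] v)"
proof
  fix v
  have "wedge 1 1 (eta_cx \<eta> c) (\<eta> 3 c) x = dt [H, h3]"
    unfolding wedge_eq_wedge_map eta_coframe wedge_map_dt_simps ..
  then show "ext_deriv 1 (eta_cx \<eta> c) x v = 2 * dt [s, t] v + (- 2 * \<i>) * dt [H, h3] v"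
    using alpha_cx[OF triple x, of v] unfolding eta_coframe by simp
qed

lemma d_conj_eta_coframe:
  "ext_deriv 1 (conj_form (eta_cx \<eta> c)) x = (\<lambda>v. 2 * dt [cj s, cj t] v + 2 * \<i> * dt [cj H, h3] v)"
proof
  fix v
  have "wedge 1 1 (conj_form (eta_cx \<eta> c)) (\<eta> 3 c) x = dt [cj H, h3]"
    unfolding wedge_eq_wedge_map eta_coframe wedge_map_dt_simps ..
  moreover have "alpha_form \<eta> 1 c x v - \<i> * alpha_form \<eta> 2 c x v = dt [cj s, cj t] v"
    using co by (simp add: coframe_def)
  ultimately show "ext_deriv 1 (conj_form (eta_cx \<eta> c)) x v = 2 * dt [cj s, cj t] v + 2 * \<i> * dt [cj H, h3] v"
    using alpha_cx_conj[OF triple x, of v] by simp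
qed

text \<open>The products containing \<eta>_3 have factors H, h3, cj H and H, cj H, h3; they cancel
  after one transposition, so that \<eta>_3 disappears from the result.\<close>

lemma d_eta_wedge_conj_eta:
  "ext_deriv 2 (wedge 1 1 (eta_cx \<eta> c) (conj_form (eta_cx \<eta> c))) x v =
    2 * (dt [s, t, cj H] v - dt [H, cj s, cj t] v)"
proof -
  have "ext_deriv 2 (wedge 1 1 (eta_cx \<eta> c) (conj_form (eta_cx \<eta> c))) x v =
    wedge 2 1 (ext_deriv 1 (eta_cx \<eta> c)) (conj_form (eta_cx \<eta> c)) x v -
    wedge 1 2 (eta_cx \<eta> c) (ext_deriv 1 (conj_form (eta_cx \<eta> c))) x v"
    using ext_deriv_wedge[OF triple_open[OF triple] k_form_eta_cx[OF triple] k_form_conj_eta_cx[OF triple] x, of v]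
    by (simp add: numeral_2_eq_2)
  also have "\<dots> = 2 * dt [s, t, cj H] v + (- 2 * \<i>) * dt [H, h3, cj H] v -
      (2 * dt [H, cj s, cj t] v + 2 * \<i> * dt [H, cj H, h3] v)"
    unfolding wedge_eq_wedge_map d_eta_coframe d_conj_eta_coframe eta_coframe(1,2) wedge_map_expand ..
  also have "dt [H, h3, cj H] v = - dt [H, cj H, h3] v"
    using dt_swap[of "[H]" h3 "cj H" "[]" v] by simp
  finally show ?thesis by (simp add: algebra_simps)
qed

text \<open>The exact part of \<alpha>_3 is closed, so only the multiple of \<eta> \<and> cnj \<eta>
  is differentiated: its coefficient collects a from \<alpha>_3 and b^2 from the explicit term. This
  sum is the origin of the condition a = -b^2 in the symplectic case.\<close>

lemma d_omega_ab:
  "ext_deriv 2 (omega_ab \<eta> a b c) x v =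
    - \<i> * of_real (a + b\<^sup>2) * (dt [s, t, cj H] v - dt [H, cj s, cj t] v)"
proof -
  let ?W = "wedge 1 1 (eta_cx \<eta> c) (conj_form (eta_cx \<eta> c))"
  let ?r = "- (\<i> / 2) * of_real (a + b\<^sup>2)"
  have E3: "k_form 2 U (ext_deriv 1 (\<eta> 3 c))" by (rule k_form_ext_deriv_1[OF k_form_eta(3)[OF triple] triple_open[OF triple]])
  have W: "k_form 2 U ?W" by (rule k_form_wedge_1_1[OF triple k_form_eta_cx[OF triple] k_form_conj_eta_cx[OF triple]])
  have "omega_ab \<eta> a b c y w = of_real a / 2 * ext_deriv 1 (\<eta> 3 c) y w + ?r * ?W y w" if "y \<in> U" for y w
    unfolding omega_ab_def alpha_form_3[OF triple that] by (simp add: algebra_simps)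
  then have "ext_deriv 2 (omega_ab \<eta> a b c) x v = ext_deriv 2 (\<lambda>y w. of_real a / 2 * ext_deriv 1 (\<eta> 3 c) y w + ?r * ?W y w) x v"
    by (rule ext_deriv_cong[OF triple_open[OF triple] x])
  also have "\<dots> = of_real a / 2 * ext_deriv 2 (ext_deriv 1 (\<eta> 3 c)) x v + ?r * ext_deriv 2 ?W x v"
    by (simp only: ext_deriv_add[OF k_form_cmult[OF triple_open[OF triple] E3] k_form_cmult[OF triple_open[OF triple] W] x]
      ext_deriv_cmult[OF E3 x] ext_deriv_cmult[OF W x])
  finally show ?thesis
    unfolding ext_deriv_ext_deriv_1[OF k_form_eta(3)[OF triple] triple_open[OF triple] x] d_eta_wedge_conj_eta
    by (simp add: algebra_simps)
qed

text \<open>In invariant terms, d\<alpha> = 2i \<alpha> \<and> \<eta>_3 - 2i \<eta> \<and>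
  \<alpha>_3. The first term comes from differentiating \<eta> in i \<eta> \<and> \<eta>_3, the
  second from d\<eta>_3, whose part along \<eta> \<and> cnj \<eta> is killed by \<eta>.\<close>

lemma d_alpha_cx:
  "ext_deriv 2 (alpha_cx \<eta> c) x =
    (\<lambda>v. 2 * \<i> * dt [s, t, h3] v + (dt [H, s, cj s] v + dt [H, t, cj t] v))"
proof
  fix v
  let ?W = "wedge 1 1 (eta_cx \<eta> c) (\<eta> 3 c)"
  have E: "k_form 2 U (ext_deriv 1 (eta_cx \<eta> c))" by (rule k_form_ext_deriv_1[OF k_form_eta_cx[OF triple] triple_open[OF triple]])
  have W: "k_form 2 U ?W" by (rule k_form_wedge_1_1[OF triple k_form_eta_cx[OF triple] k_form_eta(3)[OF triple]])
  have "ext_deriv 2 (alpha_cx \<eta> c) x v = ext_deriv 2 (\<lambda>y w. (1 / 2) * ext_deriv 1 (eta_cx \<eta> c) y w + \<i> * ?W y w) x v"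
    by (rule ext_deriv_cong[OF triple_open[OF triple] x alpha_cx[OF triple]])
  also have "\<dots> = (1 / 2) * ext_deriv 2 (ext_deriv 1 (eta_cx \<eta> c)) x v + \<i> * ext_deriv 2 ?W x v"
    by (simp only: ext_deriv_add[OF k_form_cmult[OF triple_open[OF triple] E] k_form_cmult[OF triple_open[OF triple] W] x]
      ext_deriv_cmult[OF E x] ext_deriv_cmult[OF W x])
  also have "ext_deriv 2 (ext_deriv 1 (eta_cx \<eta> c)) x v = 0"
    by (rule ext_deriv_ext_deriv_1[OF k_form_eta_cx[OF triple] triple_open[OF triple] x])
  also have "ext_deriv 2 ?W x v = wedge 2 1 (ext_deriv 1 (eta_cx \<eta> c)) (\<eta> 3 c) x v -
    wedge 1 2 (eta_cx \<eta> c) (ext_deriv 1 (\<eta> 3 c)) x v"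
    using ext_deriv_wedge[OF triple_open[OF triple] k_form_eta_cx[OF triple] k_form_eta(3)[OF triple] x, of v]
    by (simp add: numeral_2_eq_2)
  also have "ext_deriv 1 (\<eta> 3 c) x = (\<lambda>v. \<i> * (dt [s, cj s] v + dt [t, cj t] v) + \<i> * dt [H, cj H] v)"
  proof
    fix v
    have "ext_deriv 1 (\<eta> 3 c) x v = 2 * alpha_form \<eta> 3 c x v + \<i> * wedge 1 1 (eta_cx \<eta> c) (conj_form (eta_cx \<eta> c)) x v"
      unfolding alpha_form_3[OF triple x] by simp
    then show "ext_deriv 1 (\<eta> 3 c) x v = \<i> * (dt [s, cj s] v + dt [t, cj t] v) + \<i> * dt [H, cj H] v"
      unfolding wedge_eq_wedge_map eta_coframe wedge_map_dt_simps by simp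
  qed
  then have "wedge 2 1 (ext_deriv 1 (eta_cx \<eta> c)) (\<eta> 3 c) x v - wedge 1 2 (eta_cx \<eta> c) (ext_deriv 1 (\<eta> 3 c)) x v =
    2 * dt [s, t, h3] v + (- 2 * \<i>) * dt [H, h3, h3] v -
      (\<i> * (dt [H, s, cj s] v + dt [H, t, cj t] v) + \<i> * dt [H, H, cj H] v)"
    unfolding wedge_eq_wedge_map d_eta_coframe eta_coframe(1,3) by (simp only: wedge_map_expand)
  also have "dt [H, h3, h3] v = 0" by (rule dt_not_distinct) simp
  also have "dt [H, H, cj H] v = 0" by (rule dt_not_distinct) simp
  finally show "ext_deriv 2 (alpha_cx \<eta> c) x v = 2 * \<i> * dt [s, t, h3] v + (dt [H, s, cj s] v + dt [H, t, cj t] v)"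
    by (simp add: algebra_simps)
qed

text \<open>The terms with \<eta>_3 in d\<alpha> \<and> cnj \<eta> and in \<alpha> \<and> d(cnj
  \<eta>) are opposite: the weights of \<alpha> and cnj \<eta> under the Reeb flow cancel, although
  \<alpha> alone is not basic.\<close>

lemma d_Omega_ab:
  "ext_deriv 3 (Omega_ab \<eta> a b \<gamma> c) x v = of_real (a * b) * exp (\<i> * of_real \<gamma>) *
    (2 * dt [s, t, cj s, cj t] v + dt [H, s, cj s, cj H] v + dt [H, t, cj t, cj H] v)"
proof -
  let ?W = "wedge 2 1 (alpha_cx \<eta> c) (conj_form (eta_cx \<eta> c))"
  have W: "k_form 3 U ?W"
    using k_form_wedge[OF triple_open[OF triple] k_form_alpha_cx[OF triple] k_form_conj_eta_cx[OF triple]]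
    by (simp add: numeral_3_eq_3)
  have "ext_deriv 3 ?W x v = wedge 3 1 (ext_deriv 2 (alpha_cx \<eta> c)) (conj_form (eta_cx \<eta> c)) x v +
    wedge 2 2 (alpha_cx \<eta> c) (ext_deriv 1 (conj_form (eta_cx \<eta> c))) x v"
    using ext_deriv_wedge[OF triple_open[OF triple] k_form_alpha_cx[OF triple] k_form_conj_eta_cx[OF triple] x, of v]
    by (simp add: numeral_2_eq_2 numeral_3_eq_3)
  also have "\<dots> = 2 * \<i> * dt [s, t, h3, cj H] v + (dt [H, s, cj s, cj H] v + dt [H, t, cj t, cj H] v) +
    (2 * dt [s, t, cj s, cj t] v + 2 * \<i> * dt [s, t, cj H, h3] v)"
    unfolding wedge_eq_wedge_map d_alpha_cx d_conj_eta_coframe eta_coframe(2,4) by (simp only: wedge_map_expand)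
  also have "dt [s, t, h3, cj H] v = - dt [s, t, cj H, h3] v"
    using dt_swap[of "[s, t]" h3 "cj H" "[]" v] by simp
  finally show ?thesis
    unfolding Omega_ab_def ext_deriv_cmult[OF W x] by (simp add: algebra_simps)
qed

text \<open>Only s, t, H and their conjugates occur in the two forms and in their differentials, and
  all of these vanish on \<open>X x\<close>. The statements about the differentials feed Cartan's
  formula.\<close>

lemma interior_product_coframe:
  assumes "s (X x) = 0" "t (X x) = 0" "H (X x) = 0"
  shows "interior_product X (omega_ab \<eta> a b c) x v = 0"
    "interior_product X (Omega_ab \<eta> a b \<gamma> c) x v = 0"
    "interior_product X (ext_deriv 2 (omega_ab \<eta> a b c)) x v = 0"
    "interior_product X (ext_deriv 3 (Omega_ab \<eta> a b \<gamma> c)) x v = 0"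
proof -
  let ?v = "case_nat (X x) v"
  have 0: "dt fs ?v = 0" if "set fs \<subseteq> {s, t, cj s, cj t, H, cj H}" "fs \<noteq> []" for fs
    by (rule dt_eq_0[of _ _ 0]) (use that assms in \<open>auto simp: cj_def\<close>)
  show "interior_product X (omega_ab \<eta> a b c) x v = 0"
    "interior_product X (Omega_ab \<eta> a b \<gamma> c) x v = 0"
    "interior_product X (ext_deriv 2 (omega_ab \<eta> a b c)) x v = 0"
    "interior_product X (ext_deriv 3 (Omega_ab \<eta> a b \<gamma> c)) x v = 0"
    unfolding interior_product_def omega_ab_coframe Omega_ab_coframe
      d_omega_ab d_Omega_ab by (simp_all add: 0)
qed

end

lemma lie_derivative_coframe:
  fixes \<eta> :: "nat \<Rightarrow> ('a::euclidean_space, 'p) oform"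
  assumes triple: "form_triple U \<eta> c" and x: "x \<in> U" and X: "smooth_on U X"
    and co: "\<And>y. y \<in> U \<Longrightarrow> \<exists>s t. coframe \<eta> c y s t \<and> s (X y) = 0 \<and> t (X y) = 0 \<and> eta_at \<eta> c y (X y) = 0"
  shows "lie_derivative 2 X (omega_ab \<eta> a b c) x v = 0"
    "lie_derivative 3 X (Omega_ab \<eta> a b \<gamma> c) x v = 0"
proof -
  have "interior_product X (omega_ab \<eta> a b c) y v = 0 \<and> interior_product X (Omega_ab \<eta> a b \<gamma> c) y v = 0 \<and>
    interior_product X (ext_deriv 2 (omega_ab \<eta> a b c)) y v = 0 \<and>
    interior_product X (ext_deriv 3 (Omega_ab \<eta> a b \<gamma> c)) y v = 0" if y: "y \<in> U" for y v
  proof -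
    obtain s t where st: "coframe \<eta> c y s t" "s (X y) = 0" "t (X y) = 0" "eta_at \<eta> c y (X y) = 0"
      using co[OF y] by blast
    show ?thesis using interior_product_coframe[OF triple y st(1) refl refl, of X] st by blast
  qed
  note i = this
  show "lie_derivative 2 X (omega_ab \<eta> a b c) x v = 0"
    by (subst lie_derivative_eq_interior_ext_deriv[OF k_form_omega_ab[OF triple] triple_open[OF triple] x X])
      (use i x in auto)
  show "lie_derivative 3 X (Omega_ab \<eta> a b \<gamma> c) x v = 0"
    by (subst lie_derivative_eq_interior_ext_deriv[OF k_form_Omega_ab[OF triple] triple_open[OF triple] x X])
      (use i x in auto)
qed

section \<open>Pullbacks\<close>

text \<open>Constant in the chart argument, so that a pulled-back triple on any open set can be
  inserted into \<open>omega_ab\<close> and \<open>Omega_ab\<close>, which expect families indexed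
  by charts.\<close>

definition pullback_triple ::
  "('a::euclidean_space \<Rightarrow> 'b::euclidean_space) \<Rightarrow> (nat \<Rightarrow> ('b, 'p) oform) \<Rightarrow> ('b, 'p) ochart \<Rightarrow>
   nat \<Rightarrow> ('a, 'q) oform" where
  "pullback_triple f \<eta> c = (\<lambda>i _. pullback f (\<eta> i c))"

context
  fixes f :: "'a::euclidean_space \<Rightarrow> 'b::euclidean_space" and U V and \<eta> :: "nat \<Rightarrow> ('b, 'p) oform" and c
    and c' :: "('a, 'q) ochart"
  assumes triple: "form_triple V \<eta> c" and f: "open U" "smooth_on U f" "f ` U \<subseteq> V"
begin

lemma form_triple_pullback: "form_triple U (pullback_triple f \<eta> c) c'"
  unfolding form_triple_def pullback_triple_def
  using f triple k_form_pullback_1[OF triple_k_form[OF triple] f(1) triple_open[OF triple] f(2,3)]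
  by (auto simp: pullback_def form_triple_def)

lemma eta_cx_pullback: "eta_cx (pullback_triple f \<eta> c) c' = pullback f (eta_cx \<eta> c)"
  by (simp add: eta_cx_def pullback_triple_def pullback_def)

lemma conj_form_pullback: "conj_form (pullback f \<beta>) = pullback f (conj_form \<beta>)"
  by (simp add: conj_form_def pullback_def)

lemma alpha_form_pullback:
  assumes "i \<in> {1..3}" "x \<in> U"
  shows "alpha_form (pullback_triple f \<eta> c) i c' x v = pullback f (alpha_form \<eta> i c) x v"
  using ext_deriv_pullback_1[OF triple_k_form[OF triple assms(1)] f(1) triple_open[OF triple] f(2,3) assms(2)]
  by (simp add: alpha_form_def pullback_triple_def pullback_wedge[symmetric]) (simp add: pullback_def wedge_def)

lemma alpha_cx_pullback: "x \<in> U \<Longrightarrow> alpha_cx (pullback_triple f \<eta> c) c' x v = pullback f (alpha_cx \<eta> c) x v"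
  by (simp add: alpha_cx_def alpha_form_pullback) (simp add: pullback_def)

lemma omega_ab_pullback:
  "x \<in> U \<Longrightarrow> omega_ab (pullback_triple f \<eta> c) a b c' x v = pullback f (omega_ab \<eta> a b c) x v"
  by (simp add: omega_ab_def alpha_form_pullback eta_cx_pullback conj_form_pullback pullback_wedge[symmetric])
     (simp add: pullback_def)

lemma Omega_ab_pullback:
  assumes "x \<in> U"
  shows "Omega_ab (pullback_triple f \<eta> c) a b \<gamma> c' x v = pullback f (Omega_ab \<eta> a b \<gamma> c) x v"
proof -
  have "alpha_cx (pullback_triple f \<eta> c) c' x = pullback f (alpha_cx \<eta> c) x"
    using alpha_cx_pullback[OF assms] by blast
  then have "wedge 2 1 (alpha_cx (pullback_triple f \<eta> c) c') (pullback f (conj_form (eta_cx \<eta> c))) x v =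
    wedge 2 1 (pullback f (alpha_cx \<eta> c)) (pullback f (conj_form (eta_cx \<eta> c))) x v"
    by (simp add: wedge_eq_wedge_map)
  then show ?thesis
    by (simp add: Omega_ab_def eta_cx_pullback conj_form_pullback pullback_wedge[symmetric])
       (simp add: pullback_def)
qed

lemma coframe_pullback:
  assumes x: "x \<in> U" and co: "coframe \<eta> c (f x) s t"
  shows "coframe (pullback_triple f \<eta> c) c' x (s \<circ> frechet_derivative f (at x)) (t \<circ> frechet_derivative f (at x))"
proof -
  have "linear (frechet_derivative f (at x))" by (rule linear_frechet_derivative'[OF f(2) x])
  then show ?thesis
    using co unfolding coframe_def alpha_cx_pullback[OF x]
    by (auto simp: alpha_form_pullback x pullback_def dt_pair cj_def linear_compose)
qed

end

lemma linear_functional_inner: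
  fixes f :: "'a::euclidean_space \<Rightarrow> real"
  assumes "linear f"
  shows "f u = u \<bullet> (\<Sum>b\<in>Basis. f b *\<^sub>R b)"
  by (subst linear_eq_sum_Basis[OF assms]) (simp add: inner_sum_right mult.commute)

section \<open>Quaternionic frames\<close>

context
  fixes B :: "'v::euclidean_space \<Rightarrow> 'v \<Rightarrow> real" and I J K :: "'v \<Rightarrow> 'v" and E :: 'v
  assumes B: "bilinear B" and sym: "\<And>u w. B u w = B w u" and pos: "\<And>u. u \<noteq> 0 \<Longrightarrow> B u u > 0"
    and lin: "linear I" "linear J" "linear K"
    and quat: "\<And>u. I (I u) = - u" "\<And>u. J (J u) = - u" "\<And>u. K (K u) = - u"
      "\<And>u. I (J u) = K u" "\<And>u. J (I u) = - K u" "\<And>u. J (K u) = I u" "\<And>u. K (J u) = - I u"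
      "\<And>u. K (I u) = J u" "\<And>u. I (K u) = - J u"
    and isom: "\<And>u w. B (I u) (I w) = B u w" "\<And>u w. B (J u) (J w) = B u w" "\<And>u w. B (K u) (K w) = B u w"
    and E: "B E E = 1" and dim: "DIM('v) = 8"
begin

lemma quat_skew: "B u (I w) = - B (I u) w" "B u (J w) = - B (J u) w" "B u (K w) = - B (K u) w"
  using isom(1)[of u "I w"] isom(2)[of u "J w"] isom(3)[of u "K w"] quat(1-3)
  by (simp_all add: bilinear_rneg[OF B])

lemma quat_self: "B u (I u) = 0" "B u (J u) = 0" "B u (K u) = 0"
  using quat_skew[of u u] sym by (simp_all add: eq_neg_iff_add_eq_0)

lemma B_linear: "linear (B u)" "linear (\<lambda>u. B u w)"
  using B by (auto simp: bilinear_def)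

text \<open>Four linear conditions leave a nonzero solution in dimension 8; it is then rescaled to
  unit length with respect to \<open>B\<close>.\<close>

lemma quat_orthogonal_unit:
  obtains Y where "B Y Y = 1" "B Y E = 0" "B Y (I E) = 0" "B Y (J E) = 0" "B Y (K E) = 0"
proof -
  \<comment> \<open>\<open>B\<close> may differ from the ambient inner product; \<open>G u\<close>
    is the vector that represents \<open>B u\<close> in the latter, so ordinary orthogonality to
    \<open>G u\<close> expresses \<open>B\<close>-orthogonality to \<open>u\<close>.\<close>
  define G where "G u = (\<Sum>b\<in>Basis. B u b *\<^sub>R b)" for u
  have G: "B u w = w \<bullet> G u" for u w
    unfolding G_def by (rule linear_functional_inner[OF B_linear(1)])
  have "card {G E, G (I E), G (J E), G (K E)} \<le> 4" by (intro card_insert_le_m1) auto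
  then have "dim {G E, G (I E), G (J E), G (K E)} < DIM('v)"
    using dim_le_card'[of "{G E, G (I E), G (J E), G (K E)}"] dim by simp
  then obtain x where x: "x \<noteq> 0" "\<And>y. y \<in> span {G E, G (I E), G (J E), G (K E)} \<Longrightarrow> orthogonal x y"
    by (rule orthogonal_to_subspace_exists) auto
  have 0: "B u x = 0" if "u \<in> {E, I E, J E, K E}" for u
    using x(2)[of "G u"] that unfolding G orthogonal_def by (auto intro: span_base)
  define Y where "Y = (1 / sqrt (B x x)) *\<^sub>R x"
  have "B Y Y = 1"
    using pos[OF x(1)] by (simp add: Y_def bilinear_lmul[OF B] bilinear_rmul[OF B] field_simps)
  moreover have "B Y u = 0" if "u \<in> {E, I E, J E, K E}" for u
    using 0[OF that] unfolding sym[of Y u] by (simp add: Y_def bilinear_rmul[OF B])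
  ultimately show ?thesis using that by simp
qed

text \<open>The vectors Y, IY, JY, KY, E, IE, JE, KE are orthonormal for \<open>B\<close> by
  skewness and the quaternion relations; being eight, they form a basis, and expanding
  \<open>u\<close> in it gives the formula.\<close>

lemma quat_parseval:
  assumes Y: "B Y Y = 1" "B Y E = 0" "B Y (I E) = 0" "B Y (J E) = 0" "B Y (K E) = 0"
  shows "B u w = B Y u * B Y w + B (I Y) u * B (I Y) w + B (J Y) u * B (J Y) w + B (K Y) u * B (K Y) w +
    (B E u * B E w + B (I E) u * B (I E) w + B (J E) u * B (J E) w + B (K E) u * B (K E) w)"
proof -
  \<comment> \<open>The eight coordinates are packed into four complex numbers. \<open>?Q\<close> is
    a right inverse of the coordinate map \<open>?L\<close>, so \<open>?L\<close> is onto a space of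
    dimension 8 and hence injective.\<close>
  let ?L = "\<lambda>u. (Complex (B Y u) (B (I Y) u), Complex (B (J Y) u) (B (K Y) u),
    Complex (B E u) (B (I E) u), Complex (B (J E) u) (B (K E) u))"
  let ?P = "\<lambda>u. B Y u *\<^sub>R Y + B (I Y) u *\<^sub>R I Y + B (J Y) u *\<^sub>R J Y + B (K Y) u *\<^sub>R K Y +
    (B E u *\<^sub>R E + B (I E) u *\<^sub>R I E + B (J E) u *\<^sub>R J E + B (K E) u *\<^sub>R K E)"
  let ?Q = "\<lambda>(p, q, r, z). Re p *\<^sub>R Y + Im p *\<^sub>R I Y + Re q *\<^sub>R J Y + Im q *\<^sub>R K Y +
    (Re r *\<^sub>R E + Im r *\<^sub>R I E + Re z *\<^sub>R J E + Im z *\<^sub>R K E)"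
  have YE: "B E Y = 0" "B E (I Y) = 0" "B E (J Y) = 0" "B E (K Y) = 0"
    using Y quat_skew[of E Y] sym by auto
  note tab = YE Y E isom quat quat_skew(1)[of "J u" w for u w] quat_skew(1)[of "K u" w for u w]
    quat_skew(2)[of "I u" w for u w] quat_skew(2)[of "K u" w for u w] quat_skew(3)[of "I u" w for u w]
    quat_skew(3)[of "J u" w for u w] quat_self
    bilinear_lneg[OF B] bilinear_rneg[OF B]
  have self: "B (I Y) Y = 0" "B (J Y) Y = 0" "B (K Y) Y = 0" "B (I E) E = 0" "B (J E) E = 0" "B (K E) E = 0"
    "B (I Y) E = 0" "B (J Y) E = 0" "B (K Y) E = 0" "B (I E) Y = 0" "B (J E) Y = 0" "B (K E) Y = 0"
    using quat_self[of Y] quat_self[of E] Y YE by (simp_all add: sym[of "_ Y" Y] sym[of "_ E" E] sym[of "_ Y" E] sym[of "_ E" Y])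
  have LQ: "?L (?Q z) = z" for z
    by (cases z) (simp add: bilinear_radd[OF B] bilinear_rmul[OF B] tab self)
  have "linear ?L"
    by (intro linearI) (simp_all add: bilinear_radd[OF B] bilinear_rmul[OF B] plus_complex.ctr scaleR_complex.ctr)
  moreover have "surj ?L" by (rule surjI[of _ ?Q]) (rule LQ)
  ultimately have "inj ?L" by (rule eucl.linear_surjective_imp_injective) (simp add: dim)
  moreover have "?L (?P u) = ?L u"
    using LQ[of "?L u"] by simp
  ultimately have "u = ?P u" by (simp add: inj_def)
  then have "B u w = B (?P u) w" by simp
  also have "\<dots> = B Y u * B Y w + B (I Y) u * B (I Y) w + B (J Y) u * B (J Y) w + B (K Y) u * B (K Y) w +
    (B E u * B E w + B (I E) u * B (I E) w + B (J E) u * B (J E) w + B (K E) u * B (K E) w)"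
    by (simp only: bilinear_ladd[OF B] bilinear_lmul[OF B] real_scaleR_def)
  finally show ?thesis .
qed

end

section \<open>Kaehler cones\<close>

context
  fixes S :: "('e::euclidean_space, 'p) orbifold" and g gbar J and c :: "('e, 'p) ochart"
  assumes S: "is_orbifold S" "riemannian_metric S g" and cone: "is_cone_metric S g gbar"
    and K: "kaehler (cone_orbifold S) gbar J" and c: "c \<in> charts S"
begin

private abbreviation (input) "U \<equiv> cdom c"
private abbreviation (input) "JJ \<equiv> J (cone_chart c)"
private abbreviation (input) "gg \<equiv> gbar (cone_chart c)"
private abbreviation (input) "DJ \<equiv> \<lambda>p h w. frechet_derivative (\<lambda>y. JJ y w) (at p) h"

lemma cone_open: "open U" "open (U \<times> {0::real<..})"
  using S(1) c by (auto simp: is_orbifold_def uniformizing_chart_def intro!: open_Times)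

lemma cone_chart_in: "cone_chart c \<in> charts (cone_orbifold S)" "cdom (cone_chart c) = U \<times> {0<..}"
  using c by (auto simp: cone_orbifold_def cone_chart_def)

lemma gg_eq: "x \<in> U \<Longrightarrow> r > 0 \<Longrightarrow> gg (x, r) (u, a) (w, b) = a * b + r\<^sup>2 * g c x u w"
  using cone c by (auto simp: is_cone_metric_def)

lemma cone_kaehler:
  shows "p \<in> U \<times> {0<..} \<Longrightarrow> linear (JJ p)" "smooth_on (U \<times> {0<..}) (\<lambda>p. JJ p u)"
  "p \<in> U \<times> {0<..} \<Longrightarrow> JJ p (JJ p u) = - u"
  "p \<in> U \<times> {0<..} \<Longrightarrow> gg p (JJ p u) (JJ p w) = gg p u w"
  "p \<in> U \<times> {0<..} \<Longrightarrow> nijenhuis JJ (\<lambda>_. u) (\<lambda>_. w) p = 0"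
  "p \<in> U \<times> {0<..} \<Longrightarrow> ext_deriv 2 (kaehler_form gbar J (cone_chart c)) p v = 0"
  "p \<in> U \<times> {0<..} \<Longrightarrow> bilinear (gg p)" "smooth_on (U \<times> {0<..}) (\<lambda>p. gg p u w)"
  "p \<in> U \<times> {0<..} \<Longrightarrow> gg p u w = gg p w u"
  "p \<in> U \<times> {0<..} \<Longrightarrow> u \<noteq> 0 \<Longrightarrow> gg p u u > 0"
proof -
  note k = K[unfolded kaehler_def, THEN conjunct2, THEN conjunct2, THEN bspec, OF cone_chart_in(1),
      unfolded cone_chart_in(2), THEN bspec]
  note r = K[unfolded kaehler_def, THEN conjunct1, unfolded riemannian_metric_def, THEN conjunct1,
      THEN bspec, OF cone_chart_in(1), unfolded cone_chart_in(2)]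
  note e = K[unfolded kaehler_def, THEN conjunct2, THEN conjunct1, unfolded orb_endo_def, THEN conjunct1,
      THEN bspec, OF cone_chart_in(1), unfolded cone_chart_in(2)]
  show "p \<in> U \<times> {0<..} \<Longrightarrow> JJ p (JJ p u) = - u"
    "p \<in> U \<times> {0<..} \<Longrightarrow> gg p (JJ p u) (JJ p w) = gg p u w"
    "p \<in> U \<times> {0<..} \<Longrightarrow> nijenhuis JJ (\<lambda>_. u) (\<lambda>_. w) p = 0"
    "p \<in> U \<times> {0<..} \<Longrightarrow> ext_deriv 2 (kaehler_form gbar J (cone_chart c)) p v = 0"
    using k by blast+
  show "p \<in> U \<times> {0<..} \<Longrightarrow> bilinear (gg p)" "smooth_on (U \<times> {0<..}) (\<lambda>p. gg p u w)"
    "p \<in> U \<times> {0<..} \<Longrightarrow> gg p u w = gg p w u"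
    "p \<in> U \<times> {0<..} \<Longrightarrow> u \<noteq> 0 \<Longrightarrow> gg p u u > 0"
    using r by blast+
  show "p \<in> U \<times> {0<..} \<Longrightarrow> linear (JJ p)" "smooth_on (U \<times> {0<..}) (\<lambda>p. JJ p u)"
    using e by blast+
qed

lemma gg_skew: "p \<in> U \<times> {0<..} \<Longrightarrow> gg p (JJ p u) w = - gg p u (JJ p w)"
  using cone_kaehler(4)[of p "JJ p u" w] cone_kaehler(3)[of p u]
    bilinear_lneg[OF cone_kaehler(7), of p u "JJ p w"] by simp

lemma gg_radial: "p \<in> U \<times> {0<..} \<Longrightarrow> gg p (0, 1) w = snd w"
  using gg_eq[of "fst p" "snd p" 0 1 "fst w" "snd w"] S(2) c
  by (auto simp: riemannian_metric_def bilinear_lzero)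

text \<open>The radial vector is dual to dr, so skewness of \<open>J\<close> gives \<eta> = - dr
  \<circ> J at r = 1. This expresses the contact form through \<open>J\<close> alone, and its
  differential through first derivatives of \<open>J\<close>.\<close>

lemma J_radial: "p \<in> U \<times> {0<..} \<Longrightarrow> gg p (JJ p (0, 1)) w = - snd (JJ p w)"
  by (simp add: gg_skew gg_radial)

lemma DJ_has_derivative:
  "p \<in> U \<times> {0<..} \<Longrightarrow> ((\<lambda>y. JJ y w) has_derivative (\<lambda>h. DJ p h w)) (at p)"
  by (rule smooth_on_has_derivative[OF cone_kaehler(2)])

text \<open>Obtained by differentiating J^2 = -1.\<close>

lemma DJ_J:
  assumes p: "p \<in> U \<times> {0<..}"
  shows "DJ p h (JJ p w) = - JJ p (DJ p h w)"
proof -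
  have "((\<lambda>y. JJ y (JJ y w)) has_derivative (\<lambda>h. DJ p h (JJ p w) + JJ p (DJ p h w))) (at p)"
    by (rule has_derivative_linear_family[OF cone_open(2) p cone_kaehler(1,2) DJ_has_derivative[OF p]])
  moreover have "((\<lambda>y. JJ y (JJ y w)) has_derivative (\<lambda>h. 0)) (at p)"
    by (rule has_derivative_transform_within_open[OF has_derivative_const[of "- w"] cone_open(2) p
          cone_kaehler(3)[symmetric]])
  ultimately have "(\<lambda>h. DJ p h (JJ p w) + JJ p (DJ p h w)) = (\<lambda>h. 0)"
    by (rule has_derivative_unique)
  from fun_cong[OF this, of h] show ?thesis by (simp add: add_eq_0_iff2)
qed

text \<open>Constant fields have vanishing derivative, so only derivatives of \<open>J\<close>
  remain in the Nijenhuis tensor.\<close>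

lemma nijenhuis_DJ:
  assumes p: "p \<in> U \<times> {0<..}"
  shows "DJ p (JJ p u) w - DJ p (JJ p w) u = JJ p (DJ p u w - DJ p w u)"
proof -
  note l = cone_kaehler(1)[OF p]
  have c0: "frechet_derivative (\<lambda>_. z) (at q) h = 0" for z :: "'e \<times> real" and q h :: "'e \<times> real"
    by (simp add: frechet_derivative_eqI[OF has_derivative_const])
  show ?thesis
    using cone_kaehler(5)[OF p, of u w]
    by (simp add: nijenhuis_def lie_bracket_def c0 linear_diff[OF l] linear_neg[OF l] linear_0[OF l] algebra_simps)
qed

lemma kaehler_form_smooth: "smooth_on (U \<times> {0<..}) (\<lambda>p. kaehler_form gbar J (cone_chart c) p v)"
  unfolding kaehler_form_def
proof (rule smooth_on_bounded_linear_comp[OF cone_open(2) bounded_linear_of_real])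
  show "smooth_on (U \<times> {0<..}) (\<lambda>p. gg p (JJ p (v 0)) (v 1))"
    by (rule smooth_on_linear_family[where L = "\<lambda>p w. gg p w (v 1)", OF cone_open(2) _ cone_kaehler(8,2)])
      (use cone_kaehler(7) in \<open>unfold bilinear_def, blast\<close>)
qed

lemma derivative_snd_J:
  assumes p: "p \<in> U \<times> {0<..}"
  shows "frechet_derivative (\<lambda>y. complex_of_real (- snd (JJ y w))) (at p) h = - of_real (snd (DJ p h w))"
proof -
  have "((\<lambda>y. complex_of_real (- snd (JJ y w))) has_derivative (\<lambda>h. of_real (- snd (DJ p h w)))) (at p)"
    by (intro has_derivative_of_real has_derivative_minus has_derivative_snd DJ_has_derivative p)
  from frechet_derivative_eqI[OF this] show ?thesis by simp
qed

text \<open>Closedness of the Kaehler form is evaluated on the radial vector, \<open>u\<close> and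
  \<open>w\<close>. The two terms on the right arise from \<omega>(d/dr, z) = - dr(J z), which
  reduces the tangential derivatives to derivatives of \<open>J\<close>.\<close>

lemma kaehler_form_radial_derivative:
  assumes p: "p \<in> U \<times> {0<..}"
  shows "frechet_derivative (\<lambda>y. kaehler_form gbar J (cone_chart c) y (vec2 u w)) (at p) (0, 1) =
    of_real (snd (DJ p w u) - snd (DJ p u w))"
proof -
  let ?\<omega> = "kaehler_form gbar J (cone_chart c)"
  have r: "frechet_derivative (\<lambda>y. ?\<omega> y (vec2 (0, 1) z)) (at p) h = - of_real (snd (DJ p h z))" for z h
  proof -
    have "frechet_derivative (\<lambda>y. ?\<omega> y (vec2 (0, 1) z)) (at p) =
      frechet_derivative (\<lambda>y. complex_of_real (- snd (JJ y z))) (at p)"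
      by (rule frechet_derivative_cong_open[OF cone_open(2) p]) (simp add: kaehler_form_def vec2_def J_radial)
    then show ?thesis using derivative_snd_J[OF p] by simp
  qed
  define v where "v = (\<lambda>i::nat. if i = 0 then (0, 1) else if i = 1 then u else w)"
  have "?\<omega> y z = ?\<omega> y (vec2 (z 0) (z 1))" for y z by (simp add: kaehler_form_def vec2_def)
  then have "ext_deriv 2 ?\<omega> p v =
    frechet_derivative (\<lambda>y. ?\<omega> y (vec2 u w)) (at p) (0, 1)
    - frechet_derivative (\<lambda>y. ?\<omega> y (vec2 (0, 1) w)) (at p) u
    + frechet_derivative (\<lambda>y. ?\<omega> y (vec2 (0, 1) u)) (at p) w"
    unfolding ext_deriv_2 kaehler_form_def by (simp add: v_def vec2_def)
  then show ?thesis using cone_kaehler(6)[OF p, of v] unfolding r by (simp add: algebra_simps)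
qed

text \<open>The same derivative, computed from the explicit cone metric: besides the derivative of
  \<open>J\<close>, the factor r^2 contributes twice the tangential part at r = 1, whence the
  subtraction of the product of the radial components.\<close>

lemma kaehler_form_radial_derivative':
  assumes x: "x \<in> U"
  shows "frechet_derivative (\<lambda>p. kaehler_form gbar J (cone_chart c) p (vec2 u w)) (at (x, 1)) (0, 1) =
    of_real (gg (x, 1) (DJ (x, 1) (0, 1) u) w + 2 * (gg (x, 1) (JJ (x, 1) u) w - snd (JJ (x, 1) u) * snd w))"
proof -
  have p: "(x, 1) \<in> U \<times> {0::real<..}" using x by simp
  have lin_g: "linear (\<lambda>z. g c x z (fst w))" using S(2) c x by (auto simp: riemannian_metric_def bilinear_def)
  have l1: "((\<lambda>s. (x, s)) has_derivative (\<lambda>k. (0, k))) (at (1::real))"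
    by (auto intro!: derivative_eq_intros)
  have "((\<lambda>p. kaehler_form gbar J (cone_chart c) p (vec2 u w)) has_derivative
      frechet_derivative (\<lambda>p. kaehler_form gbar J (cone_chart c) p (vec2 u w)) (at (x, 1))) (at (x, 1))"
    by (rule smooth_on_has_derivative[OF kaehler_form_smooth p])
  from diff_chain_at[OF l1 this]
  have 1: "((\<lambda>s. complex_of_real (gg (x, s) (JJ (x, s) u) w)) has_derivative
      (\<lambda>k. frechet_derivative (\<lambda>p. kaehler_form gbar J (cone_chart c) p (vec2 u w)) (at (x, 1)) (0, k))) (at 1)"
    by (simp add: o_def kaehler_form_def vec2_def)
  have J: "((\<lambda>s. JJ (x, s) u) has_derivative (\<lambda>k. DJ (x, 1) (0, k) u)) (at 1)"
    using diff_chain_at[OF l1 DJ_has_derivative[OF p, of u]] by (simp add: o_def)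
  have "((\<lambda>s. snd (JJ (x, s) u) * snd w + s\<^sup>2 * g c x (fst (JJ (x, s) u)) (fst w)) has_derivative
     (\<lambda>k. snd (DJ (x, 1) (0, k) u) * snd w +
       (1\<^sup>2 * g c x (fst (DJ (x, 1) (0, k) u)) (fst w) + 2 * k * g c x (fst (JJ (x, 1) u)) (fst w)))) (at 1)"
    by (intro has_derivative_add has_derivative_mult has_derivative_mult_left has_derivative_snd J
        bounded_linear.has_derivative[OF lin_g[unfolded linear_conv_bounded_linear]] has_derivative_fst)
      (auto intro!: derivative_eq_intros)
  then have "((\<lambda>s. complex_of_real (snd (JJ (x, s) u) * snd w + s\<^sup>2 * g c x (fst (JJ (x, s) u)) (fst w))) has_derivative
     (\<lambda>k. of_real (snd (DJ (x, 1) (0, k) u) * snd w +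
       (1\<^sup>2 * g c x (fst (DJ (x, 1) (0, k) u)) (fst w) + 2 * k * g c x (fst (JJ (x, 1) u)) (fst w))))) (at 1)"
    by (rule has_derivative_of_real)
  then have "((\<lambda>s. complex_of_real (gg (x, s) (JJ (x, s) u) w)) has_derivative
     (\<lambda>k. of_real (snd (DJ (x, 1) (0, k) u) * snd w +
       (1\<^sup>2 * g c x (fst (DJ (x, 1) (0, k) u)) (fst w) + 2 * k * g c x (fst (JJ (x, 1) u)) (fst w))))) (at 1)"
  proof (rule has_derivative_transform_within_open[where s = "{0<..}"])
    fix s :: real assume "s \<in> {0<..}"
    then show "complex_of_real (snd (JJ (x, s) u) * snd w + s\<^sup>2 * g c x (fst (JJ (x, s) u)) (fst w)) =
      complex_of_real (gg (x, s) (JJ (x, s) u) w)"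
      using gg_eq[OF x, of s "fst (JJ (x, s) u)" "snd (JJ (x, s) u)" "fst w" "snd w"] by simp
  qed auto
  from fun_cong[OF has_derivative_unique[OF 1 this], of 1] show ?thesis
    using gg_eq[OF x, of 1 "fst (JJ (x, 1) u)" "snd (JJ (x, 1) u)" "fst w" "snd w"]
      gg_eq[OF x, of 1 "fst (DJ (x, 1) (0, 1) u)" "snd (DJ (x, 1) (0, 1) u)" "fst w" "snd w"]
    by (simp add: algebra_simps)
qed

text \<open>By the vanishing of the Nijenhuis tensor, the radial derivative of the Kaehler form is
  \<open>J\<close>-invariant, whereas the contribution of the derivative of \<open>J\<close> is anti-invariant.\<close>

lemma derivative_J_tangential:
  assumes x: "x \<in> U"
  shows "snd (DJ (x, 1) (w, 0) (u, 0)) - snd (DJ (x, 1) (u, 0) (w, 0)) = 2 * gg (x, 1) (JJ (x, 1) (u, 0)) (w, 0)"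
proof -
  let ?J = "JJ (x, 1)" and ?g = "gg (x, 1)" and ?D = "DJ (x, 1)"
  have p: "(x, 1) \<in> U \<times> {0::real<..}" using x by simp
  note l = cone_kaehler(1)[OF p]
  \<comment> \<open>Equates the two expressions for the radial derivative of the Kaehler form, one
    from closedness and one from the cone metric.\<close>
  have *: "snd (?D w u) - snd (?D u w) = ?g (?D (0, 1) u) w + 2 * (?g (?J u) w - snd (?J u) * snd w)" for u w
    using kaehler_form_radial_derivative[OF p, of u w] kaehler_form_radial_derivative'[OF x, of u w]
    by (metis of_real_eq_iff)
  let ?u = "(u, 0 :: real)" and ?w = "(w, 0 :: real)"
  have "snd (?D (?J ?w) (?J ?u)) - snd (?D (?J ?u) (?J ?w)) = snd (?J (?D (?J ?u) ?w - ?D (?J ?w) ?u))"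
    by (simp add: DJ_J[OF p] linear_diff[OF l])
  also have "\<dots> = snd (?D ?w ?u) - snd (?D ?u ?w)"
    unfolding nijenhuis_DJ[OF p] by (simp add: cone_kaehler(3)[OF p])
  finally have inv: "?g (?D (0, 1) (?J ?u)) (?J ?w) + 2 * (?g (?J (?J ?u)) (?J ?w) - snd (?J (?J ?u)) * snd (?J ?w)) =
    ?g (?D (0, 1) ?u) ?w + 2 * (?g (?J ?u) ?w - snd (?J ?u) * snd ?w)"
    unfolding * .
  have "?g (?D (0, 1) (?J ?u)) (?J ?w) = - ?g (?D (0, 1) ?u) ?w"
    by (simp add: DJ_J[OF p] bilinear_lneg[OF cone_kaehler(7)[OF p]] cone_kaehler(4)[OF p])
  moreover have "?g (?J (?J ?u)) (?J ?w) = ?g (?J ?u) ?w" by (rule cone_kaehler(4)[OF p])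
  moreover have "snd (?J (?J ?u)) = 0" unfolding cone_kaehler(3)[OF p] by simp
  ultimately have "?g (?D (0, 1) ?u) ?w = 0" using inv by simp
  then show ?thesis using *[of ?u ?w] by simp
qed


lemma smooth_on_section: "smooth_on U (\<lambda>x. JJ (x, 1) u)"
  by (rule smooth_on_compose[OF cone_open(1,2) _ smooth_on_Pair[OF cone_open(1) smooth_on_id[OF cone_open(1)]
          smooth_on_const[OF cone_open(1)]] cone_kaehler(2)]) auto

context
  fixes X :: "'e \<Rightarrow> 'e" and \<theta> :: "'e form"
  assumes X: "\<And>x. x \<in> U \<Longrightarrow> JJ (x, 1) (0, 1) = (X x, 0)"
    and \<theta>: "\<And>x v. x \<in> U \<Longrightarrow> \<theta> x v = complex_of_real (g c x (X x) (v 0))"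
begin

lemma contact_form_J:
  assumes "x \<in> U"
  shows "\<theta> x v = of_real (- snd (JJ (x, 1) (v 0, 0)))"
    "\<theta> x v = of_real (gg (x, 1) (JJ (x, 1) (0, 1)) (v 0, 0))"
proof -
  show "\<theta> x v = of_real (gg (x, 1) (JJ (x, 1) (0, 1)) (v 0, 0))"
    using assms by (simp add: \<theta> X gg_eq)
  then show "\<theta> x v = of_real (- snd (JJ (x, 1) (v 0, 0)))"
    using J_radial[of "(x, 1)" "(v 0, 0)"] assms by simp
qed

lemma reeb_smooth: "smooth_on U X"
proof (rule smooth_on_cong[OF cone_open(1)])
  show "fst (JJ (x, 1) (0, 1)) = X x" if "x \<in> U" for x using X[OF that] by simp
  show "smooth_on U (\<lambda>x. fst (JJ (x, 1) (0, 1)))" by (rule smooth_on_fst[OF cone_open(1) smooth_on_section])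
qed

lemma contact_k_form: "k_form 1 U \<theta>"
proof (rule k_form_cong[OF cone_open(1)])
  show "complex_of_real (- snd (JJ (x, 1) (v 0, 0))) = \<theta> x v" if "x \<in> U" for x v
    using contact_form_J(1)[OF that] by simp
  have sm: "smooth_on U (\<lambda>x. complex_of_real (- snd (JJ (x, 1) u)))" for u
    by (intro smooth_on_bounded_linear_comp[OF cone_open(1) bounded_linear_of_real] smooth_on_minus cone_open(1)
        smooth_on_bounded_linear_comp[OF cone_open(1) bounded_linear_snd] smooth_on_section)
  have li: "linear (\<lambda>u. complex_of_real (- snd (JJ (x, 1) (u, 0))))" if "x \<in> U" for x
  proof -
    have "linear (JJ (x, 1))" using cone_kaehler(1)[of "(x, 1)"] that by simp
    then have "JJ (x, 1) (u + u', 0) = JJ (x, 1) (u, 0) + JJ (x, 1) (u', 0)"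
      "JJ (x, 1) (r *\<^sub>R u, 0) = r *\<^sub>R JJ (x, 1) (u, 0)" for u u' r
      using linear_add[of "JJ (x, 1)" "(u, 0)" "(u', 0)"] linear_cmul[of "JJ (x, 1)" r "(u, 0)"] by simp_all
    then show ?thesis by (intro linearI) (simp_all add: scaleR_conv_of_real)
  qed
  show "k_form 1 U (\<lambda>x v. complex_of_real (- snd (JJ (x, 1) (v 0, 0))))"
    using k_form_1I[of U "\<lambda>x u. complex_of_real (- snd (JJ (x, 1) (u, 0)))", OF li sm] .
qed

text \<open>This is d\<eta> = 2\<omega> restricted to r = 1. With the contact form written as - dr
  \<circ> J, its antisymmetrised derivative along the slice is the left-hand side of
  \<open>derivative_J_tangential\<close>.\<close>

lemma ext_deriv_contact_form:
  assumes x: "x \<in> U"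
  shows "ext_deriv 1 \<theta> x v = of_real (2 * gg (x, 1) (JJ (x, 1) (v 0, 0)) (v 1, 0))"
proof -
  have p: "(x, 1) \<in> U \<times> {0::real<..}" using x by simp
  have "frechet_derivative (\<lambda>y. \<theta> y (\<lambda>_. u)) (at x) h = - of_real (snd (DJ (x, 1) (h, 0) (u, 0)))" for u h
  proof -
    have "((\<lambda>y. (y, 1::real)) has_derivative (\<lambda>h. (h, 0))) (at x)" by (auto intro!: derivative_eq_intros)
    from diff_chain_at[OF this DJ_has_derivative[OF p]]
    have "((\<lambda>y. JJ (y, 1) (u, 0)) has_derivative (\<lambda>h. DJ (x, 1) (h, 0) (u, 0))) (at x)" by (simp add: o_def)
    then have "((\<lambda>y. complex_of_real (- snd (JJ (y, 1) (u, 0)))) has_derivative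
      (\<lambda>h. of_real (- snd (DJ (x, 1) (h, 0) (u, 0))))) (at x)"
      by (intro has_derivative_of_real has_derivative_minus has_derivative_snd)
    moreover have "frechet_derivative (\<lambda>y. \<theta> y (\<lambda>_. u)) (at x) =
      frechet_derivative (\<lambda>y. complex_of_real (- snd (JJ (y, 1) (u, 0)))) (at x)"
      by (rule frechet_derivative_cong_open[OF cone_open(1) x]) (rule contact_form_J(1))
    ultimately show ?thesis by (simp add: frechet_derivative_eqI)
  qed
  then show ?thesis
    unfolding ext_deriv_1[OF contact_k_form cone_open(1) x] derivative_J_tangential[OF x, symmetric] by simp
qed

end

end

text \<open>Modulo \<open>X\<close>, \<open>F\<close> is the complex structure of which \<open>s\<close>, \<open>t\<close> and the conjugate of
  \<open>\<eta>\<^sub>1 + i \<eta>\<^sub>2\<close> are the (1,0)-forms.\<close>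

definition transversal_frame :: "(nat \<Rightarrow> ('a::euclidean_space, 'p) oform) \<Rightarrow> ('a, 'p) ochart \<Rightarrow> 'a \<Rightarrow>
    'a \<Rightarrow> ('a \<Rightarrow> 'a) \<Rightarrow> ('a \<Rightarrow> complex) \<Rightarrow> ('a \<Rightarrow> complex) \<Rightarrow> bool" where
  "transversal_frame \<eta> c x X F s t \<longleftrightarrow> coframe \<eta> c x s t \<and>
     s X = 0 \<and> t X = 0 \<and> eta_at \<eta> c x X = 0 \<and>
     (\<forall>u. s u = 0 \<and> t u = 0 \<and> eta_at \<eta> c x u = 0 \<longrightarrow> (\<exists>r. u = r *\<^sub>R X)) \<and>
     (\<forall>u. s (F u) = \<i> * s u \<and> t (F u) = \<i> * t u \<and> eta_at \<eta> c x (F u) = - \<i> * eta_at \<eta> c x u)"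

section \<open>From the hyperkaehler cone to frames on S\<close>

locale sasakian_cone =
  fixes S :: "('e::euclidean_space, 'p) orbifold" and g gbar and J :: "nat \<Rightarrow> ('e \<times> real, 'p \<times> real) oendo"
    and \<xi> \<eta>
  assumes S: "is_orbifold S" "riemannian_metric S g" and cone: "is_cone_metric S g gbar"
    and hk: "hyperkaehler (cone_orbifold S) gbar J"
    and xi: "\<forall>i\<in>{1..3}. \<forall>c\<in>charts S. \<forall>x\<in>cdom c. J i (cone_chart c) (x, 1) (0, 1) = (\<xi> i c x, 0)"
    and eta: "\<forall>i\<in>{1..3}. \<eta> i = contact_form g (\<xi> i)" and dim: "DIM('e) = 7"
begin

lemma kae: "i \<in> {1..3} \<Longrightarrow> kaehler (cone_orbifold S) gbar (J i)"
  using hk by (simp add: hyperkaehler_def)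

lemma J_reeb: "i \<in> {1..3} \<Longrightarrow> c \<in> charts S \<Longrightarrow> x \<in> cdom c \<Longrightarrow> J i (cone_chart c) (x, 1) (0, 1) = (\<xi> i c x, 0)"
  using xi by blast

lemma eta_contact: "i \<in> {1..3} \<Longrightarrow> \<eta> i c x v = complex_of_real (g c x (\<xi> i c x) (v 0))"
  using eta by (simp add: contact_form_def)

lemma J_quaternions:
  assumes "c \<in> charts S" "x \<in> cdom c"
  defines "I \<equiv> \<lambda>i. J i (cone_chart c) (x, 1)"
  shows "I 1 (I 1 u) = - u" "I 2 (I 2 u) = - u" "I 3 (I 3 u) = - u"
    "I 1 (I 2 u) = I 3 u" "I 2 (I 1 u) = - I 3 u" "I 2 (I 3 u) = I 1 u" "I 3 (I 2 u) = - I 1 u"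
    "I 3 (I 1 u) = I 2 u" "I 1 (I 3 u) = - I 2 u"
proof -
  note cc = cone_chart_in[OF S cone kae[of 1] assms(1), simplified]
  have "(x, 1) \<in> cdom (cone_chart c)" using assms(2) cc(2) by simp
  then have *: "I i (I j u) = - (if i = j then u else 0) + (\<Sum>k\<in>{1, 2, 3}. eps i j k *\<^sub>R I k u)"
    if "i \<in> {1, 2, 3}" "j \<in> {1, 2, 3}" for i j
  proof -
    have "{1..3} = {1, 2, 3::nat}" by auto
    then show ?thesis
      using hk[unfolded hyperkaehler_def, THEN conjunct2, THEN bspec, OF cc(1), THEN bspec, OF \<open>(x, 1) \<in> _\<close>,
          THEN bspec, of i, THEN bspec, of j] that
      unfolding I_def by (simp del: split_paired_All)
  qed
  show "I 1 (I 1 u) = - u" "I 2 (I 2 u) = - u" "I 3 (I 3 u) = - u"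
    "I 1 (I 2 u) = I 3 u" "I 2 (I 1 u) = - I 3 u" "I 2 (I 3 u) = I 1 u" "I 3 (I 2 u) = - I 1 u"
    "I 3 (I 1 u) = I 2 u" "I 1 (I 3 u) = - I 2 u"
    by (subst *; simp add: eps_def)+
qed

lemma sasakian_form_triple: "c \<in> charts S \<Longrightarrow> form_triple (cdom c) \<eta> c"
  unfolding form_triple_def
proof (intro conjI ballI allI)
  assume c: "c \<in> charts S"
  show "open (cdom c)" using cone_open(1)[OF S cone kae[of 1] c] by simp
  show "k_form 1 (cdom c) (\<eta> i c)" if "i \<in> {1..3}" for i
    by (rule contact_k_form[where \<theta> = "\<eta> i c" and X = "\<xi> i c", OF S cone kae[OF that] c J_reeb[OF that c] eta_contact[OF that]])
  show "Im (\<eta> i c x v) = 0" if "i \<in> {1..3}" for i x v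
    by (simp add: eta_contact[OF that])
qed

lemma sasakian_reeb_smooth: "i \<in> {1..3} \<Longrightarrow> c \<in> charts S \<Longrightarrow> smooth_on (cdom c) (\<xi> i c)"
  by (rule reeb_smooth[where \<theta> = "\<eta> i c" and X = "\<xi> i c", OF S cone kae _ J_reeb eta_contact])

text \<open>On the horizontal distribution this is J_3. On the span of \<xi>_1 and \<xi>_2 the
  correction reverses the sign of J_3, and taking \<open>fst\<close> sends \<xi>_3 to 0. Because of
  the reversal cnj \<eta>, rather than \<eta>, has type (1,0), as is required for \<alpha> \<and>
  cnj \<eta> to have type (3,0).\<close>

definition transversal_J :: "('e, 'p) oendo" where
  "transversal_J c x u = fst (J 3 (cone_chart c) (x, 1) (u, 0)) - (2 * g c x (\<xi> 1 c x) u) *\<^sub>R \<xi> 2 c x +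
     (2 * g c x (\<xi> 2 c x) u) *\<^sub>R \<xi> 1 c x"

lemma transversal_J_smooth:
  assumes c: "c \<in> charts S"
  shows "smooth_on (cdom c) (\<lambda>x. transversal_J c x u)"
proof -
  have o: "open (cdom c)" by (rule triple_open[OF sasakian_form_triple[OF c]])
  have xi: "smooth_on (cdom c) (\<xi> i c)" if "i \<in> {1..3}" for i by (rule sasakian_reeb_smooth[OF that c])
  have g: "smooth_on (cdom c) (\<lambda>x. g c x (\<xi> i c x) u)" if "i \<in> {1..3}" for i
    by (rule smooth_on_linear_family[OF o _ _ xi[OF that], of "\<lambda>x v. g c x v u"])
      (use S(2) c in \<open>auto simp: riemannian_metric_def bilinear_def\<close>)
  show ?thesis
    unfolding transversal_J_def
    by (intro smooth_on_add smooth_on_diff smooth_on_scaleR smooth_on_fst smooth_on_mult smooth_on_const o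
        smooth_on_section[OF S cone kae c] xi g) auto
qed

lemma linear_transversal_J:
  assumes c: "c \<in> charts S" and x: "x \<in> cdom c"
  shows "linear (transversal_J c x)"
proof -
  have "linear (J 3 (cone_chart c) (x, 1))"
    using cone_kaehler(1)[OF S cone kae c, of 3 "(x, 1)"] x by simp
  then have J: "J 3 (cone_chart c) (x, 1) (u + u', 0) = J 3 (cone_chart c) (x, 1) (u, 0) + J 3 (cone_chart c) (x, 1) (u', 0)"
      "J 3 (cone_chart c) (x, 1) (r *\<^sub>R u, 0) = r *\<^sub>R J 3 (cone_chart c) (x, 1) (u, 0)" for u u' r
    using linear_add[of "J 3 (cone_chart c) (x, 1)" "(u, 0)" "(u', 0)"]
      linear_cmul[of "J 3 (cone_chart c) (x, 1)" r "(u, 0)"] by simp_all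
  have "bilinear (g c x)" using S(2) c x by (auto simp: riemannian_metric_def)
  then show ?thesis
    by (intro linearI) (simp_all add: transversal_J_def J bilinear_radd bilinear_rmul algebra_simps)
qed

text \<open>At a point with r = 1 the tangent space of the cone is a quaternionic hermitian space of
  real dimension 8. A unit vector \<open>Y\<close> orthogonal to the quaternionic line of the radial
  vector completes the frame, and pairing with Y, I_1 Y, I_2 Y, I_3 Y yields the real coordinates
  from which \<open>s\<close> and \<open>t\<close> are built.\<close>

lemma transversal_frame_exists:
  assumes c: "c \<in> charts S" and x: "x \<in> cdom c"
  shows "\<exists>s t. transversal_frame \<eta> c x (\<xi> 3 c x) (transversal_J c x) s t"
proof -
  define B where "B = gbar (cone_chart c) (x, 1)"
  define I where "I = (\<lambda>i. J i (cone_chart c) (x, 1))"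
  let ?E = "(0, 1) :: 'e \<times> real"
  have p: "(x, 1) \<in> cdom c \<times> {0::real<..}" using x by simp
  have i13: "1 \<in> {1..3::nat}" "2 \<in> {1..3::nat}" "3 \<in> {1..3::nat}" by auto
  have B: "bilinear B" "\<And>u w. B u w = B w u" "\<And>u. u \<noteq> 0 \<Longrightarrow> B u u > 0"
    unfolding B_def using cone_kaehler(7,9,10)[OF S cone kae[OF i13(1)] c p] by blast+
  have lin: "linear (I 1)" "linear (I 2)" "linear (I 3)"
    unfolding I_def using cone_kaehler(1)[OF S cone kae c p] i13 by blast+
  have isom: "B (I 1 u) (I 1 w) = B u w" "B (I 2 u) (I 2 w) = B u w" "B (I 3 u) (I 3 w) = B u w" for u w
    unfolding I_def B_def using cone_kaehler(4)[OF S cone kae c p] i13 by blast+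
  have quat: "I 1 (I 1 u) = - u" "I 2 (I 2 u) = - u" "I 3 (I 3 u) = - u"
    "I 1 (I 2 u) = I 3 u" "I 2 (I 1 u) = - I 3 u" "I 2 (I 3 u) = I 1 u" "I 3 (I 2 u) = - I 1 u"
    "I 3 (I 1 u) = I 2 u" "I 1 (I 3 u) = - I 2 u" for u
    unfolding I_def by (rule J_quaternions[OF c x])+
  have B_eq: "B (u, a) (w, b) = a * b + g c x u w" for u w a b
    using gg_eq[OF S cone kae[OF i13(1)] c x, of 1 u a w b] by (simp add: B_def)
  have E1: "B ?E ?E = 1" using gg_radial[OF S cone kae[OF i13(1)] c p, of ?E] by (simp add: B_def)
  have "bilinear (g c x)" using S(2) c x by (auto simp: riemannian_metric_def)
  then have E: "B (0, a) (u, 0) = 0" "B (0, - 1) ?E = - 1" for a u by (simp_all add: B_eq bilinear_lzero)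
  have dimV: "DIM('e \<times> real) = 8" by (simp add: dim)
  note frame = B lin quat isom E1 dimV
  obtain Y where Y: "B Y Y = 1" "B Y ?E = 0" "B Y (I 1 ?E) = 0" "B Y (I 2 ?E) = 0" "B Y (I 3 ?E) = 0"
    using quat_orthogonal_unit[OF frame] by blast
  have parseval: "B u w = B Y u * B Y w + B (I 1 Y) u * B (I 1 Y) w + B (I 2 Y) u * B (I 2 Y) w + B (I 3 Y) u * B (I 3 Y) w +
    (B ?E u * B ?E w + B (I 1 ?E) u * B (I 1 ?E) w + B (I 2 ?E) u * B (I 2 ?E) w + B (I 3 ?E) u * B (I 3 ?E) w)" for u w
    by (rule quat_parseval[OF frame Y])
  have skew: "B u (I 1 w) = - B (I 1 u) w" "B u (I 2 w) = - B (I 2 u) w" "B u (I 3 w) = - B (I 3 u) w" for u w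
    by (rule quat_skew[OF frame]; assumption)+
  have xi: "I i ?E = (\<xi> i c x, 0)" if "i \<in> {1..3}" for i unfolding I_def by (rule J_reeb[OF that c x])
  have eta: "\<eta> i c x v = of_real (B (I i ?E) (v 0, 0))" if "i \<in> {1..3}" for i v
    unfolding xi[OF that] B_eq using eta_contact[OF that] by simp
  have d: "ext_deriv 1 (\<eta> i c) x v = of_real (2 * B (I i (v 0, 0)) (v 1, 0))" if "i \<in> {1..3}" for i v
    unfolding I_def B_def
    by (rule ext_deriv_contact_form[where \<theta> = "\<eta> i c" and X = "\<xi> i c", OF S cone kae[OF that] c J_reeb[OF that c] eta_contact[OF that] x])
  note tab = skew quat bilinear_lneg[OF B(1)] bilinear_rneg[OF B(1)] E
  note triple = sasakian_form_triple[OF c]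
  have w: "wedge 1 1 (\<eta> i c) (\<eta> j c) x v = of_real (B (I i ?E) (v 0, 0) * B (I j ?E) (v 1, 0) - B (I i ?E) (v 1, 0) * B (I j ?E) (v 0, 0))"
    if "i \<in> {1..3}" "j \<in> {1..3}" for i j v
    unfolding wedge_1_1[OF triple_k_form[OF triple that(1)] triple_k_form[OF triple that(2)] x]
      eta[OF that(1)] eta[OF that(2)] by simp
  have alpha: "alpha_form \<eta> 1 c x v = of_real (B (I 1 (v 0, 0)) (v 1, 0) -
      (B (I 2 ?E) (v 0, 0) * B (I 3 ?E) (v 1, 0) - B (I 2 ?E) (v 1, 0) * B (I 3 ?E) (v 0, 0)))"
    "alpha_form \<eta> 2 c x v = of_real (B (I 2 (v 0, 0)) (v 1, 0) -
      (B (I 3 ?E) (v 0, 0) * B (I 1 ?E) (v 1, 0) - B (I 3 ?E) (v 1, 0) * B (I 1 ?E) (v 0, 0)))"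
    "alpha_form \<eta> 3 c x v = of_real (B (I 3 (v 0, 0)) (v 1, 0) -
      (B (I 1 ?E) (v 0, 0) * B (I 2 ?E) (v 1, 0) - B (I 1 ?E) (v 1, 0) * B (I 2 ?E) (v 0, 0)))" for v
    unfolding alpha_form_def eps_sum_1 eps_sum_2 eps_sum_3 d[OF i13(1)] d[OF i13(2)] d[OF i13(3)]
      w[OF i13(2,3)] w[OF i13(3,2)] w[OF i13(3,1)] w[OF i13(1,3)] w[OF i13(1,2)] w[OF i13(2,1)]
    by simp_all
  define y where "y = (\<lambda>u. B Y (u, 0))"
  define y1 where "y1 = (\<lambda>u. B (I 1 Y) (u, 0))"
  define y2 where "y2 = (\<lambda>u. B (I 2 Y) (u, 0))"
  define y3 where "y3 = (\<lambda>u. B (I 3 Y) (u, 0))"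
  note y_defs = y_def y1_def y2_def y3_def
  \<comment> \<open>Parseval for the pair (I_i u, w). The bracket in the second line of each
    identity is \<eta>_j \<and> \<eta>_k with i, j, k cyclic, which is what \<alpha>_i subtracts; so
    \<alpha>_i only involves y, y1, y2, y3.\<close>
  have I_B: "B (I 1 (u, 0)) (w, 0) = - y1 u * y w + y u * y1 w - y3 u * y2 w + y2 u * y3 w +
      (- B (I 3 ?E) (u, 0) * B (I 2 ?E) (w, 0) + B (I 2 ?E) (u, 0) * B (I 3 ?E) (w, 0))"
    "B (I 2 (u, 0)) (w, 0) = - y2 u * y w + y3 u * y1 w + y u * y2 w - y1 u * y3 w +
      (B (I 3 ?E) (u, 0) * B (I 1 ?E) (w, 0) - B (I 1 ?E) (u, 0) * B (I 3 ?E) (w, 0))"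
    "B (I 3 (u, 0)) (w, 0) = - y3 u * y w - y2 u * y1 w + y1 u * y2 w + y u * y3 w +
      (- B (I 2 ?E) (u, 0) * B (I 1 ?E) (w, 0) + B (I 1 ?E) (u, 0) * B (I 2 ?E) (w, 0))" for u w
    unfolding parseval[of "I 1 (u, 0)" "(w, 0)"] parseval[of "I 2 (u, 0)" "(w, 0)"] parseval[of "I 3 (u, 0)" "(w, 0)"] y_defs
    by (simp_all add: tab del: One_nat_def)
  \<comment> \<open>With this pairing of the coordinates, s \<and> t has real part y \<and> y1 + y2
    \<and> y3 = \<alpha>_1 and imaginary part y \<and> y2 + y3 \<and> y1 = \<alpha>_2, while
    \<alpha>_3 = y \<and> y3 + y1 \<and> y2.\<close>
  define s where "s = (\<lambda>u. Complex (y u) (y3 u))"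
  define t where "t = (\<lambda>u. Complex (y1 u) (y2 u))"
  have B_lin: "B z (u + u', 0) = B z (u, 0) + B z (u', 0)" "B z (r *\<^sub>R u, 0) = r * B z (u, 0)" for z u u' r
    using bilinear_radd[OF B(1), of z "(u, 0)" "(u', 0)"] bilinear_rmul[OF B(1), of z r "(u, 0)"] by simp_all
  have y_lin: "linear y" "linear y1" "linear y2" "linear y3"
    by (auto intro!: linearI simp: y_defs B_lin)
  have "coframe \<eta> c x s t"
    unfolding coframe_def alpha_cx_def alpha dt_pair I_B cj_def
    using y_lin by (auto simp: s_def t_def complex_eq_iff linear_add linear_cmul field_simps intro!: linearI)
  moreover
  have H: "eta_at \<eta> c x u = Complex (B (I 1 ?E) (u, 0)) (B (I 2 ?E) (u, 0))" for u
    by (simp add: eta_cx_def eta complex_eq_iff)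
  have Y0: "B Y ?E = 0" "B (I 1 Y) ?E = 0" "B (I 2 Y) ?E = 0" "B (I 3 Y) ?E = 0"
      "B (I 1 ?E) ?E = 0" "B (I 2 ?E) ?E = 0" "B (I 3 ?E) ?E = 0"
    using Y skew[of Y ?E] quat_self[OF frame, of ?E] by (simp_all add: B(2)[of "I 1 ?E" ?E] B(2)[of "I 2 ?E" ?E] B(2)[of "I 3 ?E" ?E] del: One_nat_def)
  have xi_y: "y (\<xi> i c x) = B Y (I i ?E)" "y1 (\<xi> i c x) = B (I 1 Y) (I i ?E)"
    "y2 (\<xi> i c x) = B (I 2 Y) (I i ?E)" "y3 (\<xi> i c x) = B (I 3 Y) (I i ?E)"
    "B (I j ?E) (\<xi> i c x, 0) = B (I j ?E) (I i ?E)" if "i \<in> {1..3}" for i j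
    unfolding y_defs xi[OF that] by simp_all
  have y0: "y (\<xi> i c x) = 0" "y1 (\<xi> i c x) = 0" "y2 (\<xi> i c x) = 0" "y3 (\<xi> i c x) = 0"
    if "i \<in> {1..3}" for i
  proof -
    have "i \<in> {1, 2, 3}" using that by auto
    then show "y (\<xi> i c x) = 0" "y1 (\<xi> i c x) = 0" "y2 (\<xi> i c x) = 0" "y3 (\<xi> i c x) = 0"
      unfolding xi_y[OF that] by (auto simp: skew(1)[of _ ?E] skew(2)[of _ ?E] skew(3)[of _ ?E] quat Y0 bilinear_lneg[OF B(1)] simp del: One_nat_def)
  qed
  have e0: "B (I j ?E) (\<xi> i c x, 0) = (if i = j then 1 else 0)" if "i \<in> {1..3}" "j \<in> {1..3}" for i j
  proof -
    have "i \<in> {1, 2, 3}" "j \<in> {1, 2, 3}" using that by auto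
    then show ?thesis
      unfolding xi_y(5)[OF that(1)]
      by (auto simp: skew(1)[of _ ?E] skew(2)[of _ ?E] skew(3)[of _ ?E] quat Y0 bilinear_lneg[OF B(1)] E E1 simp del: One_nat_def)
  qed
  have "s (\<xi> 3 c x) = 0" "t (\<xi> 3 c x) = 0" "eta_at \<eta> c x (\<xi> 3 c x) = 0"
    by (simp_all add: s_def t_def H y0 e0 zero_complex.ctr)
  moreover have "\<exists>r. u = r *\<^sub>R \<xi> 3 c x" if "s u = 0" "t u = 0" "eta_at \<eta> c x u = 0" for u
  proof -
    have 0: "B Y (u, 0) = 0" "B (I 1 Y) (u, 0) = 0" "B (I 2 Y) (u, 0) = 0" "B (I 3 Y) (u, 0) = 0"
      "B (I 1 ?E) (u, 0) = 0" "B (I 2 ?E) (u, 0) = 0"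
      using that by (simp_all add: H s_def t_def y_defs complex_eq_iff)
    \<comment> \<open>The only coordinate of (u, 0) left is the one along \<xi>_3; subtracting it
      gives a vector of length 0 by Parseval, hence the zero vector.\<close>
    let ?r = "B (I 3 ?E) (u, 0)"
    let ?z = "(u, 0) - ?r *\<^sub>R I 3 ?E"
    have "B ?z ?z = 0"
      using parseval[of "(u, 0)" ?z]
      by (simp add: 0 E bilinear_lsub[OF B(1)] bilinear_lmul[OF B(1)] del: One_nat_def)
    then have "?z = 0" using B(3)[of ?z] by fastforce
    then show ?thesis unfolding xi[OF i13(3)] by (auto simp: zero_prod_def)
  qed
  moreover have "s (transversal_J c x u) = \<i> * s u \<and> t (transversal_J c x u) = \<i> * t u \<and>
    eta_at \<eta> c x (transversal_J c x u) = - \<i> * eta_at \<eta> c x u" for u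
  proof -
    have gxi: "g c x (\<xi> i c x) u = B (I i ?E) (u, 0)" if "i \<in> {1..3}" for i
      unfolding xi[OF that] B_eq by simp
    let ?a = "- (2 * B (I 1 ?E) (u, 0))" and ?b = "2 * B (I 2 ?E) (u, 0)"
    have "(transversal_J c x u, 0) = I 3 (u, 0) - snd (I 3 (u, 0)) *\<^sub>R ?E + ?a *\<^sub>R (\<xi> 2 c x, 0) + ?b *\<^sub>R (\<xi> 1 c x, 0)"
      by (simp add: transversal_J_def gxi I_def prod_eq_iff)
    then have T: "B z (transversal_J c x u, 0) = B z (I 3 (u, 0)) - snd (I 3 (u, 0)) * B z ?E +
        ?a * B z (\<xi> 2 c x, 0) + ?b * B z (\<xi> 1 c x, 0)" for z
      by (simp only: bilinear_radd[OF B(1)] bilinear_rsub[OF B(1)] bilinear_rmul[OF B(1)] real_scaleR_def)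
    have "y (transversal_J c x u) = - y3 u" "y3 (transversal_J c x u) = y u"
      "y1 (transversal_J c x u) = - y2 u" "y2 (transversal_J c x u) = y1 u"
      using y0[OF i13(1)] y0[OF i13(2)] unfolding y_defs T by (simp_all add: Y0 tab del: One_nat_def)
    moreover have "B (I 1 ?E) (transversal_J c x u, 0) = B (I 2 ?E) (u, 0)"
      "B (I 2 ?E) (transversal_J c x u, 0) = - B (I 1 ?E) (u, 0)"
      unfolding T e0[OF i13(1,1)] e0[OF i13(1,2)] e0[OF i13(2,1)] e0[OF i13(2,2)] by (simp_all add: Y0 tab del: One_nat_def)
    ultimately show ?thesis by (simp add: s_def t_def H complex_eq_iff)
  qed
  ultimately show ?thesis unfolding transversal_frame_def by blast
qed

section \<open>Transitions\<close>

text \<open>A transition of \<open>S\<close> extends to the cone by the identity on radii; this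
  makes the invariance of \<open>J\<close> on the cone available for charts of
  \<open>S\<close>.\<close>

lemma transition_cone:
  assumes h: "transition c c' N h" and c: "c \<in> charts S" "c' \<in> charts S"
  shows "transition (cone_chart c) (cone_chart c') (N \<times> {0<..}) (\<lambda>(x, r). (h x, r))"
proof -
  obtain f where N: "N \<subseteq> cdom c" "h ` N \<subseteq> cdom c'" "open N" "open (h ` N)" "smooth_on N h"
    and f: "smooth_on (h ` N) f" "\<And>x. x \<in> N \<Longrightarrow> f (h x) = x" and m: "\<And>x. x \<in> N \<Longrightarrow> cmap c' (h x) = cmap c x"
    using h by (auto simp: transition_def diffeo_on_def)
  have sm: "smooth_on (M \<times> {0<..}) (\<lambda>(x, r::real). (k x, r))" if "open M" "smooth_on M k" for M and k :: "'e \<Rightarrow> 'e"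
  proof -
    have o: "open (M \<times> {0::real<..})" using that by (intro open_Times) auto
    have "smooth_on (M \<times> {0::real<..}) (\<lambda>p. k (fst p))"
      by (rule smooth_on_compose[OF o that(1) _ _ that(2)]) (auto intro: smooth_on_bounded_linear o bounded_linear_fst)
    moreover have "smooth_on (M \<times> {0::real<..}) snd" by (intro smooth_on_bounded_linear o bounded_linear_snd)
    ultimately show ?thesis using smooth_on_Pair[OF o] by (simp add: case_prod_unfold)
  qed
  have im: "(\<lambda>(x, r). (h x, r)) ` (N \<times> {0<..}) = h ` N \<times> {0::real<..}" by force
  have "open (N \<times> {0::real<..})" "open (h ` N \<times> {0::real<..})" using N by (simp_all add: open_Times)
  moreover have "\<forall>z\<in>N \<times> {0<..}. (\<lambda>(x, r::real). (f x, r)) ((\<lambda>(x, r). (h x, r)) z) = z" using f(2) by auto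
  ultimately have "diffeo_on (N \<times> {0::real<..}) (h ` N \<times> {0<..}) (\<lambda>(x, r). (h x, r))"
    unfolding diffeo_on_def using im sm[OF N(3,5)] sm[OF N(4) f(1)] by blast
  then show ?thesis
    unfolding transition_def im using N m by (auto simp: cone_chart_def)
qed

text \<open>The extended transition preserves the radial vector and commutes with J_i, and \<xi>_i
  is the image of that vector under J_i.\<close>

lemma sasakian_reeb_transition:
  assumes h: "transition c c' N h" and c: "c \<in> charts S" "c' \<in> charts S" and x: "x \<in> N" and i: "i \<in> {1..3}"
  shows "frechet_derivative h (at x) (\<xi> i c x) = \<xi> i c' (h x)"
proof -
  have N: "x \<in> cdom c" "h x \<in> cdom c'" "smooth_on N h"
    using h x by (auto simp: transition_def diffeo_on_def)
  have "((\<lambda>p. (h (fst p), snd p)) has_derivative (\<lambda>u. (frechet_derivative h (at x) (fst u), snd u))) (at (x, 1 :: real))"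
  proof (intro has_derivative_Pair has_derivative_snd has_derivative_ident)
    show "((\<lambda>p. h (fst p)) has_derivative (\<lambda>u. frechet_derivative h (at x) (fst u))) (at (x, 1 :: real))"
      using diff_chain_at[OF has_derivative_fst[OF has_derivative_ident], of h "frechet_derivative h (at x)" "(x, 1 :: real)"]
        smooth_on_has_derivative[OF N(3) x] by (simp add: o_def)
  qed
  then have D: "frechet_derivative (\<lambda>(x, r::real). (h x, r)) (at (x, 1)) = (\<lambda>u. (frechet_derivative h (at x) (fst u), snd u))"
    by (simp add: frechet_derivative_eqI case_prod_unfold)
  have l: "linear (frechet_derivative h (at x))" by (rule linear_frechet_derivative'[OF N(3) x])
  have "orb_endo (cone_orbifold S) (J i)" using kae[OF i] by (simp add: kaehler_def)
  from this[unfolded orb_endo_def, THEN conjunct2, THEN bspec, OF cone_chart_in(1)[OF S cone kae[OF i] c(1)],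
      THEN bspec, OF cone_chart_in(1)[OF S cone kae[OF i] c(2)], THEN spec, THEN spec, THEN mp,
      OF transition_cone[OF h c], THEN bspec, of "(x, 1)", THEN spec, of "(0, 1)"] x
  have "frechet_derivative (\<lambda>(x, r). (h x, r)) (at (x, 1)) (J i (cone_chart c) (x, 1) (0, 1)) =
    J i (cone_chart c') (case (x, 1) of (x, r) \<Rightarrow> (h x, r)) (frechet_derivative (\<lambda>(x, r). (h x, r)) (at (x, 1)) (0, 1))"
    by simp
  then show ?thesis
    using J_reeb[OF i c(1) N(1)] J_reeb[OF i c(2) N(2)] by (simp add: D linear_0[OF l])
qed

lemma sasakian_eta_transition:
  assumes h: "transition c c' N h" and c: "c \<in> charts S" "c' \<in> charts S" and x: "x \<in> N" and i: "i \<in> {1..3}"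
  shows "pullback h (\<eta> i c') x v = \<eta> i c x v"
  unfolding pullback_def eta_contact[OF i] sasakian_reeb_transition[OF h c x i, symmetric]
  using S(2) h c x unfolding riemannian_metric_def by (metis (no_types, lifting))

end

section \<open>Comparison of local lifts\<close>

lemma frequently_zero_imp_derivative_zero:
  fixes d :: "real \<Rightarrow> 'a::real_normed_vector"
  assumes "(d has_vector_derivative D) (at 0)" "\<exists>\<^sub>F t in at 0. d t = 0"
  shows "d 0 = 0" "D = 0"
proof -
  have "d \<midarrow>0\<rightarrow> d 0"
    using has_vector_derivative_continuous[OF assms(1)] by (simp add: isCont_def)
  then show 0: "d 0 = 0"
    using tendsto_imp_eventually_ne[of d "d 0" "at 0" 0] assms(2) by (auto simp: frequently_def)
  have L: "((\<lambda>t. norm (d t - t *\<^sub>R D) / \<bar>t\<bar>) \<longlongrightarrow> 0) (at 0)"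
    using assms(1) 0 by (simp add: has_vector_derivative_def has_derivative_iff_norm)
  have E: "norm (d t - t *\<^sub>R D) / \<bar>t\<bar> = norm ((1 / t) *\<^sub>R d t - D)" if "t \<noteq> 0" for t
  proof -
    have "(1 / t) *\<^sub>R d t - D = (1 / t) *\<^sub>R (d t - t *\<^sub>R D)" using that by (simp add: algebra_simps)
    then show ?thesis by simp
  qed
  have "((\<lambda>t. norm ((1 / t) *\<^sub>R d t - D)) \<longlongrightarrow> 0) (at 0)"
    by (rule Lim_transform_eventually[OF L]) (simp add: eventually_at_filter E)
  then have "((\<lambda>t. (1 / t) *\<^sub>R d t) \<longlongrightarrow> D) (at 0)"
    by (rule LIM_zero_cancel[OF tendsto_norm_zero_cancel])
  moreover have "\<exists>\<^sub>F t in at 0. (1 / t) *\<^sub>R d t = 0"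
    using assms(2) by (rule frequently_elim1) simp
  ultimately show "D = 0"
    using tendsto_imp_eventually_ne[of "\<lambda>t. (1 / t) *\<^sub>R d t" D "at 0" 0] by (auto simp: frequently_def)
qed

text \<open>Otherwise the whole space would be a finite union of proper subspaces, each of Lebesgue
  measure 0.\<close>

lemma finite_union_linear_eq:
  fixes A :: "'a::euclidean_space \<Rightarrow> 'b::real_vector"
  assumes "finite G" "linear A" "\<And>f. f \<in> G \<Longrightarrow> linear (B f)" "\<And>u. \<exists>f\<in>G. A u = B f u"
  shows "\<exists>f\<in>G. \<forall>u. A u = B f u"
proof (rule ccontr)
  assume "\<not> (\<exists>f\<in>G. \<forall>u. A u = B f u)"
  then have ne: "{u. A u = B f u} \<noteq> UNIV" if "f \<in> G" for f using that by blast
  have "negligible {u. A u = B f u}" if "f \<in> G" for f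
  proof (rule negligible_lowdim)
    have "subspace {u. A u = B f u}"
      using assms(2) assms(3)[OF that] by (auto simp: subspace_def linear_add linear_cmul linear_0)
    then have "span {u. A u = B f u} \<noteq> UNIV" using ne[OF that] by (simp add: span_eq_iff[THEN iffD2])
    then show "dim {u. A u = B f u} < DIM('a)"
      using dim_subset_UNIV[of "{u. A u = B f u}"] dim_eq_full[of "{u. A u = B f u}"] by linarith
  qed
  then have "negligible (\<Union>f\<in>G. {u. A u = B f u})" using assms(1) by (intro negligible_Union) auto
  moreover have "(\<Union>f\<in>G. {u. A u = B f u}) = UNIV" using assms(4) by auto
  ultimately show False by simp
qed

lemma diffeo_on_compose:
  assumes "diffeo_on U V f" "diffeo_on V W g"
  shows "diffeo_on U W (g \<circ> f)"
proof -
  obtain f' where f': "smooth_on V f'" "\<forall>x\<in>U. f' (f x) = x" using assms(1) by (auto simp: diffeo_on_def)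
  obtain g' where g': "smooth_on W g'" "\<forall>x\<in>V. g' (g x) = x" using assms(2) by (auto simp: diffeo_on_def)
  have o: "open U" "open V" "open W" "f ` U = V" "g ` V = W" "smooth_on U f" "smooth_on V g"
    using assms by (auto simp: diffeo_on_def)
  have "smooth_on U (\<lambda>x. g (f x))" by (rule smooth_on_compose[OF o(1,2) _ o(6,7)]) (use o in auto)
  moreover have "smooth_on W (\<lambda>x. f' (g' x))" by (rule smooth_on_compose[OF o(3,2) _ g'(1) f'(1)]) (use o g' in auto)
  moreover have "(g \<circ> f) ` U = W" using o by (auto simp: image_comp[symmetric])
  ultimately show ?thesis
    unfolding diffeo_on_def using o(1,3) f'(2) g'(2) o(4) by (auto simp: o_def intro!: exI[of _ "\<lambda>x. f' (g' x)"])
qed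

lemma diffeo_on_subset:
  assumes f: "diffeo_on U V f" and W: "open W" "W \<subseteq> U"
  shows "diffeo_on W (f ` W) f"
proof -
  obtain f' where f': "smooth_on V f'" "\<forall>x\<in>U. f' (f x) = x" and o: "open U" "open V" "f ` U = V" "smooth_on U f"
    using f by (auto simp: diffeo_on_def)
  have "f ` W = V \<inter> f' -` W" using f' W o by force
  moreover have "open (V \<inter> f' -` W)"
    using smooth_on_continuous[OF f'(1)] o(2) W(1) continuous_open_preimage by blast
  ultimately have "open (f ` W)" by simp
  then show ?thesis unfolding diffeo_on_def
    using W f' o by (auto intro: smooth_on_subset intro!: exI[of _ f'])
qed

text \<open>The second lift arises from \<open>h \<circ> F1\<close> through group elements that may
  vary from point to point without continuity. Along each line through \<open>z\<close> one element
  occurs frequently, which determines the derivative in that direction; as finitely many linear maps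
  account for all directions, one of them accounts for all at once. The comparison is to first order
  at \<open>z\<close> only.\<close>

lemma lift_compare:
  fixes F1 F2 :: "'a::euclidean_space \<Rightarrow> 'e::euclidean_space"
  assumes S: "is_orbifold S" and c: "c1 \<in> charts S" "c2 \<in> charts S"
    and N: "open N" "z \<in> N" "F1 ` N \<subseteq> cdom c1" "F2 ` N \<subseteq> cdom c2" "\<And>w. w \<in> N \<Longrightarrow> cmap c1 (F1 w) = cmap c2 (F2 w)"
    and D: "(F1 has_derivative D1) (at z)" "(F2 has_derivative D2) (at z)"
  obtains M h where "transition c1 c2 M h" "F1 z \<in> M" "h (F1 z) = F2 z"
    "\<And>u. D2 u = frechet_derivative h (at (F1 z)) (D1 u)"
proof -
  have z: "F1 z \<in> cdom c1" "F2 z \<in> cdom c2" using N by auto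
  then obtain M h where h: "F1 z \<in> M" "h (F1 z) = F2 z" "transition c1 c2 M h"
    using S c N(5)[OF N(2)] unfolding is_orbifold_def by meson
  have hM: "open M" "M \<subseteq> cdom c1" "h ` M \<subseteq> cdom c2" "smooth_on M h" "diffeo_on M (h ` M) h"
    "\<And>x. x \<in> M \<Longrightarrow> cmap c2 (h x) = cmap c1 x"
    using h(3) by (auto simp: transition_def diffeo_on_def)
  have chart: "uniformizing_chart (ospace S) c2" using S c by (simp add: is_orbifold_def)
  \<comment> \<open>An element that occurs frequently along a line fixes \<open>F2 z\<close> by
    continuity, so the candidates lie in this stabiliser.\<close>
  let ?G = "{f \<in> cgrp c2. f (F2 z) = F2 z}"
  have G: "finite (cgrp c2)" "\<And>f. f \<in> cgrp c2 \<Longrightarrow> diffeo_on (cdom c2) (cdom c2) f"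
    "\<And>x y. x \<in> cdom c2 \<Longrightarrow> y \<in> cdom c2 \<Longrightarrow> cmap c2 x = cmap c2 y \<longleftrightarrow> (\<exists>f\<in>cgrp c2. y = f x)"
    using chart by (auto simp: uniformizing_chart_def)
  have fs: "smooth_on (cdom c2) f" "f ` cdom c2 = cdom c2" if "f \<in> cgrp c2" for f
    using G(2)[OF that] by (auto simp: diffeo_on_def)
  have Dfh: "((\<lambda>w. f (h (F1 w))) has_derivative
      (\<lambda>u. frechet_derivative f (at (F2 z)) (frechet_derivative h (at (F1 z)) (D1 u)))) (at z)" if "f \<in> cgrp c2" for f
  proof -
    have "(f has_derivative frechet_derivative f (at (h (F1 z)))) (at (h (F1 z)))"
      by (rule smooth_on_has_derivative[OF fs(1)[OF that]]) (use h z in simp)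
    from has_derivative_compose[OF has_derivative_compose[OF D(1) smooth_on_has_derivative[OF hM(4) h(1)]] this]
    show ?thesis using h(2) by simp
  qed
  have "\<exists>f\<in>?G. D2 u = frechet_derivative f (at (F2 z)) (frechet_derivative h (at (F1 z)) (D1 u))" for u
  proof -
    let ?l = "\<lambda>t. z + t *\<^sub>R u"
    have l: "(?l has_derivative (\<lambda>t. t *\<^sub>R u)) (at 0)" by (auto intro!: derivative_eq_intros)
    have vd: "((\<lambda>t. k (?l t)) has_vector_derivative D u) (at 0)"
      if "(k has_derivative D) (at z)" for k :: "'a \<Rightarrow> 'e" and D
      using diff_chain_at[OF l, of k D] that has_derivative_linear[OF that]
      by (simp add: o_def has_vector_derivative_def linear_cmul)
    have "(?l \<longlongrightarrow> ?l 0) (at 0)" by (intro tendsto_intros)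
    then have ev1: "eventually (\<lambda>t. ?l t \<in> N) (at 0)" using N(1,2) by (simp add: topological_tendstoD)
    have "isCont F1 z" using D(1) has_derivative_continuous by blast
    then have "((\<lambda>t. F1 (?l t)) \<longlongrightarrow> F1 z) (at 0)"
      using \<open>(?l \<longlongrightarrow> ?l 0) (at 0)\<close> by (auto intro: isCont_tendsto_compose)
    then have ev2: "eventually (\<lambda>t. F1 (?l t) \<in> M) (at 0)" using hM(1) h(1) by (rule topological_tendstoD)
    have "eventually (\<lambda>t. \<exists>f\<in>cgrp c2. F2 (?l t) - f (h (F1 (?l t))) = 0) (at 0)"
      using ev1 ev2
    proof eventually_elim
      case (elim t)
      then have "cmap c2 (h (F1 (?l t))) = cmap c2 (F2 (?l t))" using hM(6) N(5) by metis
      moreover have "h (F1 (?l t)) \<in> cdom c2" "F2 (?l t) \<in> cdom c2" using elim hM(3) N(4) by auto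
      ultimately show ?case using G(3) by simp
    qed
    then have "\<exists>\<^sub>F t in at 0. \<exists>f\<in>cgrp c2. F2 (?l t) - f (h (F1 (?l t))) = 0"
      by (rule eventually_frequently[rotated]) simp
    \<comment> \<open>Pigeonhole over the finite group.\<close>
    from frequently_bex_finite[OF G(1) this]
    obtain f where f: "f \<in> cgrp c2" "\<exists>\<^sub>F t in at 0. F2 (?l t) - f (h (F1 (?l t))) = 0" by blast
    have "((\<lambda>t. F2 (?l t) - f (h (F1 (?l t)))) has_vector_derivative
        D2 u - frechet_derivative f (at (F2 z)) (frechet_derivative h (at (F1 z)) (D1 u))) (at 0)"
      by (intro has_vector_derivative_diff vd D(2) Dfh f(1))
    from frequently_zero_imp_derivative_zero[OF this f(2)] show ?thesis using f(1) h(2) by auto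
  qed
  then obtain f where f: "f \<in> ?G"
    "\<forall>u. D2 u = frechet_derivative f (at (F2 z)) (frechet_derivative h (at (F1 z)) (D1 u))"
    using finite_union_linear_eq[of ?G D2 "\<lambda>f u. frechet_derivative f (at (F2 z)) (frechet_derivative h (at (F1 z)) (D1 u))"]
      G(1) has_derivative_linear[OF D(2)] has_derivative_linear[OF Dfh] by (auto simp: o_def)
  show ?thesis
  proof (rule that[of M "f \<circ> h"])
    have "diffeo_on (h ` M) (f ` h ` M) f"
      by (rule diffeo_on_subset[OF G(2)]) (use f hM in \<open>auto simp: diffeo_on_def\<close>)
    then have "diffeo_on M ((f \<circ> h) ` M) (f \<circ> h)"
      using diffeo_on_compose[OF hM(5)] by (simp add: image_comp)
    moreover have "cmap c2 (f y) = cmap c2 y" if "y \<in> cdom c2" for y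
    proof -
      have "f y \<in> cdom c2" using fs(2)[of f] f(1) that by auto
      then show ?thesis using G(3)[OF that, of "f y"] f(1) by auto
    qed
    ultimately show "transition c1 c2 M (f \<circ> h)"
      unfolding transition_def using hM(2,3,6) fs(2)[of f] f(1) by (auto simp: subset_iff)
    show "D2 u = frechet_derivative (f \<circ> h) (at (F1 z)) (D1 u)" for u
      using f hM fs(1)[of f] frechet_derivative_compose'[OF hM(4) fs(1) h(1), of f "D1 u"] z h(2)
      by (simp add: o_def)
  qed (use f h in auto)
qed

section \<open>Basic forms\<close>

lemma omega_ab_cong:
  assumes "open N" "x \<in> N" "\<And>i y v. i \<in> {1..3} \<Longrightarrow> y \<in> N \<Longrightarrow> \<eta> i c y v = \<eta>' i c' y v"
  shows "omega_ab \<eta> a b c x v = omega_ab \<eta>' a b c' x v" "Omega_ab \<eta> a b \<gamma> c x v = Omega_ab \<eta>' a b \<gamma> c' x v"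
proof -
  have w: "wedge 1 1 (\<eta> i c) (\<eta> j c) x v = wedge 1 1 (\<eta>' i c') (\<eta>' j c') x v" if "i \<in> {1..3}" "j \<in> {1..3}" for i j v
    using assms(2) assms(3)[OF that(1)] assms(3)[OF that(2)] by (simp add: wedge_def)
  have alpha: "alpha_form \<eta> i c x v = alpha_form \<eta>' i c' x v" if "i \<in> {1..3}" for i v
    using w that by (simp add: alpha_form_def ext_deriv_cong[OF assms(1,2) assms(3)[OF that]])
  have eta: "eta_cx \<eta> c x v = eta_cx \<eta>' c' x v" for v using assms(2,3) by (simp add: eta_cx_def)
  show "omega_ab \<eta> a b c x v = omega_ab \<eta>' a b c' x v" "Omega_ab \<eta> a b \<gamma> c x v = Omega_ab \<eta>' a b \<gamma> c' x v"
    by (simp_all add: omega_ab_def Omega_ab_def wedge_def conj_form_def alpha_cx_def alpha eta)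
qed

context sasakian_cone
begin

text \<open>Transitions preserve the \<eta>_i, and \<omega> and \<Omega> are built from these by
  natural operations; pulling back the forms is the same as forming them from the pulled-back
  triple.\<close>

lemma sasakian_orb_form:
  "orb_form S 2 (omega_ab \<eta> a b)" "orb_form S 3 (Omega_ab \<eta> a b \<gamma>)"
proof -
  note triple = sasakian_form_triple
  have "pullback h (omega_ab \<eta> a b c') x v = omega_ab \<eta> a b c x v"
    "pullback h (Omega_ab \<eta> a b \<gamma> c') x v = Omega_ab \<eta> a b \<gamma> c x v"
    if c: "c \<in> charts S" "c' \<in> charts S" and h: "transition c c' N h" and x: "x \<in> N" for c c' N h x v
  proof -
    have N: "open N" "smooth_on N h" "h ` N \<subseteq> cdom c'" using h by (auto simp: transition_def diffeo_on_def)
    have "pullback_triple h \<eta> c' i c y v = \<eta> i c y v" if "i \<in> {1..3}" "y \<in> N" for i y v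
      using sasakian_eta_transition[OF h c that(2,1)] by (simp add: pullback_triple_def)
    note cong = omega_ab_cong[where \<eta> = "pullback_triple h \<eta> c'" and c = c and \<eta>' = \<eta> and c' = c, OF N(1) x this]
    show "pullback h (omega_ab \<eta> a b c') x v = omega_ab \<eta> a b c x v"
      "pullback h (Omega_ab \<eta> a b \<gamma> c') x v = Omega_ab \<eta> a b \<gamma> c x v"
      using cong(1)[of a b v] cong(2)[of a b \<gamma> v] omega_ab_pullback[OF triple[OF c(2)] N x, where c' = c]
        Omega_ab_pullback[OF triple[OF c(2)] N x, where c' = c] by simp_all
  qed
  then show "orb_form S 2 (omega_ab \<eta> a b)" "orb_form S 3 (Omega_ab \<eta> a b \<gamma>)"
    unfolding orb_form_def using k_form_omega_ab[OF triple] k_form_Omega_ab[OF triple] by blast+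
qed

lemma sasakian_basic_form:
  "basic_form S (\<xi> 3) 2 (omega_ab \<eta> a b)" "basic_form S (\<xi> 3) 3 (Omega_ab \<eta> a b \<gamma>)"
proof -
  note triple = sasakian_form_triple
  have "interior_product (\<xi> 3 c) (omega_ab \<eta> a b c) x v = 0 \<and> lie_derivative 2 (\<xi> 3 c) (omega_ab \<eta> a b c) x v = 0 \<and>
    interior_product (\<xi> 3 c) (Omega_ab \<eta> a b \<gamma> c) x v = 0 \<and> lie_derivative 3 (\<xi> 3 c) (Omega_ab \<eta> a b \<gamma> c) x v = 0"
    if c: "c \<in> charts S" and x: "x \<in> cdom c" for c x v
  proof -
    have fr: "\<exists>s t. coframe \<eta> c y s t \<and> s (\<xi> 3 c y) = 0 \<and> t (\<xi> 3 c y) = 0 \<and> eta_at \<eta> c y (\<xi> 3 c y) = 0"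
      if "y \<in> cdom c" for y
      using transversal_frame_exists[OF c that] by (auto simp: transversal_frame_def)
    have X: "smooth_on (cdom c) (\<xi> 3 c)" by (rule sasakian_reeb_smooth[OF _ c]) simp
    obtain s t where st: "coframe \<eta> c x s t" "s (\<xi> 3 c x) = 0" "t (\<xi> 3 c x) = 0" "eta_at \<eta> c x (\<xi> 3 c x) = 0"
      using fr[OF x] by blast
    show ?thesis
      using interior_product_coframe(1,2)[where X = "\<xi> 3 c", OF triple[OF c] x st(1) refl refl st(2-4)]
        lie_derivative_coframe[OF triple[OF c] x X fr] by blast
  qed
  then show "basic_form S (\<xi> 3) 2 (omega_ab \<eta> a b)" "basic_form S (\<xi> 3) 3 (Omega_ab \<eta> a b \<gamma>)"
    unfolding basic_form_def using sasakian_orb_form by blast+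
qed

end

section \<open>Forms on the quotient\<close>

lemma smooth_on_comp_fst:
  fixes k :: "'a::euclidean_space \<Rightarrow> 'b::real_normed_vector" and M :: "'c::euclidean_space set"
  assumes "open N" "open M" "smooth_on N k"
  shows "smooth_on (N \<times> M) (\<lambda>z. k (fst z))"
proof -
  have o: "open (N \<times> M)" using assms by (intro open_Times)
  show ?thesis
    by (rule smooth_on_compose[OF o assms(1) _ smooth_on_bounded_linear[OF o bounded_linear_fst] assms(3)]) auto
qed

lemma k_form_local:
  assumes "\<And>x. x \<in> U \<Longrightarrow> \<exists>V. open V \<and> x \<in> V \<and> k_form k V \<beta>"
  shows "k_form k U \<beta>"
  unfolding k_form_iff
proof (intro conjI ballI allI)
  show "alternating_map k (\<beta> x)" if "x \<in> U" for x
    using assms[OF that] by (auto simp: k_form_iff)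
  show "smooth_on U (\<lambda>x. \<beta> x v)" for v
  proof (rule smooth_on_local)
    fix x assume "x \<in> U"
    from assms[OF this] obtain V where "open V" "x \<in> V" "k_form k V \<beta>" by blast
    then show "\<exists>V. open V \<and> x \<in> V \<and> smooth_on V (\<lambda>x. \<beta> x v)" using k_form_smooth by blast
  qed
qed

text \<open>The slots are made horizontal one after the other: by linearity the vertical component
  contributes a multiple of the value with (0, 1) in that slot, which vanishes after moving the slot
  to the front.\<close>

lemma alternating_map_horizontal:
  fixes T :: "(nat \<Rightarrow> 'a::euclidean_space \<times> real) \<Rightarrow> complex"
  assumes T: "alternating_map k T" and 0: "\<And>v. T (case_nat (0, 1) v) = 0"
  shows "T v = T (\<lambda>i. (fst (v i), 0))"
proof -
  have z: "T (v(i := (0, 1))) = 0" if "i < k" for v i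
    using alternating_map_fun_upd_cycle[OF T that, of "(0, 1)" v] 0 by simp
  have "T v = T (\<lambda>i. if i < m then (fst (v i), 0) else v i)" if "m \<le> k" for m
    using that
  proof (induction m)
    case (Suc m)
    let ?w = "\<lambda>i. if i < m then (fst (v i), 0) else v i"
    have l: "linear (\<lambda>u. T (?w(m := u)))"
      using T Suc.prems by (auto simp: alternating_map_def multilinear_map_def)
    have "T (?w(m := (fst (v m), 0) + snd (v m) *\<^sub>R (0, 1))) =
        T (?w(m := (fst (v m), 0))) + snd (v m) *\<^sub>R T (?w(m := (0, 1)))"
      using linear_add[OF l, of "(fst (v m), 0)" "snd (v m) *\<^sub>R (0, 1)"] linear_cmul[OF l, of "snd (v m)" "(0, 1)"]
      by simp
    moreover have "?w(m := (fst (v m), 0) + snd (v m) *\<^sub>R (0, 1)) = ?w" by (auto simp: fun_eq_iff)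
    moreover have "?w(m := (fst (v m), 0)) = (\<lambda>i. if i < Suc m then (fst (v i), 0) else v i)"
      by (auto simp: fun_eq_iff less_Suc_eq)
    ultimately show ?case using Suc z[of m ?w] by simp
  qed simp
  from this[of k] show ?thesis using alternating_map_cong[OF T, of "\<lambda>i. if i < k then (fst (v i), 0) else v i"] by simp
qed

lemma alternating_map_comp_linear:
  assumes T: "alternating_map k T" and L: "linear L"
  shows "alternating_map k (\<lambda>v. T (\<lambda>i. L (v i)))"
  unfolding alternating_map_def multilinear_map_def
proof (intro conjI allI impI)
  show "T (\<lambda>i. L (v i)) = T (\<lambda>i. L (w i))" if "\<forall>i<k. v i = w i" for v w
    by (rule alternating_map_cong[OF T]) (use that in simp)
  show "linear (\<lambda>u. T (\<lambda>j. L ((v(i := u)) j)))" if "i < k" for v i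
  proof -
    have "linear (\<lambda>u. T ((\<lambda>j. L (v j))(i := u)))"
      using T that by (simp add: alternating_map_def multilinear_map_def)
    from linear_compose[OF L this] show ?thesis by (simp add: o_def fun_upd_def if_distrib cong: if_cong)
  qed
  show "T (\<lambda>i. L (v i)) = 0" if "j < k" "i < j" "v i = v j" for v i j
    using T that by (auto simp: alternating_map_def)
qed

lemma lie_derivative_const:
  assumes \<beta>: "k_form k U \<beta>" "x \<in> U"
  shows "lie_derivative k (\<lambda>_. u) \<beta> x v = frechet_derivative (\<lambda>y. \<beta> y v) (at x) u"
proof -
  have "\<beta> x (v(i := 0)) = 0" if "i < k" for i
    using linear_0[OF multilinear_map_linear[of k "\<beta> x" i v]] that k_form_alternating[OF \<beta>]
    by (simp add: alternating_map_def)
  then show ?thesis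
    by (simp add: lie_derivative_def frechet_derivative_eqI[OF has_derivative_const])
qed

text \<open>The inclusion y \<mapsto> (y, t) has constant derivative u \<mapsto> (u, 0), so the
  coefficients are differentiated in horizontal directions only.\<close>

lemma ext_deriv_slice:
  fixes \<beta> :: "('a::euclidean_space \<times> real) form"
  assumes \<beta>: "k_form k (U \<times> UNIV) \<beta>" and y: "y \<in> U"
  shows "ext_deriv k (\<lambda>y v. \<beta> (y, t) (\<lambda>i. (v i, 0))) y v = ext_deriv k \<beta> (y, t) (\<lambda>i. (v i, 0))"
proof -
  have "frechet_derivative (\<lambda>y. \<beta> (y, t) w) (at y) u = frechet_derivative (\<lambda>z. \<beta> z w) (at (y, t)) (u, 0)" for w u
  proof -
    have "((\<lambda>y. (y, t)) has_derivative (\<lambda>u. (u, 0))) (at y)" by (auto intro!: derivative_eq_intros)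
    from has_derivative_compose[OF this k_form_has_derivative[OF \<beta>, of "(y, t)" w]] y
    show ?thesis by (simp add: frechet_derivative_eqI)
  qed
  moreover have "(\<lambda>j. (if j < i then v j else v (Suc j), 0)) = (\<lambda>j. if j < i then (v j, 0) else (v (Suc j), 0 :: real))" for i
    by (auto simp: fun_eq_iff)
  ultimately show ?thesis by (simp add: ext_deriv_def)
qed

lemma coframe_cong:
  assumes "open N" "x \<in> N" "\<And>i y v. i \<in> {1..3} \<Longrightarrow> y \<in> N \<Longrightarrow> \<eta> i c y v = \<eta>' i c' y v"
  shows "coframe \<eta> c x s t = coframe \<eta>' c' x s t" "eta_at \<eta> c x u = eta_at \<eta>' c' x u"
proof -
  have w: "wedge 1 1 (\<eta> i c) (\<eta> j c) x v = wedge 1 1 (\<eta>' i c') (\<eta>' j c') x v" if "i \<in> {1..3}" "j \<in> {1..3}" for i j v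
    using assms(2) assms(3)[OF that(1)] assms(3)[OF that(2)] by (simp add: wedge_def)
  have alpha: "alpha_form \<eta> i c x v = alpha_form \<eta>' i c' x v" if "i \<in> {1..3}" for i v
    using w that by (simp add: alpha_form_def ext_deriv_cong[OF assms(1,2) assms(3)[OF that]])
  then show "coframe \<eta> c x s t = coframe \<eta>' c' x s t" by (simp add: coframe_def alpha_cx_def)
  show "eta_at \<eta> c x u = eta_at \<eta>' c' x u" using assms(2,3) by (simp add: eta_cx_def)
qed

text \<open>Weaker than \<open>local_lift\<close> in that \<open>F\<close> need not be invertible; a
  lift composed with a bundle map of V \<times> R is then admissible without producing an
  inverse.\<close>

definition smooth_lift ::
  "('f::euclidean_space \<times> real \<Rightarrow> 'p) \<Rightarrow> ('f, 'q) ochart \<Rightarrow> ('e::euclidean_space, 'p) ochart \<Rightarrow>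
   ('f \<times> real) set \<Rightarrow> ('f \<times> real \<Rightarrow> 'e) \<Rightarrow> bool" where
  "smooth_lift s c c' N F \<longleftrightarrow> open N \<and> N \<subseteq> cdom c \<times> UNIV \<and> smooth_on N F \<and> F ` N \<subseteq> cdom c' \<and>
     (\<forall>z\<in>N. cmap c' (F z) = s z)"

lemma local_lift_imp_smooth_lift: "local_lift s c c' N F \<Longrightarrow> smooth_lift s c c' N F"
  by (auto simp: local_lift_def smooth_lift_def diffeo_on_def)

text \<open>The pullback of \<beta> to the bundle V \<times> R, defined pointwise through an
  arbitrary choice of lift; \<open>lift_form_eq\<close> shows that an invariant form gives the same
  value for every choice.\<close>

definition lift_form :: "('e::euclidean_space, 'p) orbifold \<Rightarrow> (('f, 'q) ochart \<Rightarrow> 'f::euclidean_space \<times> real \<Rightarrow> 'p) \<Rightarrow>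
   ('e, 'p) oform \<Rightarrow> ('f, 'q) ochart \<Rightarrow> ('f \<times> real) form" where
  "lift_form S \<sigma> \<beta> c z v = (let (c', N, F) = (SOME (c', N, F). c' \<in> charts S \<and> z \<in> N \<and> smooth_lift (\<sigma> c) c c' N F)
     in pullback F (\<beta> c') z v)"

definition slice_form :: "(('f, 'q) ochart \<Rightarrow> ('f::euclidean_space \<times> real) form) \<Rightarrow> ('f, 'q) oform" where
  "slice_form B c y v = B c (y, 0) (\<lambda>i. (v i, 0))"

context
  fixes S :: "('e::euclidean_space, 'p) orbifold" and Z :: "('f::euclidean_space, 'q) orbifold" and \<rho> \<pi> \<sigma>
  assumes S: "is_orbifold S" and Q: "circle_quotient S \<rho> Z \<pi> \<sigma>"
begin

lemma local_lift_exists: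
  assumes "c \<in> charts Z" "z \<in> cdom c \<times> UNIV"
  obtains c' N F where "c' \<in> charts S" "z \<in> N" "local_lift (\<sigma> c) c c' N F"
  using Q assms unfolding circle_quotient_def by (metis mem_Sigma_iff prod.collapse)

text \<open>To first order at \<open>z\<close> the two lifts differ by a transition of
  \<open>S\<close>, and \<beta> is invariant under transitions.\<close>

lemma lift_pullback_eq:
  assumes \<beta>: "orb_form S k \<beta>" and c: "c1 \<in> charts S" "c2 \<in> charts S"
    and F: "smooth_lift (\<sigma> c) c c1 N1 F1" "smooth_lift (\<sigma> c) c c2 N2 F2" and z: "z \<in> N1" "z \<in> N2"
  shows "pullback F1 (\<beta> c1) z v = pullback F2 (\<beta> c2) z v"
proof -
  have F': "open N1" "open N2" "F1 ` N1 \<subseteq> cdom c1" "F2 ` N2 \<subseteq> cdom c2" "smooth_on N1 F1" "smooth_on N2 F2"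
    "\<And>w. w \<in> N1 \<Longrightarrow> cmap c1 (F1 w) = \<sigma> c w" "\<And>w. w \<in> N2 \<Longrightarrow> cmap c2 (F2 w) = \<sigma> c w"
    using F by (auto simp: smooth_lift_def)
  obtain M h where h: "transition c1 c2 M h" "F1 z \<in> M" "h (F1 z) = F2 z"
    "\<And>u. frechet_derivative F2 (at z) u = frechet_derivative h (at (F1 z)) (frechet_derivative F1 (at z) u)"
    by (rule lift_compare[OF S c, of "N1 \<inter> N2" z F1 F2, OF _ _ _ _ _ smooth_on_has_derivative[OF F'(5) z(1)]
          smooth_on_has_derivative[OF F'(6) z(2)]])
      (use F' z in auto)
  have "pullback h (\<beta> c2) (F1 z) w = \<beta> c1 (F1 z) w" for w
    using \<beta> c h(1,2) unfolding orb_form_def by blast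
  then show ?thesis by (simp add: pullback_def h(3,4))
qed

lemma lift_form_eq:
  assumes \<beta>: "orb_form S k \<beta>" and c: "c' \<in> charts S" and F: "smooth_lift (\<sigma> c) c c' N F" and z: "z \<in> N"
  shows "lift_form S \<sigma> \<beta> c z v = pullback F (\<beta> c') z v"
proof -
  let ?P = "\<lambda>(c', N, F). c' \<in> charts S \<and> z \<in> N \<and> smooth_lift (\<sigma> c) c c' N F"
  have "?P (SOME t. ?P t)" by (rule someI[of ?P "(c', N, F)"]) (use assms in auto)
  then obtain c1 N1 F1 where e: "(SOME t. ?P t) = (c1, N1, F1)" "c1 \<in> charts S" "z \<in> N1" "smooth_lift (\<sigma> c) c c1 N1 F1"
    by (cases "SOME t. ?P t") auto
  show ?thesis
    unfolding lift_form_def e(1) using lift_pullback_eq[OF \<beta> e(2) c e(4) F e(3) z] by simp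
qed

lemma open_cdom_Z: "c \<in> charts Z \<Longrightarrow> open (cdom c)"
  using Q by (auto simp: circle_quotient_def is_orbifold_def uniformizing_chart_def)

text \<open>A vanishing Lie derivative along the fibre makes the coefficients constant in the fibre
  coordinate, and a vanishing contraction makes the form blind to vertical components. Together they
  show that the form is pulled back from the slice at fibre coordinate 0.\<close>

lemma lift_form_slice:
  assumes \<beta>: "orb_form S k \<beta>" and c: "c \<in> charts Z"
    and B: "k_form k (cdom c \<times> UNIV) (lift_form S \<sigma> \<beta> c)"
    and ip: "\<And>z v. z \<in> cdom c \<times> UNIV \<Longrightarrow> interior_product (\<lambda>_. (0, 1)) (lift_form S \<sigma> \<beta> c) z v = 0"
    and li: "\<And>z v. z \<in> cdom c \<times> UNIV \<Longrightarrow> lie_derivative k (\<lambda>_. (0, 1)) (lift_form S \<sigma> \<beta> c) z v = 0"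
    and z: "z \<in> cdom c \<times> UNIV"
  shows "lift_form S \<sigma> \<beta> c z v = slice_form (lift_form S \<sigma> \<beta>) c (fst z) (\<lambda>i. fst (v i))"
proof -
  let ?B = "lift_form S \<sigma> \<beta> c"
  obtain y t where yt: "z = (y, t)" "y \<in> cdom c" using z by auto
  have "((\<lambda>t. ?B (y, t) v) has_derivative (\<lambda>h. 0)) (at t)" for t v
  proof -
    have "((\<lambda>t. (y, t)) has_derivative (\<lambda>h. (0, h))) (at t)" by (auto intro!: derivative_eq_intros)
    from has_derivative_compose[OF this k_form_has_derivative[OF B, of "(y, t)" v]]
    have "((\<lambda>t. ?B (y, t) v) has_derivative (\<lambda>h. frechet_derivative (\<lambda>z. ?B z v) (at (y, t)) (0, h))) (at t)"
      using yt by simp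
    moreover have "frechet_derivative (\<lambda>z. ?B z v) (at (y, t)) (0, h) = 0" for h
    proof -
      have "linear (frechet_derivative (\<lambda>z. ?B z v) (at (y, t)))"
        by (rule linear_frechet_derivative'[OF k_form_smooth[OF B]]) (use yt in simp)
      then have "frechet_derivative (\<lambda>z. ?B z v) (at (y, t)) (h *\<^sub>R (0, 1)) = h *\<^sub>R frechet_derivative (\<lambda>z. ?B z v) (at (y, t)) (0, 1)"
        by (rule linear_cmul)
      then show ?thesis using li[of "(y, t)" v] lie_derivative_const[OF B, of "(y, t)" "(0, 1)" v] yt by simp
    qed
    ultimately show ?thesis by simp
  qed
  then have "\<exists>a. \<forall>t\<in>UNIV. ?B (y, t) v = a" for v
    by (intro has_derivative_zero_constant) auto
  then have "?B (y, t) v = ?B (y, 0) v" for v by (metis UNIV_I)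
  moreover have "?B (y, 0) v = ?B (y, 0) (\<lambda>i. (fst (v i), 0))"
    by (rule alternating_map_horizontal[OF k_form_alternating[OF B]])
      (use yt ip[of "(y, 0)"] in \<open>auto simp: interior_product_def\<close>)
  ultimately show ?thesis by (simp add: yt slice_form_def)
qed

text \<open>The delicate point is invariance under transitions of \<open>Z\<close>. A transition
  \<open>h\<close> lifts to the bundle map (w, t) \<mapsto> (h w, \<tau> w + t); composing a lift
  for \<open>c'\<close> with it gives a lift for \<open>c\<close>, and the derivative of \<tau> only
  enters vertical components, which the form does not see.\<close>

lemma descends_to_slice_form:
  assumes \<beta>: "orb_form S k \<beta>"
    and B: "\<And>c. c \<in> charts Z \<Longrightarrow> k_form k (cdom c \<times> UNIV) (lift_form S \<sigma> \<beta> c)"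
    and ip: "\<And>c z v. c \<in> charts Z \<Longrightarrow> z \<in> cdom c \<times> UNIV \<Longrightarrow> interior_product (\<lambda>_. (0, 1)) (lift_form S \<sigma> \<beta> c) z v = 0"
    and li: "\<And>c z v. c \<in> charts Z \<Longrightarrow> z \<in> cdom c \<times> UNIV \<Longrightarrow> lie_derivative k (\<lambda>_. (0, 1)) (lift_form S \<sigma> \<beta> c) z v = 0"
  shows "descends_to S Z \<sigma> k \<beta> (slice_form (lift_form S \<sigma> \<beta>))"
  unfolding descends_to_def orb_form_def
proof (intro conjI ballI allI impI)
  let ?B = "lift_form S \<sigma> \<beta>"
  have slice: "?B c z v = slice_form ?B c (fst z) (\<lambda>i. fst (v i))"
    if "c \<in> charts Z" "z \<in> cdom c \<times> UNIV" for c z v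
    by (rule lift_form_slice[OF \<beta> that(1) B[OF that(1)] ip[OF that(1)] li[OF that(1)] that(2)])
  show "k_form k (cdom c) (slice_form ?B c)" if c: "c \<in> charts Z" for c
    unfolding k_form_iff
  proof (intro conjI ballI allI)
    have "linear (\<lambda>u::'f. (u, 0::real))" by (intro linearI) auto
    then show "alternating_map k (slice_form ?B c y)" if "y \<in> cdom c" for y
      using alternating_map_comp_linear[OF k_form_alternating[OF B[OF c], of "(y, 0)"]] that
      by (simp add: slice_form_def[abs_def])
    show "smooth_on (cdom c) (\<lambda>y. slice_form ?B c y v)" for v
      unfolding slice_form_def
    proof (rule smooth_on_compose[OF open_cdom_Z[OF c] _ _ _ k_form_smooth[OF B[OF c]]])
      show "smooth_on (cdom c) (\<lambda>y. (y, 0::real))"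
        by (intro smooth_on_Pair smooth_on_id smooth_on_const open_cdom_Z[OF c])
    qed (use open_cdom_Z[OF c] in \<open>auto intro: open_Times\<close>)
  qed
  show "pullback F (\<beta> c') z v = pullback fst (slice_form ?B c) z v"
    if "c \<in> charts Z" "c' \<in> charts S" "local_lift (\<sigma> c) c c' N F" "z \<in> N" for c c' N F z v
  proof -
    note F = local_lift_imp_smooth_lift[OF that(3)]
    have "z \<in> cdom c \<times> UNIV" using F that(4) by (auto simp: smooth_lift_def)
    then show ?thesis
      using lift_form_eq[OF \<beta> that(2) F that(4), of v] slice[OF that(1), of z v]
      by (simp add: pullback_def frechet_derivative_eqI[OF has_derivative_fst[OF has_derivative_ident]])
  qed
  show "pullback h (slice_form ?B c') y v = slice_form ?B c y v"
    if c: "c \<in> charts Z" "c' \<in> charts Z" and h: "transition c c' N h" and y: "y \<in> N" for c c' N h y v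
  proof -
    obtain N' and \<tau> :: "'f \<Rightarrow> real" where N': "open N'" "y \<in> N'" "N' \<subseteq> N" "smooth_on N' \<tau>"
      "\<And>w t. w \<in> N' \<Longrightarrow> \<sigma> c' (h w, \<tau> w + t) = \<sigma> c (w, t)"
      using Q c h y unfolding circle_quotient_def by meson
    have hN: "N \<subseteq> cdom c" "h ` N \<subseteq> cdom c'" "smooth_on N h" using h by (auto simp: transition_def diffeo_on_def)
    let ?H = "\<lambda>(w, t). (h w, \<tau> w + t)"
    let ?z' = "(h y, \<tau> y)"
    have z': "?z' \<in> cdom c' \<times> UNIV" using hN y by auto
    obtain d M F where F: "d \<in> charts S" "?z' \<in> M" "local_lift (\<sigma> c') c' d M F"
      using local_lift_exists[OF c(2) z'] by blast
    note F' = local_lift_imp_smooth_lift[OF F(3)]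
    have o: "open (N' \<times> (UNIV :: real set))" using N'(1) by (intro open_Times) auto
    have sm1: "smooth_on (N' \<times> UNIV) (\<lambda>z. h (fst z))" "smooth_on (N' \<times> UNIV) (\<lambda>z. \<tau> (fst z))"
      using smooth_on_comp_fst[OF N'(1) open_UNIV smooth_on_subset[OF hN(3) N'(3)]]
        smooth_on_comp_fst[OF N'(1) open_UNIV N'(4)] .
    have H: "smooth_on (N' \<times> UNIV) ?H"
      unfolding case_prod_unfold
      by (intro smooth_on_Pair smooth_on_add sm1 o smooth_on_bounded_linear bounded_linear_snd)
    let ?M = "(N' \<times> UNIV) \<inter> ?H -` M"
    have oM: "open ?M"
      using continuous_open_preimage[OF smooth_on_continuous[OF H] o] F' by (auto simp: smooth_lift_def)
    have "smooth_lift (\<sigma> c) c d ?M (\<lambda>z. F (?H z))"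
      unfolding smooth_lift_def
    proof (intro conjI ballI)
      show "smooth_on ?M (\<lambda>z. F (?H z))"
        by (rule smooth_on_compose[OF oM _ _ smooth_on_subset[OF H]]) (use F' in \<open>auto simp: smooth_lift_def\<close>)
      show "cmap d (F (?H z)) = \<sigma> c z" if "z \<in> ?M" for z
        using that F' N'(5) by (auto simp: smooth_lift_def)
    qed (use oM N' hN F' in \<open>auto simp: smooth_lift_def\<close>)
    moreover have yM: "(y, 0) \<in> ?M" using N'(2) F(2) by simp
    ultimately have L: "?B c (y, 0) (\<lambda>i. (v i, 0)) = pullback (\<lambda>z. F (?H z)) (\<beta> d) (y, 0) (\<lambda>i. (v i, 0))"
      using lift_form_eq[OF \<beta> F(1)] by blast
    have DH: "frechet_derivative ?H (at (y, 0)) (u, 0) = (frechet_derivative h (at y) u, frechet_derivative \<tau> (at y) u)" for u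
    proof -
      have f: "(fst has_derivative fst) (at (y, 0::real))" by (auto intro!: derivative_eq_intros)
      have "((\<lambda>z. (h (fst z), \<tau> (fst z) + snd z)) has_derivative
        (\<lambda>u. (frechet_derivative h (at y) (fst u), frechet_derivative \<tau> (at y) (fst u) + snd u))) (at (y, 0::real))"
        using has_derivative_compose[OF f, of h "frechet_derivative h (at y)"]
          has_derivative_compose[OF f, of \<tau> "frechet_derivative \<tau> (at y)"]
          smooth_on_has_derivative[OF hN(3) y] smooth_on_has_derivative[OF N'(4,2)]
        by (intro has_derivative_Pair has_derivative_add has_derivative_snd has_derivative_ident) auto
      then show ?thesis by (simp add: frechet_derivative_eqI case_prod_unfold)
    qed
    have smF: "smooth_on M F" using F' by (simp add: smooth_lift_def)
    have "frechet_derivative (\<lambda>z. F (?H z)) (at (y, 0)) (u, 0) =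
        frechet_derivative F (at ?z') (frechet_derivative h (at y) u, frechet_derivative \<tau> (at y) u)" for u
      using frechet_derivative_compose'[OF H smF, of "(y, 0)" "(u, 0)"] N'(2) F(2) DH by simp
    then have "pullback (\<lambda>z. F (?H z)) (\<beta> d) (y, 0) (\<lambda>i. (v i, 0)) =
      pullback F (\<beta> d) ?z' (\<lambda>i. (frechet_derivative h (at y) (v i), frechet_derivative \<tau> (at y) (v i)))"
      by (simp add: pullback_def)
    also have "\<dots> = ?B c' ?z' (\<lambda>i. (frechet_derivative h (at y) (v i), frechet_derivative \<tau> (at y) (v i)))"
      by (rule lift_form_eq[OF \<beta> F(1) F' F(2), symmetric])
    \<comment> \<open>The slice property removes both the offset \<open>\<tau> y\<close> and the
      vertical components coming from the derivative of \<tau>.\<close>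
    also have "\<dots> = slice_form ?B c' (h y) (\<lambda>i. frechet_derivative h (at y) (v i))"
      using slice[OF c(2) z'] by simp
    finally show ?thesis using L by (simp add: pullback_def slice_form_def)
  qed
qed

end

section \<open>Frames on the quotient\<close>

definition lift_triple :: "('e::euclidean_space, 'p) orbifold \<Rightarrow> (('f, 'q) ochart \<Rightarrow> 'f::euclidean_space \<times> real \<Rightarrow> 'p) \<Rightarrow>
   (nat \<Rightarrow> ('e, 'p) oform) \<Rightarrow> ('f, 'q) ochart \<Rightarrow> nat \<Rightarrow> ('f \<times> real, 'q) oform" where
  "lift_triple S \<sigma> \<eta> c = (\<lambda>i _. lift_form S \<sigma> (\<eta> i) c)"

definition omega_pt :: "real \<Rightarrow> real \<Rightarrow> ('a \<Rightarrow> complex) \<Rightarrow> ('a \<Rightarrow> complex) \<Rightarrow> ('a \<Rightarrow> complex) \<Rightarrow> (nat \<Rightarrow> 'a) \<Rightarrow> complex" where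
  "omega_pt a b s t H v = of_real a * \<i> / 2 * (dt [s, cj s] v + dt [t, cj t] v) - \<i> / 2 * of_real (b\<^sup>2) * dt [H, cj H] v"

text \<open>For the complex structure \<open>K\<close> the (1,0)-coordinates are s, t and cnj H. In
  real dimension 6 the trivial common kernel makes these three a full set of coordinates.\<close>

definition adapted_frame :: "('a::euclidean_space \<Rightarrow> 'a) \<Rightarrow> ('a \<Rightarrow> complex) \<Rightarrow> ('a \<Rightarrow> complex) \<Rightarrow> ('a \<Rightarrow> complex) \<Rightarrow> bool" where
  "adapted_frame K s t H \<longleftrightarrow> linear s \<and> linear t \<and> linear H \<and>
     (\<forall>u. s u = 0 \<and> t u = 0 \<and> H u = 0 \<longrightarrow> u = 0) \<and>
     (\<forall>u. s (K u) = \<i> * s u \<and> t (K u) = \<i> * t u \<and> H (K u) = - \<i> * H u)"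

text \<open>One frame serves all parameters simultaneously: the complex structure is read off from
  the member \<open>\<Omega> 1 1 0\<close>, and the torsion form in the symplectic case is a
  multiple of \<open>\<omega> 1 (sqrt 2)\<close>.\<close>

definition quotient_frame :: "(real \<Rightarrow> real \<Rightarrow> ('f::euclidean_space, 'q) oform) \<Rightarrow> (real \<Rightarrow> real \<Rightarrow> real \<Rightarrow> ('f, 'q) oform) \<Rightarrow>
    ('f, 'q) ochart \<Rightarrow> 'f \<Rightarrow> ('f \<Rightarrow> 'f) \<Rightarrow> ('f \<Rightarrow> complex) \<Rightarrow> ('f \<Rightarrow> complex) \<Rightarrow> ('f \<Rightarrow> complex) \<Rightarrow> bool" where
  "quotient_frame \<omega> \<Omega> c y K s t H \<longleftrightarrow> adapted_frame K s t H \<and>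
     (\<forall>a b v. \<omega> a b c y v = omega_pt a b s t H v) \<and>
     (\<forall>a b \<gamma> v. \<Omega> a b \<gamma> c y v = of_real (a * b) * exp (\<i> * of_real \<gamma>) * dt [s, t, cj H] v) \<and>
     (\<forall>a b v. ext_deriv 2 (\<omega> a b c) y v = - \<i> * of_real (a + b\<^sup>2) * (dt [s, t, cj H] v - dt [H, cj s, cj t] v)) \<and>
     (\<forall>a b \<gamma> v. ext_deriv 3 (\<Omega> a b \<gamma> c) y v = of_real (a * b) * exp (\<i> * of_real \<gamma>) *
        (2 * dt [s, t, cj s, cj t] v + dt [H, s, cj s, cj H] v + dt [H, t, cj t, cj H] v))"

lemma lie_derivative_cong:
  assumes "open U" "x \<in> U" "\<And>y v. y \<in> U \<Longrightarrow> \<beta> y v = \<beta>' y v"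
  shows "lie_derivative k X \<beta> x v = lie_derivative k X \<beta>' x v"
  unfolding lie_derivative_def
  using frechet_derivative_cong_open[OF assms(1,2), of "\<lambda>y. \<beta> y v" "\<lambda>y. \<beta>' y v"] assms by simp

locale sasakian_quotient = sasakian_cone S g gbar J \<xi> \<eta>
  for S :: "('e::euclidean_space, 'p) orbifold" and g gbar J \<xi> \<eta> +
  fixes \<rho> T and Z :: "('f::euclidean_space, 'q) orbifold" and \<pi> \<sigma>
  assumes action: "circle_action S (\<xi> 3) \<rho> T" and Q: "circle_quotient S \<rho> Z \<pi> \<sigma>"
begin

text \<open>Near r = 0 the curve F(z + r (0, 1)) and the flow line of \<xi>_3 through
  \<open>F z\<close> lift the same orbit of \<rho>. So \<open>lift_compare\<close>, applied on the
  real line, relates their velocities by a transition, and transitions preserve \<xi>_3.\<close>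

lemma lift_reeb:
  assumes c: "c \<in> charts Z" "c' \<in> charts S" and F: "smooth_lift (\<sigma> c) c c' N F" and z: "z \<in> N"
  shows "frechet_derivative F (at z) (0, 1) = \<xi> 3 c' (F z)"
proof -
  have F': "open N" "N \<subseteq> cdom c \<times> UNIV" "smooth_on N F" "F ` N \<subseteq> cdom c'" "\<And>w. w \<in> N \<Longrightarrow> cmap c' (F w) = \<sigma> c w"
    using F by (auto simp: smooth_lift_def)
  obtain y t where yt: "z = (y, t)" "y \<in> cdom c" using F'(2) z by auto
  have Fz: "F z \<in> cdom c'" using F' z by auto
  note act = action[unfolded circle_action_def, THEN conjunct2, THEN conjunct2, THEN conjunct2, THEN conjunct2,
      THEN conjunct2, THEN bspec, OF c(2), THEN bspec, OF Fz]
  obtain e M \<Theta> where e: "e > 0" "F z \<in> M"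
    and \<Theta>: "\<And>x. x \<in> M \<Longrightarrow> \<Theta> (x, 0) = x"
      "\<And>x t. x \<in> M \<Longrightarrow> t \<in> {-e<..<e} \<Longrightarrow> \<Theta> (x, t) \<in> cdom c' \<and> cmap c' (\<Theta> (x, t)) = \<rho> t (cmap c' x) \<and>
              ((\<lambda>s. \<Theta> (x, s)) has_vector_derivative \<xi> 3 c' (\<Theta> (x, t))) (at t)"
    using act by (elim exE conjE) blast
  let ?p = "\<lambda>r. F (z + r *\<^sub>R (0, 1))" and ?q = "\<lambda>r. \<Theta> (F z, r)"
  let ?N = "(\<lambda>r. z + r *\<^sub>R (0, 1)) -` N \<inter> {-e<..<e}"
  have N: "open ?N"
    by (intro open_Int open_vimage F'(1) open_greaterThanLessThan continuous_intros)
  have D1: "(?q has_derivative (\<lambda>r. r *\<^sub>R \<xi> 3 c' (F z))) (at 0)"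
    using \<Theta>(2)[OF e(2), of 0] \<Theta>(1)[OF e(2)] e(1) by (simp add: has_vector_derivative_def)
  have D2: "(?p has_derivative (\<lambda>r. frechet_derivative F (at z) (r *\<^sub>R (0, 1)))) (at 0)"
  proof -
    have "((\<lambda>r. z + r *\<^sub>R (0, 1)) has_derivative (\<lambda>r. r *\<^sub>R (0, 1))) (at (0::real))"
      by (auto intro!: derivative_eq_intros)
    from has_derivative_compose[OF this, of F "frechet_derivative F (at z)"] show ?thesis
      using smooth_on_has_derivative[OF F'(3) z] by (simp add: zero_prod_def[symmetric])
  qed
  have n0: "0 \<in> ?N" "?q ` ?N \<subseteq> cdom c'" "?p ` ?N \<subseteq> cdom c'"
    using e z \<Theta>(2)[OF e(2)] F'(4) by (auto simp: zero_prod_def[symmetric])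
  have cm: "cmap c' (?q r) = cmap c' (?p r)" if "r \<in> ?N" for r
  proof -
    have "\<sigma> c (y, r + t) = \<rho> r (\<sigma> c (y, t))"
      using Q c(1) yt(2) unfolding circle_quotient_def by blast
    then show ?thesis using that \<Theta>(2)[OF e(2), of r] F'(5)[OF z] F'(5)[of "z + r *\<^sub>R (0, 1)"]
      by (simp add: yt(1) add.commute)
  qed
  show ?thesis
  proof (rule lift_compare[OF S(1) c(2,2) N n0 cm D1 D2])
    fix W h
    assume h: "transition c' c' W h" "?q 0 \<in> W" "h (?q 0) = ?p 0"
      and d: "\<And>r. frechet_derivative F (at z) (r *\<^sub>R (0, 1)) = frechet_derivative h (at (?q 0)) (r *\<^sub>R \<xi> 3 c' (F z))"
    have q0: "?q 0 = F z" using \<Theta>(1)[OF e(2)] .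
    have "frechet_derivative h (at (F z)) (\<xi> 3 c' (F z)) = \<xi> 3 c' (h (F z))"
      by (rule sasakian_reeb_transition[OF h(1) c(2,2)]) (use h(2) q0 in auto)
    then show ?thesis using d[of 1] h(3) unfolding q0 by (simp add: zero_prod_def[symmetric])
  qed
qed

lemma orb_form_eta: "i \<in> {1..3} \<Longrightarrow> orb_form S 1 (\<eta> i)"
  unfolding orb_form_def
  using triple_k_form[OF sasakian_form_triple] sasakian_eta_transition
  by blast

abbreviation (input) "eL \<equiv> lift_triple S \<sigma> \<eta>"

lemma lift_triple_eq:
  assumes "c' \<in> charts S" "smooth_lift (\<sigma> c) c c' N F" "i \<in> {1..3}" "z \<in> N"
  shows "eL c i d z v = pullback_triple F \<eta> c' i d' z v"
  using lift_form_eq[OF S(1) Q orb_form_eta[OF assms(3)] assms(1,2,4)]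
  by (simp add: lift_triple_def pullback_triple_def)

lemma lift_data:
  assumes "smooth_lift (\<sigma> c) c c' N F"
  shows "open N" "smooth_on N F" "F ` N \<subseteq> cdom c'"
  using assms by (auto simp: smooth_lift_def)

lemma form_triple_lift: "c \<in> charts Z \<Longrightarrow> form_triple (cdom c \<times> UNIV) (eL c) d"
  unfolding form_triple_def
proof (intro conjI ballI allI)
  assume c: "c \<in> charts Z"
  show "open (cdom c \<times> (UNIV :: real set))" using open_cdom_Z[OF S(1) Q c] by (intro open_Times) auto
  have loc: "\<exists>N c' F. c' \<in> charts S \<and> smooth_lift (\<sigma> c) c c' N F \<and> z \<in> N" if z: "z \<in> cdom c \<times> UNIV" for z
    using local_lift_exists[OF S(1) Q c z] local_lift_imp_smooth_lift by metis
  show "k_form 1 (cdom c \<times> UNIV) (eL c i d)" if i: "i \<in> {1..3}" for i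
  proof (rule k_form_local)
    fix z assume "z \<in> cdom c \<times> (UNIV :: real set)"
    then obtain N c' F where F: "c' \<in> charts S" "smooth_lift (\<sigma> c) c c' N F" "z \<in> N" using loc by blast
    have "form_triple N (pullback_triple F \<eta> c') d"
      by (rule form_triple_pullback[OF sasakian_form_triple[OF F(1)] lift_data[OF F(2)]])
    then have "k_form 1 N (pullback_triple F \<eta> c' i d)" using i unfolding form_triple_def by blast
    then have "k_form 1 N (eL c i d)"
      by (rule k_form_cong[OF lift_data(1)[OF F(2)], rotated]) (rule lift_triple_eq[OF F(1,2) i, symmetric])
    then show "\<exists>V. open V \<and> z \<in> V \<and> k_form 1 V (eL c i d)" using lift_data(1)[OF F(2)] F(3) by blast
  qed
  show "Im (eL c i d z v) = 0" if i: "i \<in> {1..3}" and z: "z \<in> cdom c \<times> UNIV" for i z v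
  proof -
    obtain N c' F where F: "c' \<in> charts S" "smooth_lift (\<sigma> c) c c' N F" "z \<in> N" using loc z by blast
    have "form_triple N (pullback_triple F \<eta> c') d"
      by (rule form_triple_pullback[OF sasakian_form_triple[OF F(1)] lift_data[OF F(2)]])
    then show ?thesis
      using lift_triple_eq[OF F(1,2) i F(3), of d v d] F(3) i unfolding form_triple_def by metis
  qed
qed

lemma lift_omega_ab:
  assumes c: "c \<in> charts Z" and z: "z \<in> cdom c \<times> UNIV"
  shows "lift_form S \<sigma> (omega_ab \<eta> a b) c z v = omega_ab (eL c) a b d z v"
    "lift_form S \<sigma> (Omega_ab \<eta> a b \<gamma>) c z v = Omega_ab (eL c) a b \<gamma> d z v"
proof -
  obtain N c' F where F: "c' \<in> charts S" "z \<in> N" "smooth_lift (\<sigma> c) c c' N F"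
    using local_lift_exists[OF S(1) Q c z] local_lift_imp_smooth_lift by metis
  note triple = sasakian_form_triple[OF F(1)]
  note o = sasakian_orb_form
  note cong = omega_ab_cong[where \<eta> = "eL c" and c = d and \<eta>' = "pullback_triple F \<eta> c'" and c' = d,
      OF lift_data(1)[OF F(3)] F(2) lift_triple_eq[OF F(1,3)]]
  show "lift_form S \<sigma> (omega_ab \<eta> a b) c z v = omega_ab (eL c) a b d z v"
    using lift_form_eq[OF S(1) Q o(1) F(1,3,2), of a b v] cong(1)[of a b v]
      omega_ab_pullback[OF triple lift_data[OF F(3)] F(2), of a b d v] by simp
  show "lift_form S \<sigma> (Omega_ab \<eta> a b \<gamma>) c z v = Omega_ab (eL c) a b \<gamma> d z v"
    using lift_form_eq[OF S(1) Q o(2) F(1,3,2), of a b \<gamma> v] cong(2)[of a b \<gamma> v]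
      Omega_ab_pullback[OF triple lift_data[OF F(3)] F(2), of a b \<gamma> d v] by simp
qed

text \<open>Frame and endomorphism are transported by the derivative \<open>DF\<close> of a lift.
  Conjugating \<open>transversal_J\<close> involves the inverse of \<open>DF\<close>, hence a lift
  that is a local diffeomorphism is taken; by \<open>lift_reeb\<close> the Reeb direction becomes
  (0, 1).\<close>

lemma lift_transversal_frame:
  assumes c: "c \<in> charts Z" and z: "z \<in> cdom c \<times> UNIV"
  obtains N K where "open N" "z \<in> N" "N \<subseteq> cdom c \<times> UNIV" "\<And>u. smooth_on N (\<lambda>w. K w u)" "\<And>w. w \<in> N \<Longrightarrow> linear (K w)"
    "\<And>w. w \<in> N \<Longrightarrow> \<exists>s t. transversal_frame (eL c) d w (0, 1) (K w) s t"
proof -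
  obtain N c' F where F: "c' \<in> charts S" "z \<in> N" "local_lift (\<sigma> c) c c' N F"
    using local_lift_exists[OF S(1) Q c z] by metis
  note F' = local_lift_imp_smooth_lift[OF F(3)]
  note fN = lift_data[OF F']
  note triple = sasakian_form_triple[OF F(1)]
  obtain f where f: "open (F ` N)" "smooth_on (F ` N) f" "\<And>w. w \<in> N \<Longrightarrow> f (F w) = w"
    using F(3) by (auto simp: local_lift_def diffeo_on_def)
  define tJ where "tJ = transversal_J c'"
  define DF where "DF = (\<lambda>w. frechet_derivative F (at w))"
  define Df where "Df = (\<lambda>w. frechet_derivative f (at (F w)))"
  have DF_lin: "linear (DF w)" if "w \<in> N" for w
    unfolding DF_def by (rule linear_frechet_derivative'[OF fN(2) that])
  have Df_lin: "linear (Df w)" if "w \<in> N" for w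
    unfolding Df_def by (rule linear_frechet_derivative'[OF f(2)]) (use that in simp)
  have inv1: "Df w (DF w u) = u" if w: "w \<in> N" for w u
  proof -
    have "frechet_derivative (\<lambda>w. f (F w)) (at w) u = Df w (DF w u)"
      unfolding Df_def DF_def by (rule frechet_derivative_compose'[OF fN(2) f(2) w]) (use w in simp)
    moreover have "frechet_derivative (\<lambda>w. f (F w)) (at w) = frechet_derivative (\<lambda>w. w) (at w)"
      by (rule frechet_derivative_cong_open[OF fN(1) w f(3)])
    ultimately show ?thesis by simp
  qed
  have inv2: "DF w (Df w u) = u" if w: "w \<in> N" for w u
  proof -
    have "F (f x) = x" if "x \<in> F ` N" for x using that f(3) by auto
    then have "frechet_derivative (\<lambda>x. F (f x)) (at (F w)) = frechet_derivative (\<lambda>x. x) (at (F w))"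
      by (intro frechet_derivative_cong_open[OF f(1)]) (use w in auto)
    moreover have "frechet_derivative (\<lambda>x. F (f x)) (at (F w)) u = DF w (Df w u)"
      using frechet_derivative_compose'[OF f(2) fN(2), of "F w" u] w f(3)[OF w] by (simp add: DF_def Df_def)
    ultimately show ?thesis by simp
  qed
  define K where "K = (\<lambda>w u. Df w (tJ (F w) (DF w u)))"
  have Fw: "F w \<in> cdom c'" if "w \<in> N" for w using fN(3) that by auto
  have tJ_lin: "linear (tJ x)" if "x \<in> cdom c'" for x
    unfolding tJ_def by (rule linear_transversal_J[OF F(1) that])
  have o: "open (cdom c')" by (rule triple_open[OF triple])
  show ?thesis
  proof (rule that[of N K])
    show "open N" "z \<in> N" "N \<subseteq> cdom c \<times> UNIV" using fN F(2) F' by (auto simp: smooth_lift_def)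
    show "smooth_on N (\<lambda>w. K w u)" for u
      unfolding K_def
    proof (rule smooth_on_linear_family[OF fN(1) Df_lin])
      show "smooth_on N (\<lambda>w. Df w v)" for v
        unfolding Df_def
        by (rule smooth_on_compose[OF fN(1) f(1) _ fN(2) smooth_on_derivative[OF f(2)]]) auto
      show "smooth_on N (\<lambda>w. tJ (F w) (DF w u))"
      proof (rule smooth_on_linear_family[OF fN(1) tJ_lin[OF Fw]])
        show "smooth_on N (\<lambda>w. tJ (F w) v)" for v
          unfolding tJ_def
          by (rule smooth_on_compose[OF fN(1) o fN(3) fN(2) transversal_J_smooth[OF F(1)]])
        show "smooth_on N (\<lambda>w. DF w u)" unfolding DF_def by (rule smooth_on_derivative[OF fN(2)])
      qed
    qed
    show "linear (K w)" if w: "w \<in> N" for w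
      using linear_compose[OF linear_compose[OF DF_lin[OF w] tJ_lin[OF Fw[OF w]]] Df_lin[OF w]]
      by (simp add: K_def o_def)
    show "\<exists>s t. transversal_frame (eL c) d w (0, 1) (K w) s t" if w: "w \<in> N" for w
    proof -
      obtain s t where st: "transversal_frame \<eta> c' (F w) (\<xi> 3 c' (F w)) (tJ (F w)) s t"
        using transversal_frame_exists[OF F(1) Fw[OF w]] unfolding tJ_def by blast
      have co: "coframe \<eta> c' (F w) s t" using st by (simp add: transversal_frame_def)
      have cong: "coframe (eL c) d w s' t' = coframe (pullback_triple F \<eta> c') d w s' t'"
        "eta_at (eL c) d w u = eta_at (pullback_triple F \<eta> c') d w u" for s' t' u
        by (rule coframe_cong[OF fN(1) w lift_triple_eq[OF F(1) F']]; assumption)+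
      have "coframe (eL c) d w (s \<circ> DF w) (t \<circ> DF w)"
        unfolding cong(1) DF_def by (rule coframe_pullback[OF triple fN w co])
      moreover have H: "eta_at (eL c) d w u = eta_at \<eta> c' (F w) (DF w u)" for u
        unfolding cong(2) by (simp add: eta_cx_def pullback_triple_def pullback_def DF_def)
      moreover have X: "DF w (0, 1) = \<xi> 3 c' (F w)" unfolding DF_def by (rule lift_reeb[OF c F(1) F' w])
      moreover have "\<exists>r. u = r *\<^sub>R (0, 1)" if k: "s (DF w u) = 0" "t (DF w u) = 0" "eta_at \<eta> c' (F w) (DF w u) = 0" for u
      proof -
        obtain r where "DF w u = r *\<^sub>R \<xi> 3 c' (F w)" using st k unfolding transversal_frame_def by blast
        then have "DF w u = DF w (r *\<^sub>R (0, 1))" using X linear_cmul[OF DF_lin[OF w], of r "(0, 1)"] by simp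
        then have "u = r *\<^sub>R (0, 1)" using inv1[OF w] by metis
        then show ?thesis by blast
      qed
      moreover have "DF w (K w u) = tJ (F w) (DF w u)" for u unfolding K_def by (rule inv2[OF w])
      ultimately have "transversal_frame (eL c) d w (0, 1) (K w) (s \<circ> DF w) (t \<circ> DF w)"
        using st unfolding transversal_frame_def by auto
      then show ?thesis by blast
    qed
  qed
qed


text \<open>A placeholder: the lifted triple is one family of forms on V \<times> R, constant in the
  chart by which the generic definitions are indexed.\<close>

abbreviation (input) "d0 \<equiv> undefined :: ('f \<times> real, 'q) ochart"
abbreviation (input) "omL \<equiv> \<lambda>a b. lift_form S \<sigma> (omega_ab \<eta> a b)"
abbreviation (input) "OmL \<equiv> \<lambda>a b \<gamma>. lift_form S \<sigma> (Omega_ab \<eta> a b \<gamma>)"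

lemmas lift_eq = lift_omega_ab[where d = d0]
lemmas lift_form_triple = form_triple_lift[where d = d0]

lemma lift_open: "c \<in> charts Z \<Longrightarrow> open (cdom c \<times> (UNIV :: real set))"
  using open_cdom_Z[OF S(1) Q] by (intro open_Times) auto

lemma k_form_lift:
  assumes "c \<in> charts Z"
  shows "k_form 2 (cdom c \<times> UNIV) (omL a b c)" "k_form 3 (cdom c \<times> UNIV) (OmL a b \<gamma> c)"
  by (rule k_form_cong[OF lift_open[OF assms] lift_eq(1)[OF assms, symmetric] k_form_omega_ab[OF lift_form_triple[OF assms]]], assumption)
     (rule k_form_cong[OF lift_open[OF assms] lift_eq(2)[OF assms, symmetric] k_form_Omega_ab[OF lift_form_triple[OF assms]]], assumption)

lemma lift_frame:
  assumes "c \<in> charts Z" "z \<in> cdom c \<times> UNIV"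
  shows "\<exists>s t. coframe (eL c) d0 z s t \<and> s (0, 1) = 0 \<and> t (0, 1) = 0 \<and> eta_at (eL c) d0 z (0, 1) = 0"
proof (rule lift_transversal_frame[OF assms, where d = d0])
  fix N K
  assume "z \<in> N" "\<And>w. w \<in> N \<Longrightarrow> \<exists>s t. transversal_frame (eL c) d0 w (0, 1) (K w) s t"
  then show ?thesis unfolding transversal_frame_def by blast
qed

lemma quotient_descends:
  "descends_to S Z \<sigma> 2 (omega_ab \<eta> a b) (slice_form (omL a b))"
  "descends_to S Z \<sigma> 3 (Omega_ab \<eta> a b \<gamma>) (slice_form (OmL a b \<gamma>))"
proof -
  have ip: "interior_product (\<lambda>_. (0, 1)) (omL a b c) z v = 0" "interior_product (\<lambda>_. (0, 1)) (OmL a b \<gamma> c) z v = 0"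
    if c: "c \<in> charts Z" and z: "z \<in> cdom c \<times> UNIV" for c z v
  proof -
    obtain s t where st: "coframe (eL c) d0 z s t" "s (0, 1) = 0" "t (0, 1) = 0" "eta_at (eL c) d0 z (0, 1) = 0"
      using lift_frame[OF c z] by blast
    show "interior_product (\<lambda>_. (0, 1)) (omL a b c) z v = 0" "interior_product (\<lambda>_. (0, 1)) (OmL a b \<gamma> c) z v = 0"
      using interior_product_coframe(1,2)[where X = "\<lambda>_. (0, 1)", OF lift_form_triple[OF c] z st(1) refl refl st(2-4)]
      unfolding interior_product_def lift_eq[OF c z] by blast+
  qed
  have li: "lie_derivative 2 (\<lambda>_. (0, 1)) (omL a b c) z v = 0" "lie_derivative 3 (\<lambda>_. (0, 1)) (OmL a b \<gamma> c) z v = 0"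
    if c: "c \<in> charts Z" and z: "z \<in> cdom c \<times> UNIV" for c z v
  proof -
    show "lie_derivative 2 (\<lambda>_. (0, 1)) (omL a b c) z v = 0"
      by (rule trans[OF lie_derivative_cong[OF lift_open[OF c] z] lie_derivative_coframe(1)[OF lift_form_triple[OF c] z
            smooth_on_const[OF lift_open[OF c]] lift_frame[OF c]]]) (rule lift_eq(1)[OF c])
    show "lie_derivative 3 (\<lambda>_. (0, 1)) (OmL a b \<gamma> c) z v = 0"
      by (rule trans[OF lie_derivative_cong[OF lift_open[OF c] z] lie_derivative_coframe(2)[OF lift_form_triple[OF c] z
            smooth_on_const[OF lift_open[OF c]] lift_frame[OF c]]]) (rule lift_eq(2)[OF c])
  qed
  note o = sasakian_orb_form
  show "descends_to S Z \<sigma> 2 (omega_ab \<eta> a b) (slice_form (omL a b))"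
    by (rule descends_to_slice_form[OF S(1) Q o(1) k_form_lift(1) ip(1) li(1)])
  show "descends_to S Z \<sigma> 3 (Omega_ab \<eta> a b \<gamma>) (slice_form (OmL a b \<gamma>))"
    by (rule descends_to_slice_form[OF S(1) Q o(2) k_form_lift(2) ip(2) li(2)])
qed

text \<open>The frame over V \<times> R is restricted to horizontal vectors at fibre coordinate 0.
  Its common kernel is spanned by the fibre direction, so the restriction has none; and the
  horizontal part of \<open>K\<close> inherits the eigenvalue equations because s, t and H vanish on
  the fibre direction.\<close>

lemma quotient_frame_local:
  assumes c: "c \<in> charts Z" and y0: "y0 \<in> cdom c"
  shows "\<exists>V K. open V \<and> y0 \<in> V \<and> V \<subseteq> cdom c \<and> (\<forall>u. smooth_on V (\<lambda>y. K y u)) \<and>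
    (\<forall>y\<in>V. linear (K y) \<and> (\<exists>s t H. quotient_frame (\<lambda>a b. slice_form (omL a b)) (\<lambda>a b \<gamma>. slice_form (OmL a b \<gamma>)) c y (K y) s t H))"
proof -
  have "(y0, 0) \<in> cdom c \<times> (UNIV :: real set)" using y0 by simp
  from lift_transversal_frame[OF c this, where d = d0]
  obtain N K where N: "open N" "(y0, 0) \<in> N" "N \<subseteq> cdom c \<times> UNIV"
    and K: "\<And>u. smooth_on N (\<lambda>w. K w u)" "\<And>w. w \<in> N \<Longrightarrow> linear (K w)"
    and fr: "\<And>w. w \<in> N \<Longrightarrow> \<exists>s t. transversal_frame (eL c) d0 w (0, 1) (K w) s t" by metis
  define V where "V = (\<lambda>y. (y, 0 :: real)) -` N"
  have V: "open V" "y0 \<in> V" "V \<subseteq> cdom c"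
    using N by (auto simp: V_def intro!: open_vimage continuous_intros)
  define K' where "K' = (\<lambda>y u. fst (K (y, 0) (u, 0)))"
  have smK: "smooth_on V (\<lambda>y. K' y u)" for u
    unfolding K'_def
  proof (rule smooth_on_fst[OF V(1) smooth_on_compose[OF V(1) N(1) _ _ K(1)]])
    show "smooth_on V (\<lambda>y. (y, 0::real))" by (intro smooth_on_Pair smooth_on_id smooth_on_const V(1))
  qed (auto simp: V_def)
  have K'_lin: "linear (K' y)" if "y \<in> V" for y
  proof -
    have "linear (K (y, 0))" using K(2) that by (simp add: V_def)
    then have "K (y, 0) (u + u', 0) = K (y, 0) (u, 0) + K (y, 0) (u', 0)"
      "K (y, 0) (r *\<^sub>R u, 0) = r *\<^sub>R K (y, 0) (u, 0)" for u u' r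
      using linear_add[of "K (y, 0)" "(u, 0)" "(u', 0)"] linear_cmul[of "K (y, 0)" r "(u, 0)"] by simp_all
    then show ?thesis by (intro linearI) (simp_all add: K'_def)
  qed
  moreover have "\<exists>s t H. quotient_frame (\<lambda>a b. slice_form (omL a b)) (\<lambda>a b \<gamma>. slice_form (OmL a b \<gamma>)) c y (K' y) s t H"
    if y: "y \<in> V" for y
  proof -
    let ?w = "(y, 0 :: real)"
    have w: "?w \<in> N" "?w \<in> cdom c \<times> UNIV" "y \<in> cdom c" using y N(3) by (auto simp: V_def)
    obtain s t where st: "transversal_frame (eL c) d0 ?w (0, 1) (K ?w) s t" using fr[OF w(1)] by blast
    define H where "H = eta_at (eL c) d0 ?w"
    have co: "coframe (eL c) d0 ?w s t" using st by (simp add: transversal_frame_def)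
    define r where "r = (\<lambda>(f :: 'f \<times> real \<Rightarrow> complex) u. f (u, 0))"
    have dt_r: "dt fs (\<lambda>i. (v i, 0)) = dt (map r fs) v" for fs v
      unfolding r_def by (rule dt_comp)
    have cj_r: "r (cj f) = cj (r f)" for f by (simp add: r_def cj_def)
    note triple = lift_form_triple[OF c]
    have lin: "linear s" "linear t" using co by (simp_all add: coframe_def)
    have H_lin: "linear H" unfolding H_def by (rule k_form_1_linear[OF k_form_eta_cx[OF triple] w(2)])
    have r_lin: "linear (r f)" if "linear f" for f
    proof -
      have "linear (\<lambda>u :: 'f. (u, 0 :: real))" by (intro linearI) auto
      from linear_compose[OF this that] show ?thesis by (simp add: r_def o_def)
    qed
    have r0: "r f (K' y u) = r' * r f u" if "linear f" "f (0, 1) = 0" "f (K ?w (u, 0)) = r' * f (u, 0)" for f u r'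
    proof -
      have "K ?w (u, 0) = (K' y u, 0) + snd (K ?w (u, 0)) *\<^sub>R (0, 1)" by (simp add: K'_def prod_eq_iff)
      then have "f (K ?w (u, 0)) = f (K' y u, 0) + snd (K ?w (u, 0)) *\<^sub>R f (0, 1)"
        using linear_add[OF that(1)] linear_cmul[OF that(1)] by metis
      then show ?thesis using that by (simp add: r_def)
    qed
    have "quotient_frame (\<lambda>a b. slice_form (omL a b)) (\<lambda>a b \<gamma>. slice_form (OmL a b \<gamma>)) c y (K' y) (r s) (r t) (r H)"
      unfolding quotient_frame_def adapted_frame_def
    proof (intro conjI allI impI)
      show "linear (r s)" "linear (r t)" "linear (r H)" using r_lin lin H_lin by blast+
      show "u = 0" if k: "r s u = 0 \<and> r t u = 0 \<and> r H u = 0" for u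
      proof -
        obtain a where "(u, 0) = a *\<^sub>R (0 :: 'f, 1 :: real)"
          using st k unfolding transversal_frame_def r_def H_def by blast
        then show ?thesis by simp
      qed
      show "r s (K' y u) = \<i> * r s u" "r t (K' y u) = \<i> * r t u" "r H (K' y u) = - \<i> * r H u" for u
        by (rule r0; use st lin H_lin in \<open>auto simp: transversal_frame_def H_def\<close>)+
      show "slice_form (omL a b) c y v = omega_pt a b (r s) (r t) (r H) v" for a b v
        unfolding slice_form_def lift_eq[OF c w(2)] omega_ab_coframe[OF triple w(2) co H_def refl] dt_r omega_pt_def
        by (simp add: cj_r)
      show "slice_form (OmL a b \<gamma>) c y v = of_real (a * b) * exp (\<i> * of_real \<gamma>) * dt [r s, r t, cj (r H)] v" for a b \<gamma> v
        unfolding slice_form_def lift_eq[OF c w(2)] Omega_ab_coframe[OF triple w(2) co H_def refl] dt_r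
        by (simp add: cj_r)
      show "ext_deriv 2 (slice_form (omL a b) c) y v =
        - \<i> * of_real (a + b\<^sup>2) * (dt [r s, r t, cj (r H)] v - dt [r H, cj (r s), cj (r t)] v)" for a b v
      proof -
        have "ext_deriv 2 (slice_form (omL a b) c) y v = ext_deriv 2 (omL a b c) ?w (\<lambda>i. (v i, 0))"
          unfolding slice_form_def by (rule ext_deriv_slice[OF k_form_lift(1)[OF c] w(3)])
        also have "\<dots> = ext_deriv 2 (omega_ab (eL c) a b d0) ?w (\<lambda>i. (v i, 0))"
          by (rule ext_deriv_cong[OF lift_open[OF c] w(2) lift_eq(1)[OF c]])
        finally show ?thesis
          unfolding d_omega_ab[OF triple w(2) co H_def refl] dt_r by (simp add: cj_r)
      qed
      show "ext_deriv 3 (slice_form (OmL a b \<gamma>) c) y v = of_real (a * b) * exp (\<i> * of_real \<gamma>) *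
        (2 * dt [r s, r t, cj (r s), cj (r t)] v + dt [r H, r s, cj (r s), cj (r H)] v + dt [r H, r t, cj (r t), cj (r H)] v)" for a b \<gamma> v
      proof -
        have "ext_deriv 3 (slice_form (OmL a b \<gamma>) c) y v = ext_deriv 3 (OmL a b \<gamma> c) ?w (\<lambda>i. (v i, 0))"
          unfolding slice_form_def by (rule ext_deriv_slice[OF k_form_lift(2)[OF c] w(3)])
        also have "\<dots> = ext_deriv 3 (Omega_ab (eL c) a b \<gamma> d0) ?w (\<lambda>i. (v i, 0))"
          by (rule ext_deriv_cong[OF lift_open[OF c] w(2) lift_eq(2)[OF c]])
        finally show ?thesis
          unfolding d_Omega_ab[OF triple w(2) co H_def refl] dt_r by (simp add: cj_r)
      qed
    qed
    then show ?thesis by blast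
  qed
  ultimately show ?thesis using V smK by blast
qed

end

section \<open>Linear algebra of the structures on the quotient\<close>

lemma dt_triple: "dt [f, g, h] v =
  f (v 0) * g (v 1) * h (v 2) - f (v 0) * g (v 2) * h (v 1) - f (v 1) * g (v 0) * h (v 2) +
  f (v 1) * g (v 2) * h (v 0) + f (v 2) * g (v 0) * h (v 1) - f (v 2) * g (v 1) * h (v 0)"
proof -
  let ?t = "Transposition.transpose :: nat \<Rightarrow> nat \<Rightarrow> nat \<Rightarrow> nat"
  have set3: "{..<3} = insert 0 (insert 1 {2::nat})" by auto
  have sgn: "sign (?t i j \<circ> (?t k l \<circ> id)) = sign (?t i j) * sign (?t k l)"
    "sign (?t i j \<circ> ?t k l) = sign (?t i j) * sign (?t k l)" for i j k l
    by (simp_all add: sign_compose permutation_swap_id)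
  have "(\<Sum>\<sigma> | \<sigma> permutes {2::nat}. F \<sigma>) = F id" for F :: "(nat \<Rightarrow> nat) \<Rightarrow> complex"
    by (simp add: permutes_sing)
  then show ?thesis
    unfolding dt_def alt_sum_def
    by (simp add: set3 numeral_3_eq_3[symmetric] sum_over_permutations_insert sgn sign_swap_id
        Transposition.transpose_def algebra_simps)
qed

lemma dt_swap4:
  "dt [c, d, a, b] v = dt [a, b, c, d] v" "dt [a, c, b, d] v = - dt [a, b, c, d] v" "dt [c, a, b, d] v = dt [a, b, c, d] v"
proof -
  show 1: "dt [a, c, b, d] v = - dt [a, b, c, d] v" for a b c d
    using dt_swap[of "[a]" c b "[d]" v] unfolding append_Cons append_Nil .
  have 2: "dt [c, a, b, d] v = - dt [a, c, b, d] v" for a b c d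
    using dt_swap[of "[]" c a "[b, d]" v] unfolding append_Nil .
  show 3: "dt [c, a, b, d] v = dt [a, b, c, d] v" for a b c d
    unfolding 2[of c a b d] 1[of a c b d] by (rule minus_minus)
  have 4: "dt [a, c, d, b] v = - dt [a, c, b, d] v"
    using dt_swap[of "[a, c]" d b "[]" v] unfolding append_Cons append_Nil .
  have "dt [c, d, a, b] v = - dt [c, a, d, b] v" by (rule 1)
  also have "dt [c, a, d, b] v = - dt [a, c, d, b] v" by (rule 2)
  also have "- (- dt [a, c, d, b] v) = - dt [a, c, b, d] v" unfolding 4 by (rule minus_minus)
  also have "\<dots> = dt [a, b, c, d] v" unfolding 1[of a c b d] by (rule minus_minus)
  finally show "dt [c, d, a, b] v = dt [a, b, c, d] v" .
qed

text \<open>Brings products to the normal order s, cj s, t, cj t, H, cj H. Moving a pair past a pair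
  costs no sign; the third rule, meant for \<Omega> \<and> cnj \<Omega>, takes four
  transpositions.\<close>

lemma dt_swap6:
  "dt [c, d, a, b, e, f] v = dt [a, b, c, d, e, f] v" "dt [e, f, a, b, c, d] v = dt [a, b, c, d, e, f] v"
  "dt [a, c, f, b, d, e] v = dt [a, b, c, d, e, f] v"
proof -
  have pair: "dt (xs @ c # d # a # b # ys) v = dt (xs @ a # b # c # d # ys) v" for xs a b c d ys
  proof -
    have "dt (xs @ c # d # a # b # ys) v = - dt (xs @ c # a # d # b # ys) v"
      using dt_swap[of "xs @ [c]" d a "b # ys" v] unfolding append_Cons append_Nil append_assoc .
    also have "dt (xs @ c # a # d # b # ys) v = - dt (xs @ a # c # d # b # ys) v"
      using dt_swap[of xs c a "d # b # ys" v] .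
    also have "dt (xs @ a # c # d # b # ys) v = - dt (xs @ a # c # b # d # ys) v"
      using dt_swap[of "xs @ [a, c]" d b ys v] unfolding append_Cons append_Nil append_assoc .
    also have "dt (xs @ a # c # b # d # ys) v = - dt (xs @ a # b # c # d # ys) v"
      using dt_swap[of "xs @ [a]" c b "d # ys" v] unfolding append_Cons append_Nil append_assoc .
    finally show ?thesis unfolding minus_minus .
  qed
  show 1: "dt [c, d, a, b, e, f] v = dt [a, b, c, d, e, f] v" for a b c d e f
    using pair[of "[]" c d a b "[e, f]"] unfolding append_Nil .
  have "dt [e, f, a, b, c, d] v = dt [a, b, e, f, c, d] v" by (rule 1)
  also have "\<dots> = dt [a, b, c, d, e, f] v"
    using pair[of "[a, b]" e f c d "[]"] unfolding append_Cons append_Nil .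
  finally show "dt [e, f, a, b, c, d] v = dt [a, b, c, d, e, f] v" .
  have "dt [a, c, f, b, d, e] v = - dt [a, c, b, f, d, e] v"
    using dt_swap[of "[a, c]" f b "[d, e]" v] unfolding append_Cons append_Nil .
  also have "dt [a, c, b, f, d, e] v = - dt [a, b, c, f, d, e] v"
    using dt_swap[of "[a]" c b "[f, d, e]" v] unfolding append_Cons append_Nil .
  also have "dt [a, b, c, f, d, e] v = - dt [a, b, c, d, f, e] v"
    using dt_swap[of "[a, b, c]" f d "[e]" v] unfolding append_Cons append_Nil .
  also have "dt [a, b, c, d, f, e] v = - dt [a, b, c, d, e, f] v"
    using dt_swap[of "[a, b, c, d]" f e "[]" v] unfolding append_Cons append_Nil .
  finally show "dt [a, c, f, b, d, e] v = dt [a, b, c, d, e, f] v" unfolding minus_minus .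
qed

lemma wedge_map_dt_simps':
  "wedge_map 2 0 (dt [f, g]) (dt []) = dt [f, g]"
  "wedge_map 2 3 (dt [f, g]) (dt [h, k, l]) = dt [f, g, h, k, l]"
  "wedge_map 3 3 (dt [f, g, h]) (dt [k, l, m]) = dt [f, g, h, k, l, m]"
  "wedge_map 2 4 (dt [f, g]) (dt [h, k, l, m]) = dt [f, g, h, k, l, m]"
  using wedge_map_dt[of "[f, g]" 2 "[]" 0] wedge_map_dt[of "[f, g]" 2 "[h, k, l]" 3]
    wedge_map_dt[of "[f, g, h]" 3 "[k, l, m]" 3] wedge_map_dt[of "[f, g]" 2 "[h, k, l, m]" 4]
  by simp_all

lemma wedge_zero: "(\<And>v. \<alpha> x v = 0) \<Longrightarrow> wedge p q \<alpha> \<beta> x v = 0"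
  by (simp add: wedge_def)

text \<open>Evaluating on the vectors of type (1,0) and (0,1) turns the sum over subsets into a product.\<close>

lemma has_type_all:
  assumes J: "\<And>Q v. Q \<subseteq> {..<k} \<Longrightarrow> \<beta> x (\<lambda>j. if j \<in> Q then J x (v j) else v j) = \<i> ^ card Q * \<beta> x v"
  shows "has_type k {k} J \<beta> x"
  unfolding has_type_def
proof (intro allI impI)
  fix P v assume P: "P \<subseteq> {..<k}" "card P \<notin> {k}"
  then obtain j where j: "j < k" "j \<notin> P"
    by (metis card_lessThan insertI1 lessThan_iff subsetI subset_antisym)
  have "(\<Sum>Q\<in>Pow {..<k}. (\<Prod>j\<in>Q. if j \<in> P then - \<i> else \<i>) * \<beta> x (\<lambda>j. if j \<in> Q then J x (v j) else v j)) =
    (\<Sum>Q\<in>Pow {..<k}. (\<Prod>j\<in>Q. (if j \<in> P then - \<i> else \<i>) * \<i>) * (\<Prod>j\<in>{..<k} - Q. 1) * \<beta> x v)"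
    by (intro sum.cong refl) (simp add: J prod.distrib)
  also have "\<dots> = (\<Prod>j<k. (if j \<in> P then - \<i> else \<i>) * \<i> + 1) * \<beta> x v"
    unfolding sum_distrib_right[symmetric] by (subst prod_add) (auto simp: finite_subset)
  also have "(\<Prod>j<k. (if j \<in> P then - \<i> else \<i>) * \<i> + 1) = 0"
    using j by (auto simp: prod_zero_iff intro!: bexI[of _ j])
  finally show "(\<Sum>Q\<in>Pow {..<k}. (\<Prod>j\<in>Q. if j \<in> P then - \<i> else \<i>) * \<beta> x (\<lambda>j. if j \<in> Q then J x (v j) else v j)) = 0"
    by simp
qed

lemma has_type_zero: "(\<And>v. \<beta> x v = 0) \<Longrightarrow> has_type k A J \<beta> x"
  by (simp add: has_type_def)

text \<open>For types (2,0) and (0,2) both vectors carry the same sign, so the sum consists of B(u,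
  w) - B(Ju, Jw) and a multiple of B(Ju, w) + B(u, Jw), both of which vanish.\<close>

lemma has_type_1_1:
  assumes dep: "\<And>v. \<beta> x v = B (v 0) (v 1)"
    and lin: "\<And>u w. B (J x u) (J x w) = B u w" "\<And>u w. B (J x u) w = - B u (J x w)"
  shows "has_type 2 {1} J \<beta> x"
  unfolding has_type_def
proof (intro allI impI)
  fix P :: "nat set" and v assume P: "P \<subseteq> {..<2}" "card P \<notin> {1}"
  have "{..<2} = {0, 1::nat}" by auto
  then have "P = {} \<or> P = {0} \<or> P = {1} \<or> P = {0, 1}" using P(1) by auto
  then have c: "P = {} \<or> P = {0, 1}" using P(2) by auto
  have pow: "Pow {..<2} = {{}, {0}, {1}, {0, 1::nat}}" by (auto simp: \<open>{..<2} = {0, 1::nat}\<close>)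
  have "{0::nat} \<noteq> {1}" "{0::nat} \<noteq> {0, 1}" "{1::nat} \<noteq> {0, 1}" by auto
  then show "(\<Sum>Q\<in>Pow {..<2}. (\<Prod>j\<in>Q. if j \<in> P then - \<i> else \<i>) * \<beta> x (\<lambda>j. if j \<in> Q then J x (v j) else v j)) = 0"
    unfolding pow dep using c lin by auto
qed

context
  fixes s t H :: "'a::euclidean_space \<Rightarrow> complex" and K :: "'a \<Rightarrow> 'a"
  assumes frame: "adapted_frame K s t H" and dim: "DIM('a) = 6"
begin

private lemma lin: "linear s" "linear t" "linear H"
  and ker: "s u = 0 \<Longrightarrow> t u = 0 \<Longrightarrow> H u = 0 \<Longrightarrow> u = 0"
  and K: "s (K u) = \<i> * s u" "t (K u) = \<i> * t u" "H (K u) = - \<i> * H u"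
  using frame by (auto simp: adapted_frame_def)

lemma frame_eqI: "s u = s w \<Longrightarrow> t u = t w \<Longrightarrow> H u = H w \<Longrightarrow> u = w"
  using ker[of "u - w"] lin by (simp add: linear_diff)

text \<open>The trivial kernel makes the coordinate map injective, hence bijective in dimension 6.
  Its inverse supplies vectors with prescribed coordinates for the tests below.\<close>

lemma frame_inverse:
  obtains P :: "complex \<times> complex \<times> complex \<Rightarrow> 'a"
  where "linear P" "\<And>p q r. s (P (p, q, r)) = p" "\<And>p q r. t (P (p, q, r)) = q" "\<And>p q r. H (P (p, q, r)) = r"
proof -
  let ?L = "\<lambda>u. (s u, t u, H u)"
  have "linear ?L" using lin by (intro linearI) (auto simp: linear_add linear_cmul)
  moreover have "inj ?L" using frame_eqI by (auto simp: inj_def)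
  ultimately have "surj ?L" by (rule eucl.linear_injective_imp_surjective) (simp add: dim)
  then have P: "?L (inv ?L z) = z" for z by (rule surj_f_inv_f)
  have *: "s (inv ?L (p, q, r)) = p" "t (inv ?L (p, q, r)) = q" "H (inv ?L (p, q, r)) = r" for p q r
    using P[of "(p, q, r)"] by auto
  have "linear (inv ?L)"
  proof (rule linearI)
    show "inv ?L (x + y) = inv ?L x + inv ?L y" for x y
      by (cases x; cases y) (auto intro!: frame_eqI simp: * linear_add[OF lin(1)] linear_add[OF lin(2)] linear_add[OF lin(3)])
    show "inv ?L (r *\<^sub>R x) = r *\<^sub>R inv ?L x" for r x
      by (cases x) (auto intro!: frame_eqI simp: * linear_cmul[OF lin(1)] linear_cmul[OF lin(2)] linear_cmul[OF lin(3)])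
  qed
  then show ?thesis using that[of "inv ?L"] * by blast
qed

lemma K_K: "K (K u) = - u"
  by (rule frame_eqI) (simp_all add: K linear_neg[OF lin(1)] linear_neg[OF lin(2)] linear_neg[OF lin(3)])

lemma omega_pt_eq: "omega_pt a b s t H v =
    of_real (- a * (Im (s (v 0) * cnj (s (v 1))) + Im (t (v 0) * cnj (t (v 1)))) + b\<^sup>2 * Im (H (v 0) * cnj (H (v 1))))"
  by (simp add: omega_pt_def dt_pair cj_def complex_eq_iff field_simps)

lemma omega_pt_K: "omega_pt a b s t H (vec2 (K u) (K w)) = omega_pt a b s t H (vec2 u w)"
  by (simp add: omega_pt_eq vec2_def K algebra_simps)

text \<open>Since \<open>K\<close> acts on \<open>H\<close> by -i, the term -(i/2) b^2 H \<and> cnj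
  H contributes positively: the metric is a (|s|^2 + |t|^2) + b^2 |H|^2, and for nonzero b the sign
  of a decides between a definite metric and signature (2,4).\<close>

lemma omega_pt_metric: "Re (omega_pt a b s t H (vec2 u (K w))) =
    a * (Re (s u * cnj (s w)) + Re (t u * cnj (t w))) + b\<^sup>2 * Re (H u * cnj (H w))"
  by (simp add: omega_pt_eq vec2_def K algebra_simps)

lemma omega_pt_type:
  assumes "\<And>v. \<beta> x v = c * omega_pt a b s t H v" "J x = K"
  shows "has_type 2 {1} J \<beta> x"
proof (rule has_type_1_1)
  show "\<beta> x v = (\<lambda>u w. c * omega_pt a b s t H (vec2 u w)) (v 0) (v 1)" for v
    by (simp add: assms omega_pt_eq vec2_def)
  show "c * omega_pt a b s t H (vec2 (J x u) (J x w)) = c * omega_pt a b s t H (vec2 u w)" for u w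
    by (simp add: assms omega_pt_K)
  show "c * omega_pt a b s t H (vec2 (J x u) w) = - (c * omega_pt a b s t H (vec2 u (J x w)))" for u w
    by (simp add: assms omega_pt_eq vec2_def K algebra_simps)
qed

lemma Omega_pt_slots:
  assumes "Q \<subseteq> {..<3}"
  shows "dt [s, t, cj H] (\<lambda>j. if j \<in> Q then K (v j) else v j) = \<i> ^ card Q * dt [s, t, cj H] v"
proof -
  have "{..<3} = {0, 1, 2::nat}" by auto
  then have "Q \<in> Pow {0, 1, 2}" using assms by simp
  then have "Q \<in> {{}, {0}, {1}, {2}, {0, 1}, {0, 2}, {1, 2}, {0, 1, 2}}" by (simp add: Pow_insert) blast
  then show ?thesis
    by (elim insertE emptyE; simp add: dt_triple cj_def K algebra_simps eval_nat_numeral)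
qed

lemma Omega_pt_type:
  assumes "\<And>v. \<beta> x v = c * dt [s, t, cj H] v" "J x = K"
  shows "has_type 3 {3} J \<beta> x"
  by (rule has_type_all) (simp only: assms Omega_pt_slots mult.left_commute)

lemma Omega_pt_nonzero: "\<exists>v. dt [s, t, cj H] v \<noteq> 0"
proof -
  obtain P where P: "\<And>p q r. s (P (p, q, r)) = p" "\<And>p q r. t (P (p, q, r)) = q" "\<And>p q r. H (P (p, q, r)) = r"
    using frame_inverse by metis
  show ?thesis
    by (rule exI[of _ "\<lambda>i::nat. if i = 0 then P (1, 0, 0) else if i = 1 then P (0, 1, 0) else P (0, 0, 1)"])
      (simp add: dt_triple P cj_def)
qed

lemma Omega_pt_K: "dt [s, t, cj H] (v(0 := K u)) = \<i> * dt [s, t, cj H] (v(0 := u))"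
  by (simp add: dt_triple K cj_def algebra_simps)

text \<open>Filling the other two slots with vectors dual to two of the coordinates isolates the
  third coordinate of \<open>w\<close>, up to conjugation in the case of \<open>H\<close>.\<close>

lemma Omega_pt_K_unique:
  assumes w: "\<And>v. dt [s, t, cj H] (v(0 := w)) = \<i> * dt [s, t, cj H] (v(0 := u))"
  shows "w = K u"
proof -
  obtain P where P: "\<And>p q r. s (P (p, q, r)) = p" "\<And>p q r. t (P (p, q, r)) = q" "\<And>p q r. H (P (p, q, r)) = r"
    using frame_inverse by metis
  have "s w = \<i> * s u"
    using w[of "\<lambda>i::nat. if i = 1 then P (0, 1, 0) else P (0, 0, 1)"] by (simp add: dt_triple P cj_def)
  moreover have "t w = \<i> * t u"
    using w[of "\<lambda>i::nat. if i = 1 then P (1, 0, 0) else P (0, 0, 1)"] by (simp add: dt_triple P cj_def)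
  moreover have "cnj (H w) = \<i> * cnj (H u)"
    using w[of "\<lambda>i::nat. if i = 1 then P (1, 0, 0) else P (0, 1, 0)"] by (simp add: dt_triple P cj_def)
  then have "H w = - \<i> * H u" by (metis complex_cnj_cnj complex_cnj_mult complex_cnj_i)
  ultimately show ?thesis by (intro frame_eqI) (simp_all add: K)
qed

text \<open>Two pairs of parameters are kept because the formula serves both \<omega> \<and>
  \<omega> and the product of \<omega> with the torsion form
  \<open>\<omega> 1 (sqrt 2)\<close>.\<close>

lemma omega_pt_square: "wedge_map 2 2 (omega_pt a' b' s t H) (omega_pt a b s t H) v =
    - of_real (a * a') / 2 * dt [s, cj s, t, cj t] v +
    of_real (a * b'\<^sup>2 + a' * b\<^sup>2) / 4 * (dt [s, cj s, H, cj H] v + dt [t, cj t, H, cj H] v)"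
proof -
  have *: "omega_pt a b s t H = (\<lambda>v. of_real a * \<i> / 2 * dt [s, cj s] v + of_real a * \<i> / 2 * dt [t, cj t] v +
      (- \<i> / 2 * of_real (b\<^sup>2)) * dt [H, cj H] v)" for a b
    by (simp add: omega_pt_def fun_eq_iff algebra_simps)
  show ?thesis
    unfolding * wedge_map_expand
    by (simp add: dt_not_distinct dt_swap4(1)[of t "cj t" s "cj s"] dt_swap4(1)[of H "cj H" s "cj s"]
        dt_swap4(1)[of H "cj H" t "cj t"]) (simp add: field_simps)
qed

lemma omega_pt_wedge_power:
  assumes "\<omega> x = omega_pt a b s t H"
  shows "wedge_power \<omega> 1 x = omega_pt a b s t H"
    "wedge_power \<omega> 2 x = (\<lambda>v. - of_real (a\<^sup>2) / 2 * dt [s, cj s, t, cj t] v +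
      of_real (a * b\<^sup>2) / 2 * (dt [s, cj s, H, cj H] v + dt [t, cj t, H, cj H] v))"
proof -
  have *: "omega_pt a b s t H = (\<lambda>v. of_real a * \<i> / 2 * dt [s, cj s] v + of_real a * \<i> / 2 * dt [t, cj t] v +
      (- \<i> / 2 * of_real (b\<^sup>2)) * dt [H, cj H] v)"
    by (simp add: omega_pt_def fun_eq_iff algebra_simps)
  have "(\<lambda>v. 1) = dt ([] :: ('a \<Rightarrow> complex) list)" by (simp add: fun_eq_iff)
  then have "wedge_power \<omega> 1 x = wedge_map 2 0 (omega_pt a b s t H) (dt [])"
    by (simp add: wedge_eq_wedge_map assms)
  then show 1: "wedge_power \<omega> 1 x = omega_pt a b s t H"
    unfolding * by (simp only: wedge_map_add_left wedge_map_cmult_left wedge_map_dt_simps')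
  have "wedge_power \<omega> 2 x = wedge_map 2 2 (\<omega> x) (wedge_power \<omega> 1 x)"
    by (simp add: numeral_2_eq_2 wedge_eq_wedge_map)
  also have "\<dots> = wedge_map 2 2 (omega_pt a b s t H) (omega_pt a b s t H)"
    by (simp only: 1 assms)
  finally show "wedge_power \<omega> 2 x = (\<lambda>v. - of_real (a\<^sup>2) / 2 * dt [s, cj s, t, cj t] v +
      of_real (a * b\<^sup>2) / 2 * (dt [s, cj s, H, cj H] v + dt [t, cj t, H, cj H] v))"
    by (simp add: omega_pt_square fun_eq_iff power2_eq_square)
qed

text \<open>The second factor is \<omega>^2 in normal order. Equal parameters give the volume; for
  a' = 1 and b'^2 = 2 the coefficient is proportional to 2a (a + b^2) and vanishes when a = -b^2,
  which is primitivity of the torsion form.\<close>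

lemma omega_pt_cube: "wedge_map 2 4 (omega_pt a' b' s t H) (\<lambda>v. - of_real (a\<^sup>2) / 2 * dt [s, cj s, t, cj t] v +
      of_real (a * b\<^sup>2) / 2 * (dt [s, cj s, H, cj H] v + dt [t, cj t, H, cj H] v)) v =
    \<i> * of_real (2 * a * a' * b\<^sup>2 + a\<^sup>2 * b'\<^sup>2) / 4 * dt [s, cj s, t, cj t, H, cj H] v"
proof -
  have *: "omega_pt a' b' s t H = (\<lambda>v. of_real a' * \<i> / 2 * dt [s, cj s] v + of_real a' * \<i> / 2 * dt [t, cj t] v +
      (- \<i> / 2 * of_real (b'\<^sup>2)) * dt [H, cj H] v)"
    by (simp add: omega_pt_def fun_eq_iff algebra_simps)
  show ?thesis
    unfolding * wedge_map_add_left wedge_map_add_right wedge_map_cmult_left wedge_map_cmult_right wedge_map_dt_simps'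
    by (simp add: dt_not_distinct dt_swap6(1)[of t "cj t" s "cj s" H "cj H"] dt_swap6(2)[of H "cj H" s "cj s" t "cj t"])
      (simp add: field_simps)
qed

text \<open>Every product in \<omega> \<and> \<Omega> repeats one of s, t, cj H. For the
  normalisation, \<omega>^3 has coefficient 3i a^2 b^2 / 4 on s, cj s, t, cj t, H, cj H, and -8i/6
  times this is a^2 b^2, the squared modulus of the factor in \<Omega>.\<close>

lemma omega_pt_volume:
  assumes \<omega>: "\<omega> x = omega_pt a b s t H" and \<Omega>: "\<And>v. \<Omega> x v = k * dt [s, t, cj H] v"
    and k: "k * cnj k = of_real (a\<^sup>2 * b\<^sup>2)"
  shows "wedge 2 3 \<omega> \<Omega> x v = 0"
    "wedge 3 3 \<Omega> (conj_form \<Omega>) x v = - 8 * \<i> * wedge_power \<omega> 3 x v / fact 3"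
proof -
  have *: "omega_pt a b s t H = (\<lambda>v. of_real a * \<i> / 2 * dt [s, cj s] v + of_real a * \<i> / 2 * dt [t, cj t] v +
      (- \<i> / 2 * of_real (b\<^sup>2)) * dt [H, cj H] v)"
    by (simp add: omega_pt_def fun_eq_iff algebra_simps)
  have O: "\<Omega> x = (\<lambda>v. k * dt [s, t, cj H] v)" "conj_form \<Omega> x = (\<lambda>v. cnj k * dt [cj s, cj t, H] v)"
    by (simp_all add: fun_eq_iff \<Omega> conj_form_def cnj_dt_cj)
  show "wedge 2 3 \<omega> \<Omega> x v = 0"
    unfolding wedge_eq_wedge_map \<omega> O * wedge_map_add_left wedge_map_cmult_left wedge_map_cmult_right wedge_map_dt_simps'
    by (simp add: dt_not_distinct)
  have "wedge_power \<omega> 3 x v = wedge_map 2 4 (\<omega> x) (wedge_power \<omega> 2 x) v"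
    by (simp add: eval_nat_numeral wedge_eq_wedge_map)
  then have *: "wedge_power \<omega> 3 x v = \<i> * of_real (2 * a * a * b\<^sup>2 + a\<^sup>2 * b\<^sup>2) / 4 * dt [s, cj s, t, cj t, H, cj H] v"
    unfolding \<omega> omega_pt_wedge_power(2)[of \<omega> x, OF \<omega>] omega_pt_cube .
  have "wedge 3 3 \<Omega> (conj_form \<Omega>) x v = k * cnj k * dt [s, cj s, t, cj t, H, cj H] v"
    unfolding wedge_eq_wedge_map O wedge_map_cmult_left wedge_map_cmult_right wedge_map_dt_simps'
    using dt_swap6(3)[of s t "cj H" "cj s" "cj t" H v] by simp
  also have "\<dots> = - 8 * \<i> * wedge_power \<omega> 3 x v / fact 3"
    unfolding k * by (simp add: fact_numeral power2_eq_square algebra_simps)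
  finally show "wedge 3 3 \<Omega> (conj_form \<Omega>) x v = - 8 * \<i> * wedge_power \<omega> 3 x v / fact 3" .
qed

text \<open>The two positive directions form the complex line s = t = 0, and the four negative ones
  the complex plane H = 0.\<close>

lemma omega_pt_signature:
  assumes "a < 0" "b \<noteq> 0"
  shows "has_signature (\<lambda>u w. Re (omega_pt a b s t H (vec2 u (K w)))) 2 4"
proof -
  obtain P where P: "linear P" "\<And>p q r. s (P (p, q, r)) = p" "\<And>p q r. t (P (p, q, r)) = q" "\<And>p q r. H (P (p, q, r)) = r"
    using frame_inverse by metis
  have m: "Re (omega_pt a b s t H (vec2 u (K u))) = a * ((cmod (s u))\<^sup>2 + (cmod (t u))\<^sup>2) + b\<^sup>2 * (cmod (H u))\<^sup>2" for u
    unfolding omega_pt_metric cmod_power2 by (simp add: power2_eq_square)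
  define V where "V = range (\<lambda>r. P (0, 0, r))"
  define W where "W = range (\<lambda>z. P (fst z, snd z, 0))"
  have inj: "inj (\<lambda>r. P (0, 0, r))" "inj (\<lambda>z. P (fst z, snd z, 0))"
    using P(2-4) by (auto simp: inj_def prod_eq_iff) metis+
  have lP: "linear (\<lambda>r. P (0, 0, r))" "linear (\<lambda>z. P (fst z, snd z, 0))"
    using linear_compose[OF _ P(1), of "\<lambda>r. (0, 0, r)"] linear_compose[OF _ P(1), of "\<lambda>z. (fst z, snd z, 0)"]
    by (simp_all add: o_def linearI)
  have "dim V = 2" "dim W = 4"
    unfolding V_def W_def using dim_image_eq[OF lP(1)] dim_image_eq[OF lP(2)] inj by (simp_all add: inj_on_subset)
  moreover have "subspace V" "subspace W"
    unfolding V_def W_def using linear_subspace_image[OF lP(1)] linear_subspace_image[OF lP(2)] by simp_all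
  moreover have "0 < Re (omega_pt a b s t H (vec2 u (K u)))" if "u \<in> V" "u \<noteq> 0" for u
  proof -
    have "s u = 0" "t u = 0" using that(1) by (auto simp: V_def P)
    moreover have "H u \<noteq> 0" using that(2) ker calculation by blast
    ultimately show ?thesis unfolding m using assms by simp
  qed
  moreover have "Re (omega_pt a b s t H (vec2 u (K u))) < 0" if "u \<in> W" "u \<noteq> 0" for u
  proof -
    have 0: "H u = 0" using that(1) by (auto simp: W_def P)
    then have "s u \<noteq> 0 \<or> t u \<noteq> 0" using that(2) ker by blast
    then have "0 < (cmod (s u))\<^sup>2 + (cmod (t u))\<^sup>2" by (auto intro: add_pos_nonneg add_nonneg_pos)
    then show ?thesis unfolding m 0 using assms by (simp add: mult_neg_pos)
  qed
  ultimately show ?thesis unfolding has_signature_def using dim by auto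
qed

lemma omega_pt_definite:
  assumes "a > 0" "b \<noteq> 0" "u \<noteq> 0"
  shows "Re (omega_pt a b s t H (vec2 u (K u))) > 0"
proof -
  have m: "Re (omega_pt a b s t H (vec2 u (K u))) = a * ((cmod (s u))\<^sup>2 + (cmod (t u))\<^sup>2) + b\<^sup>2 * (cmod (H u))\<^sup>2"
    unfolding omega_pt_metric cmod_power2 by (simp add: power2_eq_square)
  show ?thesis
  proof (cases "H u = 0")
    case True
    then have "s u \<noteq> 0 \<or> t u \<noteq> 0" using ker assms(3) by blast
    then have "0 < (cmod (s u))\<^sup>2 + (cmod (t u))\<^sup>2" by (auto intro: add_pos_nonneg add_nonneg_pos)
    then show ?thesis unfolding m True using assms(1) by simp
  next
    case False
    then show ?thesis unfolding m using assms(1,2) by (intro add_nonneg_pos) auto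
  qed
qed

lemma omega_pt_linear: "linear (\<lambda>z. omega_pt a b s t H (vec2 u z))"
  unfolding omega_pt_eq vec2_def using lin
  by (auto intro!: linearI simp: linear_add linear_cmul algebra_simps complex_eq_iff)

lemma omega_pt_bilinear: "bilinear (\<lambda>u w. Re (omega_pt a b s t H (vec2 u (K w))))"
  unfolding omega_pt_metric bilinear_def using lin
  by (auto intro!: linearI simp: linear_add linear_cmul algebra_simps)

lemma omega_pt_symmetric:
  "Re (omega_pt a b s t H (vec2 u (K w))) = Re (omega_pt a b s t H (vec2 w (K u)))"
  unfolding omega_pt_metric by (simp add: algebra_simps)

end

section \<open>The structures on the quotient\<close>

lemma orb_form_const: "(\<And>c. c \<in> charts M \<Longrightarrow> open (cdom c)) \<Longrightarrow> orb_form M 0 (\<lambda>c x v. k)"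
  by (simp add: orb_form_def k_form_def pullback_def smooth_on_const)

lemma orb_form_zero: "(\<And>c. c \<in> charts M \<Longrightarrow> open (cdom c)) \<Longrightarrow> orb_form M k (\<lambda>c x v. 0)"
  by (simp add: orb_form_def k_form_def pullback_def smooth_on_const linear_zero)

lemma orb_form_cmult:
  "(\<And>c. c \<in> charts M \<Longrightarrow> open (cdom c)) \<Longrightarrow> orb_form M k \<beta> \<Longrightarrow> orb_form M k (\<lambda>c x v. a * \<beta> c x v)"
  by (simp add: orb_form_def k_form_cmult) (simp add: pullback_def)

text \<open>The smooth left inverse makes the derivative injective, hence surjective. All test
  vectors in the target chart are therefore images, which allows identities between forms to be
  transported.\<close>

lemma transition_surj:
  fixes c c' :: "('e::euclidean_space, 'p) ochart"
  assumes h: "transition c c' N h" and x: "x \<in> N"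
  shows "linear (frechet_derivative h (at x))" "surj (frechet_derivative h (at x))"
proof -
  from h obtain f' where f: "open N" "smooth_on N h" "open (h ` N)" "smooth_on (h ` N) f'" "\<And>y. y \<in> N \<Longrightarrow> f' (h y) = y"
    unfolding transition_def diffeo_on_def by blast
  show lin: "linear (frechet_derivative h (at x))" by (rule linear_frechet_derivative'[OF f(2) x])
  have "frechet_derivative f' (at (h x)) (frechet_derivative h (at x) u) = u" for u
  proof -
    have "frechet_derivative (\<lambda>y. f' (h y)) (at x) = frechet_derivative (\<lambda>y. y) (at x)"
      by (rule frechet_derivative_cong_open[OF f(1) x f(5)])
    then show ?thesis using frechet_derivative_compose'[OF f(2) f(4) x, of u] x by simp
  qed
  then have "inj (frechet_derivative h (at x))" by (metis injI)
  then show "surj (frechet_derivative h (at x))" by (rule eucl.linear_injective_imp_surjective[OF lin]) simp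
qed

text \<open>The complex structure is recovered from the condition that \<Omega> is complex linear in
  its first slot. All \<open>\<Omega> a b \<gamma>\<close> with a and b nonzero are multiples of
  \<open>\<Omega> 1 1 0\<close>, so one endomorphism belongs to all of them.\<close>

definition structure_endo :: "(real \<Rightarrow> real \<Rightarrow> real \<Rightarrow> ('f::euclidean_space, 'q) oform) \<Rightarrow> ('f, 'q) oendo" where
  "structure_endo \<Omega> c y u = (THE w. \<forall>v. \<Omega> 1 1 0 c y (v(0 := w)) = \<i> * \<Omega> 1 1 0 c y (v(0 := u)))"

context
  fixes Z :: "(real^6, 'q) orbifold" and \<omega> :: "real \<Rightarrow> real \<Rightarrow> (real^6, 'q) oform"
    and \<Omega> :: "real \<Rightarrow> real \<Rightarrow> real \<Rightarrow> (real^6, 'q) oform"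
  assumes dom: "\<And>c. c \<in> charts Z \<Longrightarrow> open (cdom c)"
    and orb: "\<And>a b. orb_form Z 2 (\<omega> a b)" "\<And>a b \<gamma>. orb_form Z 3 (\<Omega> a b \<gamma>)"
    and loc: "\<And>c y0. c \<in> charts Z \<Longrightarrow> y0 \<in> cdom c \<Longrightarrow> \<exists>V K. open V \<and> y0 \<in> V \<and> V \<subseteq> cdom c \<and> (\<forall>u. smooth_on V (\<lambda>y. K y u)) \<and>
      (\<forall>y\<in>V. linear (K y) \<and> (\<exists>s t H. quotient_frame \<omega> \<Omega> c y (K y) s t H))"
begin

private abbreviation (input) "JZ \<equiv> structure_endo \<Omega>"

lemma quotient_frameD:
  assumes "quotient_frame \<omega> \<Omega> c y K s t H"
  shows "adapted_frame K s t H"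
    "\<omega> a b c y = omega_pt a b s t H"
    "\<Omega> a b \<gamma> c y v = of_real (a * b) * exp (\<i> * of_real \<gamma>) * dt [s, t, cj H] v"
    "ext_deriv 2 (\<omega> a b c) y v = - \<i> * of_real (a + b\<^sup>2) * (dt [s, t, cj H] v - dt [H, cj s, cj t] v)"
    "ext_deriv 3 (\<Omega> a b \<gamma> c) y v = of_real (a * b) * exp (\<i> * of_real \<gamma>) *
        (2 * dt [s, t, cj s, cj t] v + dt [H, s, cj s, cj H] v + dt [H, t, cj t, cj H] v)"
  using assms unfolding quotient_frame_def fun_eq_iff by blast+

lemma frame_rules: "quotient_frame \<omega> \<Omega> c y K s t H \<Longrightarrow> adapted_frame K s t H" "DIM(real^6) = 6"
  using quotient_frameD(1) by auto

lemma structure_endo_eq: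
  assumes q: "quotient_frame \<omega> \<Omega> c y K s t H"
  shows "JZ c y = K"
proof
  fix u
  have O: "\<Omega> 1 1 0 c y v = dt [s, t, cj H] v" for v
    using quotient_frameD(3)[OF q, of 1 1 0] by simp
  show "JZ c y u = K u"
    unfolding structure_endo_def O
  proof (rule the_equality)
    show "\<forall>v. dt [s, t, cj H] (v(0 := K u)) = \<i> * dt [s, t, cj H] (v(0 := u))"
      using Omega_pt_K[OF frame_rules(1)[OF q] frame_rules(2)] by blast
    show "w = K u" if "\<forall>v. dt [s, t, cj H] (v(0 := w)) = \<i> * dt [s, t, cj H] (v(0 := u))" for w
      by (rule Omega_pt_K_unique[OF frame_rules(1)[OF q] frame_rules(2)]) (use that in blast)
  qed
qed

lemma frame_at:
  assumes "c \<in> charts Z" "y \<in> cdom c"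
  obtains s t H where "quotient_frame \<omega> \<Omega> c y (JZ c y) s t H"
  using loc[OF assms] structure_endo_eq that by metis

lemma structure_endo_unique:
  assumes c: "c \<in> charts Z" "y \<in> cdom c"
  shows "\<Omega> 1 1 0 c y (v(0 := JZ c y u)) = \<i> * \<Omega> 1 1 0 c y (v(0 := u))"
    "(\<And>v. \<Omega> 1 1 0 c y (v(0 := w)) = \<i> * \<Omega> 1 1 0 c y (v(0 := u))) \<Longrightarrow> w = JZ c y u"
proof -
  obtain s t H where q: "quotient_frame \<omega> \<Omega> c y (JZ c y) s t H" by (rule frame_at[OF c])
  have O: "\<Omega> 1 1 0 c y v = dt [s, t, cj H] v" for v
    using quotient_frameD(3)[OF q, of 1 1 0] by simp
  show "\<Omega> 1 1 0 c y (v(0 := JZ c y u)) = \<i> * \<Omega> 1 1 0 c y (v(0 := u))"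
    unfolding O by (rule Omega_pt_K[OF frame_rules(1)[OF q] frame_rules(2)])
  show "w = JZ c y u" if "\<And>v. \<Omega> 1 1 0 c y (v(0 := w)) = \<i> * \<Omega> 1 1 0 c y (v(0 := u))"
    using that unfolding O by (rule Omega_pt_K_unique[OF frame_rules(1)[OF q] frame_rules(2)])
qed

text \<open>Linearity and smoothness come from the local frames. Compatibility with transitions
  comes from uniqueness: the transported vector satisfies the condition that characterises
  \<open>JZ\<close> in the target chart, because \<Omega> is invariant.\<close>

lemma orb_endo_structure_endo: "orb_endo Z JZ"
  unfolding orb_endo_def
proof (intro conjI ballI allI impI)
  fix c x assume c: "c \<in> charts Z" "x \<in> cdom c"
  obtain V K where "x \<in> V" "\<forall>y\<in>V. linear (K y) \<and> (\<exists>s t H. quotient_frame \<omega> \<Omega> c y (K y) s t H)"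
    using loc[OF c] by blast
  then show "linear (JZ c x)" using structure_endo_eq by metis
next
  fix c u assume c: "c \<in> charts Z"
  show "smooth_on (cdom c) (\<lambda>x. JZ c x u)"
  proof (rule smooth_on_local)
    fix x assume "x \<in> cdom c"
    from loc[OF c this] obtain V K where V: "open V" "x \<in> V" "smooth_on V (\<lambda>y. K y u)"
      "\<forall>y\<in>V. \<exists>s t H. quotient_frame \<omega> \<Omega> c y (K y) s t H" by blast
    have "K y u = JZ c y u" if "y \<in> V" for y using structure_endo_eq V(4) that by metis
    then have "smooth_on V (\<lambda>x. JZ c x u)" by (rule smooth_on_cong[OF V(1) _ V(3)])
    then show "\<exists>V. open V \<and> x \<in> V \<and> smooth_on V (\<lambda>x. JZ c x u)" using V by blast
  qed
next
  fix c c' N h x u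
  assume c: "c \<in> charts Z" "c' \<in> charts Z" and h: "transition c c' N h" and x: "x \<in> N"
  let ?D = "frechet_derivative h (at x)"
  have xc: "x \<in> cdom c" "h x \<in> cdom c'" using h x by (auto simp: transition_def)
  have pb: "\<Omega> 1 1 0 c' (h x) (\<lambda>i. ?D (v i)) = \<Omega> 1 1 0 c x v" for v
    using orb(2)[of 1 1 0] c h x unfolding orb_form_def pullback_def by blast
  show "?D (JZ c x u) = JZ c' (h x) (?D u)"
  proof (rule structure_endo_unique(2)[OF c(2) xc(2)])
    fix v' :: "nat \<Rightarrow> real^6"
    define v where "v = (\<lambda>i. inv ?D (v' i))"
    have "v' = (\<lambda>i. ?D (v i))" by (simp add: v_def surj_f_inv_f[OF transition_surj(2)[OF h x]])
    then have *: "v'(0 := ?D w) = (\<lambda>i. ?D ((v(0 := w)) i))" for w by auto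
    show "\<Omega> 1 1 0 c' (h x) (v'(0 := ?D (JZ c x u))) = \<i> * \<Omega> 1 1 0 c' (h x) (v'(0 := ?D u))"
      unfolding * pb by (rule structure_endo_unique(1)[OF c(1) xc(1)])
  qed
qed

lemma hermitian_metric_eq:
  assumes "quotient_frame \<omega> \<Omega> c y (JZ c y) s t H"
  shows "hermitian_metric (\<omega> a b) JZ c y u w = Re (omega_pt a b s t H (vec2 u (JZ c y w)))"
  unfolding hermitian_metric_def quotient_frameD(2)[OF assms] ..

lemma riemannian_hermitian_metric:
  assumes ab: "a > 0" "b \<noteq> 0"
  shows "riemannian_metric Z (hermitian_metric (\<omega> a b) JZ)"
  unfolding riemannian_metric_def
proof (intro conjI ballI allI impI)
  fix c x assume c: "c \<in> charts Z" "x \<in> cdom c"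
  obtain s t H where q: "quotient_frame \<omega> \<Omega> c x (JZ c x) s t H" by (rule frame_at[OF c])
  note e = hermitian_metric_eq[OF q]
  show "bilinear (hermitian_metric (\<omega> a b) JZ c x)"
    unfolding e[abs_def] by (rule omega_pt_bilinear[OF frame_rules(1)[OF q] frame_rules(2)])
  show "hermitian_metric (\<omega> a b) JZ c x u w = hermitian_metric (\<omega> a b) JZ c x w u" for u w
    unfolding e by (rule omega_pt_symmetric[OF frame_rules(1)[OF q] frame_rules(2)])
  show "0 < hermitian_metric (\<omega> a b) JZ c x u u" if "u \<noteq> 0" for u
    unfolding e by (rule omega_pt_definite[OF frame_rules(1)[OF q] frame_rules(2)]) (fact ab that)+
next
  fix c u w assume c: "c \<in> charts Z"
  have lin: "linear (\<lambda>z. \<omega> a b c x (vec2 u z))" if x: "x \<in> cdom c" for x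
  proof -
    obtain s t H where q: "quotient_frame \<omega> \<Omega> c x (JZ c x) s t H" by (rule frame_at[OF c x])
    show ?thesis unfolding quotient_frameD(2)[OF q]
      by (rule omega_pt_linear[OF frame_rules(1)[OF q] frame_rules(2)])
  qed
  have "smooth_on (cdom c) (\<lambda>x. \<omega> a b c x (vec2 u (JZ c x w)))"
  proof (rule smooth_on_linear_family[OF dom[OF c] lin])
    show "smooth_on (cdom c) (\<lambda>x. \<omega> a b c x (vec2 u z))" for z
      using orb(1) c by (auto simp: orb_form_def intro: k_form_smooth)
    show "smooth_on (cdom c) (\<lambda>x. JZ c x w)" using orb_endo_structure_endo c by (simp add: orb_endo_def)
  qed
  then show "smooth_on (cdom c) (\<lambda>x. hermitian_metric (\<omega> a b) JZ c x u w)"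
    unfolding hermitian_metric_def by (rule smooth_on_bounded_linear_comp[OF dom[OF c] bounded_linear_Re])
next
  fix c c' N h x u w
  assume c: "c \<in> charts Z" "c' \<in> charts Z" and h: "transition c c' N h" and x: "x \<in> N"
  let ?D = "frechet_derivative h (at x)"
  have pb: "\<omega> a b c' (h x) (\<lambda>i. ?D (v i)) = \<omega> a b c x v" for v
    using orb(1)[of a b] c h x unfolding orb_form_def pullback_def by blast
  have J: "JZ c' (h x) (?D w) = ?D (JZ c x w)" using orb_endo_structure_endo c h x by (simp add: orb_endo_def)
  have "vec2 (?D u) (?D (JZ c x w)) = (\<lambda>i. ?D (vec2 u (JZ c x w) i))" by (auto simp: vec2_def)
  then show "hermitian_metric (\<omega> a b) JZ c' (h x) (?D u) (?D w) = hermitian_metric (\<omega> a b) JZ c x u w"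
    unfolding hermitian_metric_def J by (simp add: pb)
qed

lemma su_structure_quotient:
  assumes "a \<noteq> 0" "b \<noteq> 0"
  shows "su_structure Z JZ (\<omega> a b) (\<Omega> a b \<gamma>)"
proof -
  let ?k = "of_real (a * b) * exp (\<i> * of_real \<gamma>) :: complex"
  \<comment> \<open>The phase drops out of \<open>?k * cnj ?k\<close>, so the normalisation holds
    for every \<gamma>.\<close>
  have k: "?k \<noteq> 0" "?k * cnj ?k = of_real (a\<^sup>2 * b\<^sup>2)"
    using assms by (auto simp: complex_norm_square[symmetric] norm_mult power_mult_distrib simp del: complex_cnj_mult)
  have F: "Im (\<omega> a b c x v) = 0" "\<exists>v. \<Omega> a b \<gamma> c x v \<noteq> 0" "JZ c x (JZ c x u) = - u"
    "\<omega> a b c x (vec2 (JZ c x u) (JZ c x w)) = \<omega> a b c x (vec2 u w)" "has_type 3 {3} (JZ c) (\<Omega> a b \<gamma> c) x"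
    "wedge 2 3 (\<omega> a b c) (\<Omega> a b \<gamma> c) x v = 0"
    "wedge 3 3 (\<Omega> a b \<gamma> c) (conj_form (\<Omega> a b \<gamma> c)) x v = - 8 * \<i> * wedge_power (\<omega> a b c) 3 x v / fact 3"
    if c: "c \<in> charts Z" "x \<in> cdom c" for c x u w v
  proof -
    obtain s t H where q: "quotient_frame \<omega> \<Omega> c x (JZ c x) s t H" by (rule frame_at[OF c])
    note om = quotient_frameD(2)[OF q] and Om = quotient_frameD(3)[OF q]
    have "omega_pt a b s t H v =
      of_real (- a * (Im (s (v 0) * cnj (s (v 1))) + Im (t (v 0) * cnj (t (v 1)))) + b\<^sup>2 * Im (H (v 0) * cnj (H (v 1))))"
      by (rule omega_pt_eq[OF frame_rules(1)[OF q] frame_rules(2)])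
    then show "Im (\<omega> a b c x v) = 0" unfolding om by simp
    have "\<exists>v. dt [s, t, cj H] v \<noteq> 0" by (rule Omega_pt_nonzero[OF frame_rules(1)[OF q] frame_rules(2)])
    then show "\<exists>v. \<Omega> a b \<gamma> c x v \<noteq> 0" unfolding Om using k(1) by simp
    show "JZ c x (JZ c x u) = - u" by (rule K_K[OF frame_rules(1)[OF q] frame_rules(2)])
    show "\<omega> a b c x (vec2 (JZ c x u) (JZ c x w)) = \<omega> a b c x (vec2 u w)"
      unfolding om by (rule omega_pt_K[OF frame_rules(1)[OF q] frame_rules(2)])
    show "has_type 3 {3} (JZ c) (\<Omega> a b \<gamma> c) x"
      by (rule Omega_pt_type[where J = "JZ c" and \<beta> = "\<Omega> a b \<gamma> c" and x = x, OF frame_rules(1)[OF q] frame_rules(2) Om refl])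
    show "wedge 2 3 (\<omega> a b c) (\<Omega> a b \<gamma> c) x v = 0"
      by (rule omega_pt_volume(1)[where \<omega> = "\<omega> a b c" and \<Omega> = "\<Omega> a b \<gamma> c" and x = x, OF frame_rules(1)[OF q] frame_rules(2) om[of a b] Om[of a b \<gamma>] k(2)])
    show "wedge 3 3 (\<Omega> a b \<gamma> c) (conj_form (\<Omega> a b \<gamma> c)) x v = - 8 * \<i> * wedge_power (\<omega> a b c) 3 x v / fact 3"
      by (rule omega_pt_volume(2)[where \<omega> = "\<omega> a b c" and \<Omega> = "\<Omega> a b \<gamma> c" and x = x, OF frame_rules(1)[OF q] frame_rules(2) om[of a b] Om[of a b \<gamma>] k(2)])
  qed
  show ?thesis
    unfolding su_structure_def real_form_def nonvanishing_form_def
    by (intro conjI ballI allI; (rule F orb orb_endo_structure_endo; assumption?))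
qed

section \<open>Torsion of the two structures\<close>

lemma dt_cyclic: "dt [H, cj s, cj t] v = cnj (dt [s, t, cj H] v)"
  by (simp add: dt_triple cj_def algebra_simps)

text \<open>The bracket is a number minus its conjugate, that is, 2i times its imaginary part; the
  factor -i makes the result real.\<close>

lemma d_omega_frame:
  assumes q: "quotient_frame \<omega> \<Omega> c y K s t H"
  shows "ext_deriv 2 (\<omega> a b c) y v = of_real (2 * (a + b\<^sup>2) * Im (dt [s, t, cj H] v))"
  unfolding quotient_frameD(4)[OF q] dt_cyclic by (simp add: complex_eq_iff)

lemma d_Omega_frame:
  assumes q: "quotient_frame \<omega> \<Omega> c y K s t H"
  shows "ext_deriv 3 (\<Omega> a b \<gamma> c) y v = of_real (a * b) * exp (\<i> * of_real \<gamma>) *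
    (dt [s, cj s, H, cj H] v + dt [t, cj t, H, cj H] v - 2 * dt [s, cj s, t, cj t] v)"
proof -
  have 1: "dt [s, t, cj s, cj t] v = - dt [s, cj s, t, cj t] v" by (rule dt_swap4(2))
  have 2: "dt [H, f, cj f, cj H] v = dt [f, cj f, H, cj H] v" for f by (rule dt_swap4(3))
  show ?thesis unfolding quotient_frameD(5)[OF q] 1 2 by (simp add: algebra_simps)
qed

text \<open>In d\<Omega> = W1 \<omega>^2 the component along s, cj s, t, cj t reads -2ab =
  -(4b/a)(a^2/2) after removing the phase, and this fixes W1. The remaining components ask for ab =
  2b^3, which is a = 2b^2. In the equation for d\<omega> the phases cancel, and (3/2)(4b/a)(ab) =
  6b^2 agrees with 2(a + b^2).\<close>

lemma nearly_kaehler_torsion: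
  assumes ab: "a > 0" "a = 2 * b\<^sup>2"
  shows "torsion_classes Z JZ (\<omega> a b) (\<Omega> a b \<gamma>) (\<lambda>c x v. of_real (4 * b / a) * exp (\<i> * of_real \<gamma>))
    (\<lambda>c x v. 0) (\<lambda>c x v. 0) (\<lambda>c x v. 0) (\<lambda>c x v. 0)"
proof -
  let ?e = "exp (\<i> * of_real \<gamma>) :: complex"
  have b: "b \<noteq> 0" using ab by auto
  have ee: "cnj ?e * ?e = 1" by (simp add: exp_cnj exp_add[symmetric])
  have W: "ext_deriv 2 (\<omega> a b c) x v = 3 / 2 * of_real (Im (cnj (of_real (4 * b / a) * ?e) * \<Omega> a b \<gamma> c x v))"
    "ext_deriv 3 (\<Omega> a b \<gamma> c) x v = of_real (4 * b / a) * ?e * wedge_power (\<omega> a b c) 2 x v"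
    if c: "c \<in> charts Z" "x \<in> cdom c" for c x v
  proof -
    obtain s t H where q: "quotient_frame \<omega> \<Omega> c x (JZ c x) s t H" by (rule frame_at[OF c])
    have "cnj (of_real (4 * b / a) * ?e) * \<Omega> a b \<gamma> c x v = of_real (4 * b / a * (a * b)) * (cnj ?e * ?e) * dt [s, t, cj H] v"
      unfolding quotient_frameD(3)[OF q] by simp
    then have "cnj (of_real (4 * b / a) * ?e) * \<Omega> a b \<gamma> c x v = of_real (4 * b\<^sup>2) * dt [s, t, cj H] v"
      unfolding ee using ab(1) by (simp add: power2_eq_square)
    then show "ext_deriv 2 (\<omega> a b c) x v = 3 / 2 * of_real (Im (cnj (of_real (4 * b / a) * ?e) * \<Omega> a b \<gamma> c x v))"
      unfolding d_omega_frame[OF q] by (simp add: ab(2))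
    have wp: "wedge_power (\<omega> a b c) 2 x v = - of_real (a\<^sup>2) / 2 * dt [s, cj s, t, cj t] v +
      of_real (a * b\<^sup>2) / 2 * (dt [s, cj s, H, cj H] v + dt [t, cj t, H, cj H] v)"
      by (rule fun_cong[OF omega_pt_wedge_power(2)[where \<omega> = "\<omega> a b c" and x = x, OF frame_rules(1)[OF q] frame_rules(2) quotient_frameD(2)[OF q]]])
    show "ext_deriv 3 (\<Omega> a b \<gamma> c) x v = of_real (4 * b / a) * ?e * wedge_power (\<omega> a b c) 2 x v"
      unfolding d_Omega_frame[OF q] wp using b by (simp add: ab(2) field_simps power2_eq_square)
  qed
  show ?thesis
    unfolding torsion_classes_def real_form_def primitive_form_def
    by (auto intro!: orb_form_const orb_form_zero dom has_type_zero wedge_zero simp: W wedge_zero conj_form_def)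
qed

text \<open>\<open>\<omega> 1 (sqrt 2)\<close> is \<alpha>_3 - i \<eta> \<and> cnj \<eta>; the value
  sqrt 2 makes it primitive. By \<open>omega_pt_square\<close> its product with \<omega> has
  coefficients -a/2 and (2a + b^2)/4 = a/4. Their ratio -2 is the ratio found in d\<Omega>, and the
  factor 4b brings them to -2ab and ab.\<close>

lemma symplectic_torsion:
  assumes ab: "a = - b\<^sup>2" "a \<noteq> 0"
  shows "torsion_classes Z JZ (\<omega> a b) (\<Omega> a b \<gamma>) (\<lambda>c x v. 0)
    (\<lambda>c x v. of_real (4 * b) * exp (\<i> * of_real \<gamma>) * \<omega> 1 (sqrt 2) c x v) (\<lambda>c x v. 0) (\<lambda>c x v. 0) (\<lambda>c x v. 0)"
proof -
  define k where "k = of_real (4 * b) * exp (\<i> * of_real \<gamma>)"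
  let ?W = "\<lambda>c x v. k * \<omega> 1 (sqrt 2) c x v"
  have W: "ext_deriv 2 (\<omega> a b c) x v = 0"
    "ext_deriv 3 (\<Omega> a b \<gamma> c) x v = wedge 2 2 (?W c) (\<omega> a b c) x v"
    "has_type 2 {1} (JZ c) (?W c) x" "wedge 2 4 (?W c) (wedge_power (\<omega> a b c) 2) x v = 0"
    if c: "c \<in> charts Z" "x \<in> cdom c" for c x v
  proof -
    obtain s t H where q: "quotient_frame \<omega> \<Omega> c x (JZ c x) s t H" by (rule frame_at[OF c])
    note om = quotient_frameD(2)[OF q]
    show "ext_deriv 2 (\<omega> a b c) x v = 0" unfolding d_omega_frame[OF q] by (simp add: ab(1))
    have "wedge 2 2 (?W c) (\<omega> a b c) x v = k * wedge_map 2 2 (omega_pt 1 (sqrt 2) s t H) (omega_pt a b s t H) v"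
      unfolding wedge_eq_wedge_map om wedge_map_cmult_left ..
    also have "\<dots> = k * (- of_real (a * 1) / 2 * dt [s, cj s, t, cj t] v +
      of_real (a * (sqrt 2)\<^sup>2 + 1 * b\<^sup>2) / 4 * (dt [s, cj s, H, cj H] v + dt [t, cj t, H, cj H] v))"
      unfolding omega_pt_square[OF frame_rules(1)[OF q] frame_rules(2)] ..
    also have "\<dots> = ext_deriv 3 (\<Omega> a b \<gamma> c) x v"
      unfolding d_Omega_frame[OF q] k_def by (simp add: ab(1) field_simps)
    finally show "ext_deriv 3 (\<Omega> a b \<gamma> c) x v = wedge 2 2 (?W c) (\<omega> a b c) x v" by simp
    show "has_type 2 {1} (JZ c) (?W c) x"
      by (rule omega_pt_type[where J = "JZ c" and \<beta> = "?W c" and x = x, OF frame_rules(1)[OF q] frame_rules(2) _ refl]) (simp only: om)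
    have wp: "wedge_power (\<omega> a b c) 2 x = (\<lambda>v. - of_real (a\<^sup>2) / 2 * dt [s, cj s, t, cj t] v +
      of_real (a * b\<^sup>2) / 2 * (dt [s, cj s, H, cj H] v + dt [t, cj t, H, cj H] v))"
      by (rule omega_pt_wedge_power(2)[where \<omega> = "\<omega> a b c" and x = x, OF frame_rules(1)[OF q] frame_rules(2) om])
    have "wedge 2 4 (?W c) (wedge_power (\<omega> a b c) 2) x v = k * wedge_map 2 4 (omega_pt 1 (sqrt 2) s t H)
      (\<lambda>v. - of_real (a\<^sup>2) / 2 * dt [s, cj s, t, cj t] v +
      of_real (a * b\<^sup>2) / 2 * (dt [s, cj s, H, cj H] v + dt [t, cj t, H, cj H] v)) v"
      unfolding wedge_eq_wedge_map om wp wedge_map_cmult_left ..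
    also have "\<dots> = k * (\<i> * of_real (2 * a * 1 * b\<^sup>2 + a\<^sup>2 * (sqrt 2)\<^sup>2) / 4 * dt [s, cj s, t, cj t, H, cj H] v)"
      unfolding omega_pt_cube[OF frame_rules(1)[OF q] frame_rules(2)] ..
    also have "\<dots> = 0" by (simp add: ab(1) power2_eq_square)
    finally show "wedge 2 4 (?W c) (wedge_power (\<omega> a b c) 2) x v = 0" .
  qed
  have "orb_form Z 2 ?W" by (rule orb_form_cmult[OF dom orb(1)])
  then show ?thesis
    unfolding torsion_classes_def real_form_def primitive_form_def k_def[symmetric]
    by (auto intro!: orb_form_const orb_form_zero dom simp: W wedge_zero has_type_zero conj_form_def simp del: One_nat_def)
qed

text \<open>\<open>\<omega> 1 (sqrt 2)\<close> is the fundamental form of a positive definite metric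
  for \<open>JZ\<close>, so it is nonzero on the pair u, Ju for every nonzero u.\<close>

lemma symplectic_W2_nonvanishing:
  assumes "b \<noteq> 0"
  shows "nonvanishing_form Z (\<lambda>c x v. of_real (4 * b) * exp (\<i> * of_real \<gamma>) * \<omega> 1 (sqrt 2) c x v)"
  unfolding nonvanishing_form_def
proof (intro ballI)
  fix c x assume c: "c \<in> charts Z" "x \<in> cdom c"
  obtain s t H where q: "quotient_frame \<omega> \<Omega> c x (JZ c x) s t H" by (rule frame_at[OF c])
  let ?u = "axis 1 1 :: real^6"
  have "0 < Re (omega_pt 1 (sqrt 2) s t H (vec2 ?u (JZ c x ?u)))"
    by (rule omega_pt_definite[OF frame_rules(1)[OF q] frame_rules(2)]) (simp_all add: axis_eq_0_iff)
  then have "omega_pt 1 (sqrt 2) s t H (vec2 ?u (JZ c x ?u)) \<noteq> 0" by auto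
  then show "\<exists>v. of_real (4 * b) * exp (\<i> * of_real \<gamma>) * \<omega> 1 (sqrt 2) c x v \<noteq> 0"
    unfolding quotient_frameD(2)[OF q] using assms by auto
qed

lemma nearly_kaehler_quotient:
  assumes ab: "a > 0" "a = 2 * b\<^sup>2"
  shows "\<exists>J. SU3_structure Z J (\<omega> a b) (\<Omega> a b \<gamma>) \<and>
    (\<exists>W1 W2 W3 W4 W5. torsion_classes Z J (\<omega> a b) (\<Omega> a b \<gamma>) W1 W2 W3 W4 W5 \<and>
      nonvanishing_form Z W1 \<and> zero_form Z W2 \<and> zero_form Z W3 \<and> zero_form Z W4 \<and> zero_form Z W5)"
proof -
  have b: "b \<noteq> 0" using ab by auto
  have "SU3_structure Z JZ (\<omega> a b) (\<Omega> a b \<gamma>)"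
    unfolding SU3_structure_def using su_structure_quotient riemannian_hermitian_metric ab(1) b by simp
  moreover have "nonvanishing_form Z (\<lambda>c x v. of_real (4 * b / a) * exp (\<i> * of_real \<gamma>))"
    using b ab(1) by (simp add: nonvanishing_form_def)
  moreover have "zero_form Z (\<lambda>c x v. 0)" by (simp add: zero_form_def)
  ultimately show ?thesis using nearly_kaehler_torsion[OF ab] by blast
qed

lemma symplectic_quotient:
  assumes ab: "a = - b\<^sup>2" "a \<noteq> 0"
  shows "\<exists>J. SU12_structure Z J (\<omega> a b) (\<Omega> a b \<gamma>) \<and>
    (\<forall>c\<in>charts Z. \<forall>x\<in>cdom c. \<forall>v. ext_deriv 2 (\<omega> a b c) x v = 0) \<and>
    (\<exists>W1 W2 W3 W4 W5. torsion_classes Z J (\<omega> a b) (\<Omega> a b \<gamma>) W1 W2 W3 W4 W5 \<and>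
      nonvanishing_form Z W2 \<and> zero_form Z W1 \<and> zero_form Z W3 \<and> zero_form Z W4 \<and> zero_form Z W5)"
proof -
  have b: "b \<noteq> 0" "a < 0" using ab by auto
  have "has_signature (hermitian_metric (\<omega> a b) JZ c x) 2 4" if c: "c \<in> charts Z" "x \<in> cdom c" for c x
  proof -
    obtain s t H where q: "quotient_frame \<omega> \<Omega> c x (JZ c x) s t H" by (rule frame_at[OF c])
    show ?thesis unfolding hermitian_metric_eq[OF q, abs_def]
      by (rule omega_pt_signature[OF frame_rules(1)[OF q] frame_rules(2) b(2,1)])
  qed
  then have "SU12_structure Z JZ (\<omega> a b) (\<Omega> a b \<gamma>)"
    unfolding SU12_structure_def using su_structure_quotient[OF ab(2) b(1)] by simp
  moreover have "ext_deriv 2 (\<omega> a b c) x v = 0" if c: "c \<in> charts Z" "x \<in> cdom c" for c x v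
  proof -
    obtain s t H where q: "quotient_frame \<omega> \<Omega> c x (JZ c x) s t H" by (rule frame_at[OF c])
    show ?thesis unfolding d_omega_frame[OF q] by (simp add: ab(1))
  qed
  moreover have "zero_form Z (\<lambda>c x v. 0)" by (simp add: zero_form_def)
  ultimately show ?thesis using symplectic_torsion[OF ab] symplectic_W2_nonvanishing[OF b(1)] by blast
qed

end

theorem corollary3:
  fixes S :: "(real^7, 'p) orbifold"
    and g :: "(real^7, 'p) obilinear"
    and \<xi> :: "nat \<Rightarrow> (real^7, 'p) ovector"
    and \<eta> :: "nat \<Rightarrow> (real^7, 'p) oform"
    and \<Phi> :: "nat \<Rightarrow> (real^7, 'p) oendo"
    and \<rho> :: "real \<Rightarrow> 'p \<Rightarrow> 'p" and T :: real
    and Z :: "(real^6, 'q) orbifold"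
    and \<pi> :: "'p \<Rightarrow> 'q"
    and \<sigma> :: "(real^6, 'q) ochart \<Rightarrow> (real^6) \<times> real \<Rightarrow> 'p"
    and a b \<gamma> :: real
  assumes "three_sasakian S g \<xi> \<eta> \<Phi>"
    and "regular S (\<xi> 3) \<rho> T \<or> quasi_regular S (\<xi> 3) \<rho> T"
    and "circle_quotient S \<rho> Z \<pi> \<sigma>"
  shows "basic_form S (\<xi> 3) 2 (omega_ab \<eta> a b) \<and>
    basic_form S (\<xi> 3) 3 (Omega_ab \<eta> a b \<gamma>) \<and>
    (\<exists>\<omega> \<Omega>. descends_to S Z \<sigma> 2 (omega_ab \<eta> a b) \<omega> \<and>
       descends_to S Z \<sigma> 3 (Omega_ab \<eta> a b \<gamma>) \<Omega> \<and>
       (a > 0 \<and> a = 2 * b\<^sup>2 \<longrightarrow>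
          (\<exists>J. SU3_structure Z J \<omega> \<Omega> \<and>
             (\<exists>W1 W2 W3 W4 W5. torsion_classes Z J \<omega> \<Omega> W1 W2 W3 W4 W5 \<and>
                nonvanishing_form Z W1 \<and> zero_form Z W2 \<and> zero_form Z W3 \<and>
                zero_form Z W4 \<and> zero_form Z W5))) \<and>
       (a = - b\<^sup>2 \<and> a \<noteq> 0 \<longrightarrow>
          (\<exists>J. SU12_structure Z J \<omega> \<Omega> \<and>
             (\<forall>c\<in>charts Z. \<forall>x\<in>cdom c. \<forall>v. ext_deriv 2 (\<omega> c) x v = 0) \<and>
             (\<exists>W1 W2 W3 W4 W5. torsion_classes Z J \<omega> \<Omega> W1 W2 W3 W4 W5 \<and>
                nonvanishing_form Z W2 \<and> zero_form Z W1 \<and> zero_form Z W3 \<and>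
                zero_form Z W4 \<and> zero_form Z W5))))"
proof -
  obtain gbar J where S: "is_orbifold S" "riemannian_metric S g" and cone: "is_cone_metric S g gbar"
    and hk: "hyperkaehler (cone_orbifold S) gbar J"
    and xi: "\<forall>i\<in>{1..3}. \<forall>c\<in>charts S. \<forall>x\<in>cdom c. J i (cone_chart c) (x, 1) (0, 1) = (\<xi> i c x, 0)"
    and eta: "\<forall>i\<in>{1..3}. \<eta> i = contact_form g (\<xi> i)"
    using assms(1) unfolding three_sasakian_def by blast
  have dim: "DIM(real^7) = 7" by simp
  have action: "circle_action S (\<xi> 3) \<rho> T" using assms(2) by (auto simp: regular_def quasi_regular_def)
  interpret sasakian_quotient S g gbar J \<xi> \<eta> \<rho> T Z \<pi> \<sigma>
    by unfold_locales (fact S cone hk xi eta dim action assms(3))+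
  \<comment> \<open>Both families keep their parameters variable, since W2 and the complex structure
    are taken from other parameter values than the given ones.\<close>
  let ?\<omega> = "\<lambda>a b. slice_form (lift_form S \<sigma> (omega_ab \<eta> a b))"
  let ?\<Omega> = "\<lambda>a b \<gamma>. slice_form (lift_form S \<sigma> (Omega_ab \<eta> a b \<gamma>))"
  have orb: "orb_form Z 2 (?\<omega> a b)" "orb_form Z 3 (?\<Omega> a b \<gamma>)" for a b \<gamma>
    using quotient_descends unfolding descends_to_def by blast+
  have "a > 0 \<and> a = 2 * b\<^sup>2 \<longrightarrow> (\<exists>J. SU3_structure Z J (?\<omega> a b) (?\<Omega> a b \<gamma>) \<and>
    (\<exists>W1 W2 W3 W4 W5. torsion_classes Z J (?\<omega> a b) (?\<Omega> a b \<gamma>) W1 W2 W3 W4 W5 \<and>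
      nonvanishing_form Z W1 \<and> zero_form Z W2 \<and> zero_form Z W3 \<and> zero_form Z W4 \<and> zero_form Z W5))"
    by (intro impI, elim conjE) (rule nearly_kaehler_quotient[OF open_cdom_Z[OF S(1) Q] orb quotient_frame_local])
  moreover have "a = - b\<^sup>2 \<and> a \<noteq> 0 \<longrightarrow> (\<exists>J. SU12_structure Z J (?\<omega> a b) (?\<Omega> a b \<gamma>) \<and>
    (\<forall>c\<in>charts Z. \<forall>x\<in>cdom c. \<forall>v. ext_deriv 2 (?\<omega> a b c) x v = 0) \<and>
    (\<exists>W1 W2 W3 W4 W5. torsion_classes Z J (?\<omega> a b) (?\<Omega> a b \<gamma>) W1 W2 W3 W4 W5 \<and>
      nonvanishing_form Z W2 \<and> zero_form Z W1 \<and> zero_form Z W3 \<and> zero_form Z W4 \<and> zero_form Z W5))"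
    by (intro impI, elim conjE) (rule symplectic_quotient[OF open_cdom_Z[OF S(1) Q] orb quotient_frame_local])
  ultimately show ?thesis
    using sasakian_basic_form quotient_descends by blast
qed

end
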